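(* Let $0<\alpha<2$ and $0<H<1$, and let $(Y(t),t\ge0)$ be an FBM-$H$-local time fractional symmetric $\alpha$-stable motion. Then it has a version with continuous sample paths satisfying $$\sup_{0\le s<t\le 1/2}\frac{|Y(t)-Y(s)|}{(t-s)^{1-H}\left(\log\frac{1}{t-s}\right)^{H+1/2}}<\infty\qquad\text{almost surely}.$$
   Context: A fractional Brownian motion $(B_H(t),t\ge0)$ with exponent $0<H<1$ is the continuous zero-mean Gaussian process with covariance $\mathrm{Cov}(B_H(s),B_H(t))=\frac{\mathbf{E}'B_H(1)^2}{2}\left[t^{2H}+s^{2H}-|t-s|^{2H}\right]$, with $\mathbf{E}'B_H(1)^2>0$. It lives on a probability space $(\Omega',\mathcal{F}',\mathbf{P}')$ and has a local time process $l=l(x,t)(\omega')$, $x\in\mathbb{R}$, $t\ge0$, jointly continuous in $(x,t)$ (so $\int_0^t g(B_H(s))\,ds=\int_{\mathbb{R}}g(x)l(x,t)\,dx$ for all nonnegative measurable $g$). A symmetric $\alpha$-stable (S$\alpha$S) random measure $M$ on a measurable space $(E,\mathcal{E})$ with $\sigma$-finite control measure $m$ is an independently scattered random measure whose integrals $\int_E f\,dM$ are defined for $f\in L^\alpha(E,m)$, are linear in $f$, and satisfy $\mathbf{E}\exp\left(i\theta\int_E f\,dM\right)=\exp\left(-|\theta|^\alpha\int_E|f|^\alpha\,dm\right)$. The FBM-$H$-local time fractional symmetric $\alpha$-stable motion is $Y(t)=\int_{\Omega'}\int_{\mathbb{R}}l(x,t)(\omega')\,M(d\omega',dx)$, $t\ge0$,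 where $M$ is an S$\alpha$S random measure on $\Omega'\times\mathbb{R}$ with control measure $\mathbf{P}'\times\mathrm{Leb}$ (living on another probability space). *)

theory Defs
  imports "HOL-Probability.Probability"
begin

section \<open>Fractional Brownian motion\<close>

text \<open>
  Processes indexed by \<open>t \<ge> 0\<close> are functions on the type \<^typ>\<open>real\<close>; their values at negative times
  are never used.  Degenerate (almost surely constant) variables count as Gaussian, as they must:
  a fractional Brownian motion vanishes at time 0.
\<close>

definition gaussian_rv :: "'w measure \<Rightarrow> ('w \<Rightarrow> real) \<Rightarrow> bool" where
  "gaussian_rv P X \<longleftrightarrow>
     X \<in> borel_measurable P \<and>
     ((\<exists>\<mu>. AE \<omega> in P. X \<omega> = \<mu>) \<or>
      (\<exists>\<mu> \<sigma>. 0 < \<sigma> \<and> distributed P lborel X (normal_density \<mu> \<sigma>)))"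

definition gaussian_process :: "'w measure \<Rightarrow> 't set \<Rightarrow> ('t \<Rightarrow> 'w \<Rightarrow> real) \<Rightarrow> bool" where
  "gaussian_process P T X \<longleftrightarrow>
     (\<forall>J c. finite J \<and> J \<subseteq> T \<longrightarrow> gaussian_rv P (\<lambda>\<omega>. \<Sum>t\<in>J. c t * X t \<omega>))"

definition covariance :: "'w measure \<Rightarrow> ('w \<Rightarrow> real) \<Rightarrow> ('w \<Rightarrow> real) \<Rightarrow> real" where
  "covariance P X Y =
     (\<integral>\<omega>. (X \<omega> - (\<integral>\<omega>'. X \<omega>' \<partial>P)) * (Y \<omega> - (\<integral>\<omega>'. Y \<omega>' \<partial>P)) \<partial>P)"

definition fractional_brownian_motion ::
    "'w measure \<Rightarrow> real \<Rightarrow> (real \<Rightarrow> 'w \<Rightarrow> real) \<Rightarrow> bool" where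
  "fractional_brownian_motion P H B \<longleftrightarrow>
     prob_space P \<and> 0 < H \<and> H < 1 \<and>
     gaussian_process P {0..} B \<and>
     (\<forall>t\<ge>0. (\<integral>\<omega>. B t \<omega> \<partial>P) = 0) \<and>
     0 < (\<integral>\<omega>. (B 1 \<omega>)\<^sup>2 \<partial>P) \<and>
     (\<forall>s\<ge>0. \<forall>t\<ge>0. covariance P (B s) (B t) =
        (\<integral>\<omega>. (B 1 \<omega>)\<^sup>2 \<partial>P) / 2 *
          (t powr (2 * H) + s powr (2 * H) - \<bar>t - s\<bar> powr (2 * H))) \<and>
     (AE \<omega> in P. continuous_on {0..} (\<lambda>t. B t \<omega>))"


section \<open>Local time\<close>

text \<open>
  Pathwise properties of a process are required almost surely.  Since this leaves the behaviour on
  a null set open, the joint measurability in \<open>(\<omega>, x)\<close>, without which \<open>l(\<cdot>, t)\<close> could not be integrated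
  against a random measure on \<open>\<Omega>' \<times> \<real>\<close>, is a separate clause.  Nonnegativity is a separate clause
  because \<^const>\<open>ennreal\<close> truncates negative numbers.
\<close>

definition local_time ::
    "'w measure \<Rightarrow> (real \<Rightarrow> 'w \<Rightarrow> real) \<Rightarrow> (real \<Rightarrow> real \<Rightarrow> 'w \<Rightarrow> real) \<Rightarrow> bool" where
  "local_time P B l \<longleftrightarrow>
     (\<forall>t\<ge>0. (\<lambda>(\<omega>, x). l x t \<omega>) \<in> borel_measurable (P \<Otimes>\<^sub>M lborel)) \<and>
     (AE \<omega> in P. \<forall>x. \<forall>t\<ge>0. 0 \<le> l x t \<omega>) \<and>
     (AE \<omega> in P. continuous_on (UNIV \<times> {0..}) (\<lambda>(x, t). l x t \<omega>)) \<and>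
     (AE \<omega> in P. \<forall>t\<ge>0. \<forall>g :: real \<Rightarrow> ennreal. g \<in> borel_measurable borel \<longrightarrow>
        (\<integral>\<^sup>+s\<in>{0..t}. g (B s \<omega>) \<partial>lborel) = (\<integral>\<^sup>+x. g x * ennreal (l x t \<omega>) \<partial>lborel))"


section \<open>Symmetric stable random measures\<close>

definition finite_measure_sets :: "'e measure \<Rightarrow> 'e set set" where
  "finite_measure_sets m = {A \<in> sets m. emeasure m A < \<infinity>}"

definition independently_scattered ::
    "'b measure \<Rightarrow> 'e measure \<Rightarrow> ('e set \<Rightarrow> 'b \<Rightarrow> real) \<Rightarrow> bool" where
  "independently_scattered N m M \<longleftrightarrow>
     (\<forall>A\<in>finite_measure_sets m. M A \<in> borel_measurable N) \<and>
     (\<forall>n (A :: nat \<Rightarrow> 'e set). A ` {..<n} \<subseteq> finite_measure_sets m \<and> disjoint_family_on A {..<n} \<longrightarrow>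
        prob_space.indep_vars N (\<lambda>_. borel) (\<lambda>i. M (A i)) {..<n}) \<and>
     (\<forall>A :: nat \<Rightarrow> 'e set. range A \<subseteq> finite_measure_sets m \<and> disjoint_family A \<and>
          (\<Union>i. A i) \<in> finite_measure_sets m \<longrightarrow>
        (AE \<omega> in N. (\<lambda>i. M (A i) \<omega>) sums M (\<Union>i. A i) \<omega>))"

definition L_alpha :: "real \<Rightarrow> 'e measure \<Rightarrow> ('e \<Rightarrow> real) set" where
  "L_alpha \<alpha> m = {f \<in> borel_measurable m. integrable m (\<lambda>e. \<bar>f e\<bar> powr \<alpha>)}"

text \<open>
  \<open>M\<close> is the random measure, as a set function with values in the random variables on \<open>N\<close>, and
  \<open>I f\<close> is the integral of \<open>f\<close> with respect to \<open>M\<close>.  Linearity and the characteristic function make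
  \<open>I\<close> continuous from \<open>L\<^sup>\<alpha>\<close> to convergence in probability, so that its values on indicators
  determine \<open>I f\<close> up to almost sure equality for every \<open>f\<close> in \<open>L\<^sup>\<alpha>\<close>.
\<close>

definition sas_random_measure ::
    "'b measure \<Rightarrow> 'e measure \<Rightarrow> real \<Rightarrow> ('e set \<Rightarrow> 'b \<Rightarrow> real) \<Rightarrow> (('e \<Rightarrow> real) \<Rightarrow> 'b \<Rightarrow> real) \<Rightarrow> bool"
where
  "sas_random_measure N m \<alpha> M I \<longleftrightarrow>
     prob_space N \<and> sigma_finite_measure m \<and>
     independently_scattered N m M \<and>
     (\<forall>f\<in>L_alpha \<alpha> m. I f \<in> borel_measurable N) \<and>
     (\<forall>A\<in>finite_measure_sets m. AE \<omega> in N. I (indicator A) \<omega> = M A \<omega>) \<and>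
     (\<forall>f\<in>L_alpha \<alpha> m. \<forall>g\<in>L_alpha \<alpha> m. \<forall>a b.
        AE \<omega> in N. I (\<lambda>e. a * f e + b * g e) \<omega> = a * I f \<omega> + b * I g \<omega>) \<and>
     (\<forall>f\<in>L_alpha \<alpha> m. \<forall>\<theta>.
        (CLINT \<omega>|N. exp (\<i> * complex_of_real (\<theta> * I f \<omega>))) =
          complex_of_real (exp (- (\<bar>\<theta>\<bar> powr \<alpha> * (\<integral>e. \<bar>f e\<bar> powr \<alpha> \<partial>m)))))"


section \<open>Local time fractional symmetric stable motion\<close>

text \<open>Stochastic integrals are defined up to null sets only, whence the almost sure equality.\<close>

definition fbm_local_time_stable_motion ::
    "'w measure \<Rightarrow> real \<Rightarrow> (real \<Rightarrow> 'w \<Rightarrow> real) \<Rightarrow> (real \<Rightarrow> real \<Rightarrow> 'w \<Rightarrow> real) \<Rightarrow>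
     'b measure \<Rightarrow> real \<Rightarrow> (('w \<times> real) set \<Rightarrow> 'b \<Rightarrow> real) \<Rightarrow> (('w \<times> real \<Rightarrow> real) \<Rightarrow> 'b \<Rightarrow> real) \<Rightarrow>
     (real \<Rightarrow> 'b \<Rightarrow> real) \<Rightarrow> bool" where
  "fbm_local_time_stable_motion P' H B l N \<alpha> M I Y \<longleftrightarrow>
     fractional_brownian_motion P' H B \<and>
     local_time P' B l \<and>
     sas_random_measure N (P' \<Otimes>\<^sub>M lborel) \<alpha> M I \<and>
     (\<forall>t\<ge>0. Y t \<in> borel_measurable N \<and> (AE \<omega> in N. Y t \<omega> = I (\<lambda>(\<omega>', x). l x t \<omega>') \<omega>))"

definition is_version ::
    "'b measure \<Rightarrow> (real \<Rightarrow> 'b \<Rightarrow> real) \<Rightarrow> (real \<Rightarrow> 'b \<Rightarrow> real) \<Rightarrow> bool" where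
  "is_version N Z Y \<longleftrightarrow>
     (\<forall>t\<ge>0. Z t \<in> borel_measurable N \<and> (AE \<omega> in N. Z t \<omega> = Y t \<omega>))"

end

theory Submission
  imports Defs
begin

text \<open>
  The moving average representation shows that the increment of fractional Brownian motion after a
  time \<open>u\<close>, of length \<open>h\<close>, has conditional variance at least \<open>c h\<^sup>2\<^sup>H\<close> given the past.  Hence the \<open>k\<close>-th
  moment of a local time increment over an interval of length \<open>h\<close>, integrated over space, is at most
  \<open>(C h\<^sup>1\<^sup>-\<^sup>H k\<^sup>H)\<^sup>k\<close>.  Using the moment of order \<open>n + 1\<close> on dyadic intervals of length \<open>2\<^sup>-\<^sup>n\<close>, and the
  integrability of the range of the motion, one obtains a random function \<open>K\<close> in \<open>L\<^sup>\<alpha>\<close> of the control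
  measure that dominates every dyadic increment of the local time divided by \<open>2\<^sup>-\<^sup>n\<^sup>(\<^sup>1\<^sup>-\<^sup>H\<^sup>) n\<^sup>H\<close>.

  A finite family of stable integrals whose kernels are bounded by multiples of \<open>K\<close> is a limit in law
  of sums of independent vectors which, given a sum of squared jumps common to all coordinates, are
  subgaussian.  So outside one event of small probability all dyadic increments of \<open>Y\<close> have Gaussian
  tails, and a union bound over the \<open>2\<^sup>n\<close> intervals costs a further factor \<open>n\<^sup>1\<^sup>/\<^sup>2\<close>.  Chaining over
  the dyadic points concludes.
\<close>

section \<open>The moving average kernel of fractional Brownian motion\<close>

definition mvn_kernel :: "real \<Rightarrow> real \<Rightarrow> real \<Rightarrow> real" where
  "mvn_kernel H t x = max 0 (t - x) powr (H - 1/2) - max 0 (- x) powr (H - 1/2)"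

lemma mvn_kernel_measurable [measurable]: "mvn_kernel H t \<in> borel_measurable borel"
  unfolding mvn_kernel_def [abs_def] by measurable

lemma nn_integral_powr_near_0:
  assumes "-1 < a" "0 \<le> c"
  shows "(\<integral>\<^sup>+y. ennreal (y powr a) * indicator {0..c} y \<partial>lborel) = ennreal (c powr (a + 1) / (a + 1))"
  using has_integral_powr_from_0 [OF assms] by (intro nn_integral_has_integral_lebesgue') auto

lemma mvn_kernel_1_bound:
  assumes "0 < H" "H < 1"
  shows "ennreal ((mvn_kernel H 1 (-y))\<^sup>2) \<le>
    ennreal ((1 + y) powr (2*H - 1)) * indicator {0..1} (1 + y)
    + (4 + 2 * (ennreal (y powr (2*H - 1)))) * indicator {0..1} y
    + ennreal (y powr (2*H - 3)) * indicator {1..} y"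
proof -
  have sq: "(u powr (H - 1/2))\<^sup>2 = u powr (2*H - 1)" for u :: real
    by (simp add: power2_eq_square powr_add [symmetric])
  consider "y < -1" | "-1 \<le> y" "y < 0" | "0 \<le> y" "y < 1" | "1 \<le> y" by linarith
  then show ?thesis
  proof cases
    case 1
    then show ?thesis by (simp add: mvn_kernel_def)
  next
    case 2
    then show ?thesis by (simp add: mvn_kernel_def sq)
  next
    case 3
    let ?a = "(1 + y) powr (H - 1/2)" and ?b = "y powr (H - 1/2)"
    have "(?a - ?b)\<^sup>2 \<le> 2 * ?a\<^sup>2 + 2 * ?b\<^sup>2"
      using zero_le_power2 [of "?a + ?b"] by (simp add: power2_eq_square algebra_simps)
    also have "?a\<^sup>2 \<le> 2"
    proof -
      have "?a\<^sup>2 \<le> (1 + y) powr 1"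
        unfolding sq using 3 assms by (intro powr_mono) auto
      then show ?thesis using 3 by simp
    qed
    also have "?b\<^sup>2 = y powr (2*H - 1)" by (rule sq)
    finally have "(?a - ?b)\<^sup>2 \<le> 4 + 2 * y powr (2*H - 1)" by simp
    then have "ennreal ((?a - ?b)\<^sup>2) \<le> ennreal (4 + 2 * y powr (2*H - 1))"
      by (rule ennreal_leI)
    also have "\<dots> = 4 + 2 * ennreal (y powr (2*H - 1))"
      by (simp add: ennreal_plus ennreal_mult)
    finally have *: "ennreal ((?a - ?b)\<^sup>2) \<le> 4 + 2 * ennreal (y powr (2*H - 1))" .
    show ?thesis
      using 3 * by (simp add: mvn_kernel_def max_def indicator_def add_increasing2)
  next
    case 4
    have "\<exists>z. y < z \<and> z < y + 1 \<and>
        (y + 1) powr (H - 1/2) - y powr (H - 1/2) = (y + 1 - y) * ((H - 1/2) * z powr (H - 1/2 - 1))"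
      using 4 by (intro MVT2) (auto intro!: derivative_eq_intros simp: powr_diff field_simps)
    then obtain z where z: "y < z" "z < y + 1"
      "(y + 1) powr (H - 1/2) - y powr (H - 1/2) = (H - 1/2) * z powr (H - 1/2 - 1)" by auto
    have "((H - 1/2) * z powr (H - 1/2 - 1))\<^sup>2 = (H - 1/2)\<^sup>2 * z powr (2*H - 3)"
      by (simp add: power_mult_distrib power2_eq_square powr_add [symmetric])
    also have "\<dots> \<le> 1 * y powr (2*H - 3)"
      using assms z 4
      by (intro mult_mono powr_mono2') (auto simp: power2_eq_square abs_square_le_1 [unfolded power2_eq_square])
    finally have "(mvn_kernel H 1 (-y))\<^sup>2 \<le> y powr (2*H - 3)"
      using z 4 by (simp add: mvn_kernel_def max_def add.commute)
    then have "ennreal ((mvn_kernel H 1 (-y))\<^sup>2) \<le> ennreal (y powr (2*H - 3)) * indicator {1..} y"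
      using 4 by (simp add: ennreal_leI)
    then show ?thesis by (simp add: add_increasing)
  qed
qed

lemma mvn_kernel_1_square_integrable:
  assumes H: "0 < H" "H < 1"
  shows "integrable lborel (\<lambda>x. (mvn_kernel H 1 x)\<^sup>2)"
proof -
  have 1: "(\<integral>\<^sup>+y. ennreal ((1 + y) powr (2*H - 1)) * indicator {0..1} (1 + y) \<partial>lborel) < \<infinity>"
  proof -
    have "(\<integral>\<^sup>+y. ennreal (y powr (2*H - 1)) * indicator {0..1} y \<partial>lborel) =
        ennreal \<bar>1\<bar> * (\<integral>\<^sup>+y. ennreal ((1 + 1 * y) powr (2*H - 1)) * indicator {0..1} (1 + 1 * y) \<partial>lborel)"
      by (rule nn_integral_real_affine) auto
    then show ?thesis using H by (auto simp: nn_integral_powr_near_0 dest: sym)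
  qed
  have 2: "(\<integral>\<^sup>+y. (4 + 2 * ennreal (y powr (2*H - 1))) * indicator {0..1} y \<partial>lborel) < \<infinity>"
  proof -
    have "(\<integral>\<^sup>+y. (4 + 2 * ennreal (y powr (2*H - 1))) * indicator {0..1} y \<partial>lborel) =
      (\<integral>\<^sup>+y. 4 * indicator {0..1::real} y + 2 * (ennreal (y powr (2*H - 1)) * indicator {0..1} y) \<partial>lborel)"
      by (intro nn_integral_cong) (simp add: distrib_right mult.assoc)
    also have "\<dots> = 4 + 2 * ennreal (1 / (2 * H))"
      using H by (subst nn_integral_add)
        (auto simp: nn_integral_cmult nn_integral_powr_near_0 nn_integral_cmult_indicator)
    finally show ?thesis by (simp add: ennreal_mult_less_top)
  qed
  have 3: "(\<integral>\<^sup>+y. ennreal (y powr (2*H - 3)) * indicator {1..} y \<partial>lborel) < \<infinity>"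
    using has_integral_powr_to_inf [of "2*H - 3" 1] H
    by (subst nn_integral_has_integral_lebesgue') auto
  have "(\<integral>\<^sup>+x. ennreal ((mvn_kernel H 1 x)\<^sup>2) \<partial>lborel) = ennreal \<bar>-1\<bar> * (\<integral>\<^sup>+x. ennreal ((mvn_kernel H 1 (0 + (-1) * x))\<^sup>2) \<partial>lborel)"
    by (rule nn_integral_real_affine) auto
  also have "\<dots> \<le> (\<integral>\<^sup>+y. ennreal ((1 + y) powr (2*H - 1)) * indicator {0..1} (1 + y)
    + (4 + 2 * (ennreal (y powr (2*H - 1)))) * indicator {0..1} y
    + ennreal (y powr (2*H - 3)) * indicator {1..} y \<partial>lborel)"
    using mvn_kernel_1_bound [OF H] by (auto intro!: nn_integral_mono)
  also have "\<dots> < \<infinity>"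
    using 1 2 3 by (subst nn_integral_add, simp, simp, subst nn_integral_add) auto
  finally show ?thesis
    by (intro integrableI_bounded) auto
qed

lemma mvn_kernel_diff:
  "mvn_kernel H t x - mvn_kernel H s x = mvn_kernel H (t - s) (x - s)"
  by (simp add: mvn_kernel_def)

lemma mvn_kernel_scale:
  assumes "0 < d"
  shows "mvn_kernel H d (d * x) = d powr (H - 1/2) * mvn_kernel H 1 x"
proof -
  have "max 0 (d - d * x) = d * max 0 (1 - x)" "max 0 (- (d * x)) = d * max 0 (- x)"
    using assms by (auto simp: max_def algebra_simps mult_le_0_iff zero_le_mult_iff)
  then show ?thesis
    using assms by (simp add: mvn_kernel_def powr_mult algebra_simps)
qed

definition mvn_const :: "real \<Rightarrow> real" where
  "mvn_const H = (\<integral>x. (mvn_kernel H 1 x)\<^sup>2 \<partial>lborel)"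

lemma mvn_kernel_norm:
  assumes H: "0 < H" "H < 1" and "0 \<le> d"
  shows "has_bochner_integral lborel (\<lambda>x. (mvn_kernel H d x)\<^sup>2) (mvn_const H * d powr (2 * H))"
proof (cases "d = 0")
  case True
  then show ?thesis using has_bochner_integral_zero by (simp add: mvn_kernel_def)
next
  case False
  with assms have d: "0 < d" by simp
  have eq: "(mvn_kernel H d (0 + d * x))\<^sup>2 = d powr (2*H - 1) * (mvn_kernel H 1 x)\<^sup>2" for x
    using d by (simp add: mvn_kernel_scale power_mult_distrib power2_eq_square powr_add [symmetric] algebra_simps)
  have "integrable lborel (\<lambda>x. (mvn_kernel H d (0 + d * x))\<^sup>2)"
    unfolding eq using mvn_kernel_1_square_integrable [OF H] by simp
  then have 1: "integrable lborel (\<lambda>x. (mvn_kernel H d x)\<^sup>2)"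
    using d lborel_integrable_real_affine_iff [of d "\<lambda>x. (mvn_kernel H d x)\<^sup>2" 0] by simp
  have "(\<integral>x. (mvn_kernel H d x)\<^sup>2 \<partial>lborel) = \<bar>d\<bar> *\<^sub>R (\<integral>x. (mvn_kernel H d (0 + d * x))\<^sup>2 \<partial>lborel)"
    using d by (intro lborel_integral_real_affine) simp
  also have "\<dots> = mvn_const H * (d * d powr (2*H - 1))"
    unfolding eq using d by (simp add: mvn_const_def)
  also have "d * d powr (2*H - 1) = d powr (2*H)"
    using d by (simp add: powr_mult_base)
  finally show ?thesis using 1 by (simp add: has_bochner_integral_iff)
qed

lemma mvn_kernel_increment_norm:
  assumes H: "0 < H" "H < 1"
  shows "has_bochner_integral lborel (\<lambda>x. (mvn_kernel H t x - mvn_kernel H s x)\<^sup>2) (mvn_const H * \<bar>t - s\<bar> powr (2 * H))"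
proof -
  have *: "has_bochner_integral lborel (\<lambda>x. (mvn_kernel H t x - mvn_kernel H s x)\<^sup>2) (mvn_const H * (t - s) powr (2 * H))"
    if "s \<le> t" for s t
  proof -
    have "integrable lborel (\<lambda>x. (mvn_kernel H (t - s) (- s + 1 * x))\<^sup>2)"
      using mvn_kernel_norm [OF H, of "t - s"] that
      by (intro lborel_integrable_real_affine) (auto simp: has_bochner_integral_iff)
    moreover have "(\<integral>x. (mvn_kernel H (t - s) x)\<^sup>2 \<partial>lborel) =
        \<bar>1\<bar> *\<^sub>R (\<integral>x. (mvn_kernel H (t - s) (- s + 1 * x))\<^sup>2 \<partial>lborel)"
      by (intro lborel_integral_real_affine) simp
    ultimately show ?thesis
      using mvn_kernel_norm [OF H, of "t - s"] that
      by (simp add: mvn_kernel_diff has_bochner_integral_iff)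
  qed
  show ?thesis
  proof (cases "s \<le> t")
    case True
    then show ?thesis using * by simp
  next
    case False
    then show ?thesis using * [of t s] by (simp add: power2_commute)
  qed
qed

lemma integrable_mult_square_integrable:
  fixes f g :: "'a \<Rightarrow> real"
  assumes [measurable]: "f \<in> borel_measurable M" "g \<in> borel_measurable M"
    and "integrable M (\<lambda>x. (f x)\<^sup>2)" "integrable M (\<lambda>x. (g x)\<^sup>2)"
  shows "integrable M (\<lambda>x. f x * g x)"
proof (rule Bochner_Integration.integrable_bound)
  show "integrable M (\<lambda>x. (f x)\<^sup>2 + (g x)\<^sup>2)" using assms by simp
  have "\<bar>a * b\<bar> \<le> \<bar>a\<^sup>2 + b\<^sup>2\<bar>" for a b :: real
    using zero_le_power2 [of "a + b"] zero_le_power2 [of "a - b"]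
    by (auto simp: power2_eq_square algebra_simps abs_if)
  then show "AE x in M. norm (f x * g x) \<le> norm ((f x)\<^sup>2 + (g x)\<^sup>2)" by auto
qed measurable

lemma mvn_kernel_inner:
  assumes H: "0 < H" "H < 1" and st: "0 \<le> s" "0 \<le> t"
  shows "has_bochner_integral lborel (\<lambda>x. mvn_kernel H s x * mvn_kernel H t x)
    (mvn_const H / 2 * (t powr (2 * H) + s powr (2 * H) - \<bar>t - s\<bar> powr (2 * H)))"
proof -
  have *: "mvn_kernel H s x * mvn_kernel H t x =
      ((mvn_kernel H t x)\<^sup>2 + (mvn_kernel H s x)\<^sup>2 - (mvn_kernel H t x - mvn_kernel H s x)\<^sup>2) / 2" for x
    by (simp add: power2_eq_square algebra_simps)
  show ?thesis
    unfolding *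
    using has_bochner_integral_diff [OF has_bochner_integral_add
        [OF mvn_kernel_norm [OF H st(2)] mvn_kernel_norm [OF H st(1)]]
        mvn_kernel_increment_norm [OF H, of t s]]
    by (auto simp: has_bochner_integral_iff algebra_simps)
qed

text \<open>
  The kernels of the times up to \<open>u\<close> all vanish on \<open>(u, \<infinity>)\<close>; this is the one-sided local
  nondeterminism of fractional Brownian motion.
\<close>

lemma mvn_kernel_last_increment:
  assumes H: "0 < H" "H < 1" and uv: "u \<le> v"
    and g: "integrable lborel (\<lambda>x. (mvn_kernel H v x - mvn_kernel H u x - g x)\<^sup>2)"
    and g0: "\<And>x. u < x \<Longrightarrow> g x = 0" and u: "0 \<le> u"
  shows "(v - u) powr (2 * H) / (2 * H) \<le> (\<integral>x. (mvn_kernel H v x - mvn_kernel H u x - g x)\<^sup>2 \<partial>lborel)"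
proof -
  have "ennreal ((v - u) powr (2 * H) / (2 * H)) = (\<integral>\<^sup>+y. ennreal (y powr (2*H - 1)) * indicator {0..v - u} y \<partial>lborel)"
    using nn_integral_powr_near_0 [of "2*H - 1" "v - u"] H uv by simp
  also have "(\<integral>\<^sup>+y. ennreal (y powr (2*H - 1)) * indicator {0..v - u} y \<partial>lborel) =
      ennreal \<bar>-1\<bar> * (\<integral>\<^sup>+y. ennreal ((v + (-1) * y) powr (2*H - 1)) * indicator {0..v - u} (v + (-1) * y) \<partial>lborel)"
    by (rule nn_integral_real_affine) auto
  also have "\<dots> = (\<integral>\<^sup>+y. ennreal ((v - y) powr (2*H - 1)) * indicator {0..v - u} (v - y) \<partial>lborel)" by simp
  also have "\<dots> \<le> (\<integral>\<^sup>+x. ennreal ((mvn_kernel H v x - mvn_kernel H u x - g x)\<^sup>2) \<partial>lborel)"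
  proof (rule nn_integral_mono_AE)
    have "AE x in lborel. x \<noteq> u" by (rule AE_lborel_singleton)
    then show "AE y in lborel. ennreal ((v - y) powr (2*H - 1)) * indicator {0..v - u} (v - y)
        \<le> ennreal ((mvn_kernel H v y - mvn_kernel H u y - g y)\<^sup>2)"
    proof eventually_elim
      case (elim y)
      show ?case
      proof (cases "u < y \<and> y \<le> v")
        case True
        then have "(mvn_kernel H v y - mvn_kernel H u y - g y)\<^sup>2 = (v - y) powr (2*H - 1)"
          using u by (simp add: mvn_kernel_def g0 power2_eq_square powr_add [symmetric])
        then show ?thesis by (auto simp: indicator_def)
      next
        case False
        then show ?thesis using elim by (auto simp: indicator_def)
      qed
    qed
  qed
  also have "\<dots> = ennreal (\<integral>x. (mvn_kernel H v x - mvn_kernel H u x - g x)\<^sup>2 \<partial>lborel)"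
    using g by (intro nn_integral_eq_integral) auto
  finally show ?thesis by (simp add: ennreal_le_iff integral_nonneg_AE)
qed

lemma mvn_const_pos:
  assumes H: "0 < H" "H < 1"
  shows "0 < mvn_const H"
proof -
  have "(1 - 0) powr (2 * H) / (2 * H) \<le> (\<integral>x. (mvn_kernel H 1 x - mvn_kernel H 0 x - 0)\<^sup>2 \<partial>lborel)"
    using mvn_kernel_1_square_integrable [OF H] H
    by (intro mvn_kernel_last_increment) (auto simp: mvn_kernel_def)
  then show ?thesis
    using H by (simp add: mvn_const_def mvn_kernel_def) (smt (verit) divide_pos_pos)
qed

section \<open>Gaussian bumps and projections\<close>

definition sq_integrable :: "'a measure \<Rightarrow> ('a \<Rightarrow> real) \<Rightarrow> bool" where
  "sq_integrable M f \<longleftrightarrow> f \<in> borel_measurable M \<and> integrable M (\<lambda>x. (f x)\<^sup>2)"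

definition l2_inner :: "'a measure \<Rightarrow> ('a \<Rightarrow> real) \<Rightarrow> ('a \<Rightarrow> real) \<Rightarrow> real" where
  "l2_inner M f g = (\<integral>x. f x * g x \<partial>M)"

lemma sq_integrable_mult: "sq_integrable M f \<Longrightarrow> sq_integrable M g \<Longrightarrow> integrable M (\<lambda>x. f x * g x)"
  unfolding sq_integrable_def by (intro integrable_mult_square_integrable) auto

lemma sq_integrable_cmult: "sq_integrable M f \<Longrightarrow> sq_integrable M (\<lambda>x. c * f x)"
  by (auto simp: sq_integrable_def power_mult_distrib)

lemma sq_integrable_add:
  assumes "sq_integrable M f" "sq_integrable M g"
  shows "sq_integrable M (\<lambda>x. f x + g x)"
proof -
  have "(f x + g x)\<^sup>2 = (f x)\<^sup>2 + (g x)\<^sup>2 + 2 * (f x * g x)" for x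
    by (simp add: power2_eq_square algebra_simps)
  then show ?thesis
    using assms sq_integrable_mult [OF assms] by (auto simp: sq_integrable_def)
qed

lemma sq_integrable_diff:
  "sq_integrable M f \<Longrightarrow> sq_integrable M g \<Longrightarrow> sq_integrable M (\<lambda>x. f x - g x)"
  using sq_integrable_add [of M f "\<lambda>x. (-1) * g x"] sq_integrable_cmult [of M g "-1"] by simp

lemma sq_integrable_sum:
  "(\<And>i. i \<in> I \<Longrightarrow> sq_integrable M (f i)) \<Longrightarrow> sq_integrable M (\<lambda>x. \<Sum>i\<in>I. f i x)"
proof (induction I rule: infinite_finite_induct)
  case (insert i I)
  then show ?case using sq_integrable_add [of M "f i" "\<lambda>x. \<Sum>i\<in>I. f i x"] by simp
qed (auto simp: sq_integrable_def)

lemma l2_inner_commute: "l2_inner M f g = l2_inner M g f"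
  by (simp add: l2_inner_def mult.commute)

lemma l2_inner_cmult_left: "l2_inner M (\<lambda>x. c * f x) g = c * l2_inner M f g"
  by (simp add: l2_inner_def mult.assoc)

lemma l2_inner_cmult_right: "l2_inner M f (\<lambda>x. c * g x) = c * l2_inner M f g"
  by (simp add: l2_inner_def mult.left_commute)

lemma l2_inner_add_left:
  assumes "sq_integrable M f" "sq_integrable M g" "sq_integrable M h"
  shows "l2_inner M (\<lambda>x. f x + g x) h = l2_inner M f h + l2_inner M g h"
  using assms by (simp add: l2_inner_def distrib_right sq_integrable_mult)

lemma l2_inner_diff_left:
  assumes "sq_integrable M f" "sq_integrable M g" "sq_integrable M h"
  shows "l2_inner M (\<lambda>x. f x - g x) h = l2_inner M f h - l2_inner M g h"
  using assms by (simp add: l2_inner_def left_diff_distrib sq_integrable_mult)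

lemma l2_inner_sum_left:
  assumes "\<And>i. i \<in> I \<Longrightarrow> sq_integrable M (f i)" "sq_integrable M h"
  shows "l2_inner M (\<lambda>x. \<Sum>i\<in>I. f i x) h = (\<Sum>i\<in>I. l2_inner M (f i) h)"
  using assms by (simp add: l2_inner_def sum_distrib_right sq_integrable_mult)

lemma l2_inner_zero_norm:
  assumes "sq_integrable M f" "sq_integrable M g" "l2_inner M g g = 0"
  shows "l2_inner M f g = 0"
proof -
  have "AE x in M. (g x)\<^sup>2 = 0"
    using assms by (subst integral_nonneg_eq_0_iff_AE [symmetric])
      (auto simp: sq_integrable_def l2_inner_def power2_eq_square)
  then have "AE x in M. f x * g x = 0" by auto
  then show ?thesis
    using assms unfolding l2_inner_def sq_integrable_def
    by (subst integral_cong_AE [where g="\<lambda>_. 0"]) auto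
qed

lemma l2_projection:
  fixes k :: "nat \<Rightarrow> 'a \<Rightarrow> real"
  assumes "\<And>i. i < n \<Longrightarrow> sq_integrable M (k i)" "sq_integrable M f"
  shows "\<exists>m. \<forall>j<n. l2_inner M (\<lambda>x. f x - (\<Sum>i<n. m i * k i x)) (k j) = 0"
  using assms
proof (induction n arbitrary: f)
  case 0
  then show ?case by simp
next
  case (Suc n)
  have k: "sq_integrable M (k i)" if "i \<le> n" for i using that Suc.prems by simp
  obtain m where m: "\<And>j. j < n \<Longrightarrow> l2_inner M (\<lambda>x. f x - (\<Sum>i<n. m i * k i x)) (k j) = 0"
    using Suc.IH [of f] Suc.prems by auto
  obtain p where p: "\<And>j. j < n \<Longrightarrow> l2_inner M (\<lambda>x. k n x - (\<Sum>i<n. p i * k i x)) (k j) = 0"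
    using Suc.IH [of "k n"] Suc.prems by auto
  define f' where "f' x = f x - (\<Sum>i<n. m i * k i x)" for x
  define g' where "g' x = k n x - (\<Sum>i<n. p i * k i x)" for x
  have f': "sq_integrable M f'" and g': "sq_integrable M g'"
    unfolding f'_def [abs_def] g'_def [abs_def]
    by (auto intro!: sq_integrable_diff sq_integrable_sum sq_integrable_cmult k Suc.prems)
  define a where "a = l2_inner M f' g' / l2_inner M g' g'"
  define r where "r x = f' x - a * g' x" for x
  have r: "sq_integrable M r"
    unfolding r_def [abs_def] by (intro sq_integrable_diff sq_integrable_cmult f' g')
  have r0: "l2_inner M r (k j) = 0" if "j < n" for j
    unfolding r_def [abs_def] using m [OF that] p [OF that] that k [of j] f' g'
    by (subst l2_inner_diff_left) (auto intro: sq_integrable_cmult simp: l2_inner_cmult_left f'_def [abs_def] g'_def [abs_def])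
  have rg: "l2_inner M r g' = 0"
  proof (cases "l2_inner M g' g' = 0")
    case True
    then show ?thesis using l2_inner_zero_norm [OF r g'] by simp
  next
    case False
    have "l2_inner M r g' = l2_inner M f' g' - a * l2_inner M g' g'"
      unfolding r_def [abs_def] using f' g'
      by (subst l2_inner_diff_left) (auto intro: sq_integrable_cmult simp: l2_inner_cmult_left)
    then show ?thesis using False by (simp add: a_def)
  qed
  have kn: "k n = (\<lambda>x. \<Sum>i<Suc n. if i = n then g' x else p i * k i x)"
    by (auto simp: g'_def)
  have "l2_inner M r (k n) = l2_inner M (k n) r" by (rule l2_inner_commute)
  also have "\<dots> = l2_inner M (\<lambda>x. \<Sum>i<Suc n. if i = n then g' x else p i * k i x) r"
    by (rule arg_cong [OF kn, of "\<lambda>f. l2_inner M f r"])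
  also have "l2_inner M (\<lambda>x. \<Sum>i<Suc n. if i = n then g' x else p i * k i x) r
      = (\<Sum>i<Suc n. l2_inner M (\<lambda>x. if i = n then g' x else p i * k i x) r)"
  proof (rule l2_inner_sum_left)
    show "sq_integrable M (\<lambda>x. if i = n then g' x else p i * k i x)" if "i \<in> {..<Suc n}" for i
      using that by (cases "i = n") (auto intro!: sq_integrable_cmult k g')
  qed (rule r)
  also have "\<dots> = 0"
    using rg r0 by (intro sum.neutral) (auto simp: l2_inner_cmult_right l2_inner_commute [of M _ r] less_Suc_eq)
  finally have rn: "l2_inner M r (k n) = 0" .
  have "r = (\<lambda>x. f x - (\<Sum>i<Suc n. (if i = n then a else m i - a * p i) * k i x))"
    by (auto simp: r_def f'_def g'_def algebra_simps sum_subtractf sum_distrib_left)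
  then show ?case
    using r0 rn by (intro exI [of _ "\<lambda>i. if i = n then a else m i - a * p i"]) (auto simp: less_Suc_eq)
qed

definition gauss_bump :: "real \<Rightarrow> real \<Rightarrow> real" where
  "gauss_bump d z = exp (- (z / d)\<^sup>2 / 2)"

lemma gauss_bump_measurable [measurable]: "gauss_bump d \<in> borel_measurable borel"
  unfolding gauss_bump_def [abs_def] by measurable

lemma gauss_bump_bounds: "0 < gauss_bump d z" "0 \<le> gauss_bump d z" "gauss_bump d z \<le> 1"
  by (auto simp: gauss_bump_def)

lemma gauss_bump_fourier:
  "complex_of_real (gauss_bump d z) = (CLINT y|std_normal_distribution. iexp (y * (z / d)))"
proof -
  have "(CLINT y|std_normal_distribution. iexp (y * (z / d))) = char std_normal_distribution (z / d)"
    by (simp add: char_def mult.commute)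
  then show ?thesis by (simp add: char_std_normal_distribution gauss_bump_def)
qed

lemma prob_space_std_normal: "prob_space std_normal_distribution"
  using real_dist_normal_dist by (simp add: real_distribution_def)

lemma (in prob_space) fourier_expectation:
  fixes \<phi> :: "'z \<Rightarrow> complex" and \<tau> :: "'z \<Rightarrow> real" and h :: "real \<Rightarrow> real"
  assumes "prob_space \<rho>" and [measurable]: "\<phi> \<in> borel_measurable \<rho>" "\<tau> \<in> borel_measurable \<rho>"
    and \<phi>: "\<And>z. norm (\<phi> z) \<le> 1"
    and h: "\<And>x. complex_of_real (h x) = (CLINT z|\<rho>. \<phi> z * iexp (\<tau> z * x))"
    and [measurable]: "F \<in> borel_measurable M" "Y \<in> borel_measurable M" and F: "\<And>\<omega>. norm (F \<omega> :: complex) \<le> 1"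
  shows "(CLINT \<omega>|M. F \<omega> * of_real (h (Y \<omega>))) = (CLINT z|\<rho>. \<phi> z * (CLINT \<omega>|M. F \<omega> * iexp (\<tau> z * Y \<omega>)))"
proof -
  interpret R: prob_space \<rho> by fact
  interpret RM: pair_prob_space \<rho> M ..
  have "(CLINT \<omega>|M. F \<omega> * of_real (h (Y \<omega>))) = (CLINT \<omega>|M. CLINT z|\<rho>. \<phi> z * (F \<omega> * iexp (\<tau> z * Y \<omega>)))"
    unfolding h integral_mult_right_zero [symmetric] by (simp only: mult_ac)
  also have "\<dots> = (CLINT z|\<rho>. CLINT \<omega>|M. \<phi> z * (F \<omega> * iexp (\<tau> z * Y \<omega>)))"
  proof (rule RM.Fubini_integral [of "\<lambda>z \<omega>. \<phi> z * (F \<omega> * iexp (\<tau> z * Y \<omega>))"])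
    show "integrable (\<rho> \<Otimes>\<^sub>M M) (\<lambda>(z, \<omega>). \<phi> z * (F \<omega> * iexp (\<tau> z * Y \<omega>)))"
      using F \<phi> by (intro RM.P.integrable_const_bound [where B=1]) (auto simp: norm_mult split: prod.splits intro!: mult_le_one)
  qed
  finally show ?thesis by (simp only: integral_mult_right_zero)
qed

lemma (in prob_space) gauss_bump_expectation:
  assumes "F \<in> borel_measurable M" and [measurable]: "Z \<in> borel_measurable M"
    and "\<And>\<omega>. norm (F \<omega> :: complex) \<le> 1"
  shows "(CLINT \<omega>|M. F \<omega> * of_real (gauss_bump d (Z \<omega>))) =
    (CLINT y|std_normal_distribution. CLINT \<omega>|M. F \<omega> * iexp (y * (Z \<omega> / d)))"
proof -
  have "(CLINT \<omega>|M. F \<omega> * of_real (gauss_bump d (Z \<omega>))) =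
      (CLINT y|std_normal_distribution. 1 * (CLINT \<omega>|M. F \<omega> * iexp ((y / d) * Z \<omega>)))"
    using assms by (intro fourier_expectation prob_space_std_normal) (auto simp: gauss_bump_fourier)
  then show ?thesis by simp
qed

lemma (in prob_space) gaussian_rv_char:
  assumes "gaussian_rv M X" "expectation X = 0"
  shows "integrable M X" "integrable M (\<lambda>\<omega>. (X \<omega>)\<^sup>2)"
    "(CLINT \<omega>|M. iexp (X \<omega>)) = of_real (exp (- expectation (\<lambda>\<omega>. (X \<omega>)\<^sup>2) / 2))"
proof -
  have X [measurable]: "X \<in> borel_measurable M" using assms by (simp add: gaussian_rv_def)
  consider \<mu> where "AE \<omega> in M. X \<omega> = \<mu>"
    | \<mu> \<sigma> where "0 < \<sigma>" "distributed M lborel X (normal_density \<mu> \<sigma>)"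
    using assms by (auto simp: gaussian_rv_def)
  then have "integrable M X \<and> integrable M (\<lambda>\<omega>. (X \<omega>)\<^sup>2) \<and>
    (CLINT \<omega>|M. iexp (X \<omega>)) = of_real (exp (- expectation (\<lambda>\<omega>. (X \<omega>)\<^sup>2) / 2))"
  proof cases
    case 1
    have "expectation X = expectation (\<lambda>_. \<mu>)" using 1 by (intro integral_cong_AE) auto
    with assms have "\<mu> = 0" by (simp add: prob_space)
    with 1 have 0: "AE \<omega> in M. X \<omega> = 0" by simp
    have "integrable M X" using 0 by (subst integrable_cong_AE [where g="\<lambda>_. 0"]) auto
    moreover have "integrable M (\<lambda>\<omega>. (X \<omega>)\<^sup>2)" using 0 by (subst integrable_cong_AE [where g="\<lambda>_. 0"]) auto
    moreover have "expectation (\<lambda>\<omega>. (X \<omega>)\<^sup>2) = 0"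
      using 0 by (subst integral_cong_AE [where g="\<lambda>_. 0"]) auto
    moreover have "(CLINT \<omega>|M. iexp (X \<omega>)) = 1"
      using 0 by (subst integral_cong_AE [where g="\<lambda>_. 1"]) (auto simp: prob_space)
    ultimately show ?thesis by simp
  next
    case 2
    have "\<mu> = 0" using assms normal_distributed_expectation [OF 2] by simp
    note D = 2(2) [unfolded this]
    have i1: "integrable M X"
      using 2 distributed_integrable_var [OF 2(2)] integrable_normal_moment_nz_1 [of \<sigma> \<mu>] by auto
    have i2: "integrable M (\<lambda>\<omega>. (X \<omega>)\<^sup>2)"
      using distributed_integrable [OF D, of "\<lambda>x. x\<^sup>2"] integrable_normal_moment [OF 2(1), of 0 2] by simp
    have var: "expectation (\<lambda>\<omega>. (X \<omega>)\<^sup>2) = \<sigma>\<^sup>2"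
      using normal_distributed_variance [OF 2(1) D] assms by simp
    have "distributed M lborel (\<lambda>\<omega>. (X \<omega> - 0) / \<sigma>) std_normal_density"
      using normal_standard_normal_convert [OF 2(1), of X 0] D by simp
    then have "distr M lborel (\<lambda>\<omega>. X \<omega> / \<sigma>) = std_normal_distribution"
      by (simp add: distributed_def)
    then have "(CLINT x|std_normal_distribution. iexp (\<sigma> * x)) = (CLINT x|distr M lborel (\<lambda>\<omega>. X \<omega> / \<sigma>). iexp (\<sigma> * x))"
      by simp
    also have "\<dots> = (CLINT \<omega>|M. iexp (\<sigma> * (X \<omega> / \<sigma>)))"
      by (intro integral_distr) auto
    also have "\<dots> = (CLINT \<omega>|M. iexp (X \<omega>))" using 2(1) by simp
    finally have "(CLINT \<omega>|M. iexp (X \<omega>)) = char std_normal_distribution \<sigma>"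
      by (simp add: char_def)
    then show ?thesis using i1 i2 var by (simp add: char_std_normal_distribution)
  qed
  then show "integrable M X" "integrable M (\<lambda>\<omega>. (X \<omega>)\<^sup>2)"
    "(CLINT \<omega>|M. iexp (X \<omega>)) = of_real (exp (- expectation (\<lambda>\<omega>. (X \<omega>)\<^sup>2) / 2))" by auto
qed

lemma integral_gauss_bump_std_normal:
  assumes "0 < a"
  shows "integrable std_normal_distribution (\<lambda>y. exp (- (a * y)\<^sup>2 / 2))"
    and "(\<integral>y. exp (- (a * y)\<^sup>2 / 2) \<partial>std_normal_distribution) \<le> 1 / a"
proof -
  interpret N: prob_space std_normal_distribution by (rule prob_space_std_normal)
  show "integrable std_normal_distribution (\<lambda>y. exp (- (a * y)\<^sup>2 / 2))"
    by (intro N.integrable_const_bound [where B=1]) auto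
  define s where "s = sqrt (1 + a\<^sup>2)"
  have s: "0 < s" "s\<^sup>2 = 1 + a\<^sup>2" using assms by (auto simp: s_def add_pos_nonneg)
  have "std_normal_density y * exp (- (a * y)\<^sup>2 / 2) = (1 / s) * normal_density 0 (1 / s) y" for y
  proof -
    have "- y\<^sup>2 / 2 + - (a * y)\<^sup>2 / 2 = - (s * y)\<^sup>2 / 2"
      by (simp add: power_mult_distrib s field_simps)
    moreover have "sqrt (2 * pi * (1 / s)\<^sup>2) = sqrt (2 * pi) / s"
      using s(1) by (simp add: real_sqrt_mult real_sqrt_divide power_one_over)
    moreover have "(y - 0)\<^sup>2 / (2 * (1 / s)\<^sup>2) = (s * y)\<^sup>2 / 2"
      using s(1) by (simp add: field_simps)
    moreover have "std_normal_density y * exp (- (a * y)\<^sup>2 / 2) = exp (- y\<^sup>2 / 2 + - (a * y)\<^sup>2 / 2) / sqrt (2 * pi)"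
      unfolding exp_add by (simp add: std_normal_density_def)
    ultimately show ?thesis
      using s(1) by (simp add: normal_density_def del: power_one_over)
  qed
  then have "(\<integral>y. exp (- (a * y)\<^sup>2 / 2) \<partial>std_normal_distribution) = (1 / s) * (\<integral>y. normal_density 0 (1 / s) y \<partial>lborel)"
    by (subst integral_density) (auto simp: normal_density_nonneg)
  also have "\<dots> = 1 / s" using s by simp
  also have "\<dots> \<le> 1 / a"
    using assms s(1) by (intro divide_left_mono) (auto simp: s_def intro!: real_le_rsqrt)
  finally show "(\<integral>y. exp (- (a * y)\<^sup>2 / 2) \<partial>std_normal_distribution) \<le> 1 / a" .
qed

section \<open>Local nondeterminism\<close>

locale fbm = prob_space P for P :: "'w measure" +
  fixes H :: real and B :: "real \<Rightarrow> 'w \<Rightarrow> real"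
  assumes fbm: "fractional_brownian_motion P H B"
begin

lemma H: "0 < H" "H < 1" using fbm by (auto simp: fractional_brownian_motion_def)

definition kern :: "real \<Rightarrow> real \<Rightarrow> real" where
  "kern t x = sqrt (expectation (\<lambda>\<omega>. (B 1 \<omega>)\<^sup>2) / mvn_const H) * mvn_kernel H t x"

text \<open>
  Carrying the kernel along with the random variable makes independence arguments superfluous:
  orthogonality is read off in \<open>L\<^sup>2(lborel)\<close>, and only characteristic functions of linear
  combinations of the process are ever used.
\<close>

definition gaussian_pair :: "('w \<Rightarrow> real) \<Rightarrow> (real \<Rightarrow> real) \<Rightarrow> bool" where
  "gaussian_pair X k \<longleftrightarrow> (\<exists>J c. finite J \<and> J \<subseteq> {0..} \<and>
     X = (\<lambda>\<omega>. \<Sum>t\<in>J. c t * B t \<omega>) \<and> k = (\<lambda>x. \<Sum>t\<in>J. c t * kern t x))"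

lemma gaussian_pairE:
  assumes "gaussian_pair X k"
  obtains J c where "finite J" "J \<subseteq> {0..}" "X = (\<lambda>\<omega>. \<Sum>t\<in>J. c t * B t \<omega>)"
    "k = (\<lambda>x. \<Sum>t\<in>J. c t * kern t x)"
  using assms by (auto simp: gaussian_pair_def)

lemma gaussian_rv_sum:
  "finite J \<Longrightarrow> J \<subseteq> {0..} \<Longrightarrow> gaussian_rv P (\<lambda>\<omega>. \<Sum>t\<in>J. c t * B t \<omega>)"
  using fbm by (auto simp: fractional_brownian_motion_def gaussian_process_def)

lemma gaussian_rv_B: "0 \<le> t \<Longrightarrow> gaussian_rv P (B t)"
  using gaussian_rv_sum [of "{t}" "\<lambda>_. 1"] by simp

lemma expectation_B: "0 \<le> t \<Longrightarrow> expectation (B t) = 0"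
  using fbm by (auto simp: fractional_brownian_motion_def)

lemma B_measurable [measurable]: "0 \<le> t \<Longrightarrow> B t \<in> borel_measurable P"
  using gaussian_rv_B by (auto simp: gaussian_rv_def)

lemma sq_integrable_B: "0 \<le> t \<Longrightarrow> sq_integrable P (B t)"
  using gaussian_rv_char(2) [OF gaussian_rv_B expectation_B] by (simp add: sq_integrable_def)

lemma integrable_B: "0 \<le> t \<Longrightarrow> integrable P (B t)"
  using gaussian_rv_char(1) [OF gaussian_rv_B expectation_B] by simp

lemma sq_integrable_kern: "0 \<le> t \<Longrightarrow> sq_integrable lborel (kern t)"
  unfolding kern_def [abs_def]
  using mvn_kernel_norm [OF H, of t]
  by (intro sq_integrable_cmult) (auto simp: sq_integrable_def has_bochner_integral_iff)

lemma inner_kern: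
  assumes "0 \<le> s" "0 \<le> t"
  shows "l2_inner lborel (kern s) (kern t) = l2_inner P (B s) (B t)"
proof -
  have "l2_inner P (B s) (B t) = covariance P (B s) (B t)"
    using assms by (simp add: covariance_def expectation_B l2_inner_def)
  also have "\<dots> = expectation (\<lambda>\<omega>. (B 1 \<omega>)\<^sup>2) / 2 * (t powr (2 * H) + s powr (2 * H) - \<bar>t - s\<bar> powr (2 * H))"
    using fbm assms by (simp add: fractional_brownian_motion_def)
  finally have 1: "l2_inner P (B s) (B t) = \<dots>" .
  have "l2_inner lborel (kern s) (kern t) =
      (sqrt (expectation (\<lambda>\<omega>. (B 1 \<omega>)\<^sup>2) / mvn_const H))\<^sup>2 * (\<integral>x. mvn_kernel H s x * mvn_kernel H t x \<partial>lborel)"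
    unfolding kern_def [abs_def] l2_inner_cmult_left l2_inner_cmult_right
    by (simp only: l2_inner_def power2_eq_square mult.assoc)
  also have "\<dots> = expectation (\<lambda>\<omega>. (B 1 \<omega>)\<^sup>2) / mvn_const H *
      (mvn_const H / 2 * (t powr (2 * H) + s powr (2 * H) - \<bar>t - s\<bar> powr (2 * H)))"
  proof -
    have "(sqrt (expectation (\<lambda>\<omega>. (B 1 \<omega>)\<^sup>2) / mvn_const H))\<^sup>2 = expectation (\<lambda>\<omega>. (B 1 \<omega>)\<^sup>2) / mvn_const H"
      using mvn_const_pos [OF H] by (intro real_sqrt_pow2 divide_nonneg_pos) auto
    then show ?thesis
      by (simp only: has_bochner_integral_integral_eq [OF mvn_kernel_inner [OF H assms]])
  qed
  also have "\<dots> = l2_inner P (B s) (B t)"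
    using mvn_const_pos [OF H] by (simp add: 1)
  finally show ?thesis .
qed

lemma l2_inner_sums:
  assumes "\<And>t. t \<in> J \<Longrightarrow> sq_integrable M (f t)" "finite J"
  shows "l2_inner M (\<lambda>x. \<Sum>t\<in>J. c t * f t x) (\<lambda>x. \<Sum>t\<in>J. c t * f t x) =
    (\<Sum>s\<in>J. \<Sum>t\<in>J. c s * c t * l2_inner M (f t) (f s))"
proof -
  have S: "sq_integrable M (\<lambda>x. \<Sum>t\<in>J. c t * f t x)"
    using assms by (intro sq_integrable_sum sq_integrable_cmult)
  have 1: "l2_inner M (f s) (\<lambda>x. \<Sum>t\<in>J. c t * f t x) = (\<Sum>t\<in>J. c t * l2_inner M (f t) (f s))" if "s \<in> J" for s
    using assms that by (subst l2_inner_commute, subst l2_inner_sum_left)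
      (auto intro: sq_integrable_cmult simp: l2_inner_cmult_left)
  have "l2_inner M (\<lambda>x. \<Sum>t\<in>J. c t * f t x) (\<lambda>x. \<Sum>t\<in>J. c t * f t x) =
     (\<Sum>s\<in>J. c s * l2_inner M (f s) (\<lambda>x. \<Sum>t\<in>J. c t * f t x))"
    using assms S by (subst l2_inner_sum_left) (auto intro: sq_integrable_cmult simp: l2_inner_cmult_left)
  also have "\<dots> = (\<Sum>s\<in>J. \<Sum>t\<in>J. c s * c t * l2_inner M (f t) (f s))"
    by (intro sum.cong refl) (simp add: 1 sum_distrib_left mult.assoc)
  finally show ?thesis .
qed

lemma gaussian_pair:
  assumes "gaussian_pair X k"
  shows gaussian_pair_measurable: "X \<in> borel_measurable P"
    and gaussian_pair_sq_integrable: "sq_integrable lborel k"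
    and gaussian_pair_rv: "gaussian_rv P X" "expectation X = 0"
    and gaussian_pair_var: "expectation (\<lambda>\<omega>. (X \<omega>)\<^sup>2) = l2_inner lborel k k"
    and gaussian_pair_char: "(CLINT \<omega>|P. iexp (X \<omega>)) = of_real (exp (- l2_inner lborel k k / 2))"
proof -
  obtain J c where J: "finite J" "J \<subseteq> {0..}" and X: "X = (\<lambda>\<omega>. \<Sum>t\<in>J. c t * B t \<omega>)"
    and k: "k = (\<lambda>x. \<Sum>t\<in>J. c t * kern t x)" using assms by (rule gaussian_pairE)
  show "X \<in> borel_measurable P" unfolding X using J by (intro borel_measurable_sum) auto
  show "sq_integrable lborel k"
    unfolding k using J by (intro sq_integrable_sum sq_integrable_cmult sq_integrable_kern) auto
  show g: "gaussian_rv P X" unfolding X by (rule gaussian_rv_sum [OF J])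
  show e: "expectation X = 0"
    unfolding X using J by (subst Bochner_Integration.integral_sum)
      (auto intro!: integrable_B sum.neutral simp: expectation_B subset_iff)
  show v: "expectation (\<lambda>\<omega>. (X \<omega>)\<^sup>2) = l2_inner lborel k k"
  proof -
    have "expectation (\<lambda>\<omega>. (X \<omega>)\<^sup>2) = l2_inner P X X" by (simp add: l2_inner_def power2_eq_square)
    also have "\<dots> = l2_inner lborel k k"
      unfolding X k using J
      by (subst (1 2) l2_inner_sums) (auto intro!: sq_integrable_B sq_integrable_kern sum.cong simp: inner_kern subset_iff)
    finally show ?thesis .
  qed
  show "(CLINT \<omega>|P. iexp (X \<omega>)) = of_real (exp (- l2_inner lborel k k / 2))"
    using gaussian_rv_char(3) [OF g e] by (simp add: v)
qed

lemma gaussian_pair_B: "0 \<le> t \<Longrightarrow> gaussian_pair (B t) (kern t)"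
  unfolding gaussian_pair_def by (intro exI [of _ "{t}"] exI [of _ "\<lambda>_. 1"]) simp

lemma gaussian_pair_cmult: "gaussian_pair X k \<Longrightarrow> gaussian_pair (\<lambda>\<omega>. a * X \<omega>) (\<lambda>x. a * k x)"
  unfolding gaussian_pair_def
  by (elim exE conjE, rule_tac x=J in exI, rule_tac x="\<lambda>t. a * c t" in exI)
    (simp add: sum_distrib_left mult.assoc)

lemma gaussian_pair_add:
  assumes "gaussian_pair X k" "gaussian_pair X' k'"
  shows "gaussian_pair (\<lambda>\<omega>. X \<omega> + X' \<omega>) (\<lambda>x. k x + k' x)"
proof -
  obtain J c where J: "finite J" "J \<subseteq> {0..}" and X: "X = (\<lambda>\<omega>. \<Sum>t\<in>J. c t * B t \<omega>)"
    and k: "k = (\<lambda>x. \<Sum>t\<in>J. c t * kern t x)" using assms(1) by (rule gaussian_pairE)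
  obtain J' c' where J': "finite J'" "J' \<subseteq> {0..}" and X': "X' = (\<lambda>\<omega>. \<Sum>t\<in>J'. c' t * B t \<omega>)"
    and k': "k' = (\<lambda>x. \<Sum>t\<in>J'. c' t * kern t x)" using assms(2) by (rule gaussian_pairE)
  define a where "a t = (if t \<in> J then c t else 0)" for t
  define a' where "a' t = (if t \<in> J' then c' t else 0)" for t
  have 1: "(\<Sum>t\<in>J. c t * f t) = (\<Sum>t\<in>J \<union> J'. a t * f t)" for f :: "real \<Rightarrow> real"
    using J J' by (intro sum.mono_neutral_cong_left) (auto simp: a_def)
  have 2: "(\<Sum>t\<in>J'. c' t * f t) = (\<Sum>t\<in>J \<union> J'. a' t * f t)" for f :: "real \<Rightarrow> real"
    using J J' by (intro sum.mono_neutral_cong_left) (auto simp: a'_def)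
  show ?thesis
    unfolding gaussian_pair_def using J J'
    by (intro exI [of _ "J \<union> J'"] exI [of _ "\<lambda>t. a t + a' t"])
      (auto simp: X X' k k' 1 2 sum.distrib distrib_right)
qed

lemma gaussian_pair_diff:
  "gaussian_pair X k \<Longrightarrow> gaussian_pair X' k' \<Longrightarrow> gaussian_pair (\<lambda>\<omega>. X \<omega> - X' \<omega>) (\<lambda>x. k x - k' x)"
  using gaussian_pair_add [of X k "\<lambda>\<omega>. (-1) * X' \<omega>" "\<lambda>x. (-1) * k' x"] gaussian_pair_cmult [of X' k' "-1"] by simp

lemma gaussian_pair_sum:
  "(\<And>i. i < n \<Longrightarrow> gaussian_pair (X i) (k i)) \<Longrightarrow>
    gaussian_pair (\<lambda>\<omega>. \<Sum>i<n. X i \<omega>) (\<lambda>x. \<Sum>i<(n::nat). k i x)"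
proof (induction n)
  case 0
  show ?case unfolding gaussian_pair_def by (intro exI [of _ "{}"]) simp
next
  case (Suc n)
  then show ?case using gaussian_pair_add [of "\<lambda>\<omega>. \<Sum>i<n. X i \<omega>" "\<lambda>x. \<Sum>i<n. k i x" "X n" "k n"] by simp
qed

lemma gauss_bump_prod_decouple:
  fixes Z :: "nat \<Rightarrow> 'w \<Rightarrow> real"
  assumes "\<And>i. i < n \<Longrightarrow> gaussian_pair (Z i) (k i)" and R: "gaussian_pair R r"
    and "\<And>i. i < n \<Longrightarrow> l2_inner lborel (k i) r = 0"
    and "gaussian_pair V v" "l2_inner lborel v r = 0"
  shows "(CLINT \<omega>|P. (\<Prod>i<n. of_real (gauss_bump d (Z i \<omega>))) * iexp (V \<omega> + R \<omega>)) =
    of_real (exp (- l2_inner lborel r r / 2)) * (CLINT \<omega>|P. (\<Prod>i<n. of_real (gauss_bump d (Z i \<omega>))) * iexp (V \<omega>))"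
  using assms
proof (induction n arbitrary: V v)
  case 0
  note r = gaussian_pair_sq_integrable [OF R] and v = gaussian_pair_sq_integrable [OF "0.prems"(4)]
  have "l2_inner lborel (\<lambda>x. v x + r x) (\<lambda>x. v x + r x) =
      (\<integral>x. v x * v x + 2 * (v x * r x) + r x * r x \<partial>lborel)"
    unfolding l2_inner_def by (intro Bochner_Integration.integral_cong) (auto simp: algebra_simps)
  also have "\<dots> = l2_inner lborel v v + 2 * l2_inner lborel v r + l2_inner lborel r r"
    unfolding l2_inner_def using r v by (simp add: sq_integrable_mult)
  also have "\<dots> = l2_inner lborel v v + l2_inner lborel r r" using 0 by simp
  finally have "l2_inner lborel (\<lambda>x. v x + r x) (\<lambda>x. v x + r x) = \<dots>" .
  then show ?case
    using gaussian_pair_char [OF gaussian_pair_add [OF "0.prems"(4) R]] gaussian_pair_char [OF "0.prems"(4)]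
    by (simp add: exp_add [symmetric] add_divide_distrib del: of_real_add flip: of_real_mult)
next
  case (Suc n)
  let ?F = "\<lambda>\<omega>. \<Prod>i<n. complex_of_real (gauss_bump d (Z i \<omega>))"
  have [measurable]: "Z i \<in> borel_measurable P" if "i \<le> n" for i
    using Suc.prems(1) [of i] that gaussian_pair_measurable by auto
  have [measurable]: "R \<in> borel_measurable P" "V \<in> borel_measurable P"
    using R Suc.prems(4) gaussian_pair_measurable by auto
  have [measurable]: "?F \<in> borel_measurable P"
    by (intro borel_measurable_prod) measurable
  have bound: "norm (?F \<omega> * iexp (V' \<omega>)) \<le> 1" for \<omega> and V' :: "'w \<Rightarrow> real"
    by (auto simp: norm_mult prod_norm [symmetric] gauss_bump_bounds intro!: prod_le_1)
  have step: "(CLINT \<omega>|P. (\<Prod>i<Suc n. of_real (gauss_bump d (Z i \<omega>))) * iexp (V' \<omega>)) =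
      (CLINT y|std_normal_distribution. CLINT \<omega>|P. ?F \<omega> * iexp ((y / d) * Z n \<omega> + V' \<omega>))"
    if [measurable]: "V' \<in> borel_measurable P" for V'
  proof -
    have "(CLINT \<omega>|P. (\<Prod>i<Suc n. of_real (gauss_bump d (Z i \<omega>))) * iexp (V' \<omega>)) =
      (CLINT \<omega>|P. (?F \<omega> * iexp (V' \<omega>)) * of_real (gauss_bump d (Z n \<omega>)))"
      by (simp add: mult_ac)
    also have "\<dots> = (CLINT y|std_normal_distribution. CLINT \<omega>|P. (?F \<omega> * iexp (V' \<omega>)) * iexp (y * (Z n \<omega> / d)))"
      by (intro gauss_bump_expectation bound) measurable
    also have "\<dots> = (CLINT y|std_normal_distribution. CLINT \<omega>|P. ?F \<omega> * iexp ((y / d) * Z n \<omega> + V' \<omega>))"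
      by (intro Bochner_Integration.integral_cong) (auto simp: exp_add [symmetric] mult.assoc algebra_simps)
    finally show ?thesis .
  qed
  have IH: "(CLINT \<omega>|P. ?F \<omega> * iexp ((y / d) * Z n \<omega> + (V \<omega> + R \<omega>))) =
      of_real (exp (- l2_inner lborel r r / 2)) * (CLINT \<omega>|P. ?F \<omega> * iexp ((y / d) * Z n \<omega> + V \<omega>))" for y
  proof -
    have "gaussian_pair (\<lambda>\<omega>. (y / d) * Z n \<omega> + V \<omega>) (\<lambda>x. (y / d) * k n x + v x)"
      using Suc.prems by (intro gaussian_pair_add gaussian_pair_cmult) auto
    moreover have "l2_inner lborel (\<lambda>x. (y / d) * k n x + v x) r = 0"
    proof -
      have "l2_inner lborel (\<lambda>x. (y / d) * k n x + v x) r = (y / d) * l2_inner lborel (k n) r + l2_inner lborel v r"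
        using sq_integrable_cmult [OF gaussian_pair_sq_integrable [OF Suc.prems(1) [of n]], of "y / d"]
          gaussian_pair_sq_integrable [OF R] gaussian_pair_sq_integrable [OF Suc.prems(4)]
        by (subst l2_inner_add_left) (auto simp only: l2_inner_cmult_left lessI)
      then show ?thesis using Suc.prems by simp
    qed
    ultimately show ?thesis
      using Suc.IH [OF _ R _, of "\<lambda>\<omega>. (y / d) * Z n \<omega> + V \<omega>" "\<lambda>x. (y / d) * k n x + v x"] Suc.prems
      by (simp add: add.assoc)
  qed
  show ?case
    by (subst (1 2) step) (simp_all only: IH integral_mult_right_zero, measurable)
qed

text \<open>
  Write the last variable as its projection \<open>L\<close> on the earlier ones plus an orthogonal rest.  The
  rest contributes a Gaussian factor, and \<open>L\<close> only a factor of modulus at most one under the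
  expectation.
\<close>

lemma gauss_bump_prod_step:
  fixes Z :: "nat \<Rightarrow> 'w \<Rightarrow> real"
  assumes Z: "\<And>i. i \<le> n \<Longrightarrow> gaussian_pair (Z i) (k i)" and d: "0 < d" and s: "0 < s"
    and gap: "\<And>m. s\<^sup>2 \<le> l2_inner lborel (\<lambda>x. k n x - (\<Sum>i<n. m i * k i x)) (\<lambda>x. k n x - (\<Sum>i<n. m i * k i x))"
  shows "expectation (\<lambda>\<omega>. \<Prod>i<Suc n. gauss_bump d (Z i \<omega>)) \<le> (d / s) * expectation (\<lambda>\<omega>. \<Prod>i<n. gauss_bump d (Z i \<omega>))"
proof -
  have k: "sq_integrable lborel (k i)" if "i \<le> n" for i
    using Z [OF that] gaussian_pair_sq_integrable by blast
  obtain m where m: "\<And>j. j < n \<Longrightarrow> l2_inner lborel (\<lambda>x. k n x - (\<Sum>i<n. m i * k i x)) (k j) = 0"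
    using l2_projection [of n lborel k "k n"] k by auto
  define r where "r x = k n x - (\<Sum>i<n. m i * k i x)" for x
  define R where "R \<omega> = Z n \<omega> - (\<Sum>i<n. m i * Z i \<omega>)" for \<omega>
  define L where "L \<omega> = (\<Sum>i<n. m i * Z i \<omega>)" for \<omega>
  have LL: "gaussian_pair L (\<lambda>x. \<Sum>i<n. m i * k i x)"
    unfolding L_def [abs_def] using Z by (intro gaussian_pair_sum gaussian_pair_cmult) auto
  have RR: "gaussian_pair R r"
    unfolding R_def [abs_def] r_def [abs_def] using Z LL [unfolded L_def [abs_def]]
    by (intro gaussian_pair_diff) auto
  have rj: "l2_inner lborel (k j) r = 0" if "j < n" for j
    using m [OF that] by (simp add: r_def [abs_def] l2_inner_commute)
  have rL: "l2_inner lborel (\<lambda>x. \<Sum>i<n. m i * k i x) r = 0"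
    using rj k gaussian_pair_sq_integrable [OF RR]
    by (subst l2_inner_sum_left) (auto intro!: sq_integrable_cmult sum.neutral simp: l2_inner_cmult_left)
  define \<rho> where "\<rho> = l2_inner lborel r r"
  have \<rho>: "s\<^sup>2 \<le> \<rho>" using gap [of m] by (simp add: \<rho>_def r_def [abs_def])
  have \<rho>0: "0 \<le> \<rho>" using \<rho> zero_le_power2 [of s] by linarith
  let ?F = "\<lambda>\<omega>. \<Prod>i<n. complex_of_real (gauss_bump d (Z i \<omega>))"
  define E where "E = expectation (\<lambda>\<omega>. \<Prod>i<n. gauss_bump d (Z i \<omega>))"
  have [measurable]: "Z i \<in> borel_measurable P" if "i \<le> n" for i
    using Z [OF that] gaussian_pair_measurable by auto
  have [measurable]: "L \<in> borel_measurable P" "R \<in> borel_measurable P"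
    using LL RR gaussian_pair_measurable by auto
  have [measurable]: "?F \<in> borel_measurable P" by (intro borel_measurable_prod) measurable
  have normF: "norm (?F \<omega>) = (\<Prod>i<n. gauss_bump d (Z i \<omega>))" for \<omega>
    by (simp add: prod_norm [symmetric] gauss_bump_bounds)
  have F1: "norm (?F \<omega>) \<le> 1" for \<omega>
    unfolding normF by (intro prod_le_1) (auto simp: gauss_bump_bounds)
  have Emono: "norm (CLINT \<omega>|P. ?F \<omega> * iexp (V \<omega>)) \<le> E" for V
    unfolding E_def normF [symmetric]
    by (rule order_trans [OF integral_norm_bound]) (simp add: norm_mult)
  have E0: "0 \<le> E" unfolding E_def by (intro integral_nonneg_AE) (auto intro!: prod_nonneg simp: gauss_bump_bounds)
  have "complex_of_real (expectation (\<lambda>\<omega>. \<Prod>i<Suc n. gauss_bump d (Z i \<omega>))) =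
      (CLINT \<omega>|P. ?F \<omega> * of_real (gauss_bump d (Z n \<omega>)))"
    by (simp add: integral_complex_of_real [symmetric] mult.commute)
  also have "\<dots> = (CLINT y|std_normal_distribution. CLINT \<omega>|P. ?F \<omega> * iexp (y * (Z n \<omega> / d)))"
    by (intro gauss_bump_expectation F1) measurable
  also have "\<dots> = (CLINT y|std_normal_distribution. of_real (exp (- ((sqrt \<rho> / d) * y)\<^sup>2 / 2)) * (CLINT \<omega>|P. ?F \<omega> * iexp ((y / d) * L \<omega>)))"
  proof (intro Bochner_Integration.integral_cong refl)
    fix y :: real
    have "(CLINT \<omega>|P. ?F \<omega> * iexp (y * (Z n \<omega> / d))) = (CLINT \<omega>|P. ?F \<omega> * iexp ((y / d) * L \<omega> + (y / d) * R \<omega>))"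
    proof -
      have "y * (Z n \<omega> / d) = (y / d) * L \<omega> + (y / d) * R \<omega>" for \<omega>
        by (simp add: R_def L_def algebra_simps diff_divide_distrib)
      then show ?thesis by simp
    qed
    also have "\<dots> = of_real (exp (- l2_inner lborel (\<lambda>x. (y / d) * r x) (\<lambda>x. (y / d) * r x) / 2)) * (CLINT \<omega>|P. ?F \<omega> * iexp ((y / d) * L \<omega>))"
      using Z rj rL
      by (intro gauss_bump_prod_decouple [where k = k and v = "\<lambda>x. (y / d) * (\<Sum>i<n. m i * k i x)"] gaussian_pair_cmult LL RR)
        (auto simp: l2_inner_cmult_right l2_inner_cmult_left simp del: times_divide_eq_left)
    also have "l2_inner lborel (\<lambda>x. (y / d) * r x) (\<lambda>x. (y / d) * r x) = ((sqrt \<rho> / d) * y)\<^sup>2"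
      using \<rho>0 by (simp only: l2_inner_cmult_right l2_inner_cmult_left \<rho>_def [symmetric])
        (simp add: power_mult_distrib power_divide, simp add: power2_eq_square)
    finally show "(CLINT \<omega>|P. ?F \<omega> * iexp (y * (Z n \<omega> / d))) =
      of_real (exp (- ((sqrt \<rho> / d) * y)\<^sup>2 / 2)) * (CLINT \<omega>|P. ?F \<omega> * iexp ((y / d) * L \<omega>))" .
  qed
  finally have eq: "complex_of_real (expectation (\<lambda>\<omega>. \<Prod>i<Suc n. gauss_bump d (Z i \<omega>))) =
    (CLINT y|std_normal_distribution. of_real (exp (- ((sqrt \<rho> / d) * y)\<^sup>2 / 2)) * (CLINT \<omega>|P. ?F \<omega> * iexp ((y / d) * L \<omega>)))" .
  have "expectation (\<lambda>\<omega>. \<Prod>i<Suc n. gauss_bump d (Z i \<omega>)) \<le>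
      norm (complex_of_real (expectation (\<lambda>\<omega>. \<Prod>i<Suc n. gauss_bump d (Z i \<omega>))))"
    by (simp only: norm_of_real abs_ge_self)
  also have "\<dots> = norm (CLINT y|std_normal_distribution.
      of_real (exp (- ((sqrt \<rho> / d) * y)\<^sup>2 / 2)) * (CLINT \<omega>|P. ?F \<omega> * iexp ((y / d) * L \<omega>)))"
    by (rule arg_cong [OF eq])
  also have "\<dots> \<le> (\<integral>y. exp (- ((sqrt \<rho> / d) * y)\<^sup>2 / 2) * E \<partial>std_normal_distribution)"
  proof (rule order_trans [OF integral_norm_bound], rule integral_mono')
    have "0 < sqrt \<rho> / d" using \<rho> s d by (auto intro!: divide_pos_pos) (smt (verit) zero_less_power)
    then show "integrable std_normal_distribution (\<lambda>y. exp (- ((sqrt \<rho> / d) * y)\<^sup>2 / 2) * E)"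
      by (intro integrable_mult_left integral_gauss_bump_std_normal(1))
    fix y :: real
    show "norm (of_real (exp (- ((sqrt \<rho> / d) * y)\<^sup>2 / 2)) * (CLINT \<omega>|P. ?F \<omega> * iexp ((y / d) * L \<omega>)))
        \<le> exp (- ((sqrt \<rho> / d) * y)\<^sup>2 / 2) * E"
      unfolding norm_mult norm_of_real abs_exp_cancel by (intro mult_left_mono Emono) simp
    show "0 \<le> exp (- ((sqrt \<rho> / d) * y)\<^sup>2 / 2) * E" using E0 by simp
  qed
  also have "\<dots> \<le> E * (1 / (sqrt \<rho> / d))"
  proof -
    have "0 < sqrt \<rho> / d" using \<rho> s d by (auto intro!: divide_pos_pos) (smt (verit) zero_less_power)
    from mult_left_mono [OF integral_gauss_bump_std_normal(2) [OF this] E0] show ?thesis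
      unfolding integral_mult_left_zero by (simp only: mult.commute [of E])
  qed
  also have "\<dots> \<le> E * (d / s)"
  proof -
    have "s \<le> sqrt \<rho>" using \<rho> by (rule real_le_rsqrt)
    then have "d / sqrt \<rho> \<le> d / s" using d s by (intro frac_le) auto
    then have "E * (d / sqrt \<rho>) \<le> E * (d / s)" using E0 by (rule mult_left_mono)
    then show ?thesis by simp
  qed
  finally show ?thesis by (simp add: E_def mult.commute)
qed

end

lemma borel_measurable_continuous_process:
  fixes X :: "real \<Rightarrow> 'a \<Rightarrow> real"
  assumes [measurable]: "\<And>t. X t \<in> borel_measurable M"
    and cont: "\<And>\<omega>. \<omega> \<in> space M \<Longrightarrow> continuous_on UNIV (\<lambda>t. X t \<omega>)"
  shows "(\<lambda>(t, \<omega>). X t \<omega>) \<in> borel_measurable (borel \<Otimes>\<^sub>M M)"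
proof (rule borel_measurable_LIMSEQ_real)
  fix n :: nat
  have "(\<lambda>p. (\<lambda>i p. X (of_int i / real (Suc n)) (snd p)) \<lfloor>fst p * real (Suc n)\<rfloor> p) \<in> borel_measurable (borel \<Otimes>\<^sub>M M)"
  proof (rule measurable_compose_countable [where f = "\<lambda>i p. X (of_int i / real (Suc n)) (snd p)" and g = "\<lambda>p. \<lfloor>fst p * real (Suc n)\<rfloor>"])
    show "(\<lambda>p. X (of_int i / real (Suc n)) (snd p)) \<in> borel_measurable (borel \<Otimes>\<^sub>M M)" for i
      by (rule measurable_compose [OF measurable_snd assms(1)])
    show "(\<lambda>p. \<lfloor>fst p * real (Suc n)\<rfloor>) \<in> borel \<Otimes>\<^sub>M M \<rightarrow>\<^sub>M count_space UNIV"
      by (rule measurable_compose [OF _ measurable_real_floor]) simp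
  qed
  then show "(\<lambda>p. X (of_int \<lfloor>fst p * real (Suc n)\<rfloor> / real (Suc n)) (snd p)) \<in> borel_measurable (borel \<Otimes>\<^sub>M M)"
    by simp
next
  fix p :: "real \<times> 'a" assume "p \<in> space (borel \<Otimes>\<^sub>M M)"
  then have \<omega>: "snd p \<in> space M" by (auto simp: space_pair_measure)
  have "(\<lambda>n. of_int \<lfloor>fst p * real (Suc n)\<rfloor> / real (Suc n)) \<longlonglongrightarrow> fst p"
  proof (rule tendsto_sandwich)
    show "\<forall>\<^sub>F n in sequentially. fst p - 1 / real (Suc n) \<le> of_int \<lfloor>fst p * real (Suc n)\<rfloor> / real (Suc n)"
    proof (intro always_eventually allI)
      fix n
      have "(fst p * real (Suc n) - 1) / real (Suc n) \<le> of_int \<lfloor>fst p * real (Suc n)\<rfloor> / real (Suc n)"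
        by (intro divide_right_mono) linarith+
      then show "fst p - 1 / real (Suc n) \<le> of_int \<lfloor>fst p * real (Suc n)\<rfloor> / real (Suc n)"
        by (simp add: diff_divide_distrib del: of_nat_Suc)
    qed
    show "\<forall>\<^sub>F n in sequentially. of_int \<lfloor>fst p * real (Suc n)\<rfloor> / real (Suc n) \<le> fst p"
      by (intro always_eventually allI) (simp add: divide_le_eq del: of_nat_Suc)
    show "(\<lambda>n. fst p - 1 / real (Suc n)) \<longlonglongrightarrow> fst p"
      using tendsto_diff [OF tendsto_const LIMSEQ_inverse_real_of_nat, of "fst p"] by (simp add: inverse_eq_divide)
  qed simp
  moreover have "isCont (\<lambda>t. X t (snd p)) (fst p)"
    using cont [OF \<omega>] by (simp add: continuous_on_eq_continuous_at)
  ultimately show "(\<lambda>n. X (of_int \<lfloor>fst p * real (Suc n)\<rfloor> / real (Suc n)) (snd p)) \<longlonglongrightarrow> (case p of (t, \<omega>) \<Rightarrow> X t \<omega>)"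
    by (auto simp: case_prod_beta intro: isCont_tendsto_compose [of "fst p" "\<lambda>t. X t (snd p)"])
qed

locale fbm_path = fbm P H B for P :: "'w measure" and H B +
  fixes G :: "'w set"
  assumes G_sets [measurable]: "G \<in> sets P" and G_AE: "AE \<omega> in P. \<omega> \<in> G"
    and G_cont: "\<And>\<omega>. \<omega> \<in> G \<Longrightarrow> continuous_on {0..} (\<lambda>t. B t \<omega>)"
begin

text \<open>
  Modified off \<open>G\<close> and at negative times so as to be continuous everywhere, hence jointly measurable.
\<close>

definition path :: "real \<Rightarrow> 'w \<Rightarrow> real" where
  "path t \<omega> = (if \<omega> \<in> G then B (max 0 t) \<omega> else 0)"

lemma path_eq: "\<omega> \<in> G \<Longrightarrow> 0 \<le> t \<Longrightarrow> path t \<omega> = B t \<omega>"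
  by (simp add: path_def)

lemma path_continuous: "continuous_on S (\<lambda>t. path t \<omega>)"
proof (cases "\<omega> \<in> G")
  case True
  have "continuous_on S ((\<lambda>t. B t \<omega>) \<circ> (\<lambda>t. max 0 t))"
    using G_cont [OF True]
    by (intro continuous_on_compose continuous_intros) (auto elim!: continuous_on_subset)
  then show ?thesis using True by (simp add: path_def o_def)
qed (simp add: path_def)

lemma path_joint_measurable [measurable]: "(\<lambda>(t, \<omega>). path t \<omega>) \<in> borel_measurable (borel \<Otimes>\<^sub>M P)"
  by (intro borel_measurable_continuous_process path_continuous) (simp add: path_def [abs_def], measurable)

lemma path_joint_measurable' [measurable (raw)]:
  "f \<in> borel_measurable M \<Longrightarrow> g \<in> M \<rightarrow>\<^sub>M P \<Longrightarrow> (\<lambda>x. path (f x) (g x)) \<in> borel_measurable M"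
  using measurable_compose [OF measurable_Pair [of f M borel g P] path_joint_measurable] by simp

text \<open>
  An iterated integral over ordered times \<open>u \<le> v\<^sub>1 \<le> \<dots> \<le> v\<^sub>k \<le> b\<close>, integrated from the last time
  backwards, so that only functions of one time and \<open>\<omega>\<close> occur.
\<close>

primrec bump_chain :: "real \<Rightarrow> real \<Rightarrow> nat \<Rightarrow> real \<Rightarrow> 'w \<Rightarrow> ennreal" where
  "bump_chain d b 0 u \<omega> = 1"
| "bump_chain d b (Suc k) u \<omega> = (\<integral>\<^sup>+v. (if u \<le> v \<and> v \<le> b then
      ennreal (gauss_bump d (path v \<omega> - path u \<omega>)) * bump_chain d b k v \<omega> else 0) \<partial>lborel)"

lemma bump_chain_measurable: "(\<lambda>(u, \<omega>). bump_chain d b k u \<omega>) \<in> borel_measurable (borel \<Otimes>\<^sub>M P)"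
proof (induction k)
  case 0
  then show ?case by simp
next
  case (Suc k)
  have [measurable]: "(\<lambda>x. bump_chain d b k (f x) (g x)) \<in> borel_measurable M"
    if "f \<in> borel_measurable M" "g \<in> M \<rightarrow>\<^sub>M P" for f g and M :: "'z measure"
    using measurable_compose [OF measurable_Pair [OF that] Suc.IH] by simp
  have "(\<lambda>(u, \<omega>). \<integral>\<^sup>+v. (if u \<le> v \<and> v \<le> b then
      ennreal (gauss_bump d (path v \<omega> - path u \<omega>)) * bump_chain d b k v \<omega> else 0) \<partial>lborel)
    \<in> borel_measurable (borel \<Otimes>\<^sub>M P)"
    by measurable
  then show ?case by simp
qed

lemma bump_chain_measurable' [measurable (raw)]:
  "f \<in> borel_measurable M \<Longrightarrow> g \<in> M \<rightarrow>\<^sub>M P \<Longrightarrow> (\<lambda>x. bump_chain d b k (f x) (g x)) \<in> borel_measurable M"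
  using measurable_compose [OF measurable_Pair [of f M borel g P] bump_chain_measurable] by simp

definition past :: "real \<Rightarrow> nat \<Rightarrow> (nat \<Rightarrow> real) \<Rightarrow> 'w \<Rightarrow> ennreal" where
  "past d n u \<omega> = (\<Prod>i<n. ennreal (gauss_bump d (path (u (Suc i)) \<omega> - path (u i) \<omega>)))"

lemma past_measurable [measurable]: "past d n u \<in> borel_measurable P"
  unfolding past_def [abs_def] by (intro borel_measurable_prod_ennreal) measurable

lemma nn_integral_past:
  assumes "\<And>i. i \<le> n \<Longrightarrow> 0 \<le> u i"
  shows "(\<integral>\<^sup>+\<omega>. past d n u \<omega> \<partial>P) = ennreal (expectation (\<lambda>\<omega>. \<Prod>i<n. gauss_bump d (B (u (Suc i)) \<omega> - B (u i) \<omega>)))"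
proof -
  have [measurable]: "B (u i) \<in> borel_measurable P" if "i \<le> n" for i using assms that by simp
  have "(\<integral>\<^sup>+\<omega>. past d n u \<omega> \<partial>P) = (\<integral>\<^sup>+\<omega>. ennreal (\<Prod>i<n. gauss_bump d (B (u (Suc i)) \<omega> - B (u i) \<omega>)) \<partial>P)"
    using G_AE
  proof (intro nn_integral_cong_AE, eventually_elim)
    case (elim \<omega>)
    then show ?case
      using assms by (simp add: past_def prod_ennreal gauss_bump_bounds path_eq)
  qed
  also have "\<dots> = ennreal (expectation (\<lambda>\<omega>. \<Prod>i<n. gauss_bump d (B (u (Suc i)) \<omega> - B (u i) \<omega>)))"
  proof (intro nn_integral_eq_integral integrable_const_bound [where B=1])
    show "(\<lambda>\<omega>. \<Prod>i<n. gauss_bump d (B (u (Suc i)) \<omega> - B (u i) \<omega>)) \<in> borel_measurable P"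
      using assms by (intro borel_measurable_prod measurable_compose [OF _ gauss_bump_measurable]
          borel_measurable_diff) auto
  qed (auto simp: gauss_bump_bounds abs_prod intro!: prod_le_1 prod_nonneg)
  finally show ?thesis .
qed

definition lnd_const :: real where
  "lnd_const = sqrt (2 * H) / sqrt (expectation (\<lambda>\<omega>. (B 1 \<omega>)\<^sup>2) / mvn_const H)"

lemma variance_B1_pos: "0 < expectation (\<lambda>\<omega>. (B 1 \<omega>)\<^sup>2)"
  using fbm by (simp add: fractional_brownian_motion_def)

lemma lnd_const_pos: "0 < lnd_const"
  using H mvn_const_pos [OF H] variance_B1_pos by (simp add: lnd_const_def)

lemma kern_increment_gap:
  assumes "\<And>i. i \<le> n \<Longrightarrow> 0 \<le> u i \<and> u i \<le> u n" "u n < w"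
  shows "((w - u n) powr H / lnd_const)\<^sup>2 \<le> l2_inner lborel
    (\<lambda>x. kern w x - kern (u n) x - (\<Sum>i<n. m i * (kern (u (Suc i)) x - kern (u i) x)))
    (\<lambda>x. kern w x - kern (u n) x - (\<Sum>i<n. m i * (kern (u (Suc i)) x - kern (u i) x)))"
proof -
  define \<kappa> where "\<kappa> = sqrt (expectation (\<lambda>\<omega>. (B 1 \<omega>)\<^sup>2) / mvn_const H)"
  have \<kappa>: "0 < \<kappa>" using mvn_const_pos [OF H] variance_B1_pos by (simp add: \<kappa>_def)
  define g where "g x = (\<Sum>i<n. m i * (mvn_kernel H (u (Suc i)) x - mvn_kernel H (u i) x))" for x
  define f where "f x = mvn_kernel H w x - mvn_kernel H (u n) x - g x" for x
  have K: "sq_integrable lborel (mvn_kernel H t)" if "0 \<le> t" for t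
    using mvn_kernel_norm [OF H that] by (auto simp: sq_integrable_def has_bochner_integral_iff)
  have un: "0 \<le> u n" using assms(1) [of n] by simp
  have w0: "0 \<le> w" using un assms(2) by simp
  have f: "sq_integrable lborel f"
    unfolding f_def [abs_def] g_def [abs_def] using assms un w0
    by (intro sq_integrable_diff sq_integrable_sum sq_integrable_cmult K) auto
  have g0: "g x = 0" if "u n < x" for x
  proof -
    have "mvn_kernel H (u i) x = 0" if "i \<le> n" for i
      using assms(1) [OF that] \<open>u n < x\<close> un by (simp add: mvn_kernel_def max_def)
    then show ?thesis unfolding g_def by (intro sum.neutral) auto
  qed
  have "(w - u n) powr (2 * H) / (2 * H) \<le> (\<integral>x. (f x)\<^sup>2 \<partial>lborel)"
    using f unfolding f_def
    by (intro mvn_kernel_last_increment H g0 un) (use assms(2) in \<open>auto simp: sq_integrable_def\<close>)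
  then have "\<kappa>\<^sup>2 * ((w - u n) powr (2 * H) / (2 * H)) \<le> \<kappa>\<^sup>2 * l2_inner lborel f f"
    by (intro mult_left_mono) (auto simp: l2_inner_def power2_eq_square)
  moreover have "((w - u n) powr H / lnd_const)\<^sup>2 = \<kappa>\<^sup>2 * ((w - u n) powr (2 * H) / (2 * H))"
    using \<kappa> H by (simp add: lnd_const_def \<kappa>_def [symmetric] power_divide power_mult_distrib field_simps)
      (simp add: power2_eq_square powr_add [symmetric] mult.commute)
  moreover have "(\<lambda>x. kern w x - kern (u n) x - (\<Sum>i<n. m i * (kern (u (Suc i)) x - kern (u i) x))) = (\<lambda>x. \<kappa> * f x)"
    by (auto simp: kern_def \<kappa>_def [symmetric] f_def g_def algebra_simps sum_distrib_left sum_subtractf)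
  ultimately show ?thesis
    by (simp only: l2_inner_cmult_left l2_inner_cmult_right power2_eq_square mult.assoc)
qed

lemma past_step:
  assumes u: "\<And>i. i \<le> n \<Longrightarrow> 0 \<le> u i \<and> u i \<le> u n" and w: "u n < w" and d: "0 < d"
  shows "(\<integral>\<^sup>+\<omega>. past d n u \<omega> * ennreal (gauss_bump d (path w \<omega> - path (u n) \<omega>)) \<partial>P)
    \<le> ennreal (lnd_const * d * (w - u n) powr (- H)) * (\<integral>\<^sup>+\<omega>. past d n u \<omega> \<partial>P)"
proof -
  define u' where "u' = u(Suc n := w)"
  define k where "k i x = kern (u' (Suc i)) x - kern (u' i) x" for i x
  have u0: "0 \<le> u n" "0 \<le> w" using u [of n] w by simp_all
  have u'0: "0 \<le> u' i" if "i \<le> Suc n" for i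
    using u that u0 w by (auto simp: u'_def le_Suc_eq)
  have past': "past d (Suc n) u' \<omega> = past d n u \<omega> * ennreal (gauss_bump d (path w \<omega> - path (u n) \<omega>))" for \<omega>
    by (simp add: past_def u'_def)
  have kn: "(\<lambda>x. k n x - (\<Sum>i<n. m i * k i x)) =
    (\<lambda>x. kern w x - kern (u n) x - (\<Sum>i<n. m i * (kern (u (Suc i)) x - kern (u i) x)))" for m
    by (auto simp: k_def u'_def intro!: sum.cong)
  define s where "s = (w - u n) powr H / lnd_const"
  have s: "0 < s" using w lnd_const_pos by (simp add: s_def)
  have "expectation (\<lambda>\<omega>. \<Prod>i<Suc n. gauss_bump d (B (u' (Suc i)) \<omega> - B (u' i) \<omega>))
      \<le> (d / s) * expectation (\<lambda>\<omega>. \<Prod>i<n. gauss_bump d (B (u' (Suc i)) \<omega> - B (u' i) \<omega>))"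
  proof (rule gauss_bump_prod_step [where k = k])
    show "gaussian_pair (\<lambda>\<omega>. B (u' (Suc i)) \<omega> - B (u' i) \<omega>) (k i)" if "i \<le> n" for i
      unfolding k_def [abs_def] using that by (intro gaussian_pair_diff gaussian_pair_B u'0) auto
    show "s\<^sup>2 \<le> l2_inner lborel (\<lambda>x. k n x - (\<Sum>i<n. m i * k i x)) (\<lambda>x. k n x - (\<Sum>i<n. m i * k i x))" for m
      unfolding kn s_def by (rule kern_increment_gap [where u = u and n = n and w = w, OF u w])
  qed (use d s in auto)
  then have "ennreal (expectation (\<lambda>\<omega>. \<Prod>i<Suc n. gauss_bump d (B (u' (Suc i)) \<omega> - B (u' i) \<omega>)))
      \<le> ennreal (d / s) * ennreal (expectation (\<lambda>\<omega>. \<Prod>i<n. gauss_bump d (B (u' (Suc i)) \<omega> - B (u' i) \<omega>)))"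
    using d s by (subst ennreal_mult [symmetric])
      (auto intro!: ennreal_leI integral_nonneg_AE prod_nonneg simp: gauss_bump_bounds)
  then have "(\<integral>\<^sup>+\<omega>. past d (Suc n) u' \<omega> \<partial>P) \<le> ennreal (d / s) * (\<integral>\<^sup>+\<omega>. past d n u' \<omega> \<partial>P)"
    using u'0 by (subst (1 2) nn_integral_past) auto
  moreover have "past d n u' = past d n u"
    by (auto simp: past_def [abs_def] u'_def intro!: prod.cong)
  moreover have "d / s = lnd_const * d * (w - u n) powr (- H)"
    by (simp add: s_def powr_minus field_simps)
  ultimately show ?thesis by (simp add: past')
qed

definition singular_const :: real where
  "singular_const = lnd_const * Gamma (1 - H)"

lemma singular_const_pos: "0 < singular_const"
  using H lnd_const_pos by (simp add: singular_const_def Gamma_real_pos)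

lemma nn_integral_singular_kernel:
  assumes "0 < \<theta>"
  shows "(\<integral>\<^sup>+v. ennreal ((v - u) powr (- H) * exp (- \<theta> * (v - u))) * indicator {u..} v \<partial>lborel)
    = ennreal (Gamma (1 - H) * \<theta> powr (H - 1))"
proof -
  have "((\<lambda>t. t powr (1 - H - 1) / exp t) has_integral Gamma (1 - H)) {0..}"
    using H by (intro Gamma_integral_real) simp
  then have G: "(\<integral>\<^sup>+t. ennreal (t powr (1 - H - 1) / exp t) * indicator {0..} t \<partial>lborel) = ennreal (Gamma (1 - H))"
    by (intro nn_integral_has_integral_lebesgue') auto
  have "(\<integral>\<^sup>+v. ennreal ((v - u) powr (- H) * exp (- \<theta> * (v - u))) * indicator {u..} v \<partial>lborel) =
    ennreal \<bar>1 / \<theta>\<bar> * (\<integral>\<^sup>+x. ennreal ((u + (1 / \<theta>) * x - u) powr (- H) * exp (- \<theta> * (u + (1 / \<theta>) * x - u))) * indicator {u..} (u + (1 / \<theta>) * x) \<partial>lborel)"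
    using assms by (intro nn_integral_real_affine) auto
  also have "\<dots> = ennreal (1 / \<theta>) * (\<integral>\<^sup>+x. ennreal (\<theta> powr H) * (ennreal (x powr (1 - H - 1) / exp x) * indicator {0..} x) \<partial>lborel)"
  proof -
    have "ennreal ((u + (1 / \<theta>) * x - u) powr (- H) * exp (- \<theta> * (u + (1 / \<theta>) * x - u))) * indicator {u..} (u + (1 / \<theta>) * x)
       = ennreal (\<theta> powr H) * (ennreal (x powr (1 - H - 1) / exp x) * indicator {0..} x)" for x
    proof (cases "0 \<le> x")
      case True
      then have "(x / \<theta>) powr (- H) = \<theta> powr H * x powr (- H)"
        using assms by (simp add: powr_divide powr_minus field_simps)
      then show ?thesis
        using True assms by (simp add: exp_minus ennreal_mult [symmetric] field_simps)
    next
      case False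
      then show ?thesis using assms by (simp add: indicator_def zero_le_divide_iff)
    qed
    then show ?thesis using assms by simp
  qed
  also have "\<dots> = ennreal (1 / \<theta>) * (ennreal (\<theta> powr H) * ennreal (Gamma (1 - H)))"
    by (subst nn_integral_cmult) (measurable, simp only: G)
  also have "\<dots> = ennreal (1 / \<theta> * (\<theta> powr H * Gamma (1 - H)))"
    using assms H by (simp add: ennreal_mult' [symmetric] Gamma_real_pos less_imp_le)
  also have "1 / \<theta> * (\<theta> powr H * Gamma (1 - H)) = Gamma (1 - H) * \<theta> powr (H - 1)"
    using assms by (simp add: powr_diff)
  finally show ?thesis .
qed

text \<open>
  The free parameter \<open>\<theta>\<close> replaces the exact Dirichlet integral; the choice \<open>\<theta> = k / (b - u)\<close> is
  optimal up to a factor exponential in \<open>k\<close>.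
\<close>

lemma bump_chain_bound:
  assumes d: "0 < d" and \<theta>: "0 < \<theta>"
    and "\<And>i. i \<le> n \<Longrightarrow> 0 \<le> u i \<and> u i \<le> u n"
  shows "(\<integral>\<^sup>+\<omega>. past d n u \<omega> * bump_chain d b k (u n) \<omega> \<partial>P)
    \<le> ennreal ((singular_const * d * \<theta> powr (H - 1)) ^ k * exp (\<theta> * max 0 (b - u n))) * (\<integral>\<^sup>+\<omega>. past d n u \<omega> \<partial>P)"
  using assms(3)
proof (induction k arbitrary: n u)
  case 0
  have "1 \<le> exp (\<theta> * max 0 (b - u n))" using \<theta> by simp
  then have "ennreal 1 \<le> ennreal (exp (\<theta> * max 0 (b - u n)))" by (rule ennreal_leI)
  from mult_right_mono [OF this, of "\<integral>\<^sup>+\<omega>. past d n u \<omega> \<partial>P"] show ?case by simp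
next
  case (Suc k)
  define E where "E = (\<integral>\<^sup>+\<omega>. past d n u \<omega> \<partial>P)"
  define \<rho> where "\<rho> = (singular_const * d * \<theta> powr (H - 1)) ^ k"
  have \<rho>: "0 \<le> \<rho>" using d singular_const_pos by (simp add: \<rho>_def)
  interpret PP: pair_sigma_finite P "lborel :: real measure" ..
  have "(\<integral>\<^sup>+\<omega>. past d n u \<omega> * bump_chain d b (Suc k) (u n) \<omega> \<partial>P) =
    (\<integral>\<^sup>+\<omega>. \<integral>\<^sup>+v. past d n u \<omega> * (if u n \<le> v \<and> v \<le> b then
      ennreal (gauss_bump d (path v \<omega> - path (u n) \<omega>)) * bump_chain d b k v \<omega> else 0) \<partial>lborel \<partial>P)"
    unfolding bump_chain.simps by (intro nn_integral_cong nn_integral_cmult [symmetric]) measurable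
  also have "\<dots> = (\<integral>\<^sup>+v. \<integral>\<^sup>+\<omega>. past d n u \<omega> * (if u n \<le> v \<and> v \<le> b then
      ennreal (gauss_bump d (path v \<omega> - path (u n) \<omega>)) * bump_chain d b k v \<omega> else 0) \<partial>P \<partial>lborel)"
    by (intro PP.Fubini' [symmetric]) measurable
  also have "\<dots> \<le> (\<integral>\<^sup>+v. ennreal (\<rho> * exp (\<theta> * (b - u n)) * (lnd_const * d)) * E *
      (ennreal ((v - u n) powr (- H) * exp (- \<theta> * (v - u n))) * indicator {u n..} v) * indicator {..b} v \<partial>lborel)"
  proof (rule nn_integral_mono_AE)
    have "AE v in lborel. v \<noteq> u n" by (rule AE_lborel_singleton)
    then show "AE v in lborel. (\<integral>\<^sup>+\<omega>. past d n u \<omega> * (if u n \<le> v \<and> v \<le> b then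
      ennreal (gauss_bump d (path v \<omega> - path (u n) \<omega>)) * bump_chain d b k v \<omega> else 0) \<partial>P) \<le>
      ennreal (\<rho> * exp (\<theta> * (b - u n)) * (lnd_const * d)) * E *
      (ennreal ((v - u n) powr (- H) * exp (- \<theta> * (v - u n))) * indicator {u n..} v) * indicator {..b} v"
    proof eventually_elim
      case (elim v)
      show ?case
      proof (cases "u n < v \<and> v \<le> b")
        case False
        with elim have "(u n \<le> v \<and> v \<le> b) = False" by auto
        then show ?thesis by (simp only: if_False mult_zero_right) simp
      next
        case True
        define u' where "u' = u(Suc n := v)"
        have past': "past d (Suc n) u' \<omega> = past d n u \<omega> * ennreal (gauss_bump d (path v \<omega> - path (u n) \<omega>))" for \<omega>
          by (simp add: past_def u'_def)
        have u': "0 \<le> u' i \<and> u' i \<le> u' (Suc n)" if "i \<le> Suc n" for i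
          using Suc.prems [of i] Suc.prems [of n] that True by (auto simp: u'_def le_Suc_eq)
        have "(\<integral>\<^sup>+\<omega>. past d n u \<omega> * (if u n \<le> v \<and> v \<le> b then
            ennreal (gauss_bump d (path v \<omega> - path (u n) \<omega>)) * bump_chain d b k v \<omega> else 0) \<partial>P) =
          (\<integral>\<^sup>+\<omega>. past d (Suc n) u' \<omega> * bump_chain d b k (u' (Suc n)) \<omega> \<partial>P)"
          using True by (simp add: past' mult.assoc) (simp add: u'_def)
        also have "\<dots> \<le> ennreal (\<rho> * exp (\<theta> * max 0 (b - u' (Suc n)))) * (\<integral>\<^sup>+\<omega>. past d (Suc n) u' \<omega> \<partial>P)"
          unfolding \<rho>_def by (rule Suc.IH [of "Suc n" u', OF u'])
        also have "\<dots> \<le> ennreal (\<rho> * exp (\<theta> * max 0 (b - u' (Suc n)))) * (ennreal (lnd_const * d * (v - u n) powr (- H)) * E)"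
          unfolding past' E_def using True by (intro mult_left_mono past_step [where u = u and n = n, OF Suc.prems] d) auto
        also have "\<dots> = ennreal (\<rho> * exp (\<theta> * (b - v)) * (lnd_const * d * (v - u n) powr (- H))) * E"
          using True \<rho> lnd_const_pos d by (simp add: u'_def ennreal_mult mult.assoc)
        also have "\<rho> * exp (\<theta> * (b - v)) * (lnd_const * d * (v - u n) powr (- H)) =
            \<rho> * exp (\<theta> * (b - u n)) * (lnd_const * d) * ((v - u n) powr (- H) * exp (- \<theta> * (v - u n)))"
        proof -
          have "exp (\<theta> * (b - v)) = exp (\<theta> * (b - u n)) * exp (- \<theta> * (v - u n))"
            by (simp add: exp_add [symmetric] algebra_simps)
          then show ?thesis by simp
        qed
        also have "ennreal \<dots> * E = ennreal (\<rho> * exp (\<theta> * (b - u n)) * (lnd_const * d)) * E *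
            ennreal ((v - u n) powr (- H) * exp (- \<theta> * (v - u n)))"
          using \<rho> lnd_const_pos d by (subst ennreal_mult) (auto simp: mult_ac)
        finally show ?thesis using True by simp
      qed
    qed
  qed
  also have "\<dots> \<le> (\<integral>\<^sup>+v. ennreal (\<rho> * exp (\<theta> * max 0 (b - u n)) * (lnd_const * d)) * E *
      (ennreal ((v - u n) powr (- H) * exp (- \<theta> * (v - u n))) * indicator {u n..} v) \<partial>lborel)"
    using \<rho> lnd_const_pos d \<theta>
    by (intro nn_integral_mono) (auto simp: indicator_def intro!: mult_right_mono ennreal_leI mult_left_mono)
  also have "\<dots> = ennreal (\<rho> * exp (\<theta> * max 0 (b - u n)) * (lnd_const * d)) * E * ennreal (Gamma (1 - H) * \<theta> powr (H - 1))"
    by (subst nn_integral_cmult) (measurable, simp only: nn_integral_singular_kernel [OF \<theta>])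
  also have "\<dots> = ennreal (\<rho> * exp (\<theta> * max 0 (b - u n)) * (lnd_const * d) * (Gamma (1 - H) * \<theta> powr (H - 1))) * E"
    using \<rho> lnd_const_pos d H by (subst ennreal_mult) (auto simp: mult_ac Gamma_real_pos less_imp_le)
  also have "\<rho> * exp (\<theta> * max 0 (b - u n)) * (lnd_const * d) * (Gamma (1 - H) * \<theta> powr (H - 1)) =
      (singular_const * d * \<theta> powr (H - 1)) ^ Suc k * exp (\<theta> * max 0 (b - u n))"
    by (simp add: \<rho>_def singular_const_def mult_ac)
  finally show ?case by (simp add: E_def)
qed

end

section \<open>Moments of local time increments\<close>

lemma gauss_bump_mult_le: "gauss_bump (sqrt 2 * e) y * gauss_bump (sqrt 2 * e) z \<le> gauss_bump (2 * e) (z - y)"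
proof -
  have "(z - y)\<^sup>2 \<le> 2 * (y\<^sup>2 + z\<^sup>2)"
    using zero_le_power2 [of "z + y"] by (simp add: power2_eq_square algebra_simps)
  then have "(z - y)\<^sup>2 / (8 * e\<^sup>2) \<le> 2 * (y\<^sup>2 + z\<^sup>2) / (8 * e\<^sup>2)"
    by (intro divide_right_mono) auto
  then show ?thesis
    by (simp add: gauss_bump_def exp_add [symmetric] power_divide power_mult_distrib add_divide_distrib)
qed

lemma gauss_bump_sqrt: "gauss_bump e y = gauss_bump (sqrt 2 * e) y * gauss_bump (sqrt 2 * e) y"
  by (simp add: gauss_bump_def exp_add [symmetric] power_divide power_mult_distrib)

lemma nn_integral_gauss_bump:
  assumes "0 < e"
  shows "(\<integral>\<^sup>+x. ennreal (gauss_bump e (a - x)) \<partial>lborel) = ennreal (e * sqrt (2 * pi))"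
proof -
  have eq: "gauss_bump e (a - x) = (e * sqrt (2 * pi)) * normal_density a e x" for x
    using assms by (simp add: gauss_bump_def normal_density_def real_sqrt_mult power_divide power2_commute [of a x])
  have "(\<integral>\<^sup>+x. ennreal (gauss_bump e (a - x)) \<partial>lborel) =
      (\<integral>\<^sup>+x. ennreal (e * sqrt (2 * pi)) * ennreal (normal_density a e x) \<partial>lborel)"
    unfolding eq using assms by (intro nn_integral_cong ennreal_mult) (auto simp: normal_density_nonneg)
  also have "\<dots> = ennreal (e * sqrt (2 * pi)) * ennreal (\<integral>x. normal_density a e x \<partial>lborel)"
    using assms by (simp add: nn_integral_cmult nn_integral_eq_integral normal_density_nonneg)
  finally show ?thesis using assms by simp
qed

lemma nn_integral_power_Suc:
  fixes f :: "real \<Rightarrow> real" and b :: real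
  assumes cont: "continuous_on UNIV f" and nonneg: "\<And>x. 0 \<le> f x"
  defines "F \<equiv> \<lambda>u. \<integral>\<^sup>+v. ennreal (f v) * indicator {u..b} v \<partial>lborel"
  assumes u: "u \<le> b"
  shows "F u ^ Suc k = of_nat (Suc k) * (\<integral>\<^sup>+v. ennreal (f v) * F v ^ k * indicator {u..b} v \<partial>lborel)"
proof -
  have f [measurable]: "f \<in> borel_measurable borel" by (rule borel_measurable_continuous_onI [OF cont])
  define \<Phi> where "\<Phi> x = integral {u - 1..x} f" for x
  have \<Phi>: "(\<Phi> has_real_derivative f x) (at x)" if "x \<in> {u..b}" for x
  proof -
    have "(\<Phi> has_real_derivative f x) (at x within {u - 1..b + 1})"
      unfolding \<Phi>_def [abs_def] using that
      by (intro integral_has_real_derivative continuous_on_subset [OF cont]) auto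
    moreover have "at x within {u - 1..b + 1} = at x"
      using that by (intro at_within_interior) auto
    ultimately show ?thesis by simp
  qed
  have F: "F v = ennreal (\<Phi> b - \<Phi> v)" if "v \<in> {u..b}" for v
    unfolding F_def using that by (intro nn_integral_FTC_Icc \<Phi> nonneg) auto
  have mono: "\<Phi> v \<le> \<Phi> b" if "v \<in> {u..b}" for v
    using that by (intro DERIV_nonneg_imp_nondecreasing [of v b \<Phi>]) (auto intro!: exI \<Phi> nonneg)
  have meas: "set_borel_measurable borel {u..b} \<Phi>"
  proof -
    have "continuous_on {u..b} \<Phi>"
      using \<Phi> by (intro DERIV_continuous_on) (auto intro: has_field_derivative_at_within)
    then show ?thesis
      unfolding set_borel_measurable_def by (intro borel_measurable_continuous_on_indicator) auto
  qed
  have "(\<integral>\<^sup>+v. ennreal (indicator {u..b} v *\<^sub>R (real (Suc k) * ((\<Phi> b - \<Phi> v) ^ k * f v))) * indicator {u..b} v \<partial>lborel)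
      = ennreal (- ((\<Phi> b - \<Phi> b) ^ Suc k) - - ((\<Phi> b - \<Phi> u) ^ Suc k))"
  proof (rule nn_integral_FTC_Icc)
    have "(\<lambda>v. (real (Suc k) * ((indicator {u..b} v *\<^sub>R \<Phi> b - indicator {u..b} v *\<^sub>R \<Phi> v) ^ k * f v)) * indicator {u..b} v) \<in> borel_measurable borel"
      using meas unfolding set_borel_measurable_def by measurable
    also have "(\<lambda>v. (real (Suc k) * ((indicator {u..b} v *\<^sub>R \<Phi> b - indicator {u..b} v *\<^sub>R \<Phi> v) ^ k * f v)) * indicator {u..b} v)
      = (\<lambda>v. indicator {u..b} v *\<^sub>R (real (Suc k) * ((\<Phi> b - \<Phi> v) ^ k * f v)))"
      by (auto simp: indicator_def fun_eq_iff)
    finally show "(\<lambda>v. indicator {u..b} v *\<^sub>R (real (Suc k) * ((\<Phi> b - \<Phi> v) ^ k * f v))) \<in> borel_measurable borel" .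
  next
    fix x assume x: "x \<in> {u..b}"
    show "((\<lambda>v. - ((\<Phi> b - \<Phi> v) ^ Suc k)) has_real_derivative
        indicator {u..b} x *\<^sub>R (real (Suc k) * ((\<Phi> b - \<Phi> x) ^ k * f x))) (at x)"
      using x by (auto intro!: derivative_eq_intros \<Phi> simp del: power_Suc)
    show "0 \<le> indicator {u..b} x *\<^sub>R (real (Suc k) * ((\<Phi> b - \<Phi> x) ^ k * f x))"
      using x mono nonneg by auto
  qed (rule u)
  moreover have "F u ^ Suc k = ennreal (- ((\<Phi> b - \<Phi> b) ^ Suc k) - - ((\<Phi> b - \<Phi> u) ^ Suc k))"
    using F [of u] u mono [of u] by (simp add: ennreal_power del: power_Suc)
  moreover have "(\<integral>\<^sup>+v. ennreal (indicator {u..b} v *\<^sub>R (real (Suc k) * ((\<Phi> b - \<Phi> v) ^ k * f v))) * indicator {u..b} v \<partial>lborel)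
      = (\<integral>\<^sup>+v. of_nat (Suc k) * (ennreal (f v) * F v ^ k * indicator {u..b} v) \<partial>lborel)"
  proof (intro nn_integral_cong)
    fix v
    show "ennreal (indicator {u..b} v *\<^sub>R (real (Suc k) * ((\<Phi> b - \<Phi> v) ^ k * f v))) * indicator {u..b} v =
      of_nat (Suc k) * (ennreal (f v) * F v ^ k * indicator {u..b} v)"
      using F [of v] mono [of v] nonneg [of v]
      by (cases "v \<in> {u..b}")
        (simp_all add: ennreal_mult ennreal_power ennreal_of_nat_eq_real_of_nat mult_ac del: of_nat_Suc)
  qed
  moreover have "(\<integral>\<^sup>+v. of_nat (Suc k) * (ennreal (f v) * F v ^ k * indicator {u..b} v) \<partial>lborel) =
      of_nat (Suc k) * (\<integral>\<^sup>+v. ennreal (f v) * F v ^ k * indicator {u..b} v \<partial>lborel)"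
  proof (intro nn_integral_cmult)
    have "(\<lambda>v. \<integral>\<^sup>+w. (if v \<le> w \<and> w \<le> b then ennreal (f w) else 0) \<partial>lborel) \<in> borel_measurable borel"
      by measurable
    also have "(\<lambda>v. \<integral>\<^sup>+w. (if v \<le> w \<and> w \<le> b then ennreal (f w) else 0) \<partial>lborel) = F"
      unfolding F_def by (intro ext nn_integral_cong) (auto simp: indicator_def)
    finally have [measurable]: "F \<in> borel_measurable borel" .
    show "(\<lambda>v. ennreal (f v) * F v ^ k * indicator {u..b} v) \<in> borel_measurable lborel"
      by simp
  qed
  ultimately show ?thesis by simp
qed

context fbm_path
begin

definition smoothed_time :: "real \<Rightarrow> real \<Rightarrow> real \<Rightarrow> real \<Rightarrow> 'w \<Rightarrow> ennreal" where
  "smoothed_time e b u x \<omega> = (\<integral>\<^sup>+v. ennreal (gauss_bump e (path v \<omega> - x)) * indicator {u..b} v \<partial>lborel)"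

lemma smoothed_time_measurable' [measurable (raw)]:
  assumes [measurable]: "u \<in> borel_measurable M" "f \<in> borel_measurable M" "g \<in> M \<rightarrow>\<^sub>M P"
  shows "(\<lambda>x. smoothed_time e b (u x) (f x) (g x)) \<in> borel_measurable M"
proof -
  have "(\<lambda>x. \<integral>\<^sup>+v. (if u x \<le> v \<and> v \<le> b then ennreal (gauss_bump e (path v (g x) - f x)) else 0) \<partial>lborel) \<in> borel_measurable M"
    by measurable
  also have "(\<lambda>x. \<integral>\<^sup>+v. (if u x \<le> v \<and> v \<le> b then ennreal (gauss_bump e (path v (g x) - f x)) else 0) \<partial>lborel) =
      (\<lambda>x. smoothed_time e b (u x) (f x) (g x))"
    unfolding smoothed_time_def by (intro ext nn_integral_cong) (auto simp: indicator_def)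
  finally show ?thesis .
qed

lemma smoothed_time_power:
  assumes "u \<le> b"
  shows "smoothed_time e b u x \<omega> ^ Suc k = of_nat (Suc k) *
    (\<integral>\<^sup>+v. ennreal (gauss_bump e (path v \<omega> - x)) * smoothed_time e b v x \<omega> ^ k * indicator {u..b} v \<partial>lborel)"
  unfolding smoothed_time_def
proof (rule nn_integral_power_Suc [OF _ _ assms])
  show "continuous_on UNIV (\<lambda>v. gauss_bump e (path v \<omega> - x))"
    unfolding gauss_bump_def by (cases "e = 0") (auto intro!: continuous_intros path_continuous)
qed (simp add: gauss_bump_bounds)

lemma smoothed_time_chain:
  assumes \<omega>: "\<omega> \<in> space P"
  shows "ennreal (gauss_bump (sqrt 2 * e) (path u \<omega> - x)) * smoothed_time e b u x \<omega> ^ k \<le> fact k * bump_chain (2 * e) b k u \<omega>"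
proof (induction k arbitrary: u)
  case 0
  then show ?case using ennreal_leI [OF gauss_bump_bounds(3), of "sqrt 2 * e" "path u \<omega> - x"] by simp
next
  case (Suc k)
  note [measurable] = measurable_const [OF \<omega>]
  let ?g = "\<lambda>v. ennreal (gauss_bump (sqrt 2 * e) (path v \<omega> - x))"
  show ?case
  proof (cases "u \<le> b")
    case False
    then have "smoothed_time e b u x \<omega> = 0" by (simp add: smoothed_time_def)
    then show ?thesis by simp
  next
    case True
    have sq: "ennreal (gauss_bump e (path v \<omega> - x)) = ?g v * ?g v" for v
      by (subst gauss_bump_sqrt) (simp add: ennreal_mult gauss_bump_bounds)
    have "?g u * (\<integral>\<^sup>+v. ?g v * ?g v * smoothed_time e b v x \<omega> ^ k * indicator {u..b} v \<partial>lborel) =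
      (\<integral>\<^sup>+v. ?g u * (?g v * ?g v * smoothed_time e b v x \<omega> ^ k * indicator {u..b} v) \<partial>lborel)"
      by (intro nn_integral_cmult [symmetric]) measurable
    also have "\<dots> \<le> (\<integral>\<^sup>+v. fact k * (if u \<le> v \<and> v \<le> b then
      ennreal (gauss_bump (2 * e) (path v \<omega> - path u \<omega>)) * bump_chain (2 * e) b k v \<omega> else 0) \<partial>lborel)"
    proof (intro nn_integral_mono)
      fix v
      have 1: "?g u * ?g v \<le> ennreal (gauss_bump (2 * e) (path v \<omega> - path u \<omega>))"
        using gauss_bump_mult_le [of e "path u \<omega> - x" "path v \<omega> - x"]
        by (simp add: ennreal_mult [symmetric] gauss_bump_bounds ennreal_leI)
      have "(?g u * ?g v) * (?g v * smoothed_time e b v x \<omega> ^ k) \<le>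
          ennreal (gauss_bump (2 * e) (path v \<omega> - path u \<omega>)) * (fact k * bump_chain (2 * e) b k v \<omega>)"
        by (intro mult_mono 1 Suc.IH) auto
      then show "?g u * (?g v * ?g v * smoothed_time e b v x \<omega> ^ k * indicator {u..b} v)
        \<le> fact k * (if u \<le> v \<and> v \<le> b then ennreal (gauss_bump (2 * e) (path v \<omega> - path u \<omega>)) * bump_chain (2 * e) b k v \<omega> else 0)"
        by (auto simp: indicator_def mult_ac)
    qed
    also have "\<dots> = fact k * bump_chain (2 * e) b (Suc k) u \<omega>"
      unfolding bump_chain.simps by (intro nn_integral_cmult) measurable
    finally have le: "?g u * (\<integral>\<^sup>+v. ?g v * ?g v * smoothed_time e b v x \<omega> ^ k * indicator {u..b} v \<partial>lborel)
      \<le> fact k * bump_chain (2 * e) b (Suc k) u \<omega>" .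
    have "?g u * smoothed_time e b u x \<omega> ^ Suc k =
      of_nat (Suc k) * (?g u * (\<integral>\<^sup>+v. ?g v * ?g v * smoothed_time e b v x \<omega> ^ k * indicator {u..b} v \<partial>lborel))"
      unfolding smoothed_time_power [OF True] sq by (rule mult.left_commute)
    also have "\<dots> \<le> of_nat (Suc k) * (fact k * bump_chain (2 * e) b (Suc k) u \<omega>)"
      by (rule mult_left_mono [OF le]) simp
    also have "\<dots> = fact (Suc k) * bump_chain (2 * e) b (Suc k) u \<omega>"
      by (simp only: fact_Suc mult.assoc)
    finally show ?thesis .
  qed
qed

lemma smoothed_time_moment_path:
  assumes \<omega>: "\<omega> \<in> space P" and ub: "u \<le> b" and e: "0 < e"
  shows "(\<integral>\<^sup>+x. smoothed_time e b u x \<omega> ^ Suc k \<partial>lborel) \<le>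
    ennreal (fact (Suc k) * (2 * e * sqrt pi)) * (\<integral>\<^sup>+v. bump_chain (2 * e) b k v \<omega> * indicator {u..b} v \<partial>lborel)"
proof -
  note [measurable] = measurable_const [OF \<omega>]
  let ?g = "\<lambda>x v. ennreal (gauss_bump (sqrt 2 * e) (path v \<omega> - x))"
  have sq: "ennreal (gauss_bump e (path v \<omega> - x)) = ?g x v * ?g x v" for v x
    by (subst gauss_bump_sqrt) (simp add: ennreal_mult gauss_bump_bounds)
  have "(\<integral>\<^sup>+x. smoothed_time e b u x \<omega> ^ Suc k \<partial>lborel) \<le>
      (\<integral>\<^sup>+x. \<integral>\<^sup>+v. of_nat (Suc k) * (?g x v * (fact k * bump_chain (2 * e) b k v \<omega>) * indicator {u..b} v) \<partial>lborel \<partial>lborel)"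
  proof (intro nn_integral_mono)
    fix x
    have "smoothed_time e b u x \<omega> ^ Suc k = (\<integral>\<^sup>+v. of_nat (Suc k) * (ennreal (gauss_bump e (path v \<omega> - x)) * smoothed_time e b v x \<omega> ^ k * indicator {u..b} v) \<partial>lborel)"
      unfolding smoothed_time_power [OF ub] by (intro nn_integral_cmult [symmetric]) measurable
    also have "\<dots> \<le> (\<integral>\<^sup>+v. of_nat (Suc k) * (?g x v * (fact k * bump_chain (2 * e) b k v \<omega>) * indicator {u..b} v) \<partial>lborel)"
      unfolding sq mult.assoc [of "?g x _"] using smoothed_time_chain [OF \<omega>]
      by (intro nn_integral_mono mult_left_mono) (auto simp: indicator_def intro!: mult_left_mono)
    finally show "smoothed_time e b u x \<omega> ^ Suc k \<le> \<dots>" .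
  qed
  also have "\<dots> = (\<integral>\<^sup>+v. \<integral>\<^sup>+x. of_nat (Suc k) * (?g x v * (fact k * bump_chain (2 * e) b k v \<omega>) * indicator {u..b} v) \<partial>lborel \<partial>lborel)"
    by (intro lborel_pair.Fubini' [symmetric]) measurable
  also have "\<dots> = (\<integral>\<^sup>+v. ennreal (fact (Suc k) * (2 * e * sqrt pi)) * (bump_chain (2 * e) b k v \<omega> * indicator {u..b} v) \<partial>lborel)"
  proof (intro nn_integral_cong)
    fix v
    have "(\<integral>\<^sup>+x. of_nat (Suc k) * (?g x v * (fact k * bump_chain (2 * e) b k v \<omega>) * indicator {u..b} v) \<partial>lborel) =
        (\<integral>\<^sup>+x. (of_nat (Suc k) * fact k * bump_chain (2 * e) b k v \<omega> * indicator {u..b} v) * ?g x v \<partial>lborel)"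
      by (simp add: mult_ac)
    also have "\<dots> = (of_nat (Suc k) * fact k * bump_chain (2 * e) b k v \<omega> * indicator {u..b} v) * ennreal (sqrt 2 * e * sqrt (2 * pi))"
      using e by (subst nn_integral_cmult) (measurable, simp add: nn_integral_gauss_bump)
    also have "sqrt 2 * e * sqrt (2 * pi) = 2 * e * sqrt pi" by (simp add: real_sqrt_mult)
    also have "(of_nat (Suc k) * fact k * bump_chain (2 * e) b k v \<omega> * indicator {u..b} v) * ennreal (2 * e * sqrt pi) =
      (fact (Suc k) * ennreal (2 * e * sqrt pi)) * (bump_chain (2 * e) b k v \<omega> * indicator {u..b} v)"
      by (simp add: fact_Suc mult_ac del: of_nat_Suc)
    also have "fact (Suc k) * ennreal (2 * e * sqrt pi) = ennreal (fact (Suc k) * (2 * e * sqrt pi))"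
      using e by (simp add: ennreal_mult ennreal_fact del: fact_Suc)
    finally show "(\<integral>\<^sup>+x. of_nat (Suc k) * (?g x v * (fact k * bump_chain (2 * e) b k v \<omega>) * indicator {u..b} v) \<partial>lborel) =
        ennreal (fact (Suc k) * (2 * e * sqrt pi)) * (bump_chain (2 * e) b k v \<omega> * indicator {u..b} v)" .
  qed
  also have "\<dots> = ennreal (fact (Suc k) * (2 * e * sqrt pi)) * (\<integral>\<^sup>+v. bump_chain (2 * e) b k v \<omega> * indicator {u..b} v \<partial>lborel)"
    by (intro nn_integral_cmult) measurable
  finally show ?thesis .
qed

lemma smoothed_time_moment:
  assumes u: "0 \<le> u" "u \<le> b" and e: "0 < e" and \<theta>: "0 < \<theta>"
  shows "(\<integral>\<^sup>+\<omega>. \<integral>\<^sup>+x. smoothed_time e b u x \<omega> ^ Suc k \<partial>lborel \<partial>P) \<le>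
    ennreal (fact (Suc k) * (2 * e * sqrt pi) * (b - u) * ((2 * e * singular_const * \<theta> powr (H - 1)) ^ k * exp (\<theta> * (b - u))))"
proof -
  interpret PP: pair_sigma_finite P "lborel :: real measure" ..
  define A where "A = (2 * e * singular_const * \<theta> powr (H - 1)) ^ k * exp (\<theta> * (b - u))"
  have A: "0 \<le> A" using e singular_const_pos by (simp add: A_def)
  have chain: "(\<integral>\<^sup>+\<omega>. bump_chain (2 * e) b k v \<omega> \<partial>P) \<le> ennreal A" if v: "u \<le> v" "v \<le> b" for v
  proof -
    have "(\<integral>\<^sup>+\<omega>. past (2 * e) 0 (\<lambda>_. v) \<omega> * bump_chain (2 * e) b k v \<omega> \<partial>P)
      \<le> ennreal ((singular_const * (2 * e) * \<theta> powr (H - 1)) ^ k * exp (\<theta> * max 0 (b - v))) * (\<integral>\<^sup>+\<omega>. past (2 * e) 0 (\<lambda>_. v) \<omega> \<partial>P)"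
      using bump_chain_bound [of "2 * e" \<theta> 0 "\<lambda>_. v" b k] e \<theta> u v by simp
    also have "\<dots> = ennreal ((2 * e * singular_const * \<theta> powr (H - 1)) ^ k * exp (\<theta> * (b - v)))"
      using v by (simp add: past_def emeasure_space_1 mult_ac)
    also have "\<dots> \<le> ennreal A"
      unfolding A_def using e singular_const_pos v \<theta>
      by (intro ennreal_leI mult_left_mono zero_le_power) auto
    finally show ?thesis by (simp add: past_def)
  qed
  have "(\<integral>\<^sup>+\<omega>. (\<integral>\<^sup>+v. bump_chain (2 * e) b k v \<omega> * indicator {u..b} v \<partial>lborel) \<partial>P) =
      (\<integral>\<^sup>+v. (\<integral>\<^sup>+\<omega>. bump_chain (2 * e) b k v \<omega> * indicator {u..b} v \<partial>P) \<partial>lborel)"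
    by (intro PP.Fubini' [symmetric]) measurable
  also have "\<dots> \<le> (\<integral>\<^sup>+v. ennreal A * indicator {u..b} v \<partial>lborel)"
    using chain by (intro nn_integral_mono) (auto simp: indicator_def)
  also have "\<dots> = ennreal (A * (b - u))"
    using A u by (simp add: nn_integral_cmult_indicator ennreal_mult)
  finally have le: "(\<integral>\<^sup>+\<omega>. (\<integral>\<^sup>+v. bump_chain (2 * e) b k v \<omega> * indicator {u..b} v \<partial>lborel) \<partial>P) \<le> ennreal (A * (b - u))" .
  have "(\<integral>\<^sup>+\<omega>. \<integral>\<^sup>+x. smoothed_time e b u x \<omega> ^ Suc k \<partial>lborel \<partial>P) \<le>
      (\<integral>\<^sup>+\<omega>. ennreal (fact (Suc k) * (2 * e * sqrt pi)) * (\<integral>\<^sup>+v. bump_chain (2 * e) b k v \<omega> * indicator {u..b} v \<partial>lborel) \<partial>P)"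
    by (intro nn_integral_mono smoothed_time_moment_path u e)
  also have "\<dots> = ennreal (fact (Suc k) * (2 * e * sqrt pi)) * (\<integral>\<^sup>+\<omega>. (\<integral>\<^sup>+v. bump_chain (2 * e) b k v \<omega> * indicator {u..b} v \<partial>lborel) \<partial>P)"
    by (intro nn_integral_cmult) measurable
  also have "\<dots> \<le> ennreal (fact (Suc k) * (2 * e * sqrt pi)) * ennreal (A * (b - u))"
    by (rule mult_left_mono [OF le]) simp
  also have "ennreal (fact (Suc k) * (2 * e * sqrt pi)) * ennreal (A * (b - u)) = ennreal (fact (Suc k) * (2 * e * sqrt pi) * (b - u) * A)"
    using A u e by (subst ennreal_mult [symmetric]) (auto simp: mult_ac)
  finally show ?thesis by (simp only: A_def)
qed

end

lemma ennreal_power_le_Liminf_power: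
  fixes X :: "nat \<Rightarrow> ennreal"
  assumes c: "0 \<le> c" and le: "ennreal c \<le> liminf X"
  shows "ennreal c ^ p \<le> liminf (\<lambda>n. X n ^ p)"
proof -
  have "ennreal ((c * (1 - 1 / real (Suc i))) ^ p) \<le> liminf (\<lambda>n. X n ^ p)" for i
  proof (cases "c = 0")
    case True
    then show ?thesis using zero_le by (cases p) (auto intro!: Liminf_bounded always_eventually)
  next
    case False
    then have "c * (1 - 1 / real (Suc i)) < c" using c by (simp add: field_simps)
    then have "ennreal (c * (1 - 1 / real (Suc i))) < ennreal c"
      using c False by (simp add: ennreal_less_iff)
    then have "eventually (\<lambda>n. ennreal (c * (1 - 1 / real (Suc i))) < X n) sequentially"
      using le by (auto simp: le_Liminf_iff)
    then have "eventually (\<lambda>n. ennreal ((c * (1 - 1 / real (Suc i))) ^ p) \<le> X n ^ p) sequentially"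
    proof eventually_elim
      case (elim n)
      have "ennreal ((c * (1 - 1 / real (Suc i))) ^ p) = ennreal (c * (1 - 1 / real (Suc i))) ^ p"
        using c by (intro ennreal_power [symmetric] mult_nonneg_nonneg) auto
      then show ?case using elim by (simp only: power_mono less_imp_le zero_le)
    qed
    then show ?thesis by (rule Liminf_bounded)
  qed
  moreover have "(\<lambda>i. ennreal ((c * (1 - 1 / real (Suc i))) ^ p)) \<longlonglongrightarrow> ennreal ((c * (1 - 0)) ^ p)"
    using LIMSEQ_inverse_real_of_nat
    by (intro tendsto_ennrealI tendsto_power tendsto_mult tendsto_diff tendsto_const) (simp add: inverse_eq_divide)
  ultimately have "ennreal ((c * (1 - 0)) ^ p) \<le> liminf (\<lambda>n. X n ^ p)"
    by (intro LIMSEQ_le_const2) auto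
  then show ?thesis using c by (simp add: ennreal_power)
qed

locale fbm_local_time = fbm_path P H B G for P :: "'w measure" and H B G +
  fixes l :: "real \<Rightarrow> real \<Rightarrow> 'w \<Rightarrow> real"
  assumes l_measurable: "\<And>t. 0 \<le> t \<Longrightarrow> (\<lambda>(\<omega>, x). l x t \<omega>) \<in> borel_measurable (P \<Otimes>\<^sub>M lborel)"
    and l_nonneg: "\<And>\<omega> x t. \<omega> \<in> G \<Longrightarrow> 0 \<le> t \<Longrightarrow> 0 \<le> l x t \<omega>"
    and l_continuous: "\<And>\<omega>. \<omega> \<in> G \<Longrightarrow> continuous_on (UNIV \<times> {0..}) (\<lambda>(x, t). l x t \<omega>)"
    and occupation: "\<And>\<omega> t (g :: real \<Rightarrow> ennreal). \<omega> \<in> G \<Longrightarrow> 0 \<le> t \<Longrightarrow> g \<in> borel_measurable borel \<Longrightarrow>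
      (\<integral>\<^sup>+s\<in>{0..t}. g (B s \<omega>) \<partial>lborel) = (\<integral>\<^sup>+x. g x * ennreal (l x t \<omega>) \<partial>lborel)"
begin

lemma l_continuous_space:
  assumes "\<omega> \<in> G" "0 \<le> t"
  shows "continuous_on UNIV (\<lambda>x. l x t \<omega>)"
proof -
  have "continuous_on UNIV ((\<lambda>(x, t). l x t \<omega>) \<circ> (\<lambda>x. (x, t)))"
    using assms by (intro continuous_on_compose continuous_on_subset [OF l_continuous] continuous_intros) auto
  then show ?thesis by (simp add: o_def)
qed

lemma l_continuous_time:
  assumes "\<omega> \<in> G"
  shows "continuous_on {0..} (\<lambda>t. l x t \<omega>)"
proof -
  have "continuous_on {0..} ((\<lambda>(x, t). l x t \<omega>) \<circ> (\<lambda>t. (x, t)))"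
    using assms by (intro continuous_on_compose continuous_on_subset [OF l_continuous] continuous_intros) auto
  then show ?thesis by (simp add: o_def)
qed

lemma l_borel: "\<omega> \<in> G \<Longrightarrow> 0 \<le> t \<Longrightarrow> (\<lambda>x. l x t \<omega>) \<in> borel_measurable borel"
  by (intro borel_measurable_continuous_onI l_continuous_space)

lemma occupation_path:
  assumes "\<omega> \<in> G" "0 \<le> t" "g \<in> borel_measurable borel"
  shows "(\<integral>\<^sup>+s. g (path s \<omega>) * indicator {0..t} s \<partial>lborel) = (\<integral>\<^sup>+x. g x * ennreal (l x t \<omega>) \<partial>lborel)"
proof -
  have "(\<integral>\<^sup>+s. g (path s \<omega>) * indicator {0..t} s \<partial>lborel) = (\<integral>\<^sup>+s\<in>{0..t}. g (B s \<omega>) \<partial>lborel)"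
    by (intro nn_integral_cong) (auto simp: indicator_def path_eq [OF assms(1)])
  then show ?thesis using occupation [OF assms] by simp
qed

lemma path_borel [measurable]: "(\<lambda>s. path s \<omega>) \<in> borel_measurable borel"
  by (intro borel_measurable_continuous_onI path_continuous)

lemma occupation_finite:
  assumes "\<omega> \<in> G" "0 \<le> t" "g \<in> borel_measurable borel" "\<And>x. g x \<le> 1"
  shows "(\<integral>\<^sup>+x. g x * ennreal (l x t \<omega>) \<partial>lborel) < \<infinity>"
proof -
  have "(\<integral>\<^sup>+s. g (path s \<omega>) * indicator {0..t} s \<partial>lborel) \<le> (\<integral>\<^sup>+s. 1 * indicator {0..t} s \<partial>lborel)"
    using assms(4) by (intro nn_integral_mono mult_right_mono) auto
  also have "\<dots> < \<infinity>" using assms(2) by simp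
  finally show ?thesis using occupation_path [OF assms(1-3)] by simp
qed

lemma l_mono_AE:
  assumes \<omega>: "\<omega> \<in> G" and st: "0 \<le> s" "s \<le> t"
  shows "AE x in lborel. l x s \<omega> \<le> l x t \<omega>"
proof -
  have t: "0 \<le> t" using st by simp
  note [measurable] = l_borel [OF \<omega> st(1)] l_borel [OF \<omega> t]
  define A where "A = {x. l x t \<omega> < l x s \<omega>}"
  have [measurable]: "A \<in> sets borel" unfolding A_def by measurable
  have le: "(\<integral>\<^sup>+x. indicator A x * ennreal (l x s \<omega>) \<partial>lborel) \<le> (\<integral>\<^sup>+x. indicator A x * ennreal (l x t \<omega>) \<partial>lborel)"
    unfolding occupation_path [OF \<omega> st(1), of "indicator A", symmetric, simplified]
      occupation_path [OF \<omega> t, of "indicator A", symmetric, simplified]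
    using st by (intro nn_integral_mono) (auto simp: indicator_def)
  have fin: "(\<integral>\<^sup>+x. indicator A x * ennreal (l x t \<omega>) \<partial>lborel) < \<infinity>"
    by (intro occupation_finite \<omega> t) (auto simp: indicator_def)
  have "(\<integral>\<^sup>+x. indicator A x * ennreal (l x s \<omega>) \<partial>lborel) =
    (\<integral>\<^sup>+x. indicator A x * ennreal (l x t \<omega>) + indicator A x * ennreal (l x s \<omega> - l x t \<omega>) \<partial>lborel)"
    using l_nonneg [OF \<omega> t] by (intro nn_integral_cong) (auto simp: indicator_def A_def ennreal_plus [symmetric] simp del: ennreal_plus)
  also have "\<dots> = (\<integral>\<^sup>+x. indicator A x * ennreal (l x t \<omega>) \<partial>lborel) + (\<integral>\<^sup>+x. indicator A x * ennreal (l x s \<omega> - l x t \<omega>) \<partial>lborel)"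
    by (intro nn_integral_add) auto
  finally have "(\<integral>\<^sup>+x. indicator A x * ennreal (l x t \<omega>) \<partial>lborel) + (\<integral>\<^sup>+x. indicator A x * ennreal (l x s \<omega> - l x t \<omega>) \<partial>lborel)
      \<le> (\<integral>\<^sup>+x. indicator A x * ennreal (l x t \<omega>) \<partial>lborel) + 0"
    using le by simp
  then have "(\<integral>\<^sup>+x. indicator A x * ennreal (l x s \<omega> - l x t \<omega>) \<partial>lborel) = 0"
    using fin unfolding ennreal_add_left_cancel_le by auto
  then have "AE x in lborel. indicator A x * ennreal (l x s \<omega> - l x t \<omega>) = 0"
    by (subst (asm) nn_integral_0_iff_AE) auto
  then show ?thesis
    by eventually_elim (auto simp: A_def indicator_def ennreal_eq_0_iff split: if_splits)
qed

lemma smoothed_time_eq: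
  assumes \<omega>: "\<omega> \<in> G" and st: "0 \<le> s" "s \<le> t"
  shows "smoothed_time e t s x \<omega> = (\<integral>\<^sup>+y. ennreal (gauss_bump e (y - x)) * ennreal (l y t \<omega> - l y s \<omega>) \<partial>lborel)"
proof -
  have t: "0 \<le> t" using st by simp
  note [measurable] = l_borel [OF \<omega> st(1)] l_borel [OF \<omega> t]
  let ?g = "\<lambda>y. ennreal (gauss_bump e (y - x))"
  have "(\<integral>\<^sup>+y. ?g y * ennreal (l y t \<omega>) \<partial>lborel) = (\<integral>\<^sup>+v. ?g (path v \<omega>) * indicator {0..t} v \<partial>lborel)"
    by (rule occupation_path [OF \<omega> t, symmetric]) measurable
  also have "\<dots> = (\<integral>\<^sup>+v. ?g (path v \<omega>) * indicator {0..s} v + ?g (path v \<omega>) * indicator {s..t} v \<partial>lborel)"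
  proof (rule nn_integral_cong_AE)
    have "AE v in lborel. v \<noteq> s" by (rule AE_lborel_singleton)
    then show "AE v in lborel. ?g (path v \<omega>) * indicator {0..t} v = ?g (path v \<omega>) * indicator {0..s} v + ?g (path v \<omega>) * indicator {s..t} v"
      by eventually_elim (use st in \<open>auto simp: indicator_def\<close>)
  qed
  also have "\<dots> = (\<integral>\<^sup>+v. ?g (path v \<omega>) * indicator {0..s} v \<partial>lborel) + smoothed_time e t s x \<omega>"
    unfolding smoothed_time_def by (intro nn_integral_add) auto
  also have "(\<integral>\<^sup>+v. ?g (path v \<omega>) * indicator {0..s} v \<partial>lborel) = (\<integral>\<^sup>+y. ?g y * ennreal (l y s \<omega>) \<partial>lborel)"
    by (rule occupation_path [OF \<omega> st(1)]) measurable
  finally have 1: "(\<integral>\<^sup>+y. ?g y * ennreal (l y t \<omega>) \<partial>lborel) = (\<integral>\<^sup>+y. ?g y * ennreal (l y s \<omega>) \<partial>lborel) + smoothed_time e t s x \<omega>" .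
  have "(\<integral>\<^sup>+y. ?g y * ennreal (l y t \<omega>) \<partial>lborel) = (\<integral>\<^sup>+y. ?g y * ennreal (l y s \<omega>) + ?g y * ennreal (l y t \<omega> - l y s \<omega>) \<partial>lborel)"
    using l_mono_AE [OF \<omega> st]
  proof (intro nn_integral_cong_AE, eventually_elim)
    case (elim y)
    have "ennreal (l y t \<omega>) = ennreal (l y s \<omega>) + ennreal (l y t \<omega> - l y s \<omega>)"
      using elim l_nonneg [OF \<omega> st(1)] by (simp add: ennreal_plus [symmetric] del: ennreal_plus)
    then show ?case by (simp add: distrib_left)
  qed
  also have "\<dots> = (\<integral>\<^sup>+y. ?g y * ennreal (l y s \<omega>) \<partial>lborel) + (\<integral>\<^sup>+y. ?g y * ennreal (l y t \<omega> - l y s \<omega>) \<partial>lborel)"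
    by (intro nn_integral_add) auto
  finally have 2: "(\<integral>\<^sup>+y. ?g y * ennreal (l y s \<omega>) \<partial>lborel) + smoothed_time e t s x \<omega> =
      (\<integral>\<^sup>+y. ?g y * ennreal (l y s \<omega>) \<partial>lborel) + (\<integral>\<^sup>+y. ?g y * ennreal (l y t \<omega> - l y s \<omega>) \<partial>lborel)"
    unfolding 1 .
  have "?g y \<le> 1" for y using ennreal_leI [OF gauss_bump_bounds(3), of e "y - x"] by simp
  then have "(\<integral>\<^sup>+y. ?g y * ennreal (l y s \<omega>) \<partial>lborel) < \<infinity>"
    by (intro occupation_finite \<omega> st) auto
  with 2 show ?thesis unfolding ennreal_add_left_cancel by auto
qed

lemma l_increment_le_liminf:
  assumes \<omega>: "\<omega> \<in> G" and st: "0 \<le> s" "s \<le> t"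
  shows "ennreal (sqrt (2 * pi)) * ennreal (l x t \<omega> - l x s \<omega>) \<le>
    liminf (\<lambda>j. ennreal (real (Suc j)) * smoothed_time (1 / real (Suc j)) t s x \<omega>)"
proof -
  have t: "0 \<le> t" using st by simp
  note [measurable] = l_borel [OF \<omega> st(1)] l_borel [OF \<omega> t]
  have eq: "ennreal (real (Suc j)) * smoothed_time (1 / real (Suc j)) t s x \<omega> =
      (\<integral>\<^sup>+z. ennreal (gauss_bump 1 z) * ennreal (l (x + 1 / real (Suc j) * z) t \<omega> - l (x + 1 / real (Suc j) * z) s \<omega>) \<partial>lborel)" for j
  proof -
    have "smoothed_time (1 / real (Suc j)) t s x \<omega> = ennreal \<bar>1 / real (Suc j)\<bar> *
      (\<integral>\<^sup>+z. ennreal (gauss_bump (1 / real (Suc j)) (x + 1 / real (Suc j) * z - x)) *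
        ennreal (l (x + 1 / real (Suc j) * z) t \<omega> - l (x + 1 / real (Suc j) * z) s \<omega>) \<partial>lborel)"
      unfolding smoothed_time_eq [OF \<omega> st]
      by (intro nn_integral_real_affine) auto
    also have "\<dots> = ennreal (1 / real (Suc j)) * (\<integral>\<^sup>+z. ennreal (gauss_bump 1 z) *
        ennreal (l (x + 1 / real (Suc j) * z) t \<omega> - l (x + 1 / real (Suc j) * z) s \<omega>) \<partial>lborel)"
      by (simp add: gauss_bump_def)
    finally show ?thesis
      by (simp add: mult.assoc [symmetric] ennreal_mult [symmetric] del: of_nat_Suc)
  qed
  have "ennreal (sqrt (2 * pi)) * ennreal (l x t \<omega> - l x s \<omega>) = (\<integral>\<^sup>+z. ennreal (gauss_bump 1 (0 - z)) * ennreal (l x t \<omega> - l x s \<omega>) \<partial>lborel)"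
    by (subst nn_integral_multc) (auto simp: nn_integral_gauss_bump [of 1 0, simplified])
  also have "\<dots> = (\<integral>\<^sup>+z. liminf (\<lambda>j. ennreal (gauss_bump 1 z) * ennreal (l (x + 1 / real (Suc j) * z) t \<omega> - l (x + 1 / real (Suc j) * z) s \<omega>)) \<partial>lborel)"
  proof (intro nn_integral_cong)
    fix z
    have arg: "(\<lambda>j. x + 1 / real (Suc j) * z) \<longlonglongrightarrow> x + 0 * z"
      using LIMSEQ_inverse_real_of_nat by (intro tendsto_add tendsto_mult tendsto_const) (simp add: inverse_eq_divide)
    have c: "isCont (\<lambda>y. l y t \<omega> - l y s \<omega>) x"
      using l_continuous_space [OF \<omega> st(1)] l_continuous_space [OF \<omega> t]
      by (intro continuous_diff) (auto simp: continuous_on_eq_continuous_at)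
    have "(\<lambda>j. ennreal (gauss_bump 1 z * (l (x + 1 / real (Suc j) * z) t \<omega> - l (x + 1 / real (Suc j) * z) s \<omega>))) \<longlonglongrightarrow>
       ennreal (gauss_bump 1 z * (l x t \<omega> - l x s \<omega>))"
      using isCont_tendsto_compose [OF c, of "\<lambda>j. x + 1 / real (Suc j) * z" sequentially] arg
      by (intro tendsto_ennrealI tendsto_mult tendsto_const) simp
    then have "liminf (\<lambda>j. ennreal (gauss_bump 1 z * (l (x + 1 / real (Suc j) * z) t \<omega> - l (x + 1 / real (Suc j) * z) s \<omega>))) =
       ennreal (gauss_bump 1 z * (l x t \<omega> - l x s \<omega>))"
      by (intro lim_imp_Liminf) auto
    then show "ennreal (gauss_bump 1 (0 - z)) * ennreal (l x t \<omega> - l x s \<omega>) =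
      liminf (\<lambda>j. ennreal (gauss_bump 1 z) * ennreal (l (x + 1 / real (Suc j) * z) t \<omega> - l (x + 1 / real (Suc j) * z) s \<omega>))"
      by (simp add: ennreal_mult' [symmetric] gauss_bump_bounds) (simp add: gauss_bump_def)
  qed
  also have "\<dots> \<le> liminf (\<lambda>j. \<integral>\<^sup>+z. ennreal (gauss_bump 1 z) * ennreal (l (x + 1 / real (Suc j) * z) t \<omega> - l (x + 1 / real (Suc j) * z) s \<omega>) \<partial>lborel)"
    by (intro nn_integral_liminf) auto
  finally show ?thesis unfolding eq .
qed

lemma l_increment_moment:
  assumes st: "0 \<le> s" "s \<le> t" and \<theta>: "0 < \<theta>"
  shows "(\<integral>\<^sup>+\<omega>. \<integral>\<^sup>+x. ennreal (l x t \<omega> - l x s \<omega>) ^ Suc k \<partial>lborel \<partial>P) \<le>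
    ennreal (fact (Suc k) * 2 * (t - s) * ((singular_const * \<theta> powr (H - 1)) ^ k * exp (\<theta> * (t - s))))"
proof -
  define C where "C = sqrt (2 * pi)"
  have C: "2 \<le> C" unfolding C_def using pi_gt3 by (intro real_le_rsqrt) simp
  define F where "F j x \<omega> = ennreal (real (Suc j)) * smoothed_time (1 / real (Suc j)) t s x \<omega>" for j x \<omega>
  have [measurable]: "(\<lambda>(\<omega>, x). F j x \<omega>) \<in> borel_measurable (P \<Otimes>\<^sub>M lborel)" for j
    unfolding F_def by measurable
  have Fm [measurable (raw)]: "(\<lambda>y. F j (f y) (g y)) \<in> borel_measurable M"
    if "f \<in> borel_measurable M" "g \<in> M \<rightarrow>\<^sub>M P" for f g j and M :: "'z measure"
    using that unfolding F_def by measurable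
  let ?K = "fact (Suc k) * (2 * sqrt pi) * (t - s) * ((2 * singular_const * \<theta> powr (H - 1)) ^ k * exp (\<theta> * (t - s)))"
  have bound: "(\<integral>\<^sup>+\<omega>. \<integral>\<^sup>+x. F j x \<omega> ^ Suc k \<partial>lborel \<partial>P) \<le> ennreal ?K" for j
  proof -
    define e where "e = 1 / real (Suc j)"
    have e: "0 < e" by (simp add: e_def)
    have "(\<integral>\<^sup>+\<omega>. \<integral>\<^sup>+x. F j x \<omega> ^ Suc k \<partial>lborel \<partial>P) =
      (\<integral>\<^sup>+\<omega>. \<integral>\<^sup>+x. ennreal ((1 / e) ^ Suc k) * smoothed_time e t s x \<omega> ^ Suc k \<partial>lborel \<partial>P)"
      by (simp add: F_def e_def power_mult_distrib ennreal_power del: power_Suc of_nat_Suc)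
    also have "\<dots> = (\<integral>\<^sup>+\<omega>. ennreal ((1 / e) ^ Suc k) * (\<integral>\<^sup>+x. smoothed_time e t s x \<omega> ^ Suc k \<partial>lborel) \<partial>P)"
      by (intro nn_integral_cong nn_integral_cmult) measurable
    also have "\<dots> = ennreal ((1 / e) ^ Suc k) * (\<integral>\<^sup>+\<omega>. (\<integral>\<^sup>+x. smoothed_time e t s x \<omega> ^ Suc k \<partial>lborel) \<partial>P)"
      by (intro nn_integral_cmult) measurable
    also have "\<dots> \<le> ennreal ((1 / e) ^ Suc k) * ennreal (fact (Suc k) * (2 * e * sqrt pi) * (t - s) * ((2 * e * singular_const * \<theta> powr (H - 1)) ^ k * exp (\<theta> * (t - s))))"
      by (intro mult_left_mono smoothed_time_moment st e \<theta>) simp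
    also have "\<dots> = ennreal ((1 / e) ^ Suc k * (fact (Suc k) * (2 * e * sqrt pi) * (t - s) * ((2 * e * singular_const * \<theta> powr (H - 1)) ^ k * exp (\<theta> * (t - s)))))"
      using e by (intro ennreal_mult' [symmetric]) simp
    also have "(1 / e) ^ Suc k * (fact (Suc k) * (2 * e * sqrt pi) * (t - s) * ((2 * e * singular_const * \<theta> powr (H - 1)) ^ k * exp (\<theta> * (t - s)))) = ?K"
      using e by (simp add: power_mult_distrib power_divide field_simps)
    finally show ?thesis .
  qed
  have "(\<integral>\<^sup>+\<omega>. \<integral>\<^sup>+x. (ennreal C * ennreal (l x t \<omega> - l x s \<omega>)) ^ Suc k \<partial>lborel \<partial>P) \<le>
      (\<integral>\<^sup>+\<omega>. \<integral>\<^sup>+x. liminf (\<lambda>j. F j x \<omega> ^ Suc k) \<partial>lborel \<partial>P)"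
    using G_AE
  proof (intro nn_integral_mono_AE, eventually_elim)
    case (elim \<omega>)
    have "(ennreal C * ennreal (l x t \<omega> - l x s \<omega>)) ^ Suc k \<le> liminf (\<lambda>j. F j x \<omega> ^ Suc k)" for x
    proof -
      have "ennreal C * ennreal (l x t \<omega> - l x s \<omega>) = ennreal (C * max 0 (l x t \<omega> - l x s \<omega>))"
        using C by (simp add: ennreal_mult [symmetric] max_def ennreal_neg)
      moreover have "ennreal C * ennreal (l x t \<omega> - l x s \<omega>) \<le> liminf (\<lambda>j. F j x \<omega>)"
        unfolding F_def C_def by (rule l_increment_le_liminf [OF elim(2) st])
      ultimately show ?thesis
        using C by (auto intro!: ennreal_power_le_Liminf_power simp del: power_Suc)
    qed
    then show ?case by (intro nn_integral_mono)
  qed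
  also have "\<dots> \<le> (\<integral>\<^sup>+\<omega>. liminf (\<lambda>j. \<integral>\<^sup>+x. F j x \<omega> ^ Suc k \<partial>lborel) \<partial>P)"
    by (intro nn_integral_mono nn_integral_liminf) measurable
  also have "\<dots> \<le> liminf (\<lambda>j. \<integral>\<^sup>+\<omega>. \<integral>\<^sup>+x. F j x \<omega> ^ Suc k \<partial>lborel \<partial>P)"
    by (intro nn_integral_liminf) measurable
  also have "\<dots> \<le> ennreal ?K"
    using bound by (intro Liminf_le) auto
  finally have main: "(\<integral>\<^sup>+\<omega>. \<integral>\<^sup>+x. (ennreal C * ennreal (l x t \<omega> - l x s \<omega>)) ^ Suc k \<partial>lborel \<partial>P) \<le> ennreal ?K" .
  have "(\<integral>\<^sup>+\<omega>. \<integral>\<^sup>+x. ennreal (l x t \<omega> - l x s \<omega>) ^ Suc k \<partial>lborel \<partial>P) \<le>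
      (\<integral>\<^sup>+\<omega>. ennreal ((1 / C) ^ Suc k) * (\<integral>\<^sup>+x. (ennreal C * ennreal (l x t \<omega> - l x s \<omega>)) ^ Suc k \<partial>lborel) \<partial>P)"
    using G_AE
  proof (intro nn_integral_mono_AE, eventually_elim)
    case (elim \<omega>)
    have t: "0 \<le> t" using st by simp
    note [measurable] = l_borel [OF elim(2) st(1)] l_borel [OF elim(2) t]
    have "(\<integral>\<^sup>+x. ennreal (l x t \<omega> - l x s \<omega>) ^ Suc k \<partial>lborel) =
      (\<integral>\<^sup>+x. ennreal ((1 / C) ^ Suc k) * (ennreal C * ennreal (l x t \<omega> - l x s \<omega>)) ^ Suc k \<partial>lborel)"
    proof (intro nn_integral_cong)
      fix x
      have "ennreal ((1 / C) ^ Suc k) * ennreal C ^ Suc k = 1"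
        using C by (simp add: ennreal_power ennreal_mult [symmetric] power_one_over del: power_Suc)
      then show "ennreal (l x t \<omega> - l x s \<omega>) ^ Suc k = ennreal ((1 / C) ^ Suc k) * (ennreal C * ennreal (l x t \<omega> - l x s \<omega>)) ^ Suc k"
        by (simp add: power_mult_distrib mult.assoc [symmetric] del: power_Suc)
    qed
    also have "\<dots> = ennreal ((1 / C) ^ Suc k) * (\<integral>\<^sup>+x. (ennreal C * ennreal (l x t \<omega> - l x s \<omega>)) ^ Suc k \<partial>lborel)"
      by (intro nn_integral_cmult) measurable
    finally show ?case by simp
  qed
  also have "\<dots> = ennreal ((1 / C) ^ Suc k) * (\<integral>\<^sup>+\<omega>. (\<integral>\<^sup>+x. (ennreal C * ennreal (l x t \<omega> - l x s \<omega>)) ^ Suc k \<partial>lborel) \<partial>P)"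
  proof (intro nn_integral_cmult)
    have t: "0 \<le> t" using st by simp
    note [measurable] = l_measurable [OF st(1)] l_measurable [OF t]
    show "(\<lambda>\<omega>. \<integral>\<^sup>+x. (ennreal C * ennreal (l x t \<omega> - l x s \<omega>)) ^ Suc k \<partial>lborel) \<in> borel_measurable P"
      by measurable
  qed
  also have "\<dots> \<le> ennreal ((1 / C) ^ Suc k) * ennreal ?K"
    by (intro mult_left_mono main) simp
  also have "\<dots> = ennreal ((1 / C) ^ Suc k * ?K)"
    using C by (intro ennreal_mult' [symmetric]) simp
  also have "\<dots> \<le> ennreal (fact (Suc k) * 2 * (t - s) * ((singular_const * \<theta> powr (H - 1)) ^ k * exp (\<theta> * (t - s))))"
  proof (rule ennreal_leI)
    define X where "X = fact (Suc k) * 2 * (t - s) * ((singular_const * \<theta> powr (H - 1)) ^ k * exp (\<theta> * (t - s)))"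
    have X: "0 \<le> X" using st singular_const_pos by (simp add: X_def)
    have "(1 / C) ^ Suc k * ?K = (sqrt pi / C) * (2 / C) ^ k * X"
      by (simp add: X_def power_mult_distrib power_divide mult_ac)
    also have "\<dots> \<le> 1 * 1 * X"
    proof (intro mult_right_mono mult_mono)
      show "sqrt pi / C \<le> 1" using C by (simp add: C_def)
      show "(2 / C) ^ k \<le> 1" using C by (intro power_le_one) auto
    qed (use C X in auto)
    finally show "(1 / C) ^ Suc k * ?K \<le> X" by simp
  qed
  finally show ?thesis .
qed

end

section \<open>Dyadic chaining\<close>

definition dyadic_floor :: "nat \<Rightarrow> real \<Rightarrow> real" where
  "dyadic_floor n t = real (nat \<lfloor>2 ^ n * t\<rfloor>) / 2 ^ n"

lemma dyadic_floor_nonneg: "0 \<le> dyadic_floor n t"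
  by (simp add: dyadic_floor_def)

lemma dyadic_floor_bounds:
  assumes "0 \<le> t"
  shows "dyadic_floor n t \<le> t" "t - 1 / 2 ^ n \<le> dyadic_floor n t"
proof -
  have r: "real (nat \<lfloor>2 ^ n * t\<rfloor>) = of_int \<lfloor>2 ^ n * t\<rfloor>" using assms by simp
  show "dyadic_floor n t \<le> t"
    unfolding dyadic_floor_def r by (simp add: divide_le_eq mult.commute)
  have "(2 ^ n * t - 1) / 2 ^ n \<le> of_int \<lfloor>2 ^ n * t\<rfloor> / 2 ^ n"
    by (intro divide_right_mono) (linarith, simp)
  then show "t - 1 / 2 ^ n \<le> dyadic_floor n t"
    unfolding dyadic_floor_def r by (simp add: diff_divide_distrib)
qed

lemma dyadic_floor_tendsto:
  assumes "0 \<le> t"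
  shows "(\<lambda>n. dyadic_floor n t) \<longlonglongrightarrow> t"
proof (rule tendsto_sandwich)
  show "(\<lambda>n. t - 1 / 2 ^ n) \<longlonglongrightarrow> t"
    using tendsto_diff [OF tendsto_const LIMSEQ_power_zero [of "1/2 :: real"], of t] by (simp add: power_one_over)
qed (use dyadic_floor_bounds [OF assms] in auto)

lemma dyadic_floor_Suc:
  assumes "0 \<le> t" "t \<le> real T"
  shows "dyadic_floor (Suc n) t = dyadic_floor n t \<or>
    (\<exists>k<T * 2 ^ Suc n. dyadic_floor n t = real k / 2 ^ Suc n \<and> dyadic_floor (Suc n) t = real (Suc k) / 2 ^ Suc n)"
proof -
  define j where "j = \<lfloor>2 ^ n * t\<rfloor>"
  define i where "i = \<lfloor>2 ^ Suc n * t\<rfloor>"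
  have j: "0 \<le> j" and i: "i = 2 * j \<or> i = 2 * j + 1"
    using assms unfolding i_def j_def by (simp, simp add: mult.assoc, linarith)
  have fl: "dyadic_floor n t = of_int j / 2 ^ n" "dyadic_floor (Suc n) t = of_int i / 2 ^ Suc n"
    using j i by (auto simp: dyadic_floor_def j_def [symmetric] i_def [symmetric] simp del: power_Suc)
  show ?thesis
  proof (cases "i = 2 * j")
    case True
    then show ?thesis using fl by simp
  next
    case False
    with i have i: "i = 2 * j + 1" by simp
    have "of_int i \<le> 2 ^ Suc n * t" unfolding i_def by (rule of_int_floor_le)
    also have "\<dots> \<le> 2 ^ Suc n * real T" using assms by (intro mult_left_mono) auto
    finally have "of_int i \<le> (of_int (int (T * 2 ^ Suc n)) :: real)" by (simp add: mult.commute)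
    then have "i \<le> int (T * 2 ^ Suc n)" by (simp only: of_int_le_iff)
    then have "nat (2 * j) < T * 2 ^ Suc n" using i j by linarith
    then show ?thesis
      using fl i j by (intro disjI2 exI [of _ "nat (2 * j)"]) (auto simp: add.commute)
  qed
qed

lemma dyadic_floor_close:
  assumes st: "0 \<le> s" "s \<le> t" "t \<le> real T" "t - s \<le> 1 / 2 ^ n"
  shows "dyadic_floor n t = dyadic_floor n s \<or>
    (\<exists>k<T * 2 ^ n. dyadic_floor n s = real k / 2 ^ n \<and> dyadic_floor n t = real (Suc k) / 2 ^ n)"
proof -
  define j where "j = \<lfloor>2 ^ n * s\<rfloor>"
  define i where "i = \<lfloor>2 ^ n * t\<rfloor>"
  have "2 ^ n * s \<le> 2 ^ n * t" using st by (intro mult_left_mono) auto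
  moreover have "2 ^ n * t \<le> 2 ^ n * s + 1" using st by (simp add: field_simps)
  ultimately have j: "0 \<le> j" and i: "i = j \<or> i = j + 1"
    using st unfolding i_def j_def by (simp, linarith)
  have fl: "dyadic_floor n s = of_int j / 2 ^ n" "dyadic_floor n t = of_int i / 2 ^ n"
    using j i by (auto simp: dyadic_floor_def j_def [symmetric] i_def [symmetric])
  show ?thesis
  proof (cases "i = j")
    case True
    then show ?thesis using fl by simp
  next
    case False
    with i have i: "i = j + 1" by simp
    have "of_int i \<le> 2 ^ n * t" unfolding i_def by (rule of_int_floor_le)
    also have "\<dots> \<le> 2 ^ n * real T" using st by (intro mult_left_mono) auto
    finally have "of_int i \<le> (of_int (int (T * 2 ^ n)) :: real)" by (simp add: mult.commute)
    then have "i \<le> int (T * 2 ^ n)" by (simp only: of_int_le_iff)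
    then have "nat j < T * 2 ^ n" using i j by linarith
    then show ?thesis
      using fl i j by (intro disjI2 exI [of _ "nat j"]) (auto simp: add.commute)
  qed
qed

lemma dyadic_chaining:
  fixes y :: "real \<Rightarrow> real" and a :: "nat \<Rightarrow> real" and T :: nat
  assumes inc: "\<And>n k. 1 \<le> n \<Longrightarrow> k < T * 2 ^ n \<Longrightarrow> \<bar>y (real (Suc k) / 2 ^ n) - y (real k / 2 ^ n)\<bar> \<le> a n"
    and a: "\<And>n. 0 \<le> a n" "summable a"
  defines "z \<equiv> \<lambda>t. lim (\<lambda>m. y (dyadic_floor m t))"
  shows "\<And>t. 0 \<le> t \<Longrightarrow> t \<le> real T \<Longrightarrow> (\<lambda>m. y (dyadic_floor m t)) \<longlonglongrightarrow> z t"
    and "\<And>s t n. 0 \<le> s \<Longrightarrow> s \<le> t \<Longrightarrow> t \<le> real T \<Longrightarrow> t - s \<le> 1 / 2 ^ n \<Longrightarrow> 1 \<le> n \<Longrightarrow>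
      \<bar>z t - z s\<bar> \<le> 2 * (\<Sum>i. a (i + n))"
proof -
  have step: "\<bar>y (dyadic_floor (Suc m) t) - y (dyadic_floor m t)\<bar> \<le> a (Suc m)" if "0 \<le> t" "t \<le> real T" for t m
    using dyadic_floor_Suc [OF that, of m]
  proof (elim disjE exE conjE)
    assume "dyadic_floor (Suc m) t = dyadic_floor m t"
    then show ?thesis using a(1) [of "Suc m"] by simp
  next
    fix k assume k: "k < T * 2 ^ Suc m" and e: "dyadic_floor m t = real k / 2 ^ Suc m"
      "dyadic_floor (Suc m) t = real (Suc k) / 2 ^ Suc m"
    show ?thesis unfolding e by (rule inc [OF _ k]) simp
  qed
  have lim: "(\<lambda>m. y (dyadic_floor m t)) \<longlonglongrightarrow> z t"
    and tail: "\<bar>z t - y (dyadic_floor n t)\<bar> \<le> (\<Sum>i. a (i + Suc n))" if t: "0 \<le> t" "t \<le> real T" for t n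
  proof -
    define d where "d m = y (dyadic_floor (Suc m) t) - y (dyadic_floor m t)" for m
    have sa: "summable (\<lambda>i. a (i + k))" for k using a(2) by (rule summable_ignore_initial_segment)
    have sn: "summable (\<lambda>i. norm (d (i + k)))" for k
      using step [OF t] by (intro summable_comparison_test' [OF sa [of "Suc k"], of 0]) (auto simp: d_def)
    have sd: "summable (\<lambda>i. d (i + k))" for k using sn by (rule summable_norm_cancel)
    have tele: "(\<Sum>i<m. d (i + k)) = y (dyadic_floor (m + k) t) - y (dyadic_floor k t)" for m k
      by (induction m) (auto simp: d_def)
    have c: "(\<lambda>m. y (dyadic_floor (m + k) t)) \<longlonglongrightarrow> y (dyadic_floor k t) + (\<Sum>i. d (i + k))" for k
    proof -
      have "(\<lambda>m. y (dyadic_floor k t) + (\<Sum>i<m. d (i + k))) \<longlonglongrightarrow> y (dyadic_floor k t) + (\<Sum>i. d (i + k))"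
        by (intro tendsto_add tendsto_const summable_LIMSEQ sd)
      then show ?thesis by (simp add: tele)
    qed
    have "convergent (\<lambda>m. y (dyadic_floor m t))"
      using c [of 0] by (auto simp: convergent_def)
    then show l: "(\<lambda>m. y (dyadic_floor m t)) \<longlonglongrightarrow> z t"
      by (simp add: z_def convergent_LIMSEQ_iff)
    have "z t = y (dyadic_floor n t) + (\<Sum>i. d (i + n))"
      using LIMSEQ_unique [OF c [of n]] LIMSEQ_ignore_initial_segment [OF l, of n] by simp
    then have "\<bar>z t - y (dyadic_floor n t)\<bar> = \<bar>\<Sum>i. d (i + n)\<bar>" by simp
    also have "\<dots> \<le> (\<Sum>i. norm (d (i + n)))" using summable_norm [OF sn] by simp
    also have "\<dots> \<le> (\<Sum>i. a (i + Suc n))"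
      using step [OF t] by (intro suminf_le sn sa) (auto simp: d_def)
    finally show "\<bar>z t - y (dyadic_floor n t)\<bar> \<le> (\<Sum>i. a (i + Suc n))" .
  qed
  show "\<And>t. 0 \<le> t \<Longrightarrow> t \<le> real T \<Longrightarrow> (\<lambda>m. y (dyadic_floor m t)) \<longlonglongrightarrow> z t" by (rule lim)
  fix s t n assume st: "0 \<le> s" "s \<le> t" "t \<le> real T" "t - s \<le> 1 / 2 ^ n" "1 \<le> n"
  have "\<bar>y (dyadic_floor n t) - y (dyadic_floor n s)\<bar> \<le> a n"
    using dyadic_floor_close [OF st(1-4)]
  proof (elim disjE exE conjE)
    assume "dyadic_floor n t = dyadic_floor n s"
    then show ?thesis using a(1) [of n] by simp
  next
    fix k assume k: "k < T * 2 ^ n" and e: "dyadic_floor n s = real k / 2 ^ n"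
      "dyadic_floor n t = real (Suc k) / 2 ^ n"
    show ?thesis unfolding e by (rule inc [OF st(5) k])
  qed
  moreover have "(\<Sum>i. a (i + n)) = (\<Sum>i. a (i + Suc n)) + a n"
    using suminf_split_head [OF summable_ignore_initial_segment [OF a(2), of n]] by simp
  moreover have "\<bar>z t - y (dyadic_floor n t)\<bar> \<le> (\<Sum>i. a (i + Suc n))" "\<bar>z s - y (dyadic_floor n s)\<bar> \<le> (\<Sum>i. a (i + Suc n))"
    using st tail [of t n] tail [of s n] by auto
  ultimately show "\<bar>z t - z s\<bar> \<le> 2 * (\<Sum>i. a (i + n))" using a(1) [of n] by linarith
qed

lemma summable_geometric_weight:
  fixes r \<nu> :: real
  assumes "0 < r" "r < 1" "\<nu> \<le> 2"
  shows "summable (\<lambda>i. r ^ i * (1 + real i) powr \<nu>)"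
proof -
  define q where "q = sqrt r"
  have q: "0 < q" "q < 1" "r = q\<^sup>2" using assms by (auto simp: q_def)
  define S where "S = 1 / (1 - q)\<^sup>2"
  have sums: "(\<lambda>i. real (Suc i) * q ^ i) sums S"
    using geometric_deriv_sums [of q] q by (simp add: S_def)
  have le: "real (Suc i) * q ^ i \<le> S" for i
    using sum_le_suminf [OF sums_summable [OF sums], of "{i}"] q sums_unique [OF sums] by simp
  show ?thesis
  proof (rule summable_comparison_test' [where N = 0])
    show "summable (\<lambda>i. S * (real (Suc i) * q ^ i))" using sums_summable [OF sums] by (rule summable_mult)
    fix i :: nat
    have "(1 + real i) powr \<nu> \<le> (1 + real i) powr 2" using assms by (intro powr_mono) auto
    also have "\<dots> = (real (Suc i))\<^sup>2" by (simp add: powr_numeral add.commute)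
    finally have "r ^ i * (1 + real i) powr \<nu> \<le> r ^ i * (real (Suc i))\<^sup>2"
      using assms by (intro mult_left_mono) auto
    also have "\<dots> = (real (Suc i) * q ^ i) * (real (Suc i) * q ^ i)"
      by (simp add: q(3) power2_eq_square power_mult_distrib)
    also have "\<dots> \<le> S * (real (Suc i) * q ^ i)" using le q by (intro mult_right_mono) auto
    finally show "norm (r ^ i * (1 + real i) powr \<nu>) \<le> S * (real (Suc i) * q ^ i)" using assms by simp
  qed
qed

lemma weight_tail_bound:
  fixes r \<nu> :: real
  assumes r: "0 < r" "r < 1" and \<nu>: "0 \<le> \<nu>" "\<nu> \<le> 2" and n: "1 \<le> n"
  shows "summable (\<lambda>i. r ^ i * real i powr \<nu>)"
    and "(\<Sum>i. r ^ (i + n) * real (i + n) powr \<nu>) \<le> (\<Sum>i. r ^ i * (1 + real i) powr \<nu>) * (r ^ n * real n powr \<nu>)"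
proof -
  note S = summable_geometric_weight [OF r \<nu>(2)]
  show "summable (\<lambda>i. r ^ i * real i powr \<nu>)"
    using r \<nu> by (intro summable_comparison_test' [OF S, of 0]) (auto intro!: mult_left_mono powr_mono2)
  then have s: "summable (\<lambda>i. r ^ (i + n) * real (i + n) powr \<nu>)"
    by (rule summable_ignore_initial_segment)
  have "(\<Sum>i. r ^ (i + n) * real (i + n) powr \<nu>) \<le> (\<Sum>i. (r ^ n * real n powr \<nu>) * (r ^ i * (1 + real i) powr \<nu>))"
  proof (intro suminf_le s summable_mult S)
    fix i
    have "real i \<le> real n * real i" using n by (simp add: mult_le_cancel_right1)
    then have "real (i + n) \<le> real n * (1 + real i)" by (simp add: algebra_simps)
    then have "real (i + n) powr \<nu> \<le> (real n * (1 + real i)) powr \<nu>" using \<nu> by (intro powr_mono2) auto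
    also have "\<dots> = real n powr \<nu> * (1 + real i) powr \<nu>" by (rule powr_mult)
    finally have "r ^ (i + n) * real (i + n) powr \<nu> \<le> r ^ (i + n) * (real n powr \<nu> * (1 + real i) powr \<nu>)"
      using r by (intro mult_left_mono) auto
    then show "r ^ (i + n) * real (i + n) powr \<nu> \<le> (r ^ n * real n powr \<nu>) * (r ^ i * (1 + real i) powr \<nu>)"
      by (simp add: power_add mult_ac)
  qed
  also have "\<dots> = (r ^ n * real n powr \<nu>) * (\<Sum>i. r ^ i * (1 + real i) powr \<nu>)"
    by (rule suminf_mult [OF S])
  finally show "(\<Sum>i. r ^ (i + n) * real (i + n) powr \<nu>) \<le> (\<Sum>i. r ^ i * (1 + real i) powr \<nu>) * (r ^ n * real n powr \<nu>)"
    by (simp add: mult.commute)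
qed

lemma (in prob_space) gaussian_rv_even_moment:
  assumes X: "gaussian_rv M X" "expectation X = 0" and p: "1 \<le> p"
  shows "(\<integral>\<^sup>+\<omega>. ennreal (X \<omega> ^ (2 * p)) \<partial>M) = ennreal (fact (2 * p) / (2 ^ p * fact p) * expectation (\<lambda>\<omega>. (X \<omega>)\<^sup>2) ^ p)"
proof -
  have X' [measurable]: "X \<in> borel_measurable M" using X by (simp add: gaussian_rv_def)
  consider \<mu> where "AE \<omega> in M. X \<omega> = \<mu>"
    | \<mu> \<sigma> where "0 < \<sigma>" "distributed M lborel X (normal_density \<mu> \<sigma>)"
    using X by (auto simp: gaussian_rv_def)
  then show ?thesis
  proof cases
    case 1
    have "expectation X = expectation (\<lambda>_. \<mu>)" using 1 by (intro integral_cong_AE) auto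
    with X have "\<mu> = 0" by (simp add: prob_space)
    with 1 have 0: "AE \<omega> in M. X \<omega> = 0" by simp
    have "(\<integral>\<^sup>+\<omega>. ennreal (X \<omega> ^ (2 * p)) \<partial>M) = (\<integral>\<^sup>+\<omega>. 0 \<partial>M)"
    proof (rule nn_integral_cong_AE)
      show "AE \<omega> in M. ennreal (X \<omega> ^ (2 * p)) = 0" using 0 by eventually_elim (use p in simp)
    qed
    moreover have "expectation (\<lambda>\<omega>. (X \<omega>)\<^sup>2) = 0"
      using 0 by (subst integral_cong_AE [where g="\<lambda>_. 0"]) auto
    ultimately show ?thesis using p by simp
  next
    case 2
    have "\<mu> = 0" using X normal_distributed_expectation [OF 2] by simp
    note D = 2(2) [unfolded this]
    have var: "expectation (\<lambda>\<omega>. (X \<omega>)\<^sup>2) = \<sigma>\<^sup>2"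
      using normal_distributed_variance [OF 2(1) D] X by simp
    have "(\<integral>\<^sup>+\<omega>. ennreal (X \<omega> ^ (2 * p)) \<partial>M) = (\<integral>\<^sup>+x. ennreal (normal_density 0 \<sigma> x) * ennreal (x ^ (2 * p)) \<partial>lborel)"
      using D by (intro distributed_nn_integral [symmetric]) auto
    also have "\<dots> = (\<integral>\<^sup>+x. ennreal (normal_density 0 \<sigma> x * (x - 0) ^ (2 * p)) \<partial>lborel)"
      by (simp add: ennreal_mult normal_density_nonneg power_mult)
    also have "\<dots> = ennreal (\<integral>x. normal_density 0 \<sigma> x * (x - 0) ^ (2 * p) \<partial>lborel)"
      using normal_moment_even [OF 2(1), of 0 p]
      by (intro nn_integral_eq_integral) (auto simp: has_bochner_integral_iff normal_density_nonneg power_mult)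
    also have "(\<integral>x. normal_density 0 \<sigma> x * (x - 0) ^ (2 * p) \<partial>lborel) = fact (2 * p) / ((2 / \<sigma>\<^sup>2) ^ p * fact p)"
      using normal_moment_even [OF 2(1), of 0 p] by (simp add: has_bochner_integral_iff)
    also have "\<dots> = fact (2 * p) / (2 ^ p * fact p) * (\<sigma>\<^sup>2) ^ p" using 2(1) by (simp add: power_divide)
    finally show ?thesis by (simp add: var)
  qed
qed

section \<open>The envelope of the local time\<close>

context fbm_path
begin

lemma path_increment_moment:
  assumes st: "0 \<le> s" "0 \<le> t" and p: "1 \<le> p"
  shows "(\<integral>\<^sup>+\<omega>. ennreal ((path t \<omega> - path s \<omega>) ^ (2 * p)) \<partial>P) =
    ennreal (fact (2 * p) / (2 ^ p * fact p) * (expectation (\<lambda>\<omega>. (B 1 \<omega>)\<^sup>2) * \<bar>t - s\<bar> powr (2 * H)) ^ p)"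
proof -
  define X where "X \<omega> = B t \<omega> - B s \<omega>" for \<omega>
  define k where "k x = kern t x - kern s x" for x
  have X: "gaussian_pair X k"
    unfolding X_def [abs_def] k_def [abs_def] by (intro gaussian_pair_diff gaussian_pair_B st)
  have "l2_inner lborel k k = (sqrt (expectation (\<lambda>\<omega>. (B 1 \<omega>)\<^sup>2) / mvn_const H))\<^sup>2 *
      (\<integral>x. (mvn_kernel H t x - mvn_kernel H s x)\<^sup>2 \<partial>lborel)"
    unfolding l2_inner_def k_def kern_def right_diff_distrib [symmetric] integral_mult_right_zero [symmetric]
    by (simp only: power2_eq_square mult_ac)
  also have "\<dots> = expectation (\<lambda>\<omega>. (B 1 \<omega>)\<^sup>2) / mvn_const H * (mvn_const H * \<bar>t - s\<bar> powr (2 * H))"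
  proof -
    have "(sqrt (expectation (\<lambda>\<omega>. (B 1 \<omega>)\<^sup>2) / mvn_const H))\<^sup>2 = expectation (\<lambda>\<omega>. (B 1 \<omega>)\<^sup>2) / mvn_const H"
      using mvn_const_pos [OF H] by (intro real_sqrt_pow2 divide_nonneg_pos) auto
    then show ?thesis
      by (simp only: has_bochner_integral_integral_eq [OF mvn_kernel_increment_norm [OF H]])
  qed
  also have "\<dots> = expectation (\<lambda>\<omega>. (B 1 \<omega>)\<^sup>2) * \<bar>t - s\<bar> powr (2 * H)"
    using mvn_const_pos [OF H] by simp
  finally have var: "expectation (\<lambda>\<omega>. (X \<omega>)\<^sup>2) = \<dots>" using gaussian_pair_var [OF X] by simp
  have "(\<integral>\<^sup>+\<omega>. ennreal ((path t \<omega> - path s \<omega>) ^ (2 * p)) \<partial>P) = (\<integral>\<^sup>+\<omega>. ennreal (X \<omega> ^ (2 * p)) \<partial>P)"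
    using G_AE
  proof (intro nn_integral_cong_AE, eventually_elim)
    case (elim \<omega>)
    then show ?case using st by (simp add: X_def path_eq)
  qed
  then show ?thesis
    using gaussian_rv_even_moment [OF gaussian_pair_rv [OF X] p] by (simp only: var)
qed

definition chain_level :: "nat \<Rightarrow> nat \<Rightarrow> nat \<Rightarrow> 'w \<Rightarrow> ennreal" where
  "chain_level T p n \<omega> = ennreal ((2 powr (- H / 2)) ^ n) * (1 + (\<Sum>k<T * 2 ^ n. ennreal ((1 / (2 powr (- H / 2)) ^ n) ^ (2 * p)) *
     ennreal ((path (real (Suc k) / 2 ^ n) \<omega> - path (real k / 2 ^ n) \<omega>) ^ (2 * p))))"

definition path_sup_bound :: "nat \<Rightarrow> nat \<Rightarrow> 'w \<Rightarrow> ennreal" where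
  "path_sup_bound T p \<omega> = (\<Sum>j\<le>T. ennreal \<bar>path (real j) \<omega>\<bar>) + (\<Sum>n. chain_level T p n \<omega>)"

lemma path_sup_bound_measurable [measurable]: "path_sup_bound T p \<in> borel_measurable P"
  unfolding path_sup_bound_def [abs_def] chain_level_def [abs_def] by measurable

lemma path_dyadic_increment_le_chain_level:
  assumes k: "k < T * 2 ^ n" and p: "1 \<le> p"
  shows "ennreal \<bar>path (real (Suc k) / 2 ^ n) \<omega> - path (real k / 2 ^ n) \<omega>\<bar> \<le> chain_level T p n \<omega>"
proof -
  define r where "r = (2 powr (- H / 2)) ^ n"
  have r: "0 < r" by (simp add: r_def)
  define \<Delta> where "\<Delta> = path (real (Suc k) / 2 ^ n) \<omega> - path (real k / 2 ^ n) \<omega>"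
  define x where "x = \<bar>\<Delta>\<bar> / r"
  have "x \<le> 1 + x ^ (2 * p)"
  proof (cases "x \<le> 1")
    case True
    have "0 \<le> x ^ (2 * p)" by (simp add: power_mult)
    with True show ?thesis by linarith
  next
    case False
    then have "x ^ 1 \<le> x ^ (2 * p)" using p by (intro power_increasing) auto
    then show ?thesis by simp
  qed
  also have "x ^ (2 * p) = (1 / r) ^ (2 * p) * \<Delta> ^ (2 * p)"
    by (simp add: x_def power_divide power_even_abs)
  finally have "r * x \<le> r * (1 + (1 / r) ^ (2 * p) * \<Delta> ^ (2 * p))" using r by (intro mult_left_mono) auto
  then have "\<bar>\<Delta>\<bar> \<le> r * (1 + (1 / r) ^ (2 * p) * \<Delta> ^ (2 * p))" using r by (simp add: x_def)
  then have "ennreal \<bar>\<Delta>\<bar> \<le> ennreal (r * (1 + (1 / r) ^ (2 * p) * \<Delta> ^ (2 * p)))" by (rule ennreal_leI)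
  also have "\<dots> = ennreal r * (1 + ennreal ((1 / r) ^ (2 * p)) * ennreal (\<Delta> ^ (2 * p)))"
    using r by (simp add: ennreal_mult ennreal_plus power_mult zero_le_mult_iff)
  also have "\<dots> \<le> chain_level T p n \<omega>"
    unfolding chain_level_def r_def [symmetric] \<Delta>_def using k
    by (intro mult_left_mono add_left_mono member_le_sum) auto
  finally show ?thesis by (simp add: \<Delta>_def)
qed

lemma path_le_sup_bound:
  assumes t: "0 \<le> t" "t \<le> real T" and p: "1 \<le> p"
  shows "ennreal \<bar>path t \<omega>\<bar> \<le> path_sup_bound T p \<omega>"
proof -
  have step: "ennreal \<bar>path (dyadic_floor (Suc m) t) \<omega>\<bar> \<le> ennreal \<bar>path (dyadic_floor m t) \<omega>\<bar> + chain_level T p (Suc m) \<omega>" for m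
    using dyadic_floor_Suc [OF t, of m]
  proof (elim disjE exE conjE)
    fix k assume k: "k < T * 2 ^ Suc m" and e: "dyadic_floor m t = real k / 2 ^ Suc m"
      "dyadic_floor (Suc m) t = real (Suc k) / 2 ^ Suc m"
    have "ennreal \<bar>path (dyadic_floor (Suc m) t) \<omega>\<bar> \<le>
        ennreal (\<bar>path (dyadic_floor m t) \<omega>\<bar> + \<bar>path (dyadic_floor (Suc m) t) \<omega> - path (dyadic_floor m t) \<omega>\<bar>)"
      by (intro ennreal_leI) linarith
    also have "\<dots> = ennreal \<bar>path (dyadic_floor m t) \<omega>\<bar> + ennreal \<bar>path (dyadic_floor (Suc m) t) \<omega> - path (dyadic_floor m t) \<omega>\<bar>"
      by (intro ennreal_plus) auto
    also have "\<dots> \<le> ennreal \<bar>path (dyadic_floor m t) \<omega>\<bar> + chain_level T p (Suc m) \<omega>"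
      unfolding e by (intro add_left_mono path_dyadic_increment_le_chain_level k p)
    finally show ?thesis .
  next
    assume "dyadic_floor (Suc m) t = dyadic_floor m t"
    then show ?thesis by simp
  qed
  have fin: "ennreal \<bar>path (dyadic_floor m t) \<omega>\<bar> \<le> (\<Sum>j\<le>T. ennreal \<bar>path (real j) \<omega>\<bar>) + (\<Sum>n<Suc m. chain_level T p n \<omega>)" for m
  proof (induction m)
    case 0
    have "dyadic_floor 0 t = real (nat \<lfloor>t\<rfloor>)" by (simp add: dyadic_floor_def)
    moreover have "nat \<lfloor>t\<rfloor> \<le> T" using t by (simp add: nat_le_iff floor_le_iff)
    moreover have "ennreal \<bar>path (real j) \<omega>\<bar> \<le> (\<Sum>j\<le>T. ennreal \<bar>path (real j) \<omega>\<bar>)" if "j \<le> T" for j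
      using that by (intro member_le_sum [where f = "\<lambda>j. ennreal \<bar>path (real j) \<omega>\<bar>"]) auto
    ultimately have "ennreal \<bar>path (dyadic_floor 0 t) \<omega>\<bar> \<le> (\<Sum>j\<le>T. ennreal \<bar>path (real j) \<omega>\<bar>)"
      by metis
    then show ?case by (rule add_increasing2 [rotated]) simp
  next
    case (Suc m)
    then have "ennreal \<bar>path (dyadic_floor m t) \<omega>\<bar> + chain_level T p (Suc m) \<omega> \<le>
        (\<Sum>j\<le>T. ennreal \<bar>path (real j) \<omega>\<bar>) + (\<Sum>n<Suc m. chain_level T p n \<omega>) + chain_level T p (Suc m) \<omega>"
      by (rule add_right_mono)
    from order_trans [OF step [of m] this] show ?case by (simp only: sum.lessThan_Suc [of _ "Suc m"] add.assoc)
  qed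
  have le: "ennreal \<bar>path (dyadic_floor m t) \<omega>\<bar> \<le> path_sup_bound T p \<omega>" for m
    unfolding path_sup_bound_def
    by (rule order_trans [OF fin]) (intro add_left_mono sum_le_suminf, auto)
  have "(\<lambda>m. ennreal \<bar>path (dyadic_floor m t) \<omega>\<bar>) \<longlonglongrightarrow> ennreal \<bar>path t \<omega>\<bar>"
  proof -
    have "isCont (\<lambda>t. path t \<omega>) t" using path_continuous [of UNIV \<omega>] by (simp add: continuous_on_eq_continuous_at)
    from isCont_tendsto_compose [OF this dyadic_floor_tendsto [OF t(1)]]
    show ?thesis by (intro tendsto_ennrealI tendsto_rabs)
  qed
  then show ?thesis by (rule LIMSEQ_le_const2) (use le in blast)
qed

lemma path_sup_bound_finite:
  assumes p: "1 \<le> p" "1 \<le> H * real p"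
  shows "(\<integral>\<^sup>+\<omega>. path_sup_bound T p \<omega> \<partial>P) < \<infinity>"
proof -
  define r where "r = 2 powr (- H / 2)"
  have r: "0 < r" "r < 1" using H by (auto simp: r_def powr_less_one)
  have r4: "r ^ 4 = (1/2) powr (2 * H)"
  proof -
    have "r ^ 4 = 2 powr (- H / 2 * real 4)" unfolding r_def by (subst powr_power) (auto simp: mult.commute)
    also have "\<dots> = 1 / 2 powr (2 * H)" by (simp add: powr_minus_divide)
    finally show ?thesis by (simp add: powr_divide)
  qed
  have r2p: "2 * r ^ (2 * p) \<le> 1"
  proof -
    have "r ^ (2 * p) = 2 powr (- H / 2 * real (2 * p))" unfolding r_def by (subst powr_power) (auto simp: mult.commute)
    also have "\<dots> \<le> 2 powr (-1)" using p by (intro powr_mono) auto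
    finally show ?thesis by (simp add: powr_minus)
  qed
  define c where "c = fact (2 * p) / (2 ^ p * fact p) * expectation (\<lambda>\<omega>. (B 1 \<omega>)\<^sup>2) ^ p"
  have c: "0 \<le> c" using variance_B1_pos by (simp add: c_def)
  have level: "(\<integral>\<^sup>+\<omega>. chain_level T p n \<omega> \<partial>P) \<le> ennreal (r ^ n * (1 + real T * c))" for n
  proof -
    have mom: "(\<integral>\<^sup>+\<omega>. ennreal ((path (real (Suc k) / 2 ^ n) \<omega> - path (real k / 2 ^ n) \<omega>) ^ (2 * p)) \<partial>P) = ennreal (c * (r ^ n) ^ (4 * p))" for k
    proof -
      have "real (Suc k) / 2 ^ n - real k / 2 ^ n = (1/2) ^ n" by (simp add: diff_divide_distrib [symmetric] power_one_over)
      then have "\<bar>real (Suc k) / 2 ^ n - real k / 2 ^ n\<bar> powr (2 * H) = ((1/2) ^ n) powr (2 * H)" by simp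
      also have "\<dots> = ((1/2) powr real n) powr (2 * H)" by (subst powr_realpow) auto
      also have "\<dots> = (1/2) powr (2 * H * real n)" by (simp add: powr_powr mult.commute)
      also have "\<dots> = ((1/2) powr (2 * H)) ^ n" by (subst powr_power) (auto simp: mult.commute)
      also have "\<dots> = (r ^ 4) ^ n" by (simp only: r4)
      also have "\<dots> = (r ^ n) ^ 4" by (simp only: power_mult [symmetric] mult.commute)
      finally have "\<bar>real (Suc k) / 2 ^ n - real k / 2 ^ n\<bar> powr (2 * H) = (r ^ n) ^ 4" .
      moreover have "((r ^ n) ^ 4) ^ p = (r ^ n) ^ (4 * p)" by (simp only: power_mult)
      ultimately have "fact (2 * p) / (2 ^ p * fact p) * (expectation (\<lambda>\<omega>. (B 1 \<omega>)\<^sup>2) *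
          \<bar>real (Suc k) / 2 ^ n - real k / 2 ^ n\<bar> powr (2 * H)) ^ p = c * (r ^ n) ^ (4 * p)"
        by (simp only: c_def power_mult_distrib mult.assoc)
      moreover have "0 \<le> real k / 2 ^ n" "0 \<le> real (Suc k) / 2 ^ n" by simp_all
      ultimately show ?thesis by (simp only: path_increment_moment [OF _ _ p(1)])
    qed
    define g where "g k \<omega> = ennreal ((path (real (Suc k) / 2 ^ n) \<omega> - path (real k / 2 ^ n) \<omega>) ^ (2 * p))" for k \<omega>
    have [measurable]: "g k \<in> borel_measurable P" for k unfolding g_def [abs_def] by measurable
    have "(\<integral>\<^sup>+\<omega>. chain_level T p n \<omega> \<partial>P) = (\<integral>\<^sup>+\<omega>. ennreal (r ^ n) * (1 + (\<Sum>k<T * 2 ^ n. ennreal ((1 / r ^ n) ^ (2 * p)) * g k \<omega>)) \<partial>P)"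
      by (simp only: chain_level_def r_def [symmetric] g_def)
    also have "\<dots> = ennreal (r ^ n) * (\<integral>\<^sup>+\<omega>. 1 + (\<Sum>k<T * 2 ^ n. ennreal ((1 / r ^ n) ^ (2 * p)) * g k \<omega>) \<partial>P)"
      by (rule nn_integral_cmult) measurable
    also have "(\<integral>\<^sup>+\<omega>. 1 + (\<Sum>k<T * 2 ^ n. ennreal ((1 / r ^ n) ^ (2 * p)) * g k \<omega>) \<partial>P) =
        1 + (\<integral>\<^sup>+\<omega>. (\<Sum>k<T * 2 ^ n. ennreal ((1 / r ^ n) ^ (2 * p)) * g k \<omega>) \<partial>P)"
      by (subst nn_integral_add) (auto simp: emeasure_space_1)
    also have "(\<integral>\<^sup>+\<omega>. (\<Sum>k<T * 2 ^ n. ennreal ((1 / r ^ n) ^ (2 * p)) * g k \<omega>) \<partial>P) =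
        (\<Sum>k<T * 2 ^ n. \<integral>\<^sup>+\<omega>. ennreal ((1 / r ^ n) ^ (2 * p)) * g k \<omega> \<partial>P)"
      by (rule nn_integral_sum) measurable
    also have "\<dots> = (\<Sum>k<T * 2 ^ n. ennreal ((1 / r ^ n) ^ (2 * p)) * ennreal (c * (r ^ n) ^ (4 * p)))"
    proof (intro sum.cong refl)
      fix k
      have "(\<integral>\<^sup>+\<omega>. ennreal ((1 / r ^ n) ^ (2 * p)) * g k \<omega> \<partial>P) = ennreal ((1 / r ^ n) ^ (2 * p)) * (\<integral>\<^sup>+\<omega>. g k \<omega> \<partial>P)"
        by (rule nn_integral_cmult) measurable
      then show "(\<integral>\<^sup>+\<omega>. ennreal ((1 / r ^ n) ^ (2 * p)) * g k \<omega> \<partial>P) = ennreal ((1 / r ^ n) ^ (2 * p)) * ennreal (c * (r ^ n) ^ (4 * p))"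
        unfolding g_def mom .
    qed
    also have "ennreal (r ^ n) * (1 + (\<Sum>k<T * 2 ^ n. ennreal ((1 / r ^ n) ^ (2 * p)) * ennreal (c * (r ^ n) ^ (4 * p)))) = ennreal (r ^ n * (1 + real (T * 2 ^ n) * ((1 / r ^ n) ^ (2 * p) * (c * (r ^ n) ^ (4 * p)))))"
      using r c by (simp add: ennreal_mult ennreal_plus ennreal_of_nat_eq_real_of_nat del: of_nat_mult)
    also have "\<dots> \<le> ennreal (r ^ n * (1 + real T * c))"
    proof (intro ennreal_leI mult_left_mono add_left_mono)
      have "(r ^ n) ^ (4 * p) = (r ^ n) ^ (2 * p) * (r ^ n) ^ (2 * p)" by (simp add: power_add [symmetric])
      then have "(1 / r ^ n) ^ (2 * p) * (c * (r ^ n) ^ (4 * p)) = c * (r ^ n) ^ (2 * p)"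
        using r by (simp add: power_divide)
      also have "(r ^ n) ^ (2 * p) = (r ^ (2 * p)) ^ n" by (simp add: power_mult [symmetric] mult.commute)
      finally have "real (T * 2 ^ n) * ((1 / r ^ n) ^ (2 * p) * (c * (r ^ n) ^ (4 * p))) = real T * c * (2 * r ^ (2 * p)) ^ n"
        by (simp add: power_mult_distrib)
      also have "\<dots> \<le> real T * c * 1"
        using r2p r c by (intro mult_left_mono power_le_one) auto
      finally show "real (T * 2 ^ n) * ((1 / r ^ n) ^ (2 * p) * (c * (r ^ n) ^ (4 * p))) \<le> real T * c" by simp
    qed (use r in auto)
    finally show ?thesis .
  qed
  have [measurable]: "chain_level T p n \<in> borel_measurable P" for n
    unfolding chain_level_def [abs_def] by measurable
  have "(\<integral>\<^sup>+\<omega>. (\<Sum>n. chain_level T p n \<omega>) \<partial>P) = (\<Sum>n. \<integral>\<^sup>+\<omega>. chain_level T p n \<omega> \<partial>P)"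
    by (intro nn_integral_suminf) measurable
  also have "\<dots> \<le> (\<Sum>n. ennreal (r ^ n * (1 + real T * c)))"
    using level by (intro suminf_le summableI)
  also have "\<dots> = ennreal (\<Sum>n. r ^ n * (1 + real T * c))"
    using r c by (intro suminf_ennreal2 summable_mult2 summable_geometric) auto
  also have "\<dots> < \<infinity>" by simp
  finally have 1: "(\<integral>\<^sup>+\<omega>. (\<Sum>n. chain_level T p n \<omega>) \<partial>P) < \<infinity>" .
  have "(\<integral>\<^sup>+\<omega>. ennreal \<bar>path (real j) \<omega>\<bar> \<partial>P) < \<infinity>" for j
  proof -
    have "(\<integral>\<^sup>+\<omega>. ennreal \<bar>path (real j) \<omega>\<bar> \<partial>P) = (\<integral>\<^sup>+\<omega>. ennreal \<bar>B (real j) \<omega>\<bar> \<partial>P)"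
      using G_AE by (intro nn_integral_cong_AE, eventually_elim) (simp add: path_eq)
    then show ?thesis using integrable_B [of "real j"] by (simp add: integrable_iff_bounded)
  qed
  then have "(\<integral>\<^sup>+\<omega>. (\<Sum>j\<le>T. ennreal \<bar>path (real j) \<omega>\<bar>) \<partial>P) < \<infinity>"
    by (subst nn_integral_sum) (auto simp: less_top)
  with 1 show ?thesis
    unfolding path_sup_bound_def by (subst nn_integral_add) auto
qed

end

context fbm_local_time
begin

definition increment_scale :: "nat \<Rightarrow> real" where
  "increment_scale n = (2 powr (H - 1)) ^ n * real n powr H"

lemma increment_scale_pos: "1 \<le> n \<Longrightarrow> 0 < increment_scale n"
  by (simp add: increment_scale_def)

definition l_inc :: "nat \<Rightarrow> nat \<Rightarrow> 'w \<times> real \<Rightarrow> real" where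
  "l_inc n k = (\<lambda>(\<omega>, x). l x (real (Suc k) / 2 ^ n) \<omega> - l x (real k / 2 ^ n) \<omega>)"

lemma l_measurable': "0 \<le> t \<Longrightarrow> (\<lambda>e. l (snd e) t (fst e)) \<in> borel_measurable (P \<Otimes>\<^sub>M lborel)"
  using l_measurable [of t] by (simp add: case_prod_beta')

lemma l_inc_measurable [measurable]: "l_inc n k \<in> borel_measurable (P \<Otimes>\<^sub>M lborel)"
  unfolding l_inc_def case_prod_beta' by (intro borel_measurable_diff l_measurable') auto

text \<open>
  The moment of order \<open>n + 1\<close> at dyadic level \<open>n\<close>: its growth \<open>n\<^sup>H\<^sup>n\<close> is what the logarithmic factor
  in the scale compensates.
\<close>

lemma l_inc_scaled_moment:
  assumes n: "1 \<le> n" and C: "0 < C"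
  shows "(\<integral>\<^sup>+\<omega>. \<integral>\<^sup>+x. ennreal (l_inc n k (\<omega>, x) / (C * increment_scale n)) ^ Suc n \<partial>lborel \<partial>P)
    \<le> ennreal (2 * real (Suc n) * (singular_const * exp 1 / C) ^ n / C)"
proof -
  define h where "h = (1/2 :: real) ^ n"
  have h: "0 < h" by (simp add: h_def)
  define w where "w = (2 powr (H - 1)) ^ n"
  have w: "0 < w" "h \<le> w"
  proof -
    show "0 < w" by (simp add: w_def)
    have "1 / 2 = (2 :: real) powr (-1)" by (simp add: powr_minus_divide)
    also have "\<dots> \<le> 2 powr (H - 1)" using H by (intro powr_mono) auto
    finally show "h \<le> w" unfolding h_def w_def by (intro power_mono) auto
  qed
  define N where "N = real n"
  have N: "1 \<le> N" using n by (simp add: N_def)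
  have \<psi>: "increment_scale n = w * N powr H" by (simp add: increment_scale_def w_def N_def)
  note pos = increment_scale_pos [OF n]
  have diff: "real (Suc k) / 2 ^ n - real k / 2 ^ n = h"
    by (simp add: h_def diff_divide_distrib [symmetric] power_one_over)
  have mom: "(\<integral>\<^sup>+\<omega>. \<integral>\<^sup>+x. ennreal (l_inc n k (\<omega>, x)) ^ Suc n \<partial>lborel \<partial>P) \<le>
    ennreal (fact (Suc n) * 2 * h * ((singular_const * (N / h) powr (H - 1)) ^ n * exp ((N / h) * h)))"
  proof -
    have "(\<integral>\<^sup>+\<omega>. \<integral>\<^sup>+x. ennreal (l_inc n k (\<omega>, x)) ^ Suc n \<partial>lborel \<partial>P) \<le>
    ennreal (fact (Suc n) * 2 * (real (Suc k) / 2 ^ n - real k / 2 ^ n) *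
      ((singular_const * (N / h) powr (H - 1)) ^ n * exp ((N / h) * (real (Suc k) / 2 ^ n - real k / 2 ^ n))))"
      unfolding l_inc_def prod.case
      using h N by (intro l_increment_moment) (auto intro!: divide_right_mono)
    then show ?thesis unfolding diff .
  qed
  have scale: "ennreal (x / (C * increment_scale n)) ^ Suc n = ennreal (1 / (C * increment_scale n) ^ Suc n) * ennreal x ^ Suc n" for x
  proof (cases "0 \<le> x")
    case True
    then show ?thesis
      using C pos by (simp add: ennreal_power ennreal_mult [symmetric] power_divide del: power_Suc)
  next
    case False
    then have "x / (C * increment_scale n) \<le> 0" using C pos by (intro divide_nonpos_pos) auto
    then show ?thesis using False by (simp add: ennreal_neg)
  qed
  have "(\<integral>\<^sup>+\<omega>. \<integral>\<^sup>+x. ennreal (l_inc n k (\<omega>, x) / (C * increment_scale n)) ^ Suc n \<partial>lborel \<partial>P) =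
      (\<integral>\<^sup>+\<omega>. ennreal (1 / (C * increment_scale n) ^ Suc n) * (\<integral>\<^sup>+x. ennreal (l_inc n k (\<omega>, x)) ^ Suc n \<partial>lborel) \<partial>P)"
    unfolding scale by (intro nn_integral_cong nn_integral_cmult) measurable
  also have "\<dots> = ennreal (1 / (C * increment_scale n) ^ Suc n) * (\<integral>\<^sup>+\<omega>. (\<integral>\<^sup>+x. ennreal (l_inc n k (\<omega>, x)) ^ Suc n \<partial>lborel) \<partial>P)"
    by (intro nn_integral_cmult) measurable
  also have "\<dots> \<le> ennreal (1 / (C * increment_scale n) ^ Suc n) *
     ennreal (fact (Suc n) * 2 * h * ((singular_const * (N / h) powr (H - 1)) ^ n * exp ((N / h) * h)))"
    by (intro mult_left_mono mom) simp
  also have "\<dots> = ennreal (1 / (C * increment_scale n) ^ Suc n *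
     (fact (Suc n) * 2 * h * ((singular_const * (N / h) powr (H - 1)) ^ n * exp ((N / h) * h))))"
    using C pos by (intro ennreal_mult' [symmetric]) simp
  also have "\<dots> \<le> ennreal (2 * real (Suc n) * (singular_const * exp 1 / C) ^ n / C)"
  proof (rule ennreal_leI)
    have e: "exp ((N / h) * h) = exp 1 ^ n" using h by (simp add: N_def exp_of_nat_mult [symmetric])
    have "h = 2 powr (- real n)"
      by (simp add: h_def powr_minus powr_realpow power_one_over inverse_eq_divide)
    moreover have "w = 2 powr (real n * (H - 1))" unfolding w_def by (simp add: powr_power)
    ultimately have hw: "h powr (1 - H) = w" by (simp add: powr_powr algebra_simps)
    have "(N / h) powr (H - 1) = 1 / (N / h) powr (1 - H)"
      using powr_minus_divide [of "N / h" "1 - H"] by simp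
    also have "(N / h) powr (1 - H) = N powr (1 - H) / w"
      using N h by (simp only: powr_divide hw)
    finally have Nh: "(N / h) powr (H - 1) = w / N powr (1 - H)" by simp
    have NN: "(N powr (1 - H)) ^ n * (N powr H) ^ n = N ^ n"
      using N by (simp add: power_mult_distrib [symmetric] powr_add [symmetric])
    have "1 / (C * increment_scale n) ^ Suc n *
       (fact (Suc n) * 2 * h * ((singular_const * (N / h) powr (H - 1)) ^ n * exp ((N / h) * h)))
      = (2 * fact (Suc n) / N ^ n) * (singular_const * exp 1 / C) ^ n / C * (h / w) * (1 / N powr H)"
      unfolding Nh e \<psi> NN [symmetric] using w C N
      by (simp add: power_mult_distrib power_divide field_simps)
    also have "\<dots> \<le> (2 * real (Suc n)) * (singular_const * exp 1 / C) ^ n / C * 1 * 1"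
    proof (intro mult_mono divide_right_mono)
      have "real (Suc n) * fact n \<le> real (Suc n) * N ^ n"
        using fact_le_power [of n, where 'a = real] by (intro mult_left_mono) (auto simp: N_def)
      then have "fact (Suc n) / N ^ n \<le> real (Suc n)" using N by (simp add: divide_le_eq del: of_nat_Suc)
      then have "2 * (fact (Suc n) / N ^ n) \<le> 2 * real (Suc n)" by (rule mult_left_mono) simp
      then show "2 * fact (Suc n) / N ^ n \<le> 2 * real (Suc n)" by (simp only: times_divide_eq_right)
      show "h / w \<le> 1" using w by simp
      show "1 / N powr H \<le> 1" using N H by (simp add: ge_one_powr_ge_zero)
    qed (use C w h N singular_const_pos in auto)
    finally show "1 / (C * increment_scale n) ^ Suc n *
       (fact (Suc n) * 2 * h * ((singular_const * (N / h) powr (H - 1)) ^ n * exp ((N / h) * h)))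
      \<le> 2 * real (Suc n) * (singular_const * exp 1 / C) ^ n / C" by simp
  qed
  finally show ?thesis .
qed

lemma l_support_AE:
  assumes \<omega>: "\<omega> \<in> G" and t: "0 \<le> t" "t \<le> real T" and p: "1 \<le> p"
  shows "AE x in lborel. path_sup_bound T p \<omega> < ennreal \<bar>x\<bar> \<longrightarrow> l x t \<omega> = 0"
proof -
  define A where "A = {x. path_sup_bound T p \<omega> < ennreal \<bar>x\<bar>}"
  have [measurable]: "A \<in> sets borel" unfolding A_def by measurable
  note [measurable] = l_borel [OF \<omega> t(1)]
  have "(\<integral>\<^sup>+x. indicator A x * ennreal (l x t \<omega>) \<partial>lborel) = (\<integral>\<^sup>+s. indicator A (path s \<omega>) * indicator {0..t} s \<partial>lborel)"
    by (rule occupation_path [OF \<omega> t(1), symmetric]) measurable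
  also have "\<dots> = (\<integral>\<^sup>+s. 0 \<partial>(lborel :: real measure))"
    using path_le_sup_bound [of _ T p \<omega>] t p
    by (intro nn_integral_cong) (auto simp: indicator_def A_def not_less)
  finally have "(\<integral>\<^sup>+x. indicator A x * ennreal (l x t \<omega>) \<partial>lborel) = 0" by simp
  then have "AE x in lborel. indicator A x * ennreal (l x t \<omega>) = 0"
    by (subst (asm) nn_integral_0_iff_AE) auto
  then show ?thesis
    by eventually_elim (use l_nonneg [OF \<omega> t(1)] in \<open>auto simp: A_def indicator_def ennreal_eq_0_iff intro: antisym split: if_splits\<close>)
qed

lemma local_time_envelope:
  fixes T :: nat
  assumes \<alpha>: "0 < \<alpha>" "\<alpha> < 2"
  obtains K :: "'w \<times> real \<Rightarrow> real" where "K \<in> borel_measurable (P \<Otimes>\<^sub>M lborel)" "\<And>e. 0 \<le> K e"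
    "(\<integral>\<^sup>+e. ennreal (K e powr \<alpha>) \<partial>(P \<Otimes>\<^sub>M lborel)) < \<infinity>"
    "0 < (\<integral>\<^sup>+e. ennreal (K e powr \<alpha>) \<partial>(P \<Otimes>\<^sub>M lborel))"
    "AE e in P \<Otimes>\<^sub>M lborel. \<forall>n\<ge>1. \<forall>k<T * 2 ^ n. 0 \<le> l_inc n k e \<and> l_inc n k e \<le> increment_scale n * K e"
proof -
  interpret PP: pair_sigma_finite P "lborel :: real measure" ..
  define p where "p = nat \<lceil>1 / H\<rceil> + 1"
  have p: "1 \<le> p" "1 \<le> H * real p"
  proof -
    have "1 / H \<le> real p" unfolding p_def by linarith
    then show "1 \<le> H * real p" using H by (simp add: divide_le_eq mult.commute)
  qed (simp add: p_def)
  define C where "C = 4 * (singular_const * exp 1)"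
  have C: "0 < C" using singular_const_pos by (simp add: C_def)
  have Cq: "singular_const * exp 1 / C = 1 / 4" using singular_const_pos by (simp add: C_def)
  define S where "S \<omega> = path_sup_bound T p \<omega>" for \<omega>
  have S [measurable]: "S \<in> borel_measurable P" unfolding S_def [abs_def] by measurable
  define Q1 where "Q1 = (\<lambda>(\<omega>, x). indicator {\<omega>x. ennreal \<bar>snd \<omega>x\<bar> \<le> S (fst \<omega>x) + 1} (\<omega>, x) :: ennreal)"
  define Q2 where "Q2 n e = (\<Sum>k<T * 2 ^ n. ennreal (l_inc n k e / (C * increment_scale n)) ^ Suc n)" for n e
  define Q where "Q e = Q1 e + (\<Sum>n. Q2 (Suc n) e)" for e
  have Q1m [measurable]: "Q1 \<in> borel_measurable (P \<Otimes>\<^sub>M lborel)"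
    unfolding Q1_def indicator_def [abs_def] of_bool_def by measurable
  have [measurable]: "Q2 n \<in> borel_measurable (P \<Otimes>\<^sub>M lborel)" for n
    unfolding Q2_def [abs_def] by measurable
  have [measurable]: "Q \<in> borel_measurable (P \<Otimes>\<^sub>M lborel)"
    unfolding Q_def [abs_def] by measurable
  have Q1_fin: "(\<integral>\<^sup>+e. Q1 e \<partial>(P \<Otimes>\<^sub>M lborel)) < \<infinity>"
  proof -
    have "(\<integral>\<^sup>+e. Q1 e \<partial>(P \<Otimes>\<^sub>M lborel)) = (\<integral>\<^sup>+\<omega>. \<integral>\<^sup>+x. Q1 (\<omega>, x) \<partial>lborel \<partial>P)"
      by (rule lborel.nn_integral_fst [symmetric]) measurable
    also have "\<dots> \<le> (\<integral>\<^sup>+\<omega>. 2 * (S \<omega> + 1) \<partial>P)"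
    proof (rule nn_integral_mono)
      fix \<omega>
      show "(\<integral>\<^sup>+x. Q1 (\<omega>, x) \<partial>lborel) \<le> 2 * (S \<omega> + 1)"
      proof (cases "S \<omega>")
        case (real r)
        have "(\<integral>\<^sup>+x. Q1 (\<omega>, x) \<partial>lborel) \<le> (\<integral>\<^sup>+x. indicator {- (r + 1)..r + 1} x \<partial>lborel)"
        proof (intro nn_integral_mono)
          fix x
          have "\<bar>x\<bar> \<le> r + 1" if "ennreal \<bar>x\<bar> \<le> S \<omega> + 1"
          proof -
            have "ennreal \<bar>x\<bar> \<le> ennreal (r + 1)" using that real by (simp add: ennreal_plus)
            then show ?thesis using real by (subst (asm) ennreal_le_iff) auto
          qed
          then show "Q1 (\<omega>, x) \<le> indicator {- (r + 1)..r + 1} x"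
            by (auto simp: Q1_def indicator_def abs_le_iff)
        qed
        also have "\<dots> = ennreal (2 * (r + 1))" using real by simp
        also have "\<dots> = 2 * (S \<omega> + 1)" using real by (simp add: ennreal_mult ennreal_plus)
        finally show ?thesis .
      next
        case top
        then show ?thesis by (simp add: ennreal_mult_top)
      qed
    qed
    also have "\<dots> = 2 * ((\<integral>\<^sup>+\<omega>. S \<omega> \<partial>P) + 1)"
      by (simp add: nn_integral_cmult nn_integral_add emeasure_space_1)
    also have "\<dots> < \<infinity>"
      using path_sup_bound_finite [OF p, of T] unfolding S_def by (simp add: ennreal_mult_less_top)
    finally show ?thesis .
  qed
  have Q2_le: "(\<integral>\<^sup>+e. Q2 n e \<partial>(P \<Otimes>\<^sub>M lborel)) \<le> ennreal (2 * real T / C * (real (Suc n) * (1/2) ^ n))" if n: "1 \<le> n" for n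
  proof -
    have "(\<integral>\<^sup>+e. Q2 n e \<partial>(P \<Otimes>\<^sub>M lborel)) =
        (\<Sum>k<T * 2 ^ n. \<integral>\<^sup>+e. ennreal (l_inc n k e / (C * increment_scale n)) ^ Suc n \<partial>(P \<Otimes>\<^sub>M lborel))"
      unfolding Q2_def by (intro nn_integral_sum) measurable
    also have "\<dots> \<le> (\<Sum>k<T * 2 ^ n. ennreal (2 * real (Suc n) * (singular_const * exp 1 / C) ^ n / C))"
    proof (rule sum_mono)
      fix k
      have "(\<integral>\<^sup>+e. ennreal (l_inc n k e / (C * increment_scale n)) ^ Suc n \<partial>(P \<Otimes>\<^sub>M lborel)) =
        (\<integral>\<^sup>+\<omega>. \<integral>\<^sup>+x. ennreal (l_inc n k (\<omega>, x) / (C * increment_scale n)) ^ Suc n \<partial>lborel \<partial>P)"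
        by (rule lborel.nn_integral_fst [symmetric]) measurable
      also have "\<dots> \<le> ennreal (2 * real (Suc n) * (singular_const * exp 1 / C) ^ n / C)"
        by (rule l_inc_scaled_moment [OF n C])
      finally show "(\<integral>\<^sup>+e. ennreal (l_inc n k e / (C * increment_scale n)) ^ Suc n \<partial>(P \<Otimes>\<^sub>M lborel)) \<le> \<dots>" .
    qed
    also have "\<dots> = ennreal (real (T * 2 ^ n) * (2 * real (Suc n) * (1 / 4) ^ n / C))"
      unfolding Cq sum_constant card_lessThan ennreal_of_nat_eq_real_of_nat
      using C by (intro ennreal_mult [symmetric]) auto
    also have "real (T * 2 ^ n) * (2 * real (Suc n) * (1 / 4) ^ n / C) = 2 * real T / C * (real (Suc n) * (1/2) ^ n)"
    proof -
      have "(1 / 2 :: real) ^ n = 2 ^ n * (1 / 4) ^ n" by (simp add: power_mult_distrib [symmetric])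
      then show ?thesis by (simp only: of_nat_mult of_nat_power of_nat_numeral times_divide_eq_left times_divide_eq_right mult_ac)
    qed
    finally show ?thesis .
  qed
  have Q2_fin: "(\<integral>\<^sup>+e. (\<Sum>n. Q2 (Suc n) e) \<partial>(P \<Otimes>\<^sub>M lborel)) < \<infinity>"
  proof -
    have "(\<lambda>n. real (Suc n) * (1/2) ^ n) sums (1 / (1 - 1/2)\<^sup>2 :: real)" by (rule geometric_deriv_sums) simp
    then have "summable (\<lambda>n. real (Suc n) * (1/2) ^ n :: real)" by (rule sums_summable)
    then have "summable (\<lambda>n. real (Suc (n + 1)) * (1/2) ^ (n + 1) :: real)" by (rule summable_ignore_initial_segment)
    then have s: "summable (\<lambda>n. 2 * real T / C * (real (Suc (Suc n)) * (1/2) ^ Suc n) :: real)"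
      by (intro summable_mult) (simp only: Suc_eq_plus1)
    have "(\<integral>\<^sup>+e. (\<Sum>n. Q2 (Suc n) e) \<partial>(P \<Otimes>\<^sub>M lborel)) = (\<Sum>n. \<integral>\<^sup>+e. Q2 (Suc n) e \<partial>(P \<Otimes>\<^sub>M lborel))"
      by (intro nn_integral_suminf) measurable
    also have "\<dots> \<le> (\<Sum>n. ennreal (2 * real T / C * (real (Suc (Suc n)) * (1/2) ^ Suc n)))"
      by (intro suminf_le summableI Q2_le) simp
    also have "\<dots> = ennreal (\<Sum>n. 2 * real T / C * (real (Suc (Suc n)) * (1/2) ^ Suc n))"
      using C by (intro suminf_ennreal2 s) simp
    also have "\<dots> < \<infinity>" by simp
    finally show ?thesis .
  qed
  have Q_fin: "(\<integral>\<^sup>+e. Q e \<partial>(P \<Otimes>\<^sub>M lborel)) < \<infinity>"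
    unfolding Q_def using Q1_fin Q2_fin by (subst nn_integral_add) auto
  then have Q_AE: "AE e in P \<Otimes>\<^sub>M lborel. Q e \<noteq> \<infinity>"
    by (intro nn_integral_PInf_AE) auto
  define K where "K e = C * enn2real (Q e) powr (1 / \<alpha>)" for e
  have K\<alpha>: "K e powr \<alpha> = C powr \<alpha> * enn2real (Q e)" for e
    using C \<alpha> by (simp add: K_def powr_mult powr_powr)
  have K_int: "(\<integral>\<^sup>+e. ennreal (K e powr \<alpha>) \<partial>(P \<Otimes>\<^sub>M lborel)) = ennreal (C powr \<alpha>) * (\<integral>\<^sup>+e. Q e \<partial>(P \<Otimes>\<^sub>M lborel))"
  proof -
    have "(\<integral>\<^sup>+e. ennreal (K e powr \<alpha>) \<partial>(P \<Otimes>\<^sub>M lborel)) = (\<integral>\<^sup>+e. ennreal (C powr \<alpha>) * Q e \<partial>(P \<Otimes>\<^sub>M lborel))"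
      using Q_AE
      by (intro nn_integral_cong_AE, eventually_elim) (simp add: K\<alpha> ennreal_mult less_top)
    then show ?thesis by (simp add: nn_integral_cmult)
  qed
  have Q_pos: "0 < (\<integral>\<^sup>+e. Q e \<partial>(P \<Otimes>\<^sub>M lborel))"
  proof -
    have "(0::ennreal) < 2" by simp
    also have "(2::ennreal) = (\<integral>\<^sup>+\<omega>. \<integral>\<^sup>+x. indicator {-1..1::real} x \<partial>lborel \<partial>P)"
      by (simp add: emeasure_space_1)
    also have "\<dots> \<le> (\<integral>\<^sup>+\<omega>. \<integral>\<^sup>+x. Q1 (\<omega>, x) \<partial>lborel \<partial>P)"
    proof (intro nn_integral_mono)
      fix \<omega> x
      have "ennreal \<bar>x\<bar> \<le> S \<omega> + 1" if "x \<in> {-1..1}"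
      proof -
        have "ennreal \<bar>x\<bar> \<le> ennreal 1" using that by (intro ennreal_leI) auto
        then show ?thesis by (simp add: add_increasing)
      qed
      then show "indicator {-1..1::real} x \<le> Q1 (\<omega>, x)" by (auto simp: Q1_def indicator_def)
    qed
    also have "\<dots> = (\<integral>\<^sup>+e. Q1 e \<partial>(P \<Otimes>\<^sub>M lborel))"
      by (rule lborel.nn_integral_fst) measurable
    also have "\<dots> \<le> (\<integral>\<^sup>+e. Q e \<partial>(P \<Otimes>\<^sub>M lborel))"
      unfolding Q_def by (intro nn_integral_mono) simp
    finally show ?thesis .
  qed
  have supp: "AE e in P \<Otimes>\<^sub>M lborel. \<forall>n k. k < T * 2 ^ n \<longrightarrow> 0 \<le> l_inc n k e \<and> (S (fst e) < ennreal \<bar>snd e\<bar> \<longrightarrow> l_inc n k e = 0)"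
  proof (rule PP.AE_pair_measure)
    show "{e \<in> space (P \<Otimes>\<^sub>M lborel). \<forall>n k. k < T * 2 ^ n \<longrightarrow> 0 \<le> l_inc n k e \<and> (S (fst e) < ennreal \<bar>snd e\<bar> \<longrightarrow> l_inc n k e = 0)}
        \<in> sets (P \<Otimes>\<^sub>M lborel)" by measurable
    show "AE \<omega> in P. AE x in lborel. \<forall>n k. k < T * 2 ^ n \<longrightarrow> 0 \<le> l_inc n k (\<omega>, x) \<and> (S (fst (\<omega>, x)) < ennreal \<bar>snd (\<omega>, x)\<bar> \<longrightarrow> l_inc n k (\<omega>, x) = 0)"
      using G_AE
    proof eventually_elim
      case (elim \<omega>)
      have "AE x in lborel. k < T * 2 ^ n \<longrightarrow> 0 \<le> l_inc n k (\<omega>, x) \<and> (S (fst (\<omega>, x)) < ennreal \<bar>snd (\<omega>, x)\<bar> \<longrightarrow> l_inc n k (\<omega>, x) = 0)" for n k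
      proof (cases "k < T * 2 ^ n")
        case True
        then have "real (Suc k) \<le> real (T * 2 ^ n)" by (subst of_nat_le_iff) simp
        then have kT: "real (Suc k) / 2 ^ n \<le> real T" by (simp add: divide_le_eq)
        have kk: "real k / 2 ^ n \<le> real (Suc k) / 2 ^ n" by (intro divide_right_mono) auto
        have "AE x in lborel. l x (real k / 2 ^ n) \<omega> \<le> l x (real (Suc k) / 2 ^ n) \<omega>"
          by (rule l_mono_AE [OF elim _ kk]) simp
        moreover have "AE x in lborel. path_sup_bound T p \<omega> < ennreal \<bar>x\<bar> \<longrightarrow> l x (real k / 2 ^ n) \<omega> = 0"
          using kk kT by (intro l_support_AE [OF elim] p) auto
        moreover have "AE x in lborel. path_sup_bound T p \<omega> < ennreal \<bar>x\<bar> \<longrightarrow> l x (real (Suc k) / 2 ^ n) \<omega> = 0"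
          using kT by (intro l_support_AE [OF elim] p) auto
        ultimately show ?thesis by eventually_elim (auto simp: l_inc_def S_def)
      qed simp
      then show ?case by (simp add: AE_all_countable)
    qed
  qed
  show ?thesis
  proof (rule that [of K])
    show "K \<in> borel_measurable (P \<Otimes>\<^sub>M lborel)" unfolding K_def [abs_def] by measurable
    show "0 \<le> K e" for e using C by (simp add: K_def)
    show "(\<integral>\<^sup>+e. ennreal (K e powr \<alpha>) \<partial>(P \<Otimes>\<^sub>M lborel)) < \<infinity>"
      using Q_fin by (simp add: K_int ennreal_mult_less_top)
    show "0 < (\<integral>\<^sup>+e. ennreal (K e powr \<alpha>) \<partial>(P \<Otimes>\<^sub>M lborel))"
      using Q_pos C by (simp add: K_int ennreal_zero_less_mult_iff)
    show "AE e in P \<Otimes>\<^sub>M lborel. \<forall>n\<ge>1. \<forall>k<T * 2 ^ n. 0 \<le> l_inc n k e \<and> l_inc n k e \<le> increment_scale n * K e"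
      using supp Q_AE
    proof eventually_elim
      case (elim e)
      show ?case
      proof (intro allI impI conjI)
        fix n k assume n: "1 \<le> n" and k: "k < T * 2 ^ n"
        show nn: "0 \<le> l_inc n k e" using elim(1) k by blast
        define y where "y = l_inc n k e / (C * increment_scale n)"
        have y0: "0 \<le> y" using nn C increment_scale_pos [OF n] by (simp add: y_def)
        have le: "ennreal (y powr \<alpha>) \<le> Q e"
        proof (cases "y \<le> 1")
          case True
          show ?thesis
          proof (cases "S (fst e) < ennreal \<bar>snd e\<bar>")
            case True
            then have "l_inc n k e = 0" using elim(1) k by blast
            then show ?thesis by (simp add: y_def)
          next
            case False
            then have "ennreal \<bar>snd e\<bar> \<le> S (fst e) + 1" by (simp add: not_less add_increasing2)
            then have "Q1 e = 1" by (auto simp: Q1_def indicator_def split: prod.splits)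
            moreover have "y powr \<alpha> \<le> 1" using True y0 \<alpha> by (simp add: powr_le1)
            ultimately have "ennreal (y powr \<alpha>) \<le> Q1 e" using ennreal_leI [of "y powr \<alpha>" 1] by simp
            then show ?thesis unfolding Q_def by (rule add_increasing2 [rotated]) simp
          qed
        next
          case False
          then have "y powr \<alpha> \<le> y powr real (Suc n)" using \<alpha> n by (intro powr_mono) auto
          also have "\<dots> = y ^ Suc n" using False by (simp only: powr_realpow)
          finally have "ennreal (y powr \<alpha>) \<le> ennreal (y ^ Suc n)" by (rule ennreal_leI)
          also have "\<dots> = ennreal y ^ Suc n" using y0 by (simp only: ennreal_power)
          also have "\<dots> \<le> Q2 n e"
            unfolding Q2_def y_def using k by (intro member_le_sum) auto
          also have "\<dots> \<le> (\<Sum>i. Q2 (Suc i) e)"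
            using sum_le_suminf [of "\<lambda>i. Q2 (Suc i) e" "{n - 1}"] n by simp
          also have "\<dots> \<le> Q e" unfolding Q_def by (rule add_increasing) simp_all
          finally show ?thesis .
        qed
        then have "enn2real (ennreal (y powr \<alpha>)) \<le> enn2real (Q e)"
          using elim(2) by (intro enn2real_mono) (auto simp: less_top)
        then have "y powr \<alpha> \<le> enn2real (Q e)" by simp
        then have "(y powr \<alpha>) powr (1 / \<alpha>) \<le> enn2real (Q e) powr (1 / \<alpha>)"
          using \<alpha> by (intro powr_mono2) auto
        then have "y \<le> enn2real (Q e) powr (1 / \<alpha>)" using y0 \<alpha> by (simp add: powr_powr)
        then have "(C * increment_scale n) * y \<le> (C * increment_scale n) * enn2real (Q e) powr (1 / \<alpha>)"
          using C increment_scale_pos [OF n] by (intro mult_left_mono) auto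
        then show "l_inc n k e \<le> increment_scale n * K e"
          using C increment_scale_pos [OF n] by (simp add: y_def K_def mult_ac)
      qed
    qed
  qed
qed

end

section \<open>Symmetric Pareto laws\<close>

definition stable_weight :: "real \<Rightarrow> real \<Rightarrow> real" where
  "stable_weight \<alpha> w = \<alpha> / 2 * \<bar>w\<bar> powr (- 1 - \<alpha>)"

definition stable_tail :: "real \<Rightarrow> (real \<Rightarrow> ennreal) \<Rightarrow> real \<Rightarrow> ennreal" where
  "stable_tail \<alpha> q a = (\<integral>\<^sup>+w. q w * ennreal (stable_weight \<alpha> w) * indicator {w. a \<le> \<bar>w\<bar>} w \<partial>lborel)"

definition sym_pareto :: "real \<Rightarrow> real measure" where
  "sym_pareto \<alpha> = density lborel (\<lambda>s. ennreal (stable_weight \<alpha> s) * indicator {s. 1 \<le> \<bar>s\<bar>} s)"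

lemma stable_weight_measurable [measurable]: "stable_weight \<alpha> \<in> borel_measurable borel"
  unfolding stable_weight_def [abs_def] by measurable

lemma sets_sym_pareto [simp, measurable_cong]: "sets (sym_pareto \<alpha>) = sets borel"
  by (simp add: sym_pareto_def)

lemma space_sym_pareto [simp]: "space (sym_pareto \<alpha>) = UNIV"
  by (simp add: sym_pareto_def)

lemma abs_le_sets [measurable]: "{w :: real. a \<le> \<bar>w\<bar>} \<in> sets borel"
  by measurable

lemma nn_integral_even:
  fixes f :: "real \<Rightarrow> ennreal"
  assumes [measurable]: "f \<in> borel_measurable borel" and even: "\<And>w. f (- w) = f w"
  shows "(\<integral>\<^sup>+w. f w \<partial>lborel) = 2 * (\<integral>\<^sup>+w. f w * indicator {0..} w \<partial>lborel)"
proof -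
  have "(\<integral>\<^sup>+w. f w \<partial>lborel) = (\<integral>\<^sup>+w. f w * indicator {0..} w + f w * indicator {..0} w \<partial>lborel)"
  proof (rule nn_integral_cong_AE)
    have "AE w in lborel. w \<noteq> (0::real)" by (rule AE_lborel_singleton)
    then show "AE w in lborel. f w = f w * indicator {0..} w + f w * indicator {..0} w"
      by eventually_elim (auto simp: indicator_def)
  qed
  also have "\<dots> = (\<integral>\<^sup>+w. f w * indicator {0..} w \<partial>lborel) + (\<integral>\<^sup>+w. f w * indicator {..0} w \<partial>lborel)"
    by (intro nn_integral_add) auto
  also have "(\<integral>\<^sup>+w. f w * indicator {..0} w \<partial>lborel) = ennreal \<bar>-1\<bar> * (\<integral>\<^sup>+w. f (0 + (-1) * w) * indicator {..0} (0 + (-1) * w) \<partial>lborel)"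
    by (rule nn_integral_real_affine) auto
  also have "\<dots> = (\<integral>\<^sup>+w. f w * indicator {0..} w \<partial>lborel)"
    by (auto simp: even indicator_def intro!: nn_integral_cong)
  finally show ?thesis by (simp add: mult_2)
qed

lemma nn_integral_sym_pareto:
  assumes [measurable]: "f \<in> borel_measurable borel"
  shows "(\<integral>\<^sup>+s. f s \<partial>sym_pareto \<alpha>) = (\<integral>\<^sup>+s. f s * ennreal (stable_weight \<alpha> s) * indicator {s. 1 \<le> \<bar>s\<bar>} s \<partial>lborel)"
  unfolding sym_pareto_def by (subst nn_integral_density) (auto simp: mult_ac)

lemma nn_integral_powr_tail:
  assumes "e < -1"
  shows "(\<integral>\<^sup>+y. ennreal (y powr e) * indicator {1..} y \<partial>lborel) = ennreal (- 1 / (e + 1))"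
  using has_integral_powr_to_inf [of e 1] assms
  by (subst nn_integral_has_integral_lebesgue') auto

lemma prob_space_sym_pareto:
  assumes "0 < \<alpha>"
  shows "prob_space (sym_pareto \<alpha>)"
proof
  have "emeasure (sym_pareto \<alpha>) (space (sym_pareto \<alpha>)) = (\<integral>\<^sup>+s. 1 \<partial>sym_pareto \<alpha>)" by simp
  also have "\<dots> = (\<integral>\<^sup>+s. ennreal (stable_weight \<alpha> s) * indicator {s. 1 \<le> \<bar>s\<bar>} s \<partial>lborel)"
    by (subst nn_integral_sym_pareto) auto
  also have "\<dots> = 2 * (\<integral>\<^sup>+s. ennreal (stable_weight \<alpha> s) * indicator {s. 1 \<le> \<bar>s\<bar>} s * indicator {0..} s \<partial>lborel)"
    by (rule nn_integral_even) (auto simp: stable_weight_def indicator_def)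
  also have "(\<integral>\<^sup>+s. ennreal (stable_weight \<alpha> s) * indicator {s. 1 \<le> \<bar>s\<bar>} s * indicator {0..} s \<partial>lborel) =
      (\<integral>\<^sup>+s. ennreal (\<alpha> / 2) * (ennreal (s powr (- 1 - \<alpha>)) * indicator {1..} s) \<partial>lborel)"
    using assms by (intro nn_integral_cong) (auto simp: stable_weight_def indicator_def ennreal_mult' [symmetric])
  also have "\<dots> = ennreal (\<alpha> / 2) * ennreal (1 / \<alpha>)"
    using assms by (subst nn_integral_cmult) (auto simp: nn_integral_powr_tail)
  also have "2 * (ennreal (\<alpha> / 2) * ennreal (1 / \<alpha>)) = 1"
  proof -
    have "ennreal (\<alpha> / 2) * ennreal (1 / \<alpha>) = ennreal (1 / 2)"
      using assms by (simp add: ennreal_mult' [symmetric] del: ennreal_divide_numeral)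
    then have "2 * (ennreal (\<alpha> / 2) * ennreal (1 / \<alpha>)) = ennreal 2 * ennreal (1 / 2)" by simp
    also have "\<dots> = ennreal (2 * (1 / 2))" by (rule ennreal_mult [symmetric]) auto
    finally show ?thesis by simp
  qed
  finally show "emeasure (sym_pareto \<alpha>) (space (sym_pareto \<alpha>)) = 1" .
qed

lemma nn_integral_sym_pareto_scale:
  assumes [measurable]: "q \<in> borel_measurable borel" and c: "c \<noteq> 0"
  shows "(\<integral>\<^sup>+s. q (c * s) \<partial>sym_pareto \<alpha>) = ennreal (\<bar>c\<bar> powr \<alpha>) * stable_tail \<alpha> q \<bar>c\<bar>"
proof -
  have w: "ennreal (stable_weight \<alpha> (c * s)) = ennreal (\<bar>c\<bar> powr (- 1 - \<alpha>)) * ennreal (stable_weight \<alpha> s)" for s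
    by (subst ennreal_mult' [symmetric]) (auto simp: stable_weight_def abs_mult powr_mult mult_ac)
  have "stable_tail \<alpha> q \<bar>c\<bar> = ennreal \<bar>c\<bar> * (\<integral>\<^sup>+s. q (0 + c * s) * ennreal (stable_weight \<alpha> (0 + c * s)) * indicator {w. \<bar>c\<bar> \<le> \<bar>w\<bar>} (0 + c * s) \<partial>lborel)"
    unfolding stable_tail_def by (rule nn_integral_real_affine) (use c in auto)
  also have "\<dots> = ennreal \<bar>c\<bar> * (\<integral>\<^sup>+s. ennreal (\<bar>c\<bar> powr (- 1 - \<alpha>)) * (q (c * s) * ennreal (stable_weight \<alpha> s) * indicator {w. 1 \<le> \<bar>w\<bar>} s) \<partial>lborel)"
    unfolding add_0_left w using c by (intro arg_cong [where f = "\<lambda>x. ennreal \<bar>c\<bar> * x"] nn_integral_cong)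
      (auto simp: indicator_def abs_mult mult_ac mult_le_cancel_left1)
  also have "\<dots> = ennreal \<bar>c\<bar> * (ennreal (\<bar>c\<bar> powr (- 1 - \<alpha>)) * (\<integral>\<^sup>+s. q (c * s) \<partial>sym_pareto \<alpha>))"
    by (subst nn_integral_cmult) (auto simp: nn_integral_sym_pareto)
  finally have "ennreal (\<bar>c\<bar> powr \<alpha>) * stable_tail \<alpha> q \<bar>c\<bar> =
      (ennreal (\<bar>c\<bar> powr \<alpha>) * ennreal \<bar>c\<bar> * ennreal (\<bar>c\<bar> powr (- 1 - \<alpha>))) * (\<integral>\<^sup>+s. q (c * s) \<partial>sym_pareto \<alpha>)"
    by (simp add: mult_ac)
  also have "ennreal (\<bar>c\<bar> powr \<alpha>) * ennreal \<bar>c\<bar> * ennreal (\<bar>c\<bar> powr (- 1 - \<alpha>)) = 1"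
  proof -
    have "\<bar>c\<bar> powr \<alpha> * \<bar>c\<bar> * \<bar>c\<bar> powr (- 1 - \<alpha>) = \<bar>c\<bar> powr \<alpha> * \<bar>c\<bar> powr 1 * \<bar>c\<bar> powr (- 1 - \<alpha>)"
      by simp
    also have "\<dots> = 1" using c by (simp only: powr_add [symmetric]) simp
    finally show ?thesis by (simp add: ennreal_mult' [symmetric])
  qed
  finally show ?thesis by simp
qed

lemma stable_tail_mono: "0 \<le> a \<Longrightarrow> stable_tail \<alpha> q a \<le> stable_tail \<alpha> q 0"
  unfolding stable_tail_def by (intro nn_integral_mono) (auto simp: indicator_def)

lemma stable_tail_tendsto:
  assumes [measurable]: "q \<in> borel_measurable borel" and fin: "stable_tail \<alpha> q 0 < \<infinity>"
    and a: "a \<longlonglongrightarrow> 0"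
  shows "(\<lambda>n. stable_tail \<alpha> q (a n)) \<longlonglongrightarrow> stable_tail \<alpha> q 0"
  unfolding stable_tail_def
proof (rule nn_integral_dominated_convergence [where w = "\<lambda>w. q w * ennreal (stable_weight \<alpha> w)"])
  show "(\<integral>\<^sup>+w. q w * ennreal (stable_weight \<alpha> w) \<partial>lborel) < \<infinity>"
    using fin by (simp add: stable_tail_def)
  have "AE w in lborel. w \<noteq> (0::real)" by (rule AE_lborel_singleton)
  then show "AE w in lborel. (\<lambda>n. q w * ennreal (stable_weight \<alpha> w) * indicator {w. a n \<le> \<bar>w\<bar>} w)
      \<longlonglongrightarrow> q w * ennreal (stable_weight \<alpha> w) * indicator {w. 0 \<le> \<bar>w\<bar>} w"
  proof eventually_elim
    case (elim w)
    then have "eventually (\<lambda>n. a n < \<bar>w\<bar>) sequentially"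
      using order_tendstoD(2) [OF a, of "\<bar>w\<bar>"] by simp
    then have "eventually (\<lambda>n. q w * ennreal (stable_weight \<alpha> w) * indicator {w. a n \<le> \<bar>w\<bar>} w =
        q w * ennreal (stable_weight \<alpha> w) * indicator {w. 0 \<le> \<bar>w\<bar>} w) sequentially"
      by eventually_elim (auto simp: indicator_def)
    then show ?case by (rule tendsto_eventually)
  qed
qed (auto simp: indicator_def)

lemma stable_tail_min_finite:
  assumes \<alpha>: "0 < \<alpha>" "\<alpha> < 2"
  shows "stable_tail \<alpha> (\<lambda>w. ennreal (min 1 (w\<^sup>2))) 0 < \<infinity>"
proof -
  have "stable_tail \<alpha> (\<lambda>w. ennreal (min 1 (w\<^sup>2))) 0 = (\<integral>\<^sup>+w. ennreal (min 1 (w\<^sup>2)) * ennreal (stable_weight \<alpha> w) \<partial>lborel)"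
    by (simp add: stable_tail_def)
  also have "\<dots> = 2 * (\<integral>\<^sup>+w. ennreal (min 1 (w\<^sup>2)) * ennreal (stable_weight \<alpha> w) * indicator {0..} w \<partial>lborel)"
    by (rule nn_integral_even) (auto simp: stable_weight_def)
  also have "\<dots> \<le> 2 * (\<integral>\<^sup>+w. ennreal (\<alpha> / 2) * (ennreal (w powr (1 - \<alpha>)) * indicator {0..1} w + ennreal (w powr (- 1 - \<alpha>)) * indicator {1..} w) \<partial>lborel)"
  proof (intro mult_left_mono nn_integral_mono)
    fix w :: real
    consider "w < 0" | "w = 0" | "0 < w" "w \<le> 1" | "1 < w" by linarith
    then show "ennreal (min 1 (w\<^sup>2)) * ennreal (stable_weight \<alpha> w) * indicator {0..} w \<le>
      ennreal (\<alpha> / 2) * (ennreal (w powr (1 - \<alpha>)) * indicator {0..1} w + ennreal (w powr (- 1 - \<alpha>)) * indicator {1..} w)"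
    proof cases
      case 3
      have "w\<^sup>2 * w powr (- 1 - \<alpha>) = w powr 2 * w powr (- 1 - \<alpha>)" using 3 by (simp add: powr_numeral)
      also have "\<dots> = w powr (1 - \<alpha>)" by (simp add: powr_add [symmetric])
      finally have eqm: "min 1 (w\<^sup>2) * stable_weight \<alpha> w = \<alpha> / 2 * w powr (1 - \<alpha>)"
        using 3 min_absorb2 [OF power_le_one [of w 2]] by (simp add: stable_weight_def mult.left_commute)
      have "ennreal (min 1 (w\<^sup>2)) * ennreal (stable_weight \<alpha> w) = ennreal (min 1 (w\<^sup>2) * stable_weight \<alpha> w)"
        by (rule ennreal_mult' [symmetric]) simp
      also have "\<dots> = ennreal (\<alpha> / 2 * w powr (1 - \<alpha>))" by (simp only: eqm)
      also have "\<dots> = ennreal (\<alpha> / 2) * ennreal (w powr (1 - \<alpha>))"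
        using \<alpha> by (intro ennreal_mult') auto
      finally have "ennreal (min 1 (w\<^sup>2)) * ennreal (stable_weight \<alpha> w) = ennreal (\<alpha> / 2) * ennreal (w powr (1 - \<alpha>))" .
      then show ?thesis using 3 by (simp add: distrib_left)
    next
      case 4
      then have "min 1 (w\<^sup>2) = 1" by (simp add: min_def)
      then show ?thesis using 4 \<alpha> by (simp add: stable_weight_def ennreal_mult' [symmetric])
    qed auto
  qed simp
  also have "(\<integral>\<^sup>+w. ennreal (\<alpha> / 2) * (ennreal (w powr (1 - \<alpha>)) * indicator {0..1} w + ennreal (w powr (- 1 - \<alpha>)) * indicator {1..} w) \<partial>lborel)
    = ennreal (\<alpha> / 2) * (ennreal (1 / (2 - \<alpha>)) + ennreal (1 / \<alpha>))"
    using \<alpha> nn_integral_powr_near_0 [of "1 - \<alpha>" 1]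
    by (subst nn_integral_cmult, simp, subst nn_integral_add) (auto simp: nn_integral_powr_tail)
  also have "2 * (ennreal (\<alpha> / 2) * (ennreal (1 / (2 - \<alpha>)) + ennreal (1 / \<alpha>))) < \<infinity>"
    by (simp add: ennreal_mult_less_top)
  finally show ?thesis .
qed

lemma one_minus_cos_le: "1 - cos w \<le> 2 * min 1 ((w::real)\<^sup>2)"
proof -
  have "1 - cos w = 2 * (sin (w / 2))\<^sup>2" using cos_double_sin [of "w / 2"] by simp
  moreover have "(sin (w / 2))\<^sup>2 \<le> (w / 2)\<^sup>2"
    using abs_sin_x_le_abs_x [of "w / 2"] by (simp add: abs_le_square_iff [symmetric])
  moreover have "(w / 2)\<^sup>2 \<le> w\<^sup>2" by (simp add: power_divide)
  moreover have "1 - cos w \<le> 2" using cos_ge_minus_one [of w] by linarith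
  ultimately show ?thesis by (auto simp: min_def)
qed

lemma stable_tail_cos:
  assumes \<alpha>: "0 < \<alpha>" "\<alpha> < 2"
  shows "stable_tail \<alpha> (\<lambda>w. ennreal (1 - cos w)) 0 < \<infinity>" "0 < stable_tail \<alpha> (\<lambda>w. ennreal (1 - cos w)) 0"
proof -
  have "stable_tail \<alpha> (\<lambda>w. ennreal (1 - cos w)) 0 \<le> (\<integral>\<^sup>+w. 2 * (ennreal (min 1 (w\<^sup>2)) * ennreal (stable_weight \<alpha> w) * indicator {w. 0 \<le> \<bar>w\<bar>} w) \<partial>lborel)"
    unfolding stable_tail_def
  proof (intro nn_integral_mono)
    fix w :: real
    have "ennreal (1 - cos w) \<le> ennreal (2 * min 1 (w\<^sup>2))" by (intro ennreal_leI one_minus_cos_le)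
    also have "\<dots> = 2 * ennreal (min 1 (w\<^sup>2))" by (simp add: ennreal_mult)
    finally have "ennreal (1 - cos w) * (ennreal (stable_weight \<alpha> w) * indicator {w. 0 \<le> \<bar>w\<bar>} w) \<le> 2 * ennreal (min 1 (w\<^sup>2)) * (ennreal (stable_weight \<alpha> w) * indicator {w. 0 \<le> \<bar>w\<bar>} w)"
      by (rule mult_right_mono) simp
    then show "ennreal (1 - cos w) * ennreal (stable_weight \<alpha> w) * indicator {w. 0 \<le> \<bar>w\<bar>} w \<le> 2 * (ennreal (min 1 (w\<^sup>2)) * ennreal (stable_weight \<alpha> w) * indicator {w. 0 \<le> \<bar>w\<bar>} w)"
      by (simp only: mult.assoc)
  qed
  also have "\<dots> = 2 * stable_tail \<alpha> (\<lambda>w. ennreal (min 1 (w\<^sup>2))) 0"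
    unfolding stable_tail_def by (intro nn_integral_cmult) measurable
  also have "\<dots> < \<infinity>" using stable_tail_min_finite [OF \<alpha>] by (simp add: ennreal_mult_less_top)
  finally show "stable_tail \<alpha> (\<lambda>w. ennreal (1 - cos w)) 0 < \<infinity>" .
  show "0 < stable_tail \<alpha> (\<lambda>w. ennreal (1 - cos w)) 0"
  proof (rule ccontr)
    assume "\<not> ?thesis"
    then have "AE w in lborel. ennreal (1 - cos w) * ennreal (stable_weight \<alpha> w) * indicator {w. 0 \<le> \<bar>w\<bar>} w = 0"
      unfolding stable_tail_def by (subst nn_integral_0_iff_AE [symmetric]) auto
    then have "AE w in lborel. w \<notin> {1..2::real}"
    proof eventually_elim
      case (elim w)
      show ?case
      proof
        assume w: "w \<in> {1..2}"
        have "cos w < cos 0" using w pi_gt3 by (intro cos_monotone_0_pi) auto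
        moreover have "0 < stable_weight \<alpha> w" using w \<alpha> by (simp add: stable_weight_def)
        ultimately show False using elim by (simp add: ennreal_mult' [symmetric] ennreal_eq_0_iff mult_le_0_iff)
      qed
    qed
    then have "emeasure lborel {1..2::real} = 0"
      by (subst (asm) AE_iff_measurable [where N = "{1..2}"]) auto
    then show False by simp
  qed
qed

section \<open>Convergence of smoothed box probabilities\<close>

lemma (in prob_space) fourier_product_step:
  fixes \<phi> :: "'z \<Rightarrow> complex" and \<tau> :: "'z \<Rightarrow> real" and h :: "real \<Rightarrow> real" and Y :: "'i \<Rightarrow> 'a \<Rightarrow> real"
    and \<theta> s :: "'i \<Rightarrow> real"
  assumes \<rho>: "prob_space \<rho>" and \<phi>\<tau>: "\<phi> \<in> borel_measurable \<rho>" "\<tau> \<in> borel_measurable \<rho>"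
    and \<phi>: "\<And>z. norm (\<phi> z) \<le> 1"
    and h: "\<And>x. complex_of_real (h x) = (CLINT z|\<rho>. \<phi> z * iexp (\<tau> z * x))"
    and h01: "\<And>x. 0 \<le> h x" "\<And>x. h x \<le> 1" and hm [measurable]: "h \<in> borel_measurable borel"
    and J: "finite J" and A: "finite A" "A \<subseteq> J" and k: "k \<in> J" "k \<notin> A"
    and Y: "\<And>i. i \<in> J \<Longrightarrow> Y i \<in> borel_measurable M"
  defines "\<theta>' \<equiv> \<lambda>z. \<theta>(k := \<theta> k + \<tau> z * s k)"
  shows "(CLINT \<omega>|M. (\<Prod>i\<in>insert k A. of_real (h (s i * Y i \<omega>))) * iexp (\<Sum>i\<in>J. \<theta> i * Y i \<omega>)) =
        (CLINT z|\<rho>. \<phi> z * (CLINT \<omega>|M. (\<Prod>i\<in>A. of_real (h (s i * Y i \<omega>))) * iexp (\<Sum>i\<in>J. \<theta>' z i * Y i \<omega>)))"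
    and "(\<lambda>z. \<phi> z * (CLINT \<omega>|M. (\<Prod>i\<in>A. of_real (h (s i * Y i \<omega>))) * iexp (\<Sum>i\<in>J. \<theta>' z i * Y i \<omega>))) \<in> borel_measurable \<rho>"
    and "norm (CLINT \<omega>|M. (\<Prod>i\<in>A. of_real (h (s i * Y i \<omega>))) * iexp (\<Sum>i\<in>J. \<theta>' z i * Y i \<omega>)) \<le> 1"
proof -
  interpret R: prob_space \<rho> by fact
  interpret RM: pair_prob_space \<rho> M ..
  have bound: "norm ((\<Prod>i\<in>A. complex_of_real (h (x i))) * iexp v) \<le> 1" for x :: "'i \<Rightarrow> real" and v
    by (auto simp: norm_mult prod_norm [symmetric] h01 intro!: prod_le_1)
  show "(CLINT \<omega>|M. (\<Prod>i\<in>insert k A. of_real (h (s i * Y i \<omega>))) * iexp (\<Sum>i\<in>J. \<theta> i * Y i \<omega>)) =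
        (CLINT z|\<rho>. \<phi> z * (CLINT \<omega>|M. (\<Prod>i\<in>A. of_real (h (s i * Y i \<omega>))) * iexp (\<Sum>i\<in>J. \<theta>' z i * Y i \<omega>)))"
  proof -
      have [measurable]: "(\<lambda>\<omega>. (\<Prod>i\<in>A. complex_of_real (h (s i * Y i \<omega>))) * iexp (\<Sum>i\<in>J. \<theta> i * Y i \<omega>)) \<in> borel_measurable M"
      proof (intro borel_measurable_times borel_measurable_prod)
        fix i assume "i \<in> A"
        then have [measurable]: "Y i \<in> borel_measurable M" using A(2) Y by auto
        show "(\<lambda>\<omega>. complex_of_real (h (s i * Y i \<omega>))) \<in> borel_measurable M" by measurable
      next
        have [measurable]: "(\<lambda>\<omega>. \<Sum>i\<in>J. \<theta> i * Y i \<omega>) \<in> borel_measurable M"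
          using Y by (intro borel_measurable_sum borel_measurable_times) auto
        show "(\<lambda>\<omega>. iexp (\<Sum>i\<in>J. \<theta> i * Y i \<omega>)) \<in> borel_measurable M" by measurable
      qed
      have [measurable]: "(\<lambda>\<omega>. s k * Y k \<omega>) \<in> borel_measurable M" using Y [OF k(1)] by measurable
      have "(CLINT \<omega>|M. (\<Prod>i\<in>insert k A. of_real (h (s i * Y i \<omega>))) * iexp (\<Sum>i\<in>J. \<theta> i * Y i \<omega>)) =
        (CLINT \<omega>|M. ((\<Prod>i\<in>A. of_real (h (s i * Y i \<omega>))) * iexp (\<Sum>i\<in>J. \<theta> i * Y i \<omega>)) * of_real (h (s k * Y k \<omega>)))"
        using k A by (simp add: mult_ac)
      also have "\<dots> = (CLINT z|\<rho>. \<phi> z * (CLINT \<omega>|M. ((\<Prod>i\<in>A. of_real (h (s i * Y i \<omega>))) * iexp (\<Sum>i\<in>J. \<theta> i * Y i \<omega>)) * iexp (\<tau> z * (s k * Y k \<omega>))))"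
        by (rule fourier_expectation [OF \<rho> \<phi>\<tau> \<phi> h]) (measurable, rule bound)
      also have "\<dots> = (CLINT z|\<rho>. \<phi> z * (CLINT \<omega>|M. (\<Prod>i\<in>A. of_real (h (s i * Y i \<omega>))) * iexp (\<Sum>i\<in>J. \<theta>' z i * Y i \<omega>)))"
      proof -
        have "(\<Sum>i\<in>J. \<theta>' z i * Y i \<omega>) = (\<Sum>i\<in>J. \<theta> i * Y i \<omega>) + \<tau> z * (s k * Y k \<omega>)" for z \<omega>
          using J k by (simp add: \<theta>'_def sum.remove [of J k] algebra_simps)
        then show ?thesis by (simp add: exp_add [symmetric] mult.assoc distrib_left)
      qed
      finally show ?thesis .
  qed
  show "(\<lambda>z. \<phi> z * (CLINT \<omega>|M. (\<Prod>i\<in>A. of_real (h (s i * Y i \<omega>))) * iexp (\<Sum>i\<in>J. \<theta>' z i * Y i \<omega>))) \<in> borel_measurable \<rho>"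
  proof -
        have "(\<lambda>z. \<theta>' z i) \<in> borel_measurable \<rho>" for i using \<phi>\<tau> by (auto simp: \<theta>'_def)
        then have [measurable]: "(\<lambda>(z, \<omega>). \<Sum>i\<in>J. \<theta>' z i * Y i \<omega>) \<in> borel_measurable (\<rho> \<Otimes>\<^sub>M M)"
          unfolding case_prod_beta'
          by (intro borel_measurable_sum borel_measurable_times measurable_compose [OF measurable_fst] measurable_compose [OF measurable_snd Y]) auto
        have [measurable]: "(\<lambda>\<omega>. \<Prod>i\<in>A. complex_of_real (h (s i * Y i \<omega>))) \<in> borel_measurable M"
        proof (intro borel_measurable_prod)
          fix i assume "i \<in> A"
          then have [measurable]: "Y i \<in> borel_measurable M" using A(2) Y by auto
          show "(\<lambda>\<omega>. complex_of_real (h (s i * Y i \<omega>))) \<in> borel_measurable M" by measurable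
        qed
        have "(\<lambda>z. CLINT \<omega>|M. (\<Prod>i\<in>A. of_real (h (s i * Y i \<omega>))) * iexp (\<Sum>i\<in>J. \<theta>' z i * Y i \<omega>)) \<in> borel_measurable \<rho>"
          by measurable
        then show ?thesis using \<phi>\<tau> by measurable
  qed
  have "norm (CLINT \<omega>|M. (\<Prod>i\<in>A. of_real (h (s i * Y i \<omega>))) * iexp (\<Sum>i\<in>J. \<theta>' z i * Y i \<omega>)) \<le>
      (\<integral>\<omega>. norm ((\<Prod>i\<in>A. complex_of_real (h (s i * Y i \<omega>))) * iexp (\<Sum>i\<in>J. \<theta>' z i * Y i \<omega>)) \<partial>M)"
    by (rule integral_norm_bound)
  also have "\<dots> \<le> (\<integral>\<omega>. 1 \<partial>M)"
    by (intro integral_mono' bound) auto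
  finally show "norm (CLINT \<omega>|M. (\<Prod>i\<in>A. of_real (h (s i * Y i \<omega>))) * iexp (\<Sum>i\<in>J. \<theta>' z i * Y i \<omega>)) \<le> 1"
    by (simp add: prob_space)
qed

lemma fourier_product_tendsto:
  fixes N :: "'b measure" and Nn :: "nat \<Rightarrow> 'c measure" and X :: "'i \<Rightarrow> 'b \<Rightarrow> real"
    and Xn :: "nat \<Rightarrow> 'i \<Rightarrow> 'c \<Rightarrow> real" and \<phi> :: "'z \<Rightarrow> complex" and \<tau> :: "'z \<Rightarrow> real" and h :: "real \<Rightarrow> real"
  assumes N: "prob_space N" and Nn: "\<And>n. prob_space (Nn n)" and J: "finite J"
    and X: "\<And>i. i \<in> J \<Longrightarrow> X i \<in> borel_measurable N"
    and Xn: "\<And>n i. i \<in> J \<Longrightarrow> Xn n i \<in> borel_measurable (Nn n)"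
    and conv: "\<And>\<theta>. (\<lambda>n. CLINT \<omega>|Nn n. iexp (\<Sum>i\<in>J. \<theta> i * Xn n i \<omega>)) \<longlonglongrightarrow> (CLINT \<omega>|N. iexp (\<Sum>i\<in>J. \<theta> i * X i \<omega>))"
    and \<rho>: "prob_space \<rho>" and \<phi>\<tau>: "\<phi> \<in> borel_measurable \<rho>" "\<tau> \<in> borel_measurable \<rho>"
    and \<phi>: "\<And>z. norm (\<phi> z) \<le> 1"
    and h: "\<And>x. complex_of_real (h x) = (CLINT z|\<rho>. \<phi> z * iexp (\<tau> z * x))"
    and h01: "\<And>x. 0 \<le> h x" "\<And>x. h x \<le> 1" and hm [measurable]: "h \<in> borel_measurable borel"
    and "A \<subseteq> J"
  shows "(\<lambda>n. CLINT \<omega>|Nn n. (\<Prod>i\<in>A. of_real (h (s i * Xn n i \<omega>))) * iexp (\<Sum>i\<in>J. \<theta> i * Xn n i \<omega>)) \<longlonglongrightarrow>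
    (CLINT \<omega>|N. (\<Prod>i\<in>A. of_real (h (s i * X i \<omega>))) * iexp (\<Sum>i\<in>J. \<theta> i * X i \<omega>))"
proof -
  have "finite A" using \<open>A \<subseteq> J\<close> J by (rule finite_subset)
  then show ?thesis using \<open>A \<subseteq> J\<close>
  proof (induction A arbitrary: \<theta> rule: finite_induct)
    case empty
    then show ?case using conv by simp
  next
    case (insert k A)
    have k: "k \<in> J" and A: "A \<subseteq> J" using insert.prems by auto
    define \<theta>' where "\<theta>' z = \<theta>(k := \<theta> k + \<tau> z * s k)" for z
    interpret R: prob_space \<rho> by fact
    note stepN = prob_space.fourier_product_step [where Y = X and M = N and \<theta> = \<theta> and s = s and h = h and \<phi> = \<phi> and \<tau> = \<tau>,
      OF N \<rho> \<phi>\<tau> \<phi> h h01 hm J insert.hyps(1) A k insert.hyps(2) X, folded \<theta>'_def]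
    note stepn = prob_space.fourier_product_step [where Y = "Xn n" and M = "Nn n" and \<theta> = \<theta> and s = s and h = h and \<phi> = \<phi> and \<tau> = \<tau> for n,
      OF Nn \<rho> \<phi>\<tau> \<phi> h h01 hm J insert.hyps(1) A k insert.hyps(2) Xn, folded \<theta>'_def]
    show ?case
    proof (simp only: stepN(1) stepn(1), rule integral_dominated_convergence [where w = "\<lambda>_. 1"])
      show "AE z in \<rho>. (\<lambda>n. \<phi> z * (CLINT \<omega>|Nn n. (\<Prod>i\<in>A. of_real (h (s i * Xn n i \<omega>))) * iexp (\<Sum>i\<in>J. \<theta>' z i * Xn n i \<omega>)))
          \<longlonglongrightarrow> \<phi> z * (CLINT \<omega>|N. (\<Prod>i\<in>A. of_real (h (s i * X i \<omega>))) * iexp (\<Sum>i\<in>J. \<theta>' z i * X i \<omega>))"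
        by (intro AE_I2 tendsto_mult tendsto_const insert.IH A)
      show "AE z in \<rho>. norm (\<phi> z * (CLINT \<omega>|Nn n. (\<Prod>i\<in>A. of_real (h (s i * Xn n i \<omega>))) * iexp (\<Sum>i\<in>J. \<theta>' z i * Xn n i \<omega>))) \<le> 1" for n
        unfolding norm_mult by (intro AE_I2 mult_le_one \<phi> stepn(3)) auto
    qed (use stepN(2) stepn(2) in auto)
  qed
qed

definition soft_interval :: "real \<Rightarrow> real \<Rightarrow> real" where
  "soft_interval \<sigma> x = measure std_normal_distribution {t. \<bar>x + \<sigma> * t\<bar> \<le> 1}"

definition soft_weight :: "real \<Rightarrow> real \<Rightarrow> real" where
  "soft_weight \<sigma> x = (\<integral>y. gauss_bump \<sigma> (x - y) \<partial>uniform_measure lborel {-1..1})"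

lemma prob_space_uniform_unit: "prob_space (uniform_measure lborel {-1..1::real})"
  by (rule prob_space_uniform_measure) auto

lemma soft_weight_eq:
  assumes \<sigma>: "0 < \<sigma>"
  shows "soft_weight \<sigma> x = \<sigma> * sqrt (2 * pi) / 2 * soft_interval \<sigma> x"
proof -
  have "soft_weight \<sigma> x = (\<integral>y. gauss_bump \<sigma> (x - y) * indicator {-1..1} y \<partial>lborel) / 2"
  proof -
    have "soft_weight \<sigma> x = (\<integral>y. gauss_bump \<sigma> (x - y) \<partial>density lborel (\<lambda>y. ennreal (indicator {-1..1} y / 2)))"
      unfolding soft_weight_def uniform_measure_def
      by (intro arg_cong [where f = "\<lambda>M. integral\<^sup>L M (\<lambda>y. gauss_bump \<sigma> (x - y))"] density_cong)
        (auto simp: indicator_def divide_ennreal [symmetric])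
    also have "\<dots> = (\<integral>y. (indicator {-1..1} y / 2) *\<^sub>R gauss_bump \<sigma> (x - y) \<partial>lborel)"
      by (intro integral_density) auto
    also have "\<dots> = (\<integral>y. (gauss_bump \<sigma> (x - y) * indicator {-1..1} y) / 2 \<partial>lborel)"
      by (intro Bochner_Integration.integral_cong) auto
    finally show ?thesis by simp
  qed
  also have "(\<integral>y. gauss_bump \<sigma> (x - y) * indicator {-1..1} y \<partial>lborel) =
      \<bar>\<sigma>\<bar> *\<^sub>R (\<integral>t. gauss_bump \<sigma> (x - (x + \<sigma> * t)) * indicator {-1..1} (x + \<sigma> * t) \<partial>lborel)"
    using \<sigma> by (intro lborel_integral_real_affine) simp
  also have "\<dots> = \<sigma> * (\<integral>t. sqrt (2 * pi) * (std_normal_density t * indicator {t. \<bar>x + \<sigma> * t\<bar> \<le> 1} t) \<partial>lborel)"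
    using \<sigma> by (auto simp: gauss_bump_def std_normal_density_def indicator_def abs_le_iff
      intro!: Bochner_Integration.integral_cong)
  also have "\<dots> = \<sigma> * sqrt (2 * pi) * (\<integral>t. std_normal_density t * indicator {t. \<bar>x + \<sigma> * t\<bar> \<le> 1} t \<partial>lborel)"
    by simp
  also have "(\<integral>t. std_normal_density t * indicator {t. \<bar>x + \<sigma> * t\<bar> \<le> 1} t \<partial>lborel) =
      (\<integral>t. indicator {t. \<bar>x + \<sigma> * t\<bar> \<le> 1} t \<partial>std_normal_distribution)"
    by (subst integral_density) (auto simp: normal_density_nonneg)
  also have "\<dots> = soft_interval \<sigma> x" by (simp add: soft_interval_def)
  finally show ?thesis by simp
qed

lemma soft_weight_measurable [measurable]: "soft_weight \<sigma> \<in> borel_measurable borel"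
proof -
  interpret prob_space "uniform_measure lborel {-1..1::real}" by (rule prob_space_uniform_unit)
  show ?thesis unfolding soft_weight_def [abs_def] by measurable
qed

lemma soft_weight_bounds: "0 \<le> soft_weight \<sigma> x" "soft_weight \<sigma> x \<le> 1"
proof -
  interpret prob_space "uniform_measure lborel {-1..1::real}" by (rule prob_space_uniform_unit)
  show "0 \<le> soft_weight \<sigma> x"
    unfolding soft_weight_def by (intro integral_nonneg_AE) (auto simp: gauss_bump_bounds)
  have "soft_weight \<sigma> x \<le> (\<integral>y. 1 \<partial>uniform_measure lborel {-1..1::real})"
    unfolding soft_weight_def by (intro integral_mono') (auto simp: gauss_bump_bounds)
  then show "soft_weight \<sigma> x \<le> 1" by (simp add: prob_space)
qed

lemma soft_weight_fourier:
  "complex_of_real (soft_weight \<sigma> x) =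
    (CLINT z|uniform_measure lborel {-1..1::real} \<Otimes>\<^sub>M std_normal_distribution. iexp (- (snd z / \<sigma>) * fst z) * iexp ((snd z / \<sigma>) * x))"
proof -
  interpret U: prob_space "uniform_measure lborel {-1..1::real}" by (rule prob_space_uniform_unit)
  interpret S: prob_space std_normal_distribution by (rule prob_space_std_normal)
  interpret US: pair_prob_space "uniform_measure lborel {-1..1::real}" std_normal_distribution ..
  have [measurable_cong]: "sets (uniform_measure lborel {-1..1::real}) = sets borel" by simp
  have e: "iexp (- (snd z / \<sigma>) * fst z) * iexp ((snd z / \<sigma>) * x) = iexp (snd z * ((x - fst z) / \<sigma>))" for z
  proof -
    have "snd z * ((x - fst z) / \<sigma>) = - (snd z / \<sigma>) * fst z + (snd z / \<sigma>) * x"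
      by (simp add: diff_divide_distrib algebra_simps)
    then show ?thesis by (simp only: of_real_add distrib_left exp_add)
  qed
  have "complex_of_real (soft_weight \<sigma> x) = (CLINT y|uniform_measure lborel {-1..1::real}. of_real (gauss_bump \<sigma> (x - y)))"
    unfolding soft_weight_def by simp
  also have "\<dots> = (CLINT y|uniform_measure lborel {-1..1::real}. CLINT t|std_normal_distribution. iexp (t * ((x - y) / \<sigma>)))"
    by (simp only: gauss_bump_fourier)
  also have "\<dots> = (CLINT z|uniform_measure lborel {-1..1::real} \<Otimes>\<^sub>M std_normal_distribution. iexp (snd z * ((x - fst z) / \<sigma>)))"
    by (subst US.integral_fst' [symmetric]) (auto intro!: US.P.integrable_const_bound [where B=1])
  finally show ?thesis unfolding e .
qed

lemma soft_interval_bounds: "0 \<le> soft_interval \<sigma> x" "soft_interval \<sigma> x \<le> 1"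
  using prob_space.prob_le_1 [OF prob_space_std_normal] by (auto simp: soft_interval_def)

lemma soft_interval_core:
  assumes "\<bar>x\<bar> \<le> 1 / 2"
  shows "measure std_normal_distribution {t. \<bar>\<sigma> * t\<bar> \<le> 1 / 2} \<le> soft_interval \<sigma> x"
proof -
  interpret S: prob_space std_normal_distribution by (rule prob_space_std_normal)
  have "{t. \<bar>x + \<sigma> * t\<bar> \<le> 1} \<in> sets std_normal_distribution" by simp
  then show ?thesis
    unfolding soft_interval_def using assms by (intro S.finite_measure_mono) auto
qed

lemma soft_limits:
  assumes \<sigma>: "\<sigma> \<longlonglongrightarrow> 0"
  shows "(\<lambda>k. measure std_normal_distribution {t. \<bar>\<sigma> k * t\<bar> \<le> 1 / 2}) \<longlonglongrightarrow> 1"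
    and "1 < \<bar>x\<bar> \<Longrightarrow> (\<lambda>k. soft_interval (\<sigma> k) x) \<longlonglongrightarrow> 0"
proof -
  interpret S: prob_space std_normal_distribution by (rule prob_space_std_normal)
  have lim: "(\<lambda>k. measure std_normal_distribution {t. \<bar>x + \<sigma> k * t\<bar> \<le> c}) \<longlonglongrightarrow> (if \<bar>x\<bar> < c then 1 else 0)"
    if "\<bar>x\<bar> \<noteq> c" for x c
  proof -
    have "(\<lambda>k. \<integral>t. indicator {t. \<bar>x + \<sigma> k * t\<bar> \<le> c} t \<partial>std_normal_distribution) \<longlonglongrightarrow> (\<integral>t. (if \<bar>x\<bar> < c then 1 else 0 :: real) \<partial>std_normal_distribution)"
    proof (rule integral_dominated_convergence [where w = "\<lambda>_. 1"])
      show "AE t in std_normal_distribution. (\<lambda>k. indicator {t. \<bar>x + \<sigma> k * t\<bar> \<le> c} t :: real) \<longlonglongrightarrow> (if \<bar>x\<bar> < c then 1 else 0)"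
      proof (intro AE_I2 tendsto_eventually)
        fix t
        have l: "(\<lambda>k. \<bar>x + \<sigma> k * t\<bar>) \<longlonglongrightarrow> \<bar>x + 0 * t\<bar>"
          by (intro tendsto_intros \<sigma>)
        show "eventually (\<lambda>k. indicator {t. \<bar>x + \<sigma> k * t\<bar> \<le> c} t = (if \<bar>x\<bar> < c then 1 else 0 :: real)) sequentially"
        proof (cases "\<bar>x\<bar> < c")
          case True
          then have "eventually (\<lambda>k. \<bar>x + \<sigma> k * t\<bar> < c) sequentially" using order_tendstoD(2) [OF l] by simp
          then show ?thesis by eventually_elim (use True in \<open>auto simp: indicator_def\<close>)
        next
          case False
          then have "eventually (\<lambda>k. c < \<bar>x + \<sigma> k * t\<bar>) sequentially" using order_tendstoD(1) [OF l] that by simp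
          then show ?thesis by eventually_elim (use False in \<open>auto simp: indicator_def\<close>)
        qed
      qed
    qed (auto simp: indicator_def)
    then show ?thesis by (simp add: S.prob_space [simplified])
  qed
  show "(\<lambda>k. measure std_normal_distribution {t. \<bar>\<sigma> k * t\<bar> \<le> 1 / 2}) \<longlonglongrightarrow> 1"
    using lim [of 0 "1/2"] by simp
  show "(\<lambda>k. soft_interval (\<sigma> k) x) \<longlonglongrightarrow> 0" if "1 < \<bar>x\<bar>"
    using lim [of x 1] that by (simp add: soft_interval_def)
qed

section \<open>Domain of attraction of a stable vector\<close>

lemma cosh_le_exp_half_square: "cosh x \<le> exp (x\<^sup>2 / 2)" for x :: real
proof -
  have tanh: "tanh y \<le> y" if "0 \<le> y" for y :: real
  proof -
    have "0 - tanh 0 \<le> y - tanh y"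
    proof (rule DERIV_nonneg_imp_nondecreasing [OF that])
      fix z :: real
      have "((\<lambda>y. y - tanh y) has_real_derivative (tanh z)\<^sup>2) (at z)"
        by (auto intro!: derivative_eq_intros)
      then show "\<exists>d. ((\<lambda>y. y - tanh y) has_real_derivative d) (at z) \<and> 0 \<le> d" by auto
    qed
    then show ?thesis by simp
  qed
  have pos: "cosh y \<le> exp (y\<^sup>2 / 2)" if "0 \<le> y" for y :: real
  proof -
    have "0\<^sup>2 / 2 - ln (cosh 0) \<le> y\<^sup>2 / 2 - ln (cosh y)"
    proof (rule DERIV_nonneg_imp_nondecreasing [OF that])
      fix z :: real assume z: "0 \<le> z"
      have "((\<lambda>y. y\<^sup>2 / 2 - ln (cosh y)) has_real_derivative (z - tanh z)) (at z)"
        by (auto intro!: derivative_eq_intros simp: tanh_def)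
      then show "\<exists>d. ((\<lambda>y. y\<^sup>2 / 2 - ln (cosh y)) has_real_derivative d) (at z) \<and> 0 \<le> d"
        using tanh [OF z] by auto
    qed
    then have "ln (cosh y) \<le> y\<^sup>2 / 2" by simp
    then show ?thesis by (metis cosh_real_pos exp_le_cancel_iff exp_ln)
  qed
  show ?thesis using pos [of x] pos [of "- x"] by (cases "0 \<le> x") auto
qed

lemma nn_integral_sym_pareto_minus:
  assumes [measurable]: "f \<in> borel_measurable borel"
  shows "(\<integral>\<^sup>+s. f (- s) \<partial>sym_pareto \<alpha>) = (\<integral>\<^sup>+s. f s \<partial>sym_pareto \<alpha>)"
proof -
  have "(\<integral>\<^sup>+s. f s \<partial>sym_pareto \<alpha>) =
     ennreal \<bar>-1\<bar> * (\<integral>\<^sup>+s. f (0 + (-1) * s) * ennreal (stable_weight \<alpha> (0 + (-1) * s)) * indicator {s. 1 \<le> \<bar>s\<bar>} (0 + (-1) * s) \<partial>lborel)"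
    unfolding nn_integral_sym_pareto [OF assms] by (rule nn_integral_real_affine) auto
  also have "\<dots> = (\<integral>\<^sup>+s. f (- s) \<partial>sym_pareto \<alpha>)"
    by (subst nn_integral_sym_pareto) (auto simp: stable_weight_def indicator_def intro!: nn_integral_cong)
  finally show ?thesis by simp
qed

lemma sym_pareto_subgaussian:
  assumes \<alpha>: "0 < \<alpha>" and r: "\<bar>r\<bar> \<le> \<psi>"
  shows "(\<integral>\<^sup>+s. ennreal (exp (v * s * r - (v * \<psi> * s)\<^sup>2 / 2)) \<partial>sym_pareto \<alpha>) \<le> 1"
proof -
  interpret prob_space "sym_pareto \<alpha>" by (rule prob_space_sym_pareto [OF \<alpha>])
  define f where "f s = exp (v * s * r - (v * \<psi> * s)\<^sup>2 / 2)" for s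
  have [measurable]: "f \<in> borel_measurable borel" unfolding f_def [abs_def] by measurable
  have "f s + f (- s) \<le> 2" for s
  proof -
    have "f s + f (- s) = 2 * cosh (v * s * r) * exp (- (v * \<psi> * s)\<^sup>2 / 2)"
    proof -
      have "f s = exp (v * s * r) * exp (- (v * \<psi> * s)\<^sup>2 / 2)" "f (- s) = exp (- (v * s * r)) * exp (- (v * \<psi> * s)\<^sup>2 / 2)"
        by (simp_all add: f_def exp_add [symmetric] power_mult_distrib)
      then show ?thesis by (simp only: cosh_field_def) (simp add: distrib_right)
    qed
    also have "\<dots> \<le> 2 * exp ((v * s * r)\<^sup>2 / 2) * exp (- (v * \<psi> * s)\<^sup>2 / 2)"
      using cosh_le_exp_half_square by (intro mult_mono) auto
    also have "\<dots> = 2 * exp ((v * s * r)\<^sup>2 / 2 - (v * \<psi> * s)\<^sup>2 / 2)" by (simp add: exp_add [symmetric])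
    also have "\<dots> \<le> 2 * exp 0"
    proof -
      have "\<bar>r\<bar> \<le> \<bar>\<psi>\<bar>" using r by linarith
      then have "\<bar>v * s\<bar> * \<bar>r\<bar> \<le> \<bar>v * s\<bar> * \<bar>\<psi>\<bar>" by (intro mult_left_mono) auto
      then have "\<bar>v * s * r\<bar> \<le> \<bar>v * \<psi> * s\<bar>" by (simp only: abs_mult mult_ac)
      then have "(v * s * r)\<^sup>2 \<le> (v * \<psi> * s)\<^sup>2" by (simp add: abs_le_square_iff)
      then show ?thesis by (intro mult_left_mono) auto
    qed
    finally show ?thesis by simp
  qed
  then have le: "(\<integral>\<^sup>+s. ennreal (f s) + ennreal (f (- s)) \<partial>sym_pareto \<alpha>) \<le> (\<integral>\<^sup>+s. 2 \<partial>sym_pareto \<alpha>)"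
    by (intro nn_integral_mono) (simp add: f_def ennreal_plus [symmetric] ennreal_leI del: ennreal_plus flip: ennreal_numeral)
  have "(\<integral>\<^sup>+s. ennreal (f s) + ennreal (f (- s)) \<partial>sym_pareto \<alpha>) = (\<integral>\<^sup>+s. ennreal (f s) \<partial>sym_pareto \<alpha>) + (\<integral>\<^sup>+s. ennreal (f (- s)) \<partial>sym_pareto \<alpha>)"
    by (intro nn_integral_add) measurable
  also have "\<dots> = 2 * (\<integral>\<^sup>+s. ennreal (f s) \<partial>sym_pareto \<alpha>)"
    using nn_integral_sym_pareto_minus [of "\<lambda>s. ennreal (f s)" \<alpha>] by (simp add: mult_2)
  finally have "2 * (\<integral>\<^sup>+s. ennreal (f s) \<partial>sym_pareto \<alpha>) \<le> 2 * 1"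
    using le emeasure_space_1 by simp
  then show ?thesis unfolding f_def by (subst (asm) ennreal_mult_le_mult_iff) auto
qed

lemma sym_pareto_char:
  assumes \<alpha>: "0 < \<alpha>" "\<alpha> < 2"
  shows "(CLINT s|sym_pareto \<alpha>. iexp (u * s)) = of_real (1 - \<bar>u\<bar> powr \<alpha> * enn2real (stable_tail \<alpha> (\<lambda>w. ennreal (1 - cos w)) \<bar>u\<bar>))"
proof -
  interpret prob_space "sym_pareto \<alpha>" by (rule prob_space_sym_pareto [OF \<alpha>(1)])
  have i: "integrable (sym_pareto \<alpha>) (\<lambda>s. cos (u * s))" "integrable (sym_pareto \<alpha>) (\<lambda>s. sin (u * s))"
    by (auto intro!: integrable_const_bound [where B = 1])
  have w0: "0 \<le> stable_weight \<alpha> s" for s using \<alpha> by (simp add: stable_weight_def)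
  have dens: "sym_pareto \<alpha> = density lborel (\<lambda>s. ennreal (stable_weight \<alpha> s * indicator {s. 1 \<le> \<bar>s\<bar>} s))"
    unfolding sym_pareto_def by (intro density_cong) (auto simp: indicator_def)
  define I where "I = (\<integral>s. sin (u * s) \<partial>sym_pareto \<alpha>)"
  have I: "I = (\<integral>s. (stable_weight \<alpha> s * indicator {s. 1 \<le> \<bar>s\<bar>} s) * sin (u * s) \<partial>lborel)"
    unfolding I_def dens by (subst integral_density) (auto simp: w0)
  also have "\<dots> = \<bar>-1\<bar> *\<^sub>R (\<integral>s. (stable_weight \<alpha> (0 + (-1) * s) * indicator {s. 1 \<le> \<bar>s\<bar>} (0 + (-1) * s)) * sin (u * (0 + (-1) * s)) \<partial>lborel)"
    by (rule lborel_integral_real_affine) simp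
  also have "\<dots> = (\<integral>s. - ((stable_weight \<alpha> s * indicator {s. 1 \<le> \<bar>s\<bar>} s) * sin (u * s)) \<partial>lborel)"
    by (simp add: stable_weight_def indicator_def)
  also have "\<dots> = - I" unfolding I by simp
  finally have sin0: "(\<integral>s. sin (u * s) \<partial>sym_pareto \<alpha>) = 0" by (simp add: I_def)
  have cos: "(\<integral>s. 1 - cos (u * s) \<partial>sym_pareto \<alpha>) = \<bar>u\<bar> powr \<alpha> * enn2real (stable_tail \<alpha> (\<lambda>w. ennreal (1 - cos w)) \<bar>u\<bar>)"
  proof (cases "u = 0")
    case False
    have "(\<integral>s. 1 - cos (u * s) \<partial>sym_pareto \<alpha>) = enn2real (\<integral>\<^sup>+s. ennreal (1 - cos (u * s)) \<partial>sym_pareto \<alpha>)"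
      by (rule integral_eq_nn_integral) auto
    also have "(\<integral>\<^sup>+s. ennreal (1 - cos (u * s)) \<partial>sym_pareto \<alpha>) = ennreal (\<bar>u\<bar> powr \<alpha>) * stable_tail \<alpha> (\<lambda>w. ennreal (1 - cos w)) \<bar>u\<bar>"
      using nn_integral_sym_pareto_scale [of "\<lambda>w. ennreal (1 - cos w)" u \<alpha>] False by simp
    finally show ?thesis by (simp add: enn2real_mult)
  qed simp
  have "(CLINT s|sym_pareto \<alpha>. iexp (u * s)) = (CLINT s|sym_pareto \<alpha>. of_real (cos (u * s)) + \<i> * of_real (sin (u * s)))"
    by (simp only: cis_conv_exp [symmetric] cis.ctr Complex_eq)
  also have "\<dots> = of_real (\<integral>s. cos (u * s) \<partial>sym_pareto \<alpha>) + \<i> * of_real (\<integral>s. sin (u * s) \<partial>sym_pareto \<alpha>)"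
    using i by simp
  also have "(\<integral>s. cos (u * s) \<partial>sym_pareto \<alpha>) = 1 - (\<integral>s. 1 - cos (u * s) \<partial>sym_pareto \<alpha>)"
    using i by (simp add: prob_space [simplified])
  finally show ?thesis by (simp add: sin0 cos)
qed

lemma tendsto_one_minus_over_power:
  fixes z :: "nat \<Rightarrow> real"
  assumes z: "z \<longlonglongrightarrow> l"
  shows "(\<lambda>n. (1 - z n / real (Suc n)) ^ Suc n) \<longlonglongrightarrow> exp (- l)"
proof -
  have lim: "(\<lambda>n. (1 + (- l) / real (Suc n)) ^ Suc n) \<longlonglongrightarrow> exp (- l)"
    by (rule LIMSEQ_Suc [OF tendsto_exp_limit_sequentially])
  have over: "(\<lambda>n. y n / real (Suc n)) \<longlonglongrightarrow> 0" if "y \<longlonglongrightarrow> y0" for y :: "nat \<Rightarrow> real" and y0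
    using tendsto_mult [OF that LIMSEQ_inverse_real_of_nat] by (simp add: divide_inverse)
  have "(\<lambda>n. exp (real (Suc n) * ln (1 - z n / real (Suc n)))) \<longlonglongrightarrow> exp (- l)"
  proof (rule tendsto_exp)
    have up: "eventually (\<lambda>n. real (Suc n) * ln (1 - z n / real (Suc n)) \<le> - z n) sequentially"
      using order_tendstoD(2) [OF over [OF z] zero_less_one]
    proof eventually_elim
      case (elim n)
      then have "ln (1 - z n / real (Suc n)) \<le> - z n / real (Suc n)"
        using ln_le_minus_one [of "1 - z n / real (Suc n)"] by simp
      then have "real (Suc n) * ln (1 - z n / real (Suc n)) \<le> real (Suc n) * (- z n / real (Suc n))"
        by (rule mult_left_mono) simp
      then show ?case by simp
    qed
    have low: "eventually (\<lambda>n. - z n / (1 - z n / real (Suc n)) \<le> real (Suc n) * ln (1 - z n / real (Suc n))) sequentially"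
      using order_tendstoD(2) [OF over [OF z] zero_less_one]
    proof eventually_elim
      case (elim n)
      define x where "x = 1 - z n / real (Suc n)"
      have x: "0 < x" using elim by (simp add: x_def)
      have "ln (1 / x) \<le> 1 / x - 1" using x by (intro ln_le_minus_one) simp
      then have "1 - 1 / x \<le> ln x" using x by (simp add: ln_div)
      then have "real (Suc n) * (1 - 1 / x) \<le> real (Suc n) * ln x" by (rule mult_left_mono) simp
      moreover have "real (Suc n) * (1 - 1 / x) = - z n / x"
      proof -
        have "1 - 1 / x = (x - 1) / x" using x by (simp add: diff_divide_distrib)
        also have "x - 1 = - (z n / real (Suc n))" by (simp add: x_def)
        finally show ?thesis by simp
      qed
      ultimately have "- z n / x \<le> real (Suc n) * ln x" by (simp only:)
      then show ?case by (simp only: x_def)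
    qed
    have l1: "(\<lambda>n. - z n / (1 - z n / real (Suc n))) \<longlonglongrightarrow> - l / (1 - 0)"
      by (intro tendsto_divide tendsto_minus tendsto_diff tendsto_const z over [OF z]) simp
    show "(\<lambda>n. real (Suc n) * ln (1 - z n / real (Suc n))) \<longlonglongrightarrow> - l"
      using l1 by (intro tendsto_sandwich [OF low up _ tendsto_minus [OF z]]) simp
  qed
  moreover have "eventually (\<lambda>n. exp (real (Suc n) * ln (1 - z n / real (Suc n))) = (1 - z n / real (Suc n)) ^ Suc n) sequentially"
    using order_tendstoD(2) [OF over [OF z] zero_less_one]
    by eventually_elim (simp add: exp_of_nat_mult del: power_Suc of_nat_Suc)
  ultimately show ?thesis by (rule Lim_transform_eventually)
qed

locale stable_sample =
  fixes \<alpha> \<kappa> :: real and m :: "'e measure" and K :: "'e \<Rightarrow> real" and J :: "'i set" and a :: "'i \<Rightarrow> 'e \<Rightarrow> real" and \<psi> :: "'i \<Rightarrow> real"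
  assumes \<alpha>: "0 < \<alpha>" "\<alpha> < 2" and \<kappa>: "0 < \<kappa>" "(\<integral>\<^sup>+e. ennreal (K e powr \<alpha>) \<partial>m) = ennreal \<kappa>"
    and K [measurable]: "K \<in> borel_measurable m" and K0: "\<And>e. 0 \<le> K e"
    and J: "finite J" and a: "\<And>i. i \<in> J \<Longrightarrow> a i \<in> borel_measurable m" and \<psi>: "\<And>i. i \<in> J \<Longrightarrow> 0 < \<psi> i"
    and a_le: "AE e in m. \<forall>i\<in>J. \<bar>a i e\<bar> \<le> \<psi> i * K e"
begin

definition cos_tail :: "real \<Rightarrow> real" where
  "cos_tail u = enn2real (stable_tail \<alpha> (\<lambda>w. ennreal (1 - cos w)) u)"

definition mark_law :: "'e measure" where
  "mark_law = density m (\<lambda>e. ennreal (K e powr \<alpha> / \<kappa>))"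

text \<open>
  The truncation changes \<open>a i / K\<close> on a null set only.
\<close>

definition ratio :: "'i \<Rightarrow> 'e \<Rightarrow> real" where
  "ratio i e = max (- \<psi> i) (min (\<psi> i) (a i e / K e))"

definition scale :: "nat \<Rightarrow> real" where
  "scale n = (\<kappa> / cos_tail 0 / real n) powr (1 / \<alpha>)"

definition sample :: "nat \<Rightarrow> (nat \<Rightarrow> 'e \<times> real) measure" where
  "sample n = PiM {..<n} (\<lambda>_. mark_law \<Otimes>\<^sub>M sym_pareto \<alpha>)"

text \<open>
  A normalised sum of \<open>n\<close> independent symmetric Pareto vectors, which lies in the domain of
  attraction of the stable vector with kernels \<open>a i\<close>.
\<close>

definition approx :: "nat \<Rightarrow> 'i \<Rightarrow> (nat \<Rightarrow> 'e \<times> real) \<Rightarrow> real" where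
  "approx n i \<zeta> = (\<Sum>j<n. scale n * snd (\<zeta> j) * ratio i (fst (\<zeta> j)))"

lemma cos_tail_pos: "0 < cos_tail 0"
  using stable_tail_cos [OF \<alpha>] by (simp add: cos_tail_def enn2real_positive_iff)

lemma cos_tail_bounds: "0 \<le> cos_tail u" "0 \<le> u \<Longrightarrow> cos_tail u \<le> cos_tail 0"
  using stable_tail_cos [OF \<alpha>] stable_tail_mono [of u \<alpha>] by (auto simp: cos_tail_def intro!: enn2real_mono)

lemma cos_tail_tendsto:
  assumes "u \<longlonglongrightarrow> 0"
  shows "(\<lambda>n. cos_tail (u n)) \<longlonglongrightarrow> cos_tail 0"
  unfolding cos_tail_def
  using stable_tail_tendsto [OF _ stable_tail_cos(1) [OF \<alpha>] assms] stable_tail_cos(1) [OF \<alpha>]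
  by (intro tendsto_enn2real) (auto simp: less_top)

lemma sets_mark_law [measurable_cong]: "sets mark_law = sets m"
  by (simp add: mark_law_def)

lemma scale_pos: "1 \<le> n \<Longrightarrow> 0 < scale n"
  using \<kappa> cos_tail_pos by (simp add: scale_def)

lemma scale_powr: "1 \<le> n \<Longrightarrow> scale n powr \<alpha> = \<kappa> / cos_tail 0 / real n"
  using \<kappa> cos_tail_pos \<alpha> by (simp add: scale_def powr_powr)

lemma prob_space_mark_law: "prob_space mark_law"
proof
  have "emeasure mark_law (space mark_law) = (\<integral>\<^sup>+e. ennreal (K e powr \<alpha> / \<kappa>) \<partial>m)"
    unfolding mark_law_def by (subst emeasure_density) (auto intro!: nn_integral_cong)
  also have "\<dots> = (\<integral>\<^sup>+e. ennreal (1 / \<kappa>) * ennreal (K e powr \<alpha>) \<partial>m)"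
    using \<kappa> by (intro nn_integral_cong) (simp add: ennreal_mult' [symmetric])
  also have "\<dots> = ennreal (1 / \<kappa>) * ennreal \<kappa>" by (subst nn_integral_cmult) (auto simp: \<kappa>)
  also have "\<dots> = 1" using \<kappa> by (simp add: ennreal_mult' [symmetric])
  finally show "emeasure mark_law (space mark_law) = 1" .
qed

lemma ratio_measurable [measurable]: "i \<in> J \<Longrightarrow> ratio i \<in> borel_measurable m"
  unfolding ratio_def [abs_def] using a by measurable

lemma ratio_bound: "i \<in> J \<Longrightarrow> \<bar>ratio i e\<bar> \<le> \<psi> i"
  using \<psi> [of i] by (auto simp: ratio_def)

lemma ratio_eq: "AE e in m. \<forall>i\<in>J. a i e = K e * ratio i e"
  using a_le
proof eventually_elim
  case (elim e)
  show ?case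
  proof
    fix i assume i: "i \<in> J"
    show "a i e = K e * ratio i e"
    proof (cases "K e = 0")
      case True
      then show ?thesis using elim i by auto
    next
      case False
      then have "0 < K e" using K0 [of e] by simp
      then have "\<bar>a i e / K e\<bar> \<le> \<psi> i" using elim i by (simp add: divide_le_eq)
      then have "a i e / K e \<le> \<psi> i" "- \<psi> i \<le> a i e / K e" unfolding abs_le_iff by linarith+
      then have "ratio i e = a i e / K e" unfolding ratio_def by (simp only: min_absorb2 max_absorb2)
      then show ?thesis using False by simp
    qed
  qed
qed

lemma prob_space_one_sample: "prob_space (mark_law \<Otimes>\<^sub>M sym_pareto \<alpha>)"
  using prob_space_pair [OF prob_space_mark_law prob_space_sym_pareto [OF \<alpha>(1)]] .

lemma prob_space_sample: "prob_space (sample n)"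
  unfolding sample_def by (intro prob_space_PiM prob_space_one_sample)

lemma approx_measurable [measurable]: "i \<in> J \<Longrightarrow> approx n i \<in> borel_measurable (sample n)"
  unfolding approx_def [abs_def] sample_def by measurable

lemma sample_char:
  assumes n: "1 \<le> n"
  shows "(CLINT \<zeta>|sample n. iexp (\<Sum>i\<in>J. \<theta> i * approx n i \<zeta>)) = of_real ((1 -
    (\<integral>e. \<kappa> / cos_tail 0 * \<bar>\<Sum>i\<in>J. \<theta> i * ratio i e\<bar> powr \<alpha> * cos_tail (scale n * \<bar>\<Sum>i\<in>J. \<theta> i * ratio i e\<bar>) \<partial>mark_law) / real n) ^ n)"
proof -
  interpret M: prob_space mark_law by (rule prob_space_mark_law)
  interpret S: prob_space "sym_pareto \<alpha>" by (rule prob_space_sym_pareto [OF \<alpha>(1)])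
  interpret MS: pair_prob_space mark_law "sym_pareto \<alpha>" ..
  interpret PS: product_prob_space "\<lambda>_. mark_law \<Otimes>\<^sub>M sym_pareto \<alpha>" "{..<n}" ..
  define R where "R e = (\<Sum>i\<in>J. \<theta> i * ratio i e)" for e
  have [measurable]: "R \<in> borel_measurable m" unfolding R_def [abs_def] by measurable
  have one: "(CLINT q|mark_law \<Otimes>\<^sub>M sym_pareto \<alpha>. iexp (scale n * snd q * R (fst q))) =
      of_real (1 - (\<integral>e. \<kappa> / cos_tail 0 * \<bar>R e\<bar> powr \<alpha> * cos_tail (scale n * \<bar>R e\<bar>) \<partial>mark_law) / real n)"
  proof -
    have "(CLINT q|mark_law \<Otimes>\<^sub>M sym_pareto \<alpha>. iexp (scale n * snd q * R (fst q))) =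
      (CLINT e|mark_law. CLINT s|sym_pareto \<alpha>. iexp (scale n * s * R e))"
      by (subst MS.integral_fst' [symmetric]) (auto intro!: MS.P.integrable_const_bound [where B=1])
    also have "\<dots> = (CLINT e|mark_law. of_real (1 - \<bar>scale n * R e\<bar> powr \<alpha> * cos_tail \<bar>scale n * R e\<bar>))"
      unfolding cos_tail_def sym_pareto_char [OF \<alpha>, symmetric] by (simp only: mult_ac)
    also have "\<dots> = of_real (\<integral>e. 1 - \<bar>scale n * R e\<bar> powr \<alpha> * cos_tail \<bar>scale n * R e\<bar> \<partial>mark_law)"
      by (rule integral_complex_of_real)
    also have "(\<integral>e. 1 - \<bar>scale n * R e\<bar> powr \<alpha> * cos_tail \<bar>scale n * R e\<bar> \<partial>mark_law) =
        (\<integral>e. 1 - (\<kappa> / cos_tail 0 * \<bar>R e\<bar> powr \<alpha> * cos_tail (scale n * \<bar>R e\<bar>)) / real n \<partial>mark_law)"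
      using scale_pos [OF n] by (intro Bochner_Integration.integral_cong refl) (simp add: abs_mult powr_mult scale_powr [OF n])
    also have "\<dots> = 1 - (\<integral>e. \<kappa> / cos_tail 0 * \<bar>R e\<bar> powr \<alpha> * cos_tail (scale n * \<bar>R e\<bar>) \<partial>mark_law) / real n"
    proof -
      have "integrable mark_law (\<lambda>e. \<kappa> / cos_tail 0 * \<bar>R e\<bar> powr \<alpha> * cos_tail (scale n * \<bar>R e\<bar>))"
      proof (rule M.integrable_const_bound [where B = "\<kappa> / cos_tail 0 * (\<Sum>i\<in>J. \<bar>\<theta> i\<bar> * \<psi> i) powr \<alpha> * cos_tail 0"])
        have "\<bar>R e\<bar> \<le> (\<Sum>i\<in>J. \<bar>\<theta> i\<bar> * \<psi> i)" for e
          unfolding R_def by (rule order_trans [OF sum_abs]) (auto simp: abs_mult intro!: sum_mono mult_left_mono ratio_bound)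
        then have "\<bar>R e\<bar> powr \<alpha> \<le> (\<Sum>i\<in>J. \<bar>\<theta> i\<bar> * \<psi> i) powr \<alpha>" for e
          using \<alpha> by (intro powr_mono2) auto
        then have "\<kappa> / cos_tail 0 * \<bar>R e\<bar> powr \<alpha> * cos_tail (scale n * \<bar>R e\<bar>) \<le> \<kappa> / cos_tail 0 * (\<Sum>i\<in>J. \<bar>\<theta> i\<bar> * \<psi> i) powr \<alpha> * cos_tail 0" for e
          using cos_tail_pos cos_tail_bounds \<kappa>(1) scale_pos [OF n] by (intro mult_mono) auto
        moreover have "0 \<le> \<kappa> / cos_tail 0 * \<bar>R e\<bar> powr \<alpha> * cos_tail (scale n * \<bar>R e\<bar>)" for e
          using cos_tail_pos cos_tail_bounds \<kappa>(1) by (intro mult_nonneg_nonneg) auto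
        ultimately show "AE e in mark_law. norm (\<kappa> / cos_tail 0 * \<bar>R e\<bar> powr \<alpha> * cos_tail (scale n * \<bar>R e\<bar>)) \<le> \<kappa> / cos_tail 0 * (\<Sum>i\<in>J. \<bar>\<theta> i\<bar> * \<psi> i) powr \<alpha> * cos_tail 0"
          by (intro AE_I2) (simp only: real_norm_def abs_of_nonneg)
        have "(\<lambda>e. CLINT s|sym_pareto \<alpha>. iexp (scale n * s * R e)) \<in> borel_measurable mark_law" by measurable
        also have "(\<lambda>e. CLINT s|sym_pareto \<alpha>. iexp (scale n * s * R e)) = (\<lambda>e. of_real (1 - \<bar>scale n * R e\<bar> powr \<alpha> * cos_tail \<bar>scale n * R e\<bar>))"
          unfolding cos_tail_def sym_pareto_char [OF \<alpha>, symmetric] by (simp only: mult_ac)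
        finally have "(\<lambda>e. Re (of_real (1 - \<bar>scale n * R e\<bar> powr \<alpha> * cos_tail \<bar>scale n * R e\<bar>))) \<in> borel_measurable mark_law"
          unfolding borel_measurable_complex_iff by simp
        then have "(\<lambda>e. real n * (1 - Re (of_real (1 - \<bar>scale n * R e\<bar> powr \<alpha> * cos_tail \<bar>scale n * R e\<bar>)))) \<in> borel_measurable mark_law"
          by measurable
        also have "(\<lambda>e. real n * (1 - Re (of_real (1 - \<bar>scale n * R e\<bar> powr \<alpha> * cos_tail \<bar>scale n * R e\<bar>)))) = (\<lambda>e. \<kappa> / cos_tail 0 * \<bar>R e\<bar> powr \<alpha> * cos_tail (scale n * \<bar>R e\<bar>))"
          using scale_pos [OF n] n by (simp add: abs_mult powr_mult scale_powr [OF n] fun_eq_iff)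
        finally show "(\<lambda>e. \<kappa> / cos_tail 0 * \<bar>R e\<bar> powr \<alpha> * cos_tail (scale n * \<bar>R e\<bar>)) \<in> borel_measurable mark_law" .
      qed
      then have "(\<integral>e. 1 - g e / real n \<partial>mark_law) = 1 - (\<integral>e. g e \<partial>mark_law) / real n"
        if "g = (\<lambda>e. \<kappa> / cos_tail 0 * \<bar>R e\<bar> powr \<alpha> * cos_tail (scale n * \<bar>R e\<bar>))" for g
        using that by (subst Bochner_Integration.integral_diff) (simp_all only: integrable_divide M.integrable_const integral_divide_zero lebesgue_integral_const M.prob_space scaleR_one)
      then show ?thesis by blast
    qed
    finally show ?thesis .
  qed
  have sum: "(\<Sum>i\<in>J. \<theta> i * approx n i \<zeta>) = (\<Sum>j<n. scale n * snd (\<zeta> j) * R (fst (\<zeta> j)))" for \<zeta>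
    unfolding approx_def R_def sum_distrib_left by (subst sum.swap) (simp add: mult_ac)
  have "(CLINT \<zeta>|sample n. iexp (\<Sum>i\<in>J. \<theta> i * approx n i \<zeta>)) = (CLINT \<zeta>|sample n. (\<Prod>j<n. iexp (scale n * snd (\<zeta> j) * R (fst (\<zeta> j)))))"
    unfolding sum by (simp add: exp_sum sum_distrib_left)
  also have "\<dots> = (\<Prod>j<n. CLINT q|mark_law \<Otimes>\<^sub>M sym_pareto \<alpha>. iexp (scale n * snd q * R (fst q)))"
    unfolding sample_def
    by (rule PS.product_integral_prod) (auto intro!: MS.P.integrable_const_bound [where B=1])
  also have "\<dots> = of_real ((1 - (\<integral>e. \<kappa> / cos_tail 0 * \<bar>R e\<bar> powr \<alpha> * cos_tail (scale n * \<bar>R e\<bar>) \<partial>mark_law) / real n) ^ n)"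
    unfolding one by simp
  finally show ?thesis by (simp only: R_def)
qed

end

context stable_sample
begin

lemma sample_char_tendsto:
  "(\<lambda>n. CLINT \<zeta>|sample (Suc n). iexp (\<Sum>i\<in>J. \<theta> i * approx (Suc n) i \<zeta>)) \<longlonglongrightarrow>
    of_real (exp (- (\<integral>e. \<bar>\<Sum>i\<in>J. \<theta> i * a i e\<bar> powr \<alpha> \<partial>m)))"
proof -
  interpret M: prob_space mark_law by (rule prob_space_mark_law)
  define R where "R e = (\<Sum>i\<in>J. \<theta> i * ratio i e)" for e
  have R [measurable]: "R \<in> borel_measurable m" unfolding R_def [abs_def] by measurable
  define g where "g n e = \<kappa> / cos_tail 0 * \<bar>R e\<bar> powr \<alpha> * cos_tail (scale n * \<bar>R e\<bar>)" for n e
  define z where "z n = (\<integral>e. g (Suc n) e \<partial>mark_law)" for n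
  have "\<bar>R e\<bar> \<le> (\<Sum>i\<in>J. \<bar>\<theta> i\<bar> * \<psi> i)" for e
    unfolding R_def by (rule order_trans [OF sum_abs]) (auto simp: abs_mult intro!: sum_mono mult_left_mono ratio_bound)
  then have Ra: "\<bar>R e\<bar> powr \<alpha> \<le> (\<Sum>i\<in>J. \<bar>\<theta> i\<bar> * \<psi> i) powr \<alpha>" for e
    using \<alpha> by (intro powr_mono2) auto
  have tail_meas: "(\<lambda>e. cos_tail (scale n * \<bar>R e\<bar>)) \<in> borel_measurable m" for n
  proof -
    have "(\<lambda>u. stable_tail \<alpha> (\<lambda>w. ennreal (1 - cos w)) u) \<in> borel_measurable borel"
    proof -
      have "(\<lambda>u. \<integral>\<^sup>+w. ennreal (1 - cos w) * ennreal (stable_weight \<alpha> w) * (if u \<le> \<bar>w\<bar> then 1 else 0) \<partial>lborel) \<in> borel_measurable borel"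
        by measurable
      then show ?thesis by (simp add: stable_tail_def indicator_def of_bool_def)
    qed
    then show ?thesis unfolding cos_tail_def by measurable
  qed
  have z: "z \<longlonglongrightarrow> (\<integral>e. \<kappa> * \<bar>R e\<bar> powr \<alpha> \<partial>mark_law)"
    unfolding z_def
  proof (rule integral_dominated_convergence [where w = "\<lambda>_. \<kappa> / cos_tail 0 * (\<Sum>i\<in>J. \<bar>\<theta> i\<bar> * \<psi> i) powr \<alpha> * cos_tail 0"])
    show "AE e in mark_law. (\<lambda>n. g (Suc n) e) \<longlonglongrightarrow> \<kappa> * \<bar>R e\<bar> powr \<alpha>"
    proof (intro AE_I2)
      fix e
      have "(\<lambda>n. scale (Suc n)) \<longlonglongrightarrow> 0"
      proof -
        have "(\<lambda>n. \<kappa> / cos_tail 0 / real (Suc n)) \<longlonglongrightarrow> 0"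
          using tendsto_mult [OF tendsto_const LIMSEQ_inverse_real_of_nat, of "\<kappa> / cos_tail 0"] by (simp add: divide_inverse)
        then have "(\<lambda>n. (\<kappa> / cos_tail 0 / real (Suc n)) powr (1 / \<alpha>)) \<longlonglongrightarrow> 0 powr (1 / \<alpha>)"
          using \<alpha> \<kappa> cos_tail_pos by (intro tendsto_powr' tendsto_const) (auto intro!: always_eventually)
        then show ?thesis by (simp add: scale_def)
      qed
      then have "(\<lambda>n. scale (Suc n) * \<bar>R e\<bar>) \<longlonglongrightarrow> 0 * \<bar>R e\<bar>" by (intro tendsto_mult tendsto_const)
      then have "(\<lambda>n. cos_tail (scale (Suc n) * \<bar>R e\<bar>)) \<longlonglongrightarrow> cos_tail 0" by (intro cos_tail_tendsto) simp
      then have "(\<lambda>n. g (Suc n) e) \<longlonglongrightarrow> \<kappa> / cos_tail 0 * \<bar>R e\<bar> powr \<alpha> * cos_tail 0"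
        unfolding g_def by (intro tendsto_mult tendsto_const)
      then show "(\<lambda>n. g (Suc n) e) \<longlonglongrightarrow> \<kappa> * \<bar>R e\<bar> powr \<alpha>" using cos_tail_pos by simp
    qed
    show "AE e in mark_law. norm (g (Suc n) e) \<le> \<kappa> / cos_tail 0 * (\<Sum>i\<in>J. \<bar>\<theta> i\<bar> * \<psi> i) powr \<alpha> * cos_tail 0" for n
    proof (intro AE_I2)
      fix e
      have "0 < scale (Suc n)" by (intro scale_pos) simp
      then have "g (Suc n) e \<le> \<kappa> / cos_tail 0 * (\<Sum>i\<in>J. \<bar>\<theta> i\<bar> * \<psi> i) powr \<alpha> * cos_tail 0"
        unfolding g_def using Ra cos_tail_pos cos_tail_bounds \<kappa>(1) by (intro mult_mono) auto
      moreover have "0 \<le> g (Suc n) e"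
        unfolding g_def using cos_tail_pos cos_tail_bounds \<kappa>(1) by (intro mult_nonneg_nonneg) auto
      ultimately show "norm (g (Suc n) e) \<le> \<kappa> / cos_tail 0 * (\<Sum>i\<in>J. \<bar>\<theta> i\<bar> * \<psi> i) powr \<alpha> * cos_tail 0"
        by (simp only: real_norm_def abs_of_nonneg)
    qed
    show "g (Suc n) \<in> borel_measurable mark_law" for n
      unfolding g_def [abs_def] using tail_meas by measurable
  qed auto
  have lim: "(\<integral>e. \<kappa> * \<bar>R e\<bar> powr \<alpha> \<partial>mark_law) = (\<integral>e. \<bar>\<Sum>i\<in>J. \<theta> i * a i e\<bar> powr \<alpha> \<partial>m)"
  proof -
    have "(\<integral>e. \<kappa> * \<bar>R e\<bar> powr \<alpha> \<partial>mark_law) = (\<integral>e. (K e powr \<alpha> / \<kappa>) *\<^sub>R (\<kappa> * \<bar>R e\<bar> powr \<alpha>) \<partial>m)"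
      unfolding mark_law_def using \<kappa> by (intro integral_density) auto
    also have "\<dots> = (\<integral>e. \<bar>\<Sum>i\<in>J. \<theta> i * a i e\<bar> powr \<alpha> \<partial>m)"
    proof (rule integral_cong_AE)
      show "(\<lambda>e. \<bar>\<Sum>i\<in>J. \<theta> i * a i e\<bar> powr \<alpha>) \<in> borel_measurable m" using a by measurable
      show "AE e in m. (K e powr \<alpha> / \<kappa>) *\<^sub>R (\<kappa> * \<bar>R e\<bar> powr \<alpha>) = \<bar>\<Sum>i\<in>J. \<theta> i * a i e\<bar> powr \<alpha>"
        using ratio_eq
      proof eventually_elim
        case (elim e)
        have "(\<Sum>i\<in>J. \<theta> i * a i e) = K e * R e"
          unfolding R_def sum_distrib_left using elim by (intro sum.cong) auto
        then show ?case using \<kappa>(1) K0 [of e] by (simp add: abs_mult powr_mult)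
      qed
    qed measurable
    finally show ?thesis .
  qed
  have "(\<lambda>n. complex_of_real ((1 - z n / real (Suc n)) ^ Suc n)) \<longlonglongrightarrow> of_real (exp (- (\<integral>e. \<bar>\<Sum>i\<in>J. \<theta> i * a i e\<bar> powr \<alpha> \<partial>m)))"
    using tendsto_one_minus_over_power [OF z] unfolding lim by (rule tendsto_of_real)
  moreover have "(CLINT \<zeta>|sample (Suc n). iexp (\<Sum>i\<in>J. \<theta> i * approx (Suc n) i \<zeta>)) = complex_of_real ((1 - z n / real (Suc n)) ^ Suc n)" for n
    unfolding z_def g_def R_def by (rule sample_char) simp
  ultimately show ?thesis by (simp only:)
qed

definition quad :: "nat \<Rightarrow> (nat \<Rightarrow> 'e \<times> real) \<Rightarrow> real" where
  "quad n \<zeta> = (\<Sum>j<n. (scale n * snd (\<zeta> j))\<^sup>2)"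

lemma quad_measurable [measurable]: "quad n \<in> borel_measurable (sample n)"
  unfolding quad_def [abs_def] sample_def by measurable

definition tail_const :: real where
  "tail_const = \<kappa> / cos_tail 0 * enn2real (stable_tail \<alpha> (\<lambda>w. ennreal (min 1 (w\<^sup>2))) 0)"

lemma quad_tail:
  assumes n: "1 \<le> n" and w: "0 < w"
  shows "emeasure (sample n) {\<zeta> \<in> space (sample n). w < quad n \<zeta>} \<le> ennreal (tail_const * w powr (- \<alpha> / 2))"
proof -
  interpret M: prob_space mark_law by (rule prob_space_mark_law)
  interpret S: prob_space "sym_pareto \<alpha>" by (rule prob_space_sym_pareto [OF \<alpha>(1)])
  interpret MS: pair_prob_space mark_law "sym_pareto \<alpha>" ..
  define q where "q x = ennreal (min 1 (x\<^sup>2))" for x :: real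
  have [measurable]: "q \<in> borel_measurable borel" unfolding q_def [abs_def] by measurable
  define c where "c = scale n / sqrt w"
  have c: "0 < c" using scale_pos [OF n] w by (simp add: c_def)
  have "emeasure (sample n) {\<zeta> \<in> space (sample n). w < quad n \<zeta>} = (\<integral>\<^sup>+\<zeta>. indicator {\<zeta> \<in> space (sample n). w < quad n \<zeta>} \<zeta> \<partial>sample n)"
    by simp
  also have "\<dots> \<le> (\<integral>\<^sup>+\<zeta>. (\<Sum>j<n. q (c * snd (\<zeta> j))) \<partial>sample n)"
  proof (intro nn_integral_mono)
    fix \<zeta>
    have "1 \<le> (\<Sum>j<n. min 1 ((c * snd (\<zeta> j))\<^sup>2))" if wq: "w < quad n \<zeta>"
    proof (cases "\<exists>j<n. 1 < (c * snd (\<zeta> j))\<^sup>2")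
      case True
      then obtain j where j: "j < n" "1 < (c * snd (\<zeta> j))\<^sup>2" by blast
      then have "1 = min 1 ((c * snd (\<zeta> j))\<^sup>2)" by simp
      also have "\<dots> \<le> (\<Sum>j<n. min 1 ((c * snd (\<zeta> j))\<^sup>2))" using j by (intro member_le_sum) auto
      finally show ?thesis .
    next
      case False
      have "(c * snd (\<zeta> j))\<^sup>2 \<le> 1" if "j < n" for j
      proof (rule ccontr)
        assume "\<not> ?thesis"
        with that have "\<exists>j<n. 1 < (c * snd (\<zeta> j))\<^sup>2" by (intro exI [of _ j]) simp
        with False show False by contradiction
      qed
      then have "(\<Sum>j<n. min 1 ((c * snd (\<zeta> j))\<^sup>2)) = (\<Sum>j<n. (c * snd (\<zeta> j))\<^sup>2)"
        by (intro sum.cong refl min_absorb2) simp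
      also have "\<dots> = quad n \<zeta> / w"
        using w by (simp add: quad_def c_def power_mult_distrib power_divide sum_divide_distrib)
      finally show ?thesis using wq w by simp
    qed
    then have "indicator {\<zeta> \<in> space (sample n). w < quad n \<zeta>} \<zeta> \<le> ennreal (\<Sum>j<n. min 1 ((c * snd (\<zeta> j))\<^sup>2))"
      by (auto simp: indicator_def ennreal_leI [of 1, simplified] sum_nonneg)
    also have "\<dots> = (\<Sum>j<n. q (c * snd (\<zeta> j)))" unfolding q_def by (intro sum_ennreal [symmetric]) auto
    finally show "indicator {\<zeta> \<in> space (sample n). w < quad n \<zeta>} \<zeta> \<le> (\<Sum>j<n. q (c * snd (\<zeta> j)))" .
  qed
  also have "\<dots> = (\<Sum>j<n. \<integral>\<^sup>+\<zeta>. q (c * snd (\<zeta> j)) \<partial>sample n)"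
    unfolding sample_def by (intro nn_integral_sum) measurable
  also have "\<dots> = (\<Sum>j<n. \<integral>\<^sup>+s. q (c * s) \<partial>sym_pareto \<alpha>)"
  proof (intro sum.cong refl)
    fix j assume j: "j \<in> {..<n}"
    have "(\<integral>\<^sup>+\<zeta>. q (c * snd (\<zeta> j)) \<partial>sample n) = (\<integral>\<^sup>+p. q (c * snd p) \<partial>distr (sample n) (mark_law \<Otimes>\<^sub>M sym_pareto \<alpha>) (\<lambda>\<zeta>. \<zeta> j))"
      unfolding sample_def using j by (subst nn_integral_distr) auto
    also have "distr (sample n) (mark_law \<Otimes>\<^sub>M sym_pareto \<alpha>) (\<lambda>\<zeta>. \<zeta> j) = mark_law \<Otimes>\<^sub>M sym_pareto \<alpha>"
      unfolding sample_def using j prob_space_one_sample by (intro distr_PiM_component)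
    also have "(\<integral>\<^sup>+p. q (c * snd p) \<partial>(mark_law \<Otimes>\<^sub>M sym_pareto \<alpha>)) = (\<integral>\<^sup>+e. \<integral>\<^sup>+s. q (c * s) \<partial>sym_pareto \<alpha> \<partial>mark_law)"
      by (subst S.nn_integral_fst [symmetric]) auto
    also have "\<dots> = (\<integral>\<^sup>+s. q (c * s) \<partial>sym_pareto \<alpha>)" by (simp add: M.emeasure_space_1)
    finally show "(\<integral>\<^sup>+\<zeta>. q (c * snd (\<zeta> j)) \<partial>sample n) = (\<integral>\<^sup>+s. q (c * s) \<partial>sym_pareto \<alpha>)" .
  qed
  also have "\<dots> = of_nat n * (ennreal (c powr \<alpha>) * stable_tail \<alpha> q c)"
    using c by (subst nn_integral_sym_pareto_scale) auto
  also have "\<dots> \<le> of_nat n * (ennreal (c powr \<alpha>) * stable_tail \<alpha> q 0)"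
    using c by (intro mult_left_mono stable_tail_mono) auto
  also have "stable_tail \<alpha> q 0 = ennreal (enn2real (stable_tail \<alpha> (\<lambda>w. ennreal (min 1 (w\<^sup>2))) 0))"
    using stable_tail_min_finite [OF \<alpha>] by (simp add: q_def [abs_def] less_top)
  also have "of_nat n * (ennreal (c powr \<alpha>) * ennreal (enn2real (stable_tail \<alpha> (\<lambda>w. ennreal (min 1 (w\<^sup>2))) 0))) =
      ennreal (real n * (c powr \<alpha> * enn2real (stable_tail \<alpha> (\<lambda>w. ennreal (min 1 (w\<^sup>2))) 0)))"
    unfolding ennreal_of_nat_eq_real_of_nat
    by (simp only: ennreal_mult' [symmetric] of_nat_0_le_iff powr_ge_zero)
  also have "real n * (c powr \<alpha> * enn2real (stable_tail \<alpha> (\<lambda>w. ennreal (min 1 (w\<^sup>2))) 0)) = tail_const * w powr (- \<alpha> / 2)"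
  proof -
    have "sqrt w powr \<alpha> = w powr (\<alpha> / 2)" using w by (simp add: powr_half_sqrt [symmetric] powr_powr)
    then have "c powr \<alpha> = \<kappa> / cos_tail 0 / real n * w powr (- \<alpha> / 2)"
      using scale_pos [OF n] w by (simp add: c_def powr_divide scale_powr [OF n] powr_minus_divide)
    then show ?thesis using n by (simp add: tail_const_def)
  qed
  finally show ?thesis .
qed

lemma approx_exp_moment:
  assumes i: "i \<in> J"
  shows "(\<integral>\<^sup>+\<zeta>. ennreal (exp (t * approx n i \<zeta> - (t * \<psi> i)\<^sup>2 * quad n \<zeta> / 2)) \<partial>sample n) \<le> 1"
proof -
  interpret M: prob_space mark_law by (rule prob_space_mark_law)
  interpret S: prob_space "sym_pareto \<alpha>" by (rule prob_space_sym_pareto [OF \<alpha>(1)])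
  interpret MS: pair_prob_space mark_law "sym_pareto \<alpha>" ..
  interpret PS: product_prob_space "\<lambda>_. mark_law \<Otimes>\<^sub>M sym_pareto \<alpha>" "{..<n}" ..
  define v where "v = t * scale n"
  define f where "f p = ennreal (exp (v * snd p * ratio i (fst p) - (v * \<psi> i * snd p)\<^sup>2 / 2))" for p :: "'e \<times> real"
  note [measurable] = ratio_measurable [OF i]
  have [measurable]: "f \<in> borel_measurable (mark_law \<Otimes>\<^sub>M sym_pareto \<alpha>)" unfolding f_def [abs_def] by measurable
  have "ennreal (exp (t * approx n i \<zeta> - (t * \<psi> i)\<^sup>2 * quad n \<zeta> / 2)) = (\<Prod>j<n. f (\<zeta> j))" for \<zeta>
  proof -
    have "t * approx n i \<zeta> - (t * \<psi> i)\<^sup>2 * quad n \<zeta> / 2 = (\<Sum>j<n. v * snd (\<zeta> j) * ratio i (fst (\<zeta> j)) - (v * \<psi> i * snd (\<zeta> j))\<^sup>2 / 2)"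
      by (simp add: approx_def quad_def v_def sum_subtractf sum_distrib_left sum_divide_distrib power_mult_distrib mult_ac)
    then show ?thesis unfolding f_def by (simp add: exp_sum prod_ennreal)
  qed
  then have "(\<integral>\<^sup>+\<zeta>. ennreal (exp (t * approx n i \<zeta> - (t * \<psi> i)\<^sup>2 * quad n \<zeta> / 2)) \<partial>sample n) = (\<integral>\<^sup>+\<zeta>. (\<Prod>j<n. f (\<zeta> j)) \<partial>sample n)"
    by simp
  also have "\<dots> = (\<Prod>j<n. \<integral>\<^sup>+p. f p \<partial>(mark_law \<Otimes>\<^sub>M sym_pareto \<alpha>))"
    unfolding sample_def by (rule PS.product_nn_integral_prod) auto
  also have "\<dots> = (\<integral>\<^sup>+p. f p \<partial>(mark_law \<Otimes>\<^sub>M sym_pareto \<alpha>)) ^ n" by simp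
  also have "\<dots> \<le> 1 ^ n"
  proof (rule power_mono)
    have "(\<integral>\<^sup>+p. f p \<partial>(mark_law \<Otimes>\<^sub>M sym_pareto \<alpha>)) = (\<integral>\<^sup>+e. \<integral>\<^sup>+s. f (e, s) \<partial>sym_pareto \<alpha> \<partial>mark_law)"
      by (rule S.nn_integral_fst [symmetric]) measurable
    also have "\<dots> \<le> (\<integral>\<^sup>+e. 1 \<partial>mark_law)"
      unfolding f_def fst_conv snd_conv
      by (intro nn_integral_mono sym_pareto_subgaussian \<alpha> ratio_bound i)
    finally show "(\<integral>\<^sup>+p. f p \<partial>(mark_law \<Otimes>\<^sub>M sym_pareto \<alpha>)) \<le> 1"
      by (simp add: M.emeasure_space_1)
  qed simp
  finally show ?thesis by simp
qed

text \<open>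
  Given \<open>quad\<close>, the sum is subgaussian by symmetry.
\<close>

lemma approx_tail_one_sided:
  assumes i: "i \<in> J" and b: "0 < b" and w: "0 < w" and t: "t = b / (w * (\<psi> i)\<^sup>2) \<or> t = - b / (w * (\<psi> i)\<^sup>2)"
  shows "emeasure (sample n) {\<zeta> \<in> space (sample n). quad n \<zeta> \<le> w \<and> b * \<bar>t\<bar> < t * approx n i \<zeta>} \<le> ennreal (exp (- b\<^sup>2 / (2 * w * (\<psi> i)\<^sup>2)))"
proof -
  define d where "d = exp (- b\<^sup>2 / (2 * w * (\<psi> i)\<^sup>2))"
  have \<psi>i: "0 < \<psi> i" using \<psi> i by simp
  have at: "\<bar>t\<bar> = b / (w * (\<psi> i)\<^sup>2)" using t b w \<psi>i by (auto simp: abs_divide)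
  note [measurable] = approx_measurable [OF i]
  have "emeasure (sample n) {\<zeta> \<in> space (sample n). quad n \<zeta> \<le> w \<and> b * \<bar>t\<bar> < t * approx n i \<zeta>} =
      (\<integral>\<^sup>+\<zeta>. indicator {\<zeta> \<in> space (sample n). quad n \<zeta> \<le> w \<and> b * \<bar>t\<bar> < t * approx n i \<zeta>} \<zeta> \<partial>sample n)" by simp
  also have "\<dots> \<le> (\<integral>\<^sup>+\<zeta>. ennreal d * ennreal (exp (t * approx n i \<zeta> - (t * \<psi> i)\<^sup>2 * quad n \<zeta> / 2)) \<partial>sample n)"
  proof (intro nn_integral_mono)
    fix \<zeta>
    show "indicator {\<zeta> \<in> space (sample n). quad n \<zeta> \<le> w \<and> b * \<bar>t\<bar> < t * approx n i \<zeta>} \<zeta> \<le> ennreal d * ennreal (exp (t * approx n i \<zeta> - (t * \<psi> i)\<^sup>2 * quad n \<zeta> / 2))"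
    proof (cases "quad n \<zeta> \<le> w \<and> b * \<bar>t\<bar> < t * approx n i \<zeta>")
      case True
      have "(t * \<psi> i)\<^sup>2 = b\<^sup>2 / (w\<^sup>2 * (\<psi> i)\<^sup>2)"
      proof -
        have "(t * \<psi> i)\<^sup>2 = (\<bar>t\<bar> * \<psi> i)\<^sup>2" by (simp add: power_mult_distrib)
        also have "\<dots> = (b / (w * \<psi> i))\<^sup>2" unfolding at using \<psi>i by (simp add: power2_eq_square)
        finally show ?thesis by (simp add: power_divide power_mult_distrib)
      qed
      moreover have "(t * \<psi> i)\<^sup>2 * quad n \<zeta> / 2 \<le> (t * \<psi> i)\<^sup>2 * w / 2"
        using True by (intro divide_right_mono mult_left_mono) auto
      ultimately have "(t * \<psi> i)\<^sup>2 * quad n \<zeta> / 2 \<le> b\<^sup>2 / (2 * w * (\<psi> i)\<^sup>2)"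
        using w by (simp add: power2_eq_square mult_ac)
      moreover have "b * \<bar>t\<bar> = 2 * (b\<^sup>2 / (2 * w * (\<psi> i)\<^sup>2))" unfolding at by (simp add: power2_eq_square)
      moreover have "b * \<bar>t\<bar> < t * approx n i \<zeta>" using True by simp
      moreover have "- b\<^sup>2 / (2 * w * (\<psi> i)\<^sup>2) = - (b\<^sup>2 / (2 * w * (\<psi> i)\<^sup>2))" by (rule minus_divide_left [symmetric])
      ultimately have "0 \<le> - b\<^sup>2 / (2 * w * (\<psi> i)\<^sup>2) + (t * approx n i \<zeta> - (t * \<psi> i)\<^sup>2 * quad n \<zeta> / 2)"
        by linarith
      then have "1 \<le> d * exp (t * approx n i \<zeta> - (t * \<psi> i)\<^sup>2 * quad n \<zeta> / 2)"
        unfolding d_def exp_add [symmetric] by simp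
      then have "ennreal 1 \<le> ennreal (d * exp (t * approx n i \<zeta> - (t * \<psi> i)\<^sup>2 * quad n \<zeta> / 2))" by (rule ennreal_leI)
      also have "\<dots> = ennreal d * ennreal (exp (t * approx n i \<zeta> - (t * \<psi> i)\<^sup>2 * quad n \<zeta> / 2))"
        by (intro ennreal_mult) (auto simp: d_def)
      finally show ?thesis by (auto simp: indicator_def)
    next
      case False
      then show ?thesis by (auto simp: indicator_def)
    qed
  qed
  also have "\<dots> = ennreal d * (\<integral>\<^sup>+\<zeta>. ennreal (exp (t * approx n i \<zeta> - (t * \<psi> i)\<^sup>2 * quad n \<zeta> / 2)) \<partial>sample n)"
    by (intro nn_integral_cmult) measurable
  also have "\<dots> \<le> ennreal d * 1" by (intro mult_left_mono approx_exp_moment i) simp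
  finally show ?thesis by (simp add: d_def)
qed

lemma approx_max_tail:
  assumes n: "1 \<le> n" and w: "0 < w" and b: "\<And>i. i \<in> J \<Longrightarrow> 0 < b i"
  shows "measure (sample n) {\<zeta> \<in> space (sample n). \<exists>i\<in>J. b i < \<bar>approx n i \<zeta>\<bar>} \<le>
    tail_const * w powr (- \<alpha> / 2) + (\<Sum>i\<in>J. 2 * exp (- (b i)\<^sup>2 / (2 * w * (\<psi> i)\<^sup>2)))"
proof -
  interpret prob_space "sample n" by (rule prob_space_sample)
  define A where "A = {\<zeta> \<in> space (sample n). w < quad n \<zeta>}"
  define T where "T i = b i / (w * (\<psi> i)\<^sup>2)" for i
  define E where "E t i = {\<zeta> \<in> space (sample n). quad n \<zeta> \<le> w \<and> b i * \<bar>t\<bar> < t * approx n i \<zeta>}" for t i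
  have T: "0 < T i" if "i \<in> J" for i using b [OF that] \<psi> [OF that] w by (simp add: T_def)
  have [measurable]: "A \<in> sets (sample n)" unfolding A_def by measurable
  have Em [measurable]: "E t i \<in> sets (sample n)" if "i \<in> J" for t i
  proof -
    note [measurable] = approx_measurable [OF that]
    show ?thesis unfolding E_def by measurable
  qed
  have "{\<zeta> \<in> space (sample n). \<exists>i\<in>J. b i < \<bar>approx n i \<zeta>\<bar>} \<subseteq> A \<union> (\<Union>i\<in>J. E (T i) i \<union> E (- T i) i)"
  proof
    fix \<zeta> assume "\<zeta> \<in> {\<zeta> \<in> space (sample n). \<exists>i\<in>J. b i < \<bar>approx n i \<zeta>\<bar>}"
    then obtain i where i: "\<zeta> \<in> space (sample n)" "i \<in> J" "b i < \<bar>approx n i \<zeta>\<bar>" by auto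
    have "b i * T i < T i * \<bar>approx n i \<zeta>\<bar>" using T [OF i(2)] i(3) by (simp add: mult.commute)
    then have "w < quad n \<zeta> \<or> \<zeta> \<in> E (T i) i \<or> \<zeta> \<in> E (- T i) i"
      using T [OF i(2)] i(1) by (cases "0 \<le> approx n i \<zeta>") (auto simp: E_def)
    then show "\<zeta> \<in> A \<union> (\<Union>i\<in>J. E (T i) i \<union> E (- T i) i)" using i by (auto simp: A_def)
  qed
  then have "prob {\<zeta> \<in> space (sample n). \<exists>i\<in>J. b i < \<bar>approx n i \<zeta>\<bar>} \<le> prob (A \<union> (\<Union>i\<in>J. E (T i) i \<union> E (- T i) i))"
    using J by (intro finite_measure_mono sets.Un sets.finite_UN) auto
  also have "\<dots> \<le> prob A + prob (\<Union>i\<in>J. E (T i) i \<union> E (- T i) i)"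
    using J by (intro measure_Un_le sets.finite_UN) auto
  also have "prob (\<Union>i\<in>J. E (T i) i \<union> E (- T i) i) \<le> (\<Sum>i\<in>J. prob (E (T i) i \<union> E (- T i) i))"
    using J by (intro measure_UNION_le) auto
  also have "\<dots> \<le> (\<Sum>i\<in>J. 2 * exp (- (b i)\<^sup>2 / (2 * w * (\<psi> i)\<^sup>2)))"
  proof (rule sum_mono)
    fix i assume i: "i \<in> J"
    have "prob (E t i) \<le> exp (- (b i)\<^sup>2 / (2 * w * (\<psi> i)\<^sup>2))" if "t = T i \<or> t = - T i" for t
    proof -
      have "emeasure (sample n) (E t i) \<le> ennreal (exp (- (b i)\<^sup>2 / (2 * w * (\<psi> i)\<^sup>2)))"
        unfolding E_def using that by (intro approx_tail_one_sided i b w) (auto simp: T_def)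
      then show ?thesis by (simp add: emeasure_eq_measure)
    qed
    from this [of "T i"] this [of "- T i"] measure_Un_le [OF Em [OF i, of "T i"] Em [OF i, of "- T i"]]
    show "prob (E (T i) i \<union> E (- T i) i) \<le> 2 * exp (- (b i)\<^sup>2 / (2 * w * (\<psi> i)\<^sup>2))" by simp
  qed
  also have "prob A \<le> tail_const * w powr (- \<alpha> / 2)"
  proof -
    have "0 \<le> tail_const" using \<kappa> cos_tail_pos by (simp add: tail_const_def)
    then show ?thesis using quad_tail [OF n w] by (simp add: A_def emeasure_eq_measure)
  qed
  finally show ?thesis by simp
qed

end

context stable_sample
begin

text \<open>
  The first term does not depend on \<open>J\<close>: one exceptional event serves all coordinates at once.
\<close>

theorem stable_max_tail:
  fixes N :: "'b measure" and X :: "'i \<Rightarrow> 'b \<Rightarrow> real"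
  assumes N: "prob_space N" and X: "\<And>i. i \<in> J \<Longrightarrow> X i \<in> borel_measurable N"
    and char: "\<And>\<theta>. (CLINT \<omega>|N. iexp (\<Sum>i\<in>J. \<theta> i * X i \<omega>)) = of_real (exp (- (\<integral>e. \<bar>\<Sum>i\<in>J. \<theta> i * a i e\<bar> powr \<alpha> \<partial>m)))"
    and w: "0 < w" and b: "\<And>i. i \<in> J \<Longrightarrow> 0 < b i"
  shows "measure N {\<omega> \<in> space N. \<exists>i\<in>J. b i < \<bar>X i \<omega>\<bar>} \<le>
    tail_const * w powr (- \<alpha> / 2) + (\<Sum>i\<in>J. 2 * exp (- (b i)\<^sup>2 / (8 * w * (\<psi> i)\<^sup>2)))"
proof -
  interpret prob_space N by fact
  define \<epsilon> where "\<epsilon> = tail_const * w powr (- \<alpha> / 2) + (\<Sum>i\<in>J. 2 * exp (- (b i)\<^sup>2 / (8 * w * (\<psi> i)\<^sup>2)))"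
  define \<sigma> where "\<sigma> k = 1 / real (Suc k)" for k
  have \<sigma>: "0 < \<sigma> k" for k by (simp add: \<sigma>_def)
  have \<sigma>0: "\<sigma> \<longlonglongrightarrow> 0"
    using LIMSEQ_inverse_real_of_nat by (simp add: \<sigma>_def [abs_def] inverse_eq_divide)
  define q where "q k = measure std_normal_distribution {t. \<bar>\<sigma> k * t\<bar> \<le> 1 / 2}" for k
  have q0: "0 \<le> q k" for k by (simp add: q_def)
  have soft_meas: "(\<lambda>\<omega>. soft_interval (\<sigma> k) (1 / b i * X i \<omega>)) \<in> borel_measurable N" if "i \<in> J" for k i
  proof -
    note [measurable] = X [OF that]
    have "(\<lambda>\<omega>. soft_weight (\<sigma> k) (1 / b i * X i \<omega>) / (\<sigma> k * sqrt (2 * pi) / 2)) \<in> borel_measurable N" by measurable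
    then show ?thesis using \<sigma> [of k] by (simp add: soft_weight_eq)
  qed
  have lower: "q k ^ card J * (1 - \<epsilon>) \<le> expectation (\<lambda>\<omega>. \<Prod>i\<in>J. soft_interval (\<sigma> k) (1 / b i * X i \<omega>))" for k
  proof -
    define c where "c = \<sigma> k * sqrt (2 * pi) / 2"
    have c: "0 < c" using \<sigma> by (simp add: c_def)
    have [measurable_cong]: "sets (uniform_measure lborel {-1..1::real} \<Otimes>\<^sub>M std_normal_distribution) = sets (borel \<Otimes>\<^sub>M borel)"
      by (intro sets_pair_measure_cong) auto
    have "(\<lambda>n. CLINT \<zeta>|sample (Suc n). (\<Prod>i\<in>J. of_real (soft_weight (\<sigma> k) (1 / b i * approx (Suc n) i \<zeta>))) * iexp (\<Sum>i\<in>J. (\<lambda>_. 0) i * approx (Suc n) i \<zeta>))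
      \<longlonglongrightarrow> (CLINT \<omega>|N. (\<Prod>i\<in>J. of_real (soft_weight (\<sigma> k) (1 / b i * X i \<omega>))) * iexp (\<Sum>i\<in>J. (\<lambda>_. 0) i * X i \<omega>))"
    proof (rule fourier_product_tendsto [where \<rho> = "uniform_measure lborel {-1..1::real} \<Otimes>\<^sub>M std_normal_distribution"
        and \<phi> = "\<lambda>z. iexp (- (snd z / \<sigma> k) * fst z)" and \<tau> = "\<lambda>z. snd z / \<sigma> k"])
      show "prob_space (uniform_measure lborel {-1..1::real} \<Otimes>\<^sub>M std_normal_distribution)"
        by (intro prob_space_pair prob_space_uniform_unit prob_space_std_normal)
      show "(\<lambda>n. CLINT \<omega>|sample (Suc n). iexp (\<Sum>i\<in>J. \<theta> i * approx (Suc n) i \<omega>)) \<longlonglongrightarrow> (CLINT \<omega>|N. iexp (\<Sum>i\<in>J. \<theta> i * X i \<omega>))" for \<theta>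
        unfolding char by (rule sample_char_tendsto)
      show "complex_of_real (soft_weight (\<sigma> k) x) = (CLINT z|uniform_measure lborel {-1..1::real} \<Otimes>\<^sub>M std_normal_distribution.
         iexp (- (snd z / \<sigma> k) * fst z) * iexp (snd z / \<sigma> k * x))" for x
        by (rule soft_weight_fourier)
    qed (auto simp: N prob_space_sample J X soft_weight_bounds)
    then have "(\<lambda>n. Re (complex_of_real (\<integral>\<zeta>. (\<Prod>i\<in>J. soft_weight (\<sigma> k) (1 / b i * approx (Suc n) i \<zeta>)) \<partial>sample (Suc n))))
      \<longlonglongrightarrow> Re (complex_of_real (expectation (\<lambda>\<omega>. \<Prod>i\<in>J. soft_weight (\<sigma> k) (1 / b i * X i \<omega>))))"
      by (intro tendsto_Re) (simp flip: integral_complex_of_real)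
    then have lim: "(\<lambda>n. \<integral>\<zeta>. (\<Prod>i\<in>J. soft_weight (\<sigma> k) (1 / b i * approx (Suc n) i \<zeta>)) \<partial>sample (Suc n))
      \<longlonglongrightarrow> expectation (\<lambda>\<omega>. \<Prod>i\<in>J. soft_weight (\<sigma> k) (1 / b i * X i \<omega>))" by simp
    have "(c * q k) ^ card J * (1 - \<epsilon>) \<le> (\<integral>\<zeta>. (\<Prod>i\<in>J. soft_weight (\<sigma> k) (1 / b i * approx (Suc n) i \<zeta>)) \<partial>sample (Suc n))" for n
    proof -
      interpret S: prob_space "sample (Suc n)" by (rule prob_space_sample)
      define Bad where "Bad = {\<zeta> \<in> space (sample (Suc n)). \<exists>i\<in>J. b i / 2 < \<bar>approx (Suc n) i \<zeta>\<bar>}"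
      have Bad [measurable]: "Bad \<in> sets (sample (Suc n))"
      proof -
        have "Bad = (\<Union>i\<in>J. {\<zeta> \<in> space (sample (Suc n)). b i / 2 < \<bar>approx (Suc n) i \<zeta>\<bar>})" by (auto simp: Bad_def)
        also have "\<dots> \<in> sets (sample (Suc n))"
          using J
        proof (intro sets.finite_UN)
          fix i assume "i \<in> J"
          note [measurable] = approx_measurable [OF this]
          show "{\<zeta> \<in> space (sample (Suc n)). b i / 2 < \<bar>approx (Suc n) i \<zeta>\<bar>} \<in> sets (sample (Suc n))" by measurable
        qed
        finally show ?thesis .
      qed
      have bad: "S.prob Bad \<le> \<epsilon>"
      proof -
        have "S.prob Bad \<le> tail_const * w powr (- \<alpha> / 2) + (\<Sum>i\<in>J. 2 * exp (- (b i / 2)\<^sup>2 / (2 * w * (\<psi> i)\<^sup>2)))"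
          unfolding Bad_def using w b by (intro approx_max_tail) auto
        then show ?thesis by (simp add: \<epsilon>_def power_divide mult_ac)
      qed
      have "(c * q k) ^ card J * (1 - \<epsilon>) \<le> (c * q k) ^ card J * (1 - S.prob Bad)"
        using bad c q0 by (intro mult_left_mono) auto
      also have "\<dots> = (\<integral>\<zeta>. (c * q k) ^ card J * indicator (space (sample (Suc n)) - Bad) \<zeta> \<partial>sample (Suc n))"
        by (simp add: S.prob_compl)
      also have "\<dots> \<le> (\<integral>\<zeta>. (\<Prod>i\<in>J. soft_weight (\<sigma> k) (1 / b i * approx (Suc n) i \<zeta>)) \<partial>sample (Suc n))"
      proof (rule integral_mono')
        show "integrable (sample (Suc n)) (\<lambda>\<zeta>. \<Prod>i\<in>J. soft_weight (\<sigma> k) (1 / b i * approx (Suc n) i \<zeta>))"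
        proof (rule S.integrable_const_bound [where B = 1])
          show "AE \<zeta> in sample (Suc n). norm (\<Prod>i\<in>J. soft_weight (\<sigma> k) (1 / b i * approx (Suc n) i \<zeta>)) \<le> 1"
            by (auto simp: abs_prod soft_weight_bounds intro!: prod_le_1)
          show "(\<lambda>\<zeta>. \<Prod>i\<in>J. soft_weight (\<sigma> k) (1 / b i * approx (Suc n) i \<zeta>)) \<in> borel_measurable (sample (Suc n))"
            by (intro borel_measurable_prod measurable_compose [OF _ soft_weight_measurable] borel_measurable_times) auto
        qed
        fix \<zeta> assume \<zeta>: "\<zeta> \<in> space (sample (Suc n))"
        show "0 \<le> (\<Prod>i\<in>J. soft_weight (\<sigma> k) (1 / b i * approx (Suc n) i \<zeta>))"
          by (intro prod_nonneg) (auto simp: soft_weight_bounds)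
        show "(c * q k) ^ card J * indicator (space (sample (Suc n)) - Bad) \<zeta> \<le> (\<Prod>i\<in>J. soft_weight (\<sigma> k) (1 / b i * approx (Suc n) i \<zeta>))"
        proof (cases "\<zeta> \<in> Bad")
          case True
          then show ?thesis by (simp add: prod_nonneg soft_weight_bounds)
        next
          case False
          have "(\<Prod>i\<in>J. c * q k) \<le> (\<Prod>i\<in>J. soft_weight (\<sigma> k) (1 / b i * approx (Suc n) i \<zeta>))"
          proof (intro prod_mono conjI)
            fix i assume i: "i \<in> J"
            show "0 \<le> c * q k" using c q0 by simp
            have "\<bar>approx (Suc n) i \<zeta>\<bar> \<le> b i / 2" using False \<zeta> i by (auto simp: Bad_def not_less)
            then have "\<bar>1 / b i * approx (Suc n) i \<zeta>\<bar> \<le> 1 / 2" using b [OF i] by (simp add: abs_mult field_simps)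
            then show "c * q k \<le> soft_weight (\<sigma> k) (1 / b i * approx (Suc n) i \<zeta>)"
              unfolding soft_weight_eq [OF \<sigma>] c_def q_def using \<sigma> [of k] by (intro mult_left_mono soft_interval_core) auto
          qed
          then show ?thesis using \<zeta> False by simp
        qed
      qed
      finally show ?thesis .
    qed
    then have "(c * q k) ^ card J * (1 - \<epsilon>) \<le> expectation (\<lambda>\<omega>. \<Prod>i\<in>J. soft_weight (\<sigma> k) (1 / b i * X i \<omega>))"
      by (intro LIMSEQ_le_const [OF lim]) auto
    also have "\<dots> = c ^ card J * expectation (\<lambda>\<omega>. \<Prod>i\<in>J. soft_interval (\<sigma> k) (1 / b i * X i \<omega>))"
      unfolding soft_weight_eq [OF \<sigma>] c_def [symmetric] by (simp add: prod.distrib)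
    finally have "c ^ card J * (q k ^ card J * (1 - \<epsilon>)) \<le> c ^ card J * expectation (\<lambda>\<omega>. \<Prod>i\<in>J. soft_interval (\<sigma> k) (1 / b i * X i \<omega>))"
      by (simp add: power_mult_distrib mult.assoc)
    then show ?thesis using c by (simp add: mult_le_cancel_left_pos)
  qed
  define Bad where "Bad = {\<omega> \<in> space N. \<exists>i\<in>J. b i < \<bar>X i \<omega>\<bar>}"
  have Bad [measurable]: "Bad \<in> sets N"
  proof -
    have "Bad = (\<Union>i\<in>J. {\<omega> \<in> space N. b i < \<bar>X i \<omega>\<bar>})" by (auto simp: Bad_def)
    also have "\<dots> \<in> sets N"
      using J
    proof (intro sets.finite_UN)
      fix i assume "i \<in> J"
      note [measurable] = X [OF this]
      show "{\<omega> \<in> space N. b i < \<bar>X i \<omega>\<bar>} \<in> sets N" by measurable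
    qed
    finally show ?thesis .
  qed
  define V where "V k = (\<integral>\<omega>. indicator Bad \<omega> * (\<Prod>i\<in>J. soft_interval (\<sigma> k) (1 / b i * X i \<omega>)) \<partial>N)" for k
  have prod01: "0 \<le> (\<Prod>i\<in>J. soft_interval s (x i))" "(\<Prod>i\<in>J. soft_interval s (x i)) \<le> 1" for s x
    by (auto intro!: prod_nonneg prod_le_1 simp: soft_interval_bounds)
  have pm [measurable]: "(\<lambda>\<omega>. \<Prod>i\<in>J. soft_interval (\<sigma> k) (1 / b i * X i \<omega>)) \<in> borel_measurable N" for k
    by (intro borel_measurable_prod soft_meas)
  have [measurable]: "(\<lambda>\<omega>. \<Prod>i\<in>J. soft_interval (\<sigma> k) (X i \<omega> / b i)) \<in> borel_measurable N" for k
    using pm [of k] by simp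
  have upper: "expectation (\<lambda>\<omega>. \<Prod>i\<in>J. soft_interval (\<sigma> k) (1 / b i * X i \<omega>)) \<le> (1 - prob Bad) + V k" for k
  proof -
    have "expectation (\<lambda>\<omega>. \<Prod>i\<in>J. soft_interval (\<sigma> k) (1 / b i * X i \<omega>)) \<le>
      expectation (\<lambda>\<omega>. indicator (space N - Bad) \<omega> + indicator Bad \<omega> * (\<Prod>i\<in>J. soft_interval (\<sigma> k) (1 / b i * X i \<omega>)))"
    proof (rule integral_mono)
      show "integrable N (\<lambda>\<omega>. \<Prod>i\<in>J. soft_interval (\<sigma> k) (1 / b i * X i \<omega>))"
        using prod01 by (intro integrable_const_bound [where B = 1]) auto
      show "integrable N (\<lambda>\<omega>. indicator (space N - Bad) \<omega> + indicator Bad \<omega> * (\<Prod>i\<in>J. soft_interval (\<sigma> k) (1 / b i * X i \<omega>)))"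
        using prod01 by (intro integrable_const_bound [where B = 1]) (auto simp: indicator_def)
    qed (use prod01 in \<open>auto simp: indicator_def\<close>)
    also have "\<dots> = expectation (indicator (space N - Bad)) + V k"
      unfolding V_def
    proof (rule Bochner_Integration.integral_add)
      show "integrable N (\<lambda>\<omega>. indicator Bad \<omega> * (\<Prod>i\<in>J. soft_interval (\<sigma> k) (1 / b i * X i \<omega>)))"
        using prod01 by (intro integrable_const_bound [where B = 1]) (auto simp: indicator_def)
    qed (auto simp: less_top [symmetric])
    finally show ?thesis by (simp add: prob_compl)
  qed
  have V: "V \<longlonglongrightarrow> 0"
  proof -
    have "V \<longlonglongrightarrow> (\<integral>\<omega>. 0 \<partial>N)"
      unfolding V_def
    proof (rule integral_dominated_convergence [where w = "\<lambda>_. 1"])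
      show "AE \<omega> in N. (\<lambda>k. indicator Bad \<omega> * (\<Prod>i\<in>J. soft_interval (\<sigma> k) (1 / b i * X i \<omega>))) \<longlonglongrightarrow> 0"
      proof (intro AE_I2)
        fix \<omega> assume "\<omega> \<in> space N"
        show "(\<lambda>k. indicator Bad \<omega> * (\<Prod>i\<in>J. soft_interval (\<sigma> k) (1 / b i * X i \<omega>))) \<longlonglongrightarrow> 0"
        proof (cases "\<omega> \<in> Bad")
          case True
          then obtain i where i: "i \<in> J" "b i < \<bar>X i \<omega>\<bar>" by (auto simp: Bad_def)
          have "1 < \<bar>1 / b i * X i \<omega>\<bar>" using b [OF i(1)] i(2) by (simp add: abs_mult)
          then have l: "(\<lambda>k. soft_interval (\<sigma> k) (1 / b i * X i \<omega>)) \<longlonglongrightarrow> 0"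
            by (rule soft_limits(2) [OF \<sigma>0])
          show ?thesis
          proof (rule tendsto_sandwich [OF _ _ tendsto_const l])
            show "\<forall>\<^sub>F k in sequentially. indicator Bad \<omega> * (\<Prod>i\<in>J. soft_interval (\<sigma> k) (1 / b i * X i \<omega>)) \<le> soft_interval (\<sigma> k) (1 / b i * X i \<omega>)"
            proof (intro always_eventually allI)
              fix k
              have "(\<Prod>i\<in>J. soft_interval (\<sigma> k) (1 / b i * X i \<omega>)) =
                  soft_interval (\<sigma> k) (1 / b i * X i \<omega>) * (\<Prod>i\<in>J - {i}. soft_interval (\<sigma> k) (1 / b i * X i \<omega>))"
                using J i(1) by (rule prod.remove)
              also have "\<dots> \<le> soft_interval (\<sigma> k) (1 / b i * X i \<omega>) * 1"
                by (intro mult_left_mono prod_le_1) (auto simp: soft_interval_bounds)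
              finally show "indicator Bad \<omega> * (\<Prod>i\<in>J. soft_interval (\<sigma> k) (1 / b i * X i \<omega>)) \<le> soft_interval (\<sigma> k) (1 / b i * X i \<omega>)"
                using True by simp
            qed
          qed (use prod01 in \<open>auto intro!: always_eventually\<close>)
        qed simp
      qed
    qed (use prod01 in \<open>auto simp: indicator_def\<close>)
    then show ?thesis by simp
  qed
  have ql: "(\<lambda>k. q k ^ card J * (1 - \<epsilon>)) \<longlonglongrightarrow> 1 ^ card J * (1 - \<epsilon>)"
    unfolding q_def by (intro tendsto_mult tendsto_power tendsto_const soft_limits(1) \<sigma>0)
  have Vl: "(\<lambda>k. (1 - prob Bad) + V k) \<longlonglongrightarrow> (1 - prob Bad) + 0"
    by (intro tendsto_add tendsto_const V)
  have "1 ^ card J * (1 - \<epsilon>) \<le> (1 - prob Bad) + 0"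
    by (rule LIMSEQ_le [OF ql Vl]) (use order_trans [OF lower upper] in blast)
  then show ?thesis by (simp add: \<epsilon>_def Bad_def)
qed

end

section \<open>The stable motion\<close>

lemma L_alpha_bound:
  assumes \<alpha>: "0 < \<alpha>" and f: "f \<in> borel_measurable m" and g: "g \<in> L_alpha \<alpha> m"
    and le: "AE e in m. \<bar>f e\<bar> \<le> c * \<bar>g e\<bar>" and c: "0 \<le> c"
  shows "f \<in> L_alpha \<alpha> m"
proof -
  have "integrable m (\<lambda>e. \<bar>f e\<bar> powr \<alpha>)"
  proof (rule Bochner_Integration.integrable_bound)
    show "integrable m (\<lambda>e. c powr \<alpha> * \<bar>g e\<bar> powr \<alpha>)" using g by (simp add: L_alpha_def)
    show "AE e in m. norm (\<bar>f e\<bar> powr \<alpha>) \<le> norm (c powr \<alpha> * \<bar>g e\<bar> powr \<alpha>)"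
      using le
    proof eventually_elim
      case (elim e)
      then have "\<bar>f e\<bar> powr \<alpha> \<le> (c * \<bar>g e\<bar>) powr \<alpha>" using \<alpha> by (intro powr_mono2) auto
      also have "\<dots> = c powr \<alpha> * \<bar>g e\<bar> powr \<alpha>" by (rule powr_mult)
      finally show ?case by simp
    qed
  qed (use f in measurable)
  with f show ?thesis by (simp add: L_alpha_def)
qed

lemma L_alpha_lincomb:
  assumes \<alpha>: "0 < \<alpha>" and f: "f \<in> L_alpha \<alpha> m" and g: "g \<in> L_alpha \<alpha> m"
  shows "(\<lambda>e. a * f e + b * g e) \<in> L_alpha \<alpha> m"
proof -
  have [measurable]: "f \<in> borel_measurable m" "g \<in> borel_measurable m" using f g by (auto simp: L_alpha_def)
  have "integrable m (\<lambda>e. \<bar>a * f e + b * g e\<bar> powr \<alpha>)"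
  proof (rule Bochner_Integration.integrable_bound)
    show "integrable m (\<lambda>e. (2 * \<bar>a\<bar>) powr \<alpha> * \<bar>f e\<bar> powr \<alpha> + (2 * \<bar>b\<bar>) powr \<alpha> * \<bar>g e\<bar> powr \<alpha>)"
      using f g by (simp add: L_alpha_def)
    have "\<bar>a * f e + b * g e\<bar> powr \<alpha> \<le> (2 * \<bar>a\<bar>) powr \<alpha> * \<bar>f e\<bar> powr \<alpha> + (2 * \<bar>b\<bar>) powr \<alpha> * \<bar>g e\<bar> powr \<alpha>" for e
    proof -
      have "\<bar>a * f e + b * g e\<bar> \<le> max (2 * \<bar>a\<bar> * \<bar>f e\<bar>) (2 * \<bar>b\<bar> * \<bar>g e\<bar>)"
        using abs_triangle_ineq [of "a * f e" "b * g e"] by (simp add: abs_mult max_def)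
      then have "\<bar>a * f e + b * g e\<bar> powr \<alpha> \<le> (max (2 * \<bar>a\<bar> * \<bar>f e\<bar>) (2 * \<bar>b\<bar> * \<bar>g e\<bar>)) powr \<alpha>"
        using \<alpha> by (intro powr_mono2) auto
      also have "\<dots> \<le> (2 * \<bar>a\<bar> * \<bar>f e\<bar>) powr \<alpha> + (2 * \<bar>b\<bar> * \<bar>g e\<bar>) powr \<alpha>"
        by (simp add: max_def)
      finally show ?thesis by (simp only: powr_mult)
    qed
    then show "AE e in m. norm (\<bar>a * f e + b * g e\<bar> powr \<alpha>) \<le>
        norm ((2 * \<bar>a\<bar>) powr \<alpha> * \<bar>f e\<bar> powr \<alpha> + (2 * \<bar>b\<bar>) powr \<alpha> * \<bar>g e\<bar> powr \<alpha>)"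
      by (intro AE_I2) simp
  qed measurable
  then show ?thesis by (simp add: L_alpha_def)
qed

locale local_time_stable_motion = fbm_local_time P H B G l for P :: "'w measure" and H B G l +
  fixes N :: "'b measure" and \<alpha> :: real and M :: "('w \<times> real) set \<Rightarrow> 'b \<Rightarrow> real"
    and I :: "('w \<times> real \<Rightarrow> real) \<Rightarrow> 'b \<Rightarrow> real" and Y :: "real \<Rightarrow> 'b \<Rightarrow> real"
  assumes \<alpha>: "0 < \<alpha>" "\<alpha> < 2"
    and sas: "sas_random_measure N (P \<Otimes>\<^sub>M lborel) \<alpha> M I"
    and Y_measurable: "\<And>t. 0 \<le> t \<Longrightarrow> Y t \<in> borel_measurable N"
    and Y_eq: "\<And>t. 0 \<le> t \<Longrightarrow> AE \<omega> in N. Y t \<omega> = I (\<lambda>(\<omega>', x). l x t \<omega>') \<omega>"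
begin

abbreviation control :: "('w \<times> real) measure" where "control \<equiv> P \<Otimes>\<^sub>M lborel"

definition lt :: "real \<Rightarrow> 'w \<times> real \<Rightarrow> real" where
  "lt t = (\<lambda>(\<omega>, x). l x t \<omega>)"

lemma lt_measurable [measurable]: "0 \<le> t \<Longrightarrow> lt t \<in> borel_measurable control"
  unfolding lt_def by (rule l_measurable)

lemma prob_space_N: "prob_space N" using sas by (simp add: sas_random_measure_def)

lemma I_measurable: "f \<in> L_alpha \<alpha> control \<Longrightarrow> I f \<in> borel_measurable N"
  using sas by (simp add: sas_random_measure_def)

lemma I_lincomb: "f \<in> L_alpha \<alpha> control \<Longrightarrow> g \<in> L_alpha \<alpha> control \<Longrightarrow>
    AE \<omega> in N. I (\<lambda>e. a * f e + b * g e) \<omega> = a * I f \<omega> + b * I g \<omega>"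
  using sas by (simp add: sas_random_measure_def)

lemma I_char: "f \<in> L_alpha \<alpha> control \<Longrightarrow>
    (CLINT \<omega>|N. iexp (\<theta> * I f \<omega>)) = of_real (exp (- (\<bar>\<theta>\<bar> powr \<alpha> * (\<integral>e. \<bar>f e\<bar> powr \<alpha> \<partial>control))))"
  using sas by (simp add: sas_random_measure_def)

lemma AE_controlI:
  assumes "Measurable.pred control Q" "\<And>\<omega>. \<omega> \<in> G \<Longrightarrow> AE x in lborel. Q (\<omega>, x)"
  shows "AE e in control. Q e"
proof -
  interpret PP: pair_sigma_finite P "lborel :: real measure" ..
  show ?thesis
  proof (rule PP.AE_pair_measure)
    show "{e \<in> space control. Q e} \<in> sets control" using assms(1) by measurable
    show "AE \<omega> in P. AE x in lborel. Q (\<omega>, x)" using G_AE by eventually_elim (rule assms(2))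
  qed
qed

lemma lt_mono_AE:
  assumes "0 \<le> s" "s \<le> t"
  shows "AE e in control. 0 \<le> lt s e \<and> lt s e \<le> lt t e"
proof (rule AE_controlI)
  have t: "0 \<le> t" using assms by simp
  note [measurable] = lt_measurable [OF assms(1)] lt_measurable [OF t]
  show "Measurable.pred control (\<lambda>e. 0 \<le> lt s e \<and> lt s e \<le> lt t e)" by measurable
  fix \<omega> assume \<omega>: "\<omega> \<in> G"
  show "AE x in lborel. 0 \<le> lt s (\<omega>, x) \<and> lt s (\<omega>, x) \<le> lt t (\<omega>, x)"
    using l_mono_AE [OF \<omega> assms] by eventually_elim (simp add: lt_def l_nonneg [OF \<omega> assms(1)])
qed

lemma lt_0_AE: "AE e in control. lt 0 e = 0"
proof (rule AE_controlI)
  show "Measurable.pred control (\<lambda>e. lt 0 e = 0)" by measurable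
  fix \<omega> assume \<omega>: "\<omega> \<in> G"
  note [measurable] = l_borel [OF \<omega> order_refl]
  have "(\<integral>\<^sup>+x. 1 * ennreal (l x 0 \<omega>) \<partial>lborel) = (\<integral>\<^sup>+s. 1 * indicator {0..0::real} s \<partial>lborel)"
    by (rule occupation_path [OF \<omega> order_refl, symmetric]) measurable
  also have "\<dots> = 0" by simp
  finally have "AE x in lborel. ennreal (l x 0 \<omega>) = 0"
    by (subst (asm) nn_integral_0_iff_AE) auto
  then show "AE x in lborel. lt 0 (\<omega>, x) = 0"
    by eventually_elim (use l_nonneg [OF \<omega> order_refl] in \<open>auto simp: lt_def ennreal_eq_0_iff intro: antisym\<close>)
qed

lemma lt_L_alpha:
  assumes t: "0 \<le> t"
  shows "lt t \<in> L_alpha \<alpha> control"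
proof -
  define T where "T = nat \<lceil>t\<rceil>"
  have tT: "t \<le> real T" unfolding T_def by linarith
  obtain K where K: "K \<in> borel_measurable control" "\<And>e. 0 \<le> K e"
    "(\<integral>\<^sup>+e. ennreal (K e powr \<alpha>) \<partial>control) < \<infinity>"
    and le: "AE e in control. \<forall>n\<ge>1. \<forall>k<T * 2 ^ n. 0 \<le> l_inc n k e \<and> l_inc n k e \<le> increment_scale n * K e"
    by (rule local_time_envelope [OF \<alpha>, of T]) (rule that)
  have KL: "K \<in> L_alpha \<alpha> control"
    unfolding L_alpha_def using K by (auto intro!: integrableI_bounded)
  have sum: "(\<Sum>k<j. l_inc 1 k e) = lt (real j / 2) e - lt 0 e" for j e
    by (induction j) (auto simp: l_inc_def lt_def case_prod_beta)
  show ?thesis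
  proof (rule L_alpha_bound [OF \<alpha>(1) lt_measurable [OF t] KL])
    show "AE e in control. \<bar>lt t e\<bar> \<le> (real (T * 2) * increment_scale 1) * \<bar>K e\<bar>"
      using le lt_0_AE lt_mono_AE [OF t tT]
    proof eventually_elim
      case (elim e)
      have "lt t e \<le> (\<Sum>k<T * 2. l_inc 1 k e)" using elim sum [of e "T * 2"] by simp
      also have "\<dots> \<le> (\<Sum>k<T * 2. increment_scale 1 * K e)"
        using elim(1) by (intro sum_mono) (metis lessThan_iff order_refl power_one_right)
      finally show ?case using elim K(2) [of e] by simp
    qed
    show "0 \<le> real (T * 2) * increment_scale 1" using increment_scale_pos [of 1] by simp
  qed
qed

lemma increment_L_alpha:
  assumes "0 \<le> s" "0 \<le> t"
  shows "(\<lambda>e. lt t e - lt s e) \<in> L_alpha \<alpha> control"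
  using L_alpha_lincomb [OF \<alpha>(1) lt_L_alpha [OF assms(2)] lt_L_alpha [OF assms(1)], of 1 "-1"] by simp

lemma Y_increment:
  assumes "0 \<le> s" "0 \<le> t"
  shows "AE \<omega> in N. Y t \<omega> - Y s \<omega> = I (\<lambda>e. lt t e - lt s e) \<omega>"
  using Y_eq [OF assms(1)] Y_eq [OF assms(2)] I_lincomb [OF lt_L_alpha [OF assms(2)] lt_L_alpha [OF assms(1)], of 1 "-1"]
  by eventually_elim (simp add: lt_def)

lemma Y_increment_sum:
  assumes "finite J" "\<And>i. i \<in> J \<Longrightarrow> 0 \<le> s i \<and> 0 \<le> t i"
  shows "(\<lambda>e. \<Sum>i\<in>J. \<theta> i * (lt (t i) e - lt (s i) e)) \<in> L_alpha \<alpha> control \<and>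
    (AE \<omega> in N. (\<Sum>i\<in>J. \<theta> i * (Y (t i) \<omega> - Y (s i) \<omega>)) = I (\<lambda>e. \<Sum>i\<in>J. \<theta> i * (lt (t i) e - lt (s i) e)) \<omega>)"
  using assms
proof (induction J rule: finite_induct)
  case empty
  have "(\<lambda>e. 0 * lt 0 e + 0 * lt 0 e) \<in> L_alpha \<alpha> control"
    by (intro L_alpha_lincomb \<alpha> lt_L_alpha) auto
  moreover have "AE \<omega> in N. I (\<lambda>e. 0 * lt 0 e + 0 * lt 0 e) \<omega> = 0 * I (lt 0) \<omega> + 0 * I (lt 0) \<omega>"
    by (intro I_lincomb lt_L_alpha) auto
  ultimately show ?case by simp
next
  case (insert j J)
  let ?S = "\<lambda>e. \<Sum>i\<in>J. \<theta> i * (lt (t i) e - lt (s i) e)"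
  let ?D = "\<lambda>e. lt (t j) e - lt (s j) e"
  have IH: "?S \<in> L_alpha \<alpha> control" "AE \<omega> in N. (\<Sum>i\<in>J. \<theta> i * (Y (t i) \<omega> - Y (s i) \<omega>)) = I ?S \<omega>"
    using insert.IH insert.prems by auto
  have D: "?D \<in> L_alpha \<alpha> control" "AE \<omega> in N. Y (t j) \<omega> - Y (s j) \<omega> = I ?D \<omega>"
    using insert.prems [of j] by (auto intro!: increment_L_alpha Y_increment)
  have eq: "(\<lambda>e. \<Sum>i\<in>insert j J. \<theta> i * (lt (t i) e - lt (s i) e)) = (\<lambda>e. \<theta> j * ?D e + 1 * ?S e)"
    using insert.hyps by simp
  have "(\<lambda>e. \<theta> j * ?D e + 1 * ?S e) \<in> L_alpha \<alpha> control"
    by (intro L_alpha_lincomb \<alpha> D IH)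
  moreover have "AE \<omega> in N. (\<Sum>i\<in>insert j J. \<theta> i * (Y (t i) \<omega> - Y (s i) \<omega>)) = I (\<lambda>e. \<theta> j * ?D e + 1 * ?S e) \<omega>"
    using I_lincomb [OF D(1) IH(1), of "\<theta> j" 1] D(2) IH(2)
    by eventually_elim (use insert.hyps in simp)
  ultimately show ?case unfolding eq by simp
qed

lemma Y_increment_char:
  assumes J: "finite J" "\<And>i. i \<in> J \<Longrightarrow> 0 \<le> s i \<and> 0 \<le> t i"
  shows "(CLINT \<omega>|N. iexp (\<Sum>i\<in>J. \<theta> i * (Y (t i) \<omega> - Y (s i) \<omega>))) =
    of_real (exp (- (\<integral>e. \<bar>\<Sum>i\<in>J. \<theta> i * (lt (t i) e - lt (s i) e)\<bar> powr \<alpha> \<partial>control)))"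
proof -
  let ?S = "\<lambda>e. \<Sum>i\<in>J. \<theta> i * (lt (t i) e - lt (s i) e)"
  have S: "?S \<in> L_alpha \<alpha> control" "AE \<omega> in N. (\<Sum>i\<in>J. \<theta> i * (Y (t i) \<omega> - Y (s i) \<omega>)) = I ?S \<omega>"
    using Y_increment_sum [where \<theta> = \<theta> and s = s and t = t, OF J] by auto
  have [measurable]: "(\<lambda>\<omega>. \<Sum>i\<in>J. \<theta> i * (Y (t i) \<omega> - Y (s i) \<omega>)) \<in> borel_measurable N"
    using J by (intro borel_measurable_sum borel_measurable_times borel_measurable_diff Y_measurable) auto
  have [measurable]: "I ?S \<in> borel_measurable N" by (rule I_measurable [OF S(1)])
  have "(CLINT \<omega>|N. iexp (\<Sum>i\<in>J. \<theta> i * (Y (t i) \<omega> - Y (s i) \<omega>))) = (CLINT \<omega>|N. iexp (1 * I ?S \<omega>))"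
  proof (rule integral_cong_AE)
    show "AE \<omega> in N. iexp (\<Sum>i\<in>J. \<theta> i * (Y (t i) \<omega> - Y (s i) \<omega>)) = iexp (1 * I ?S \<omega>)"
      using S(2) by eventually_elim simp
  qed measurable
  then show ?thesis unfolding I_char [OF S(1)] by simp
qed

definition level_bound :: "real \<Rightarrow> nat \<Rightarrow> real" where
  "level_bound \<beta> n = \<beta> * (increment_scale n * sqrt (real n))"

definition Y_inc :: "nat \<times> nat \<Rightarrow> 'b \<Rightarrow> real" where
  "Y_inc = (\<lambda>(n, k) \<omega>. Y (real (Suc k) / 2 ^ n) \<omega> - Y (real k / 2 ^ n) \<omega>)"

definition irregular :: "nat \<Rightarrow> real \<Rightarrow> nat \<Rightarrow> 'b set" where
  "irregular T \<beta> n0 = {\<omega> \<in> space N. \<exists>p\<in>{(n, k). 1 \<le> n \<and> n \<le> n0 \<and> k < T * 2 ^ n}. level_bound \<beta> (fst p) < \<bar>Y_inc p \<omega>\<bar>}"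

lemma Y_inc_measurable [measurable]: "Y_inc p \<in> borel_measurable N"
  unfolding Y_inc_def by (cases p) (auto intro!: borel_measurable_diff Y_measurable)

lemma finite_levels: "finite {(n, k). 1 \<le> n \<and> n \<le> n0 \<and> k < T * 2 ^ (n::nat) }" for T n0 :: nat
proof (rule finite_subset)
  show "{(n, k). 1 \<le> n \<and> n \<le> n0 \<and> k < T * 2 ^ n} \<subseteq> (SIGMA n:{..n0}. {..<T * 2 ^ n})" by auto
qed auto

lemma irregular_measurable [measurable]: "irregular T \<beta> n0 \<in> sets N"
proof -
  have "irregular T \<beta> n0 = (\<Union>p\<in>{(n, k). 1 \<le> n \<and> n \<le> n0 \<and> k < T * 2 ^ n}. {\<omega> \<in> space N. level_bound \<beta> (fst p) < \<bar>Y_inc p \<omega>\<bar>})"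
    unfolding irregular_def by blast
  also have "\<dots> \<in> sets N" by (intro sets.finite_UN finite_levels) measurable
  finally show ?thesis .
qed

lemma irregular_small:
  fixes T :: nat
  assumes \<epsilon>: "0 < \<epsilon>"
  shows "\<exists>\<beta>>0. \<forall>n0. measure N (irregular T \<beta> n0) \<le> \<epsilon>"
proof -
  obtain K where K: "K \<in> borel_measurable control" "\<And>e. 0 \<le> K e"
    "(\<integral>\<^sup>+e. ennreal (K e powr \<alpha>) \<partial>control) < \<infinity>" "0 < (\<integral>\<^sup>+e. ennreal (K e powr \<alpha>) \<partial>control)"
    and le: "AE e in control. \<forall>n\<ge>1. \<forall>k<T * 2 ^ n. 0 \<le> l_inc n k e \<and> l_inc n k e \<le> increment_scale n * K e"
    by (rule local_time_envelope [OF \<alpha>, of T]) (rule that)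
  define \<kappa> where "\<kappa> = enn2real (\<integral>\<^sup>+e. ennreal (K e powr \<alpha>) \<partial>control)"
  have \<kappa>: "0 < \<kappa>" "(\<integral>\<^sup>+e. ennreal (K e powr \<alpha>) \<partial>control) = ennreal \<kappa>"
    using K by (auto simp: \<kappa>_def enn2real_positive_iff less_top)
  define J where "J n0 = {(n, k). 1 \<le> n \<and> n \<le> n0 \<and> k < T * 2 ^ n}" for n0 :: nat
  have S: "stable_sample \<alpha> \<kappa> control K (J n0) (\<lambda>(n, k). l_inc n k) (\<lambda>(n, k). increment_scale n)" for n0
  proof
    show "AE e in control. \<forall>i\<in>J n0. \<bar>(case i of (n, k) \<Rightarrow> l_inc n k) e\<bar> \<le> (case i of (n, k) \<Rightarrow> increment_scale n) * K e"
      using le by eventually_elim (auto simp: J_def)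
  qed (auto simp: \<alpha> \<kappa> K J_def finite_levels [simplified] increment_scale_pos)
  define D where "D = stable_sample.tail_const \<alpha> \<kappa>"
  have D: "0 \<le> D" using \<kappa>(1) stable_sample.cos_tail_pos [OF S] by (simp add: D_def stable_sample.tail_const_def [OF S])
  define w where "w = (2 * (D + 1) / \<epsilon>) powr (2 / \<alpha>)"
  have w: "0 < w" using D \<epsilon> by (simp add: w_def)
  have Dw: "D * w powr (- \<alpha> / 2) \<le> \<epsilon> / 2"
  proof -
    have "w powr (- \<alpha> / 2) = (2 * (D + 1) / \<epsilon>) powr (-1)"
      using \<alpha> D \<epsilon> unfolding w_def by (subst powr_powr) simp
    also have "\<dots> = \<epsilon> / (2 * (D + 1))" using D \<epsilon> by (simp add: powr_minus_divide)
    finally have "D * w powr (- \<alpha> / 2) = (D / (D + 1)) * (\<epsilon> / 2)" by simp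
    also have "\<dots> \<le> 1 * (\<epsilon> / 2)" using D \<epsilon> by (intro mult_right_mono) auto
    finally show ?thesis by simp
  qed
  define r where "r = min (1 / 2) (\<epsilon> / (8 * (real T + 1)))"
  have r1: "0 < r" using \<epsilon> by (simp add: r_def)
  have r2: "r \<le> 1 / 2" unfolding r_def by (rule min.cobounded1)
  have r3: "r \<le> \<epsilon> / (8 * (real T + 1))" unfolding r_def by (rule min.cobounded2)
  note r = r1 r2 r3
  define L where "L = ln (2 / r)"
  have L: "0 < L" "2 * exp (- L) = r" using r by (auto simp: L_def exp_minus ln_gt_zero)
  define \<beta> where "\<beta> = sqrt (8 * w * L)"
  have \<beta>: "0 < \<beta>" "\<beta>\<^sup>2 = 8 * w * L" using w L by (auto simp: \<beta>_def)
  have "measure N (irregular T \<beta> n0) \<le> \<epsilon>" for n0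
  proof -
    interpret S: stable_sample \<alpha> \<kappa> control K "J n0" "\<lambda>(n, k). l_inc n k" "\<lambda>(n, k). increment_scale n" by (rule S)
    have Jf: "finite (J n0)" by (rule S.J)
    have char: "(CLINT \<omega>|N. iexp (\<Sum>i\<in>J n0. \<theta> i * Y_inc i \<omega>)) =
        of_real (exp (- (\<integral>e. \<bar>\<Sum>i\<in>J n0. \<theta> i * (case i of (n, k) \<Rightarrow> l_inc n k) e\<bar> powr \<alpha> \<partial>control)))" for \<theta>
    proof -
      have 1: "Y_inc i \<omega> = Y (real (Suc (snd i)) / 2 ^ fst i) \<omega> - Y (real (snd i) / 2 ^ fst i) \<omega>" for i \<omega>
        by (simp add: Y_inc_def split: prod.splits)
      have 2: "(case i of (n, k) \<Rightarrow> l_inc n k) e = lt (real (Suc (snd i)) / 2 ^ fst i) e - lt (real (snd i) / 2 ^ fst i) e" for i e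
        by (simp add: l_inc_def lt_def split: prod.splits)
      show ?thesis unfolding 1 2 by (rule Y_increment_char [OF Jf]) simp
    qed
    have "measure N {\<omega> \<in> space N. \<exists>i\<in>J n0. level_bound \<beta> (fst i) < \<bar>Y_inc i \<omega>\<bar>} \<le>
      S.tail_const * w powr (- \<alpha> / 2) + (\<Sum>i\<in>J n0. 2 * exp (- (level_bound \<beta> (fst i))\<^sup>2 / (8 * w * (case i of (n, k) \<Rightarrow> increment_scale n)\<^sup>2)))"
      using char w \<beta> by (intro S.stable_max_tail prob_space_N) (auto simp: J_def level_bound_def increment_scale_pos)
    also have "S.tail_const * w powr (- \<alpha> / 2) \<le> \<epsilon> / 2" using Dw by (simp add: D_def)
    also have "(\<Sum>i\<in>J n0. 2 * exp (- (level_bound \<beta> (fst i))\<^sup>2 / (8 * w * (case i of (n, k) \<Rightarrow> increment_scale n)\<^sup>2))) =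
        (\<Sum>i\<in>J n0. 2 * exp (- L) ^ fst i)"
    proof (intro sum.cong refl)
      fix i assume "i \<in> J n0"
      then obtain n k where i: "i = (n, k)" "1 \<le> n" by (auto simp: J_def)
      have "(level_bound \<beta> n)\<^sup>2 = (8 * w * (increment_scale n)\<^sup>2) * (real n * L)"
        using i \<beta> by (simp add: level_bound_def power_mult_distrib)
      then have "- (level_bound \<beta> n)\<^sup>2 / (8 * w * (increment_scale n)\<^sup>2) = - (real n * L)"
        using w increment_scale_pos [OF i(2)] by simp
      then show "2 * exp (- (level_bound \<beta> (fst i))\<^sup>2 / (8 * w * (case i of (n, k) \<Rightarrow> increment_scale n)\<^sup>2)) = 2 * exp (- L) ^ fst i"
        by (simp add: i exp_of_nat_mult [symmetric])
    qed
    also have "(\<Sum>i\<in>J n0. 2 * exp (- L) ^ fst i) = (\<Sum>n\<in>{1..n0}. \<Sum>k<T * 2 ^ n. 2 * exp (- L) ^ n)"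
    proof -
      have "J n0 = (SIGMA n:{1..n0}. {..<T * 2 ^ n})" by (auto simp: J_def)
      then show ?thesis by (subst sum.Sigma) (auto simp: case_prod_beta)
    qed
    also have "\<dots> = (\<Sum>n\<in>{1..n0}. 2 * real T * r ^ n)"
      unfolding L(2) [symmetric] by (intro sum.cong refl) (simp add: power_mult_distrib)
    also have "\<dots> \<le> (\<Sum>n\<in>{1..n0}. 2 * real T * r * (1/2) ^ (n - 1))"
    proof (rule sum_mono)
      fix n assume "n \<in> {1..n0}"
      then have "r ^ n = r * r ^ (n - 1)" by (cases n) auto
      also have "\<dots> \<le> r * (1/2) ^ (n - 1)" using r by (intro mult_left_mono power_mono) auto
      finally have "(2 * real T) * r ^ n \<le> (2 * real T) * (r * (1/2) ^ (n - 1))" by (intro mult_left_mono) auto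
      then show "2 * real T * r ^ n \<le> 2 * real T * r * (1/2) ^ (n - 1)" by (simp only: mult.assoc)
    qed
    also have "\<dots> = 2 * real T * r * (\<Sum>n\<in>{1..n0}. (1/2) ^ (n - 1))" by (rule sum_distrib_left [symmetric])
    also have "\<dots> \<le> 2 * real T * r * 2"
    proof (intro mult_left_mono)
      have "(\<Sum>n\<in>{1..n0}. (1/2 :: real) ^ (n - 1)) = (\<Sum>n<n0. (1/2) ^ n)"
        by (rule sum.reindex_bij_witness [where i = Suc and j = "\<lambda>n. n - 1"]) auto
      also have "\<dots> \<le> (\<Sum>n. (1/2) ^ n)" by (intro sum_le_suminf summable_geometric) auto
      also have "\<dots> = 2" by (subst suminf_geometric) auto
      finally show "(\<Sum>n\<in>{1..n0}. (1/2 :: real) ^ (n - 1)) \<le> 2" .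
    qed (use r in auto)
    also have "\<dots> \<le> \<epsilon> / 2"
    proof -
      have "r * (8 * (real T + 1)) \<le> \<epsilon>" using r(3) by (simp add: le_divide_eq)
      moreover have "0 \<le> r" using r by simp
      ultimately show ?thesis by (simp add: algebra_simps)
    qed
    finally show ?thesis by (simp add: irregular_def J_def)
  qed
  with \<beta>(1) show ?thesis by blast
qed

end

context local_time_stable_motion
begin

lemma AE_regular:
  "AE \<omega> in N. \<forall>T::nat. \<exists>\<beta>::nat. \<forall>n\<ge>1. \<forall>k<T * 2 ^ n. \<bar>Y_inc (n, k) \<omega>\<bar> \<le> level_bound (real \<beta>) n"
  unfolding AE_all_countable
proof
  fix T :: nat
  interpret N: prob_space N by (rule prob_space_N)
  define S where "S \<beta> = (\<Union>n0. irregular T \<beta> n0)" for \<beta>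
  have [measurable]: "S \<beta> \<in> sets N" for \<beta> unfolding S_def by measurable
  have inc: "incseq (irregular T \<beta>)" for \<beta>
    by (rule incseq_SucI) (force simp: irregular_def)
  have anti: "S \<beta>' \<subseteq> S \<beta>" if "\<beta> \<le> \<beta>'" for \<beta> \<beta>'
  proof -
    have "level_bound \<beta> n \<le> level_bound \<beta>' n" if "1 \<le> n" for n
      unfolding level_bound_def using \<open>\<beta> \<le> \<beta>'\<close> increment_scale_pos [OF that] by (intro mult_right_mono) auto
    then have "irregular T \<beta>' n0 \<subseteq> irregular T \<beta> n0" for n0
      by (fastforce simp: irregular_def)
    then show ?thesis unfolding S_def by blast
  qed
  have small: "\<exists>\<beta>>0. N.prob (S \<beta>) \<le> \<epsilon>" if \<epsilon>: "0 < \<epsilon>" for \<epsilon>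
  proof -
    obtain \<beta> where \<beta>: "0 < \<beta>" "\<And>n0. N.prob (irregular T \<beta> n0) \<le> \<epsilon>"
      using irregular_small [OF \<epsilon>, of T] by blast
    have "(\<lambda>n0. N.prob (irregular T \<beta> n0)) \<longlonglongrightarrow> N.prob (S \<beta>)"
      unfolding S_def using inc by (intro N.finite_Lim_measure_incseq) auto
    then have "N.prob (S \<beta>) \<le> \<epsilon>" using \<beta>(2) by (intro LIMSEQ_le_const2) auto
    with \<beta>(1) show ?thesis by blast
  qed
  have "N.prob (\<Inter>\<beta>::nat. S (real \<beta>)) \<le> 0 + \<epsilon>" if \<epsilon>: "0 < \<epsilon>" for \<epsilon>
  proof -
    obtain \<beta> where \<beta>: "0 < \<beta>" "N.prob (S \<beta>) \<le> \<epsilon>" using small [OF \<epsilon>] by blast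
    have "(\<Inter>\<beta>::nat. S (real \<beta>)) \<subseteq> S (real (nat \<lceil>\<beta>\<rceil>))" by blast
    also have "\<dots> \<subseteq> S \<beta>" by (rule anti) linarith
    finally have "N.prob (\<Inter>\<beta>::nat. S (real \<beta>)) \<le> N.prob (S \<beta>)" by (intro N.finite_measure_mono) auto
    with \<beta>(2) show ?thesis by simp
  qed
  then have "N.prob (\<Inter>\<beta>::nat. S (real \<beta>)) \<le> 0" by (rule field_le_epsilon)
  then have "(\<Inter>\<beta>::nat. S (real \<beta>)) \<in> null_sets N"
    by (intro null_setsI) (auto simp: N.emeasure_eq_measure intro: antisym)
  then have "AE \<omega> in N. \<omega> \<notin> (\<Inter>\<beta>::nat. S (real \<beta>))" by (rule AE_not_in)
  then show "AE \<omega> in N. \<exists>\<beta>::nat. \<forall>n\<ge>1. \<forall>k<T * 2 ^ n. \<bar>Y_inc (n, k) \<omega>\<bar> \<le> level_bound (real \<beta>) n"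
    using AE_space
  proof eventually_elim
    case (elim \<omega>)
    then obtain \<beta> :: nat where \<beta>: "\<omega> \<notin> S (real \<beta>)" by auto
    have "\<bar>Y_inc (n, k) \<omega>\<bar> \<le> level_bound (real \<beta>) n" if "1 \<le> n" "k < T * 2 ^ n" for n k
    proof -
      have "\<omega> \<notin> irregular T (real \<beta>) n" using \<beta> by (simp add: S_def)
      moreover have "\<omega> \<in> irregular T (real \<beta>) n" if "\<not> \<bar>Y_inc (n, k) \<omega>\<bar> \<le> level_bound (real \<beta>) n"
      proof -
        have "(n, k) \<in> {(n', k). 1 \<le> n' \<and> n' \<le> n \<and> k < T * 2 ^ n'}"
          using \<open>1 \<le> n\<close> \<open>k < T * 2 ^ n\<close> by simp
        moreover have "level_bound (real \<beta>) (fst (n, k)) < \<bar>Y_inc (n, k) \<omega>\<bar>" using that by simp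
        ultimately show ?thesis unfolding irregular_def using elim(2) by blast
      qed
      ultimately show ?thesis by blast
    qed
    then show ?case by blast
  qed
qed

definition regular :: "'b set" where
  "regular = {\<omega> \<in> space N. \<forall>T::nat. \<exists>\<beta>::nat. \<forall>n k. 1 \<le> n \<and> k < T * 2 ^ n \<longrightarrow> \<bar>Y_inc (n, k) \<omega>\<bar> \<le> level_bound (real \<beta>) n}"

lemma regular_measurable [measurable]: "regular \<in> sets N"
  unfolding regular_def by measurable

lemma regular_AE: "AE \<omega> in N. \<omega> \<in> regular"
  using AE_regular AE_space by eventually_elim (unfold regular_def, blast)

definition version :: "real \<Rightarrow> 'b \<Rightarrow> real" where
  "version t \<omega> = (if \<omega> \<in> regular \<and> 0 \<le> t then lim (\<lambda>m. Y (dyadic_floor m t) \<omega>) else 0)"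

definition modulus :: "nat \<Rightarrow> real" where
  "modulus n = (2 powr (H - 1)) ^ n * real n powr (H + 1 / 2)"

lemma base_bounds: "0 < 2 powr (H - 1)" "2 powr (H - 1) < 1"
  using H by (auto simp: powr_less_one)

lemma version_regularity:
  fixes T :: nat
  assumes \<omega>: "\<omega> \<in> regular"
  obtains A where "0 \<le> A"
    "\<And>t. 0 \<le> t \<Longrightarrow> t \<le> real T \<Longrightarrow> (\<lambda>m. Y (dyadic_floor m t) \<omega>) \<longlonglongrightarrow> version t \<omega>"
    "\<And>s t n. 0 \<le> s \<Longrightarrow> s \<le> t \<Longrightarrow> t \<le> real T \<Longrightarrow> t - s \<le> 1 / 2 ^ n \<Longrightarrow> 1 \<le> n \<Longrightarrow> \<bar>version t \<omega> - version s \<omega>\<bar> \<le> A * modulus n"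
proof -
  obtain \<beta> :: nat where \<beta>: "\<And>n k. 1 \<le> n \<Longrightarrow> k < T * 2 ^ n \<Longrightarrow> \<bar>Y_inc (n, k) \<omega>\<bar> \<le> level_bound (real \<beta>) n"
    using \<omega> unfolding regular_def by blast
  define a where "a n = real \<beta> * modulus n" for n
  define C where "C = (\<Sum>i. (2 powr (H - 1)) ^ i * (1 + real i) powr (H + 1 / 2))"
  have \<nu>: "0 \<le> H + 1 / 2" "H + 1 / 2 \<le> 2" using H by auto
  note W = weight_tail_bound [OF base_bounds \<nu>]
  have C: "0 \<le> C" unfolding C_def by (intro suminf_nonneg summable_geometric_weight base_bounds \<nu>) auto
  have sm: "summable modulus" using W(1) [of 1] by (simp add: modulus_def [abs_def])
  have inc: "\<bar>Y (real (Suc k) / 2 ^ n) \<omega> - Y (real k / 2 ^ n) \<omega>\<bar> \<le> a n" if "1 \<le> n" "k < T * 2 ^ n" for n k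
  proof -
    have "increment_scale n * sqrt (real n) = modulus n"
      using that(1) by (simp add: increment_scale_def modulus_def powr_add powr_half_sqrt)
    then show ?thesis using \<beta> [OF that] by (simp add: Y_inc_def level_bound_def a_def)
  qed
  have a0: "0 \<le> a n" for n by (simp add: a_def modulus_def)
  have sa: "summable a" unfolding a_def [abs_def] by (intro summable_mult sm)
  note chain = dyadic_chaining [where y = "\<lambda>t. Y t \<omega>", OF inc a0 sa]
  have ver: "version t \<omega> = lim (\<lambda>m. Y (dyadic_floor m t) \<omega>)" if "0 \<le> t" for t
    using \<omega> that by (simp add: version_def)
  show ?thesis
  proof (rule that [of "2 * real \<beta> * C"])
    show "0 \<le> 2 * real \<beta> * C" using C by simp
    show "(\<lambda>m. Y (dyadic_floor m t) \<omega>) \<longlonglongrightarrow> version t \<omega>" if "0 \<le> t" "t \<le> real T" for t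
      unfolding ver [OF that(1)] by (rule chain(1) [OF _ _ that]) auto
    show "\<bar>version t \<omega> - version s \<omega>\<bar> \<le> (2 * real \<beta> * C) * modulus n"
      if st: "0 \<le> s" "s \<le> t" "t \<le> real T" "t - s \<le> 1 / 2 ^ n" "1 \<le> n" for s t n
    proof -
      have t0: "0 \<le> t" using st by simp
      have "\<bar>version t \<omega> - version s \<omega>\<bar> \<le> 2 * (\<Sum>i. a (i + n))"
        unfolding ver [OF st(1)] ver [OF t0] by (rule chain(2) [OF _ _ st]) auto
      also have "(\<Sum>i. a (i + n)) = real \<beta> * (\<Sum>i. modulus (i + n))"
        unfolding a_def by (rule suminf_mult [OF summable_ignore_initial_segment [OF sm]])
      also have "(\<Sum>i. modulus (i + n)) \<le> C * modulus n"
        unfolding modulus_def C_def by (rule W(2) [OF st(5)])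
      finally show ?thesis by (simp add: mult_left_mono mult.assoc)
    qed
  qed
qed

lemma modulus_tendsto: "modulus \<longlonglongrightarrow> 0"
proof -
  have "summable modulus"
    using weight_tail_bound(1) [OF base_bounds, of "H + 1 / 2" 1] H by (simp add: modulus_def [abs_def])
  then show ?thesis by (rule summable_LIMSEQ_zero)
qed

lemma version_continuous: "continuous_on {0..} (\<lambda>t. version t \<omega>)"
proof (cases "\<omega> \<in> regular")
  case False
  then show ?thesis by (simp add: version_def)
next
  case True
  show ?thesis
    unfolding continuous_on_iff
  proof (intro ballI allI impI)
    fix t \<epsilon> :: real assume t: "t \<in> {0..}" and \<epsilon>: "0 < \<epsilon>"
    define T where "T = nat \<lceil>t\<rceil> + 1"
    have tT: "t + 1 \<le> real T" unfolding T_def by linarith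
    obtain A where A: "0 \<le> A"
      "\<And>s t n. 0 \<le> s \<Longrightarrow> s \<le> t \<Longrightarrow> t \<le> real T \<Longrightarrow> t - s \<le> 1 / 2 ^ n \<Longrightarrow> 1 \<le> n \<Longrightarrow> \<bar>version t \<omega> - version s \<omega>\<bar> \<le> A * modulus n"
      using version_regularity [OF True, of T] by metis
    have "(\<lambda>n. A * modulus n) \<longlonglongrightarrow> A * 0" by (intro tendsto_mult tendsto_const modulus_tendsto)
    then have "eventually (\<lambda>n. A * modulus n < \<epsilon>) sequentially" using \<epsilon> by (intro order_tendstoD) auto
    then have "eventually (\<lambda>n. A * modulus n < \<epsilon> \<and> 1 \<le> n) sequentially"
      using eventually_ge_at_top by (rule eventually_conj)
    then obtain n where n: "A * modulus n < \<epsilon>" "1 \<le> n" by (auto simp: eventually_sequentially)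
    have one: "1 / 2 ^ n \<le> (1::real)" by simp
    show "\<exists>d>0. \<forall>s\<in>{0..}. dist s t < d \<longrightarrow> dist (version s \<omega>) (version t \<omega>) < \<epsilon>"
    proof (intro exI [of _ "1 / 2 ^ n"] conjI ballI impI)
      fix s assume s: "s \<in> {0..}" "dist s t < 1 / 2 ^ n"
      have "\<bar>version s \<omega> - version t \<omega>\<bar> \<le> A * modulus n"
      proof (cases "s \<le> t")
        case True
        then show ?thesis using A(2) [of s t n] s t tT n one by (auto simp: dist_real_def abs_minus_commute)
      next
        case False
        then show ?thesis using A(2) [of t s n] s t tT n one by (auto simp: dist_real_def)
      qed
      then show "dist (version s \<omega>) (version t \<omega>) < \<epsilon>" using n by (simp add: dist_real_def)
    qed simp
  qed
qed

lemma version_measurable: "version t \<in> borel_measurable N"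
proof (cases "0 \<le> t")
  case False
  then show ?thesis by (simp add: version_def [abs_def])
next
  case True
  show ?thesis
  proof (rule borel_measurable_LIMSEQ_real)
    fix m
    have [measurable]: "Y (dyadic_floor m t) \<in> borel_measurable N" by (rule Y_measurable [OF dyadic_floor_nonneg])
    show "(\<lambda>\<omega>. if \<omega> \<in> regular then Y (dyadic_floor m t) \<omega> else 0) \<in> borel_measurable N" by measurable
  next
    fix \<omega>
    show "(\<lambda>m. if \<omega> \<in> regular then Y (dyadic_floor m t) \<omega> else 0) \<longlonglongrightarrow> version t \<omega>"
    proof (cases "\<omega> \<in> regular")
      case reg: True
      have "t \<le> real (nat \<lceil>t\<rceil>)" by linarith
      then have "(\<lambda>m. Y (dyadic_floor m t) \<omega>) \<longlonglongrightarrow> version t \<omega>"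
        using version_regularity [OF reg, of "nat \<lceil>t\<rceil>"] True by metis
      then show ?thesis using reg by simp
    qed (simp add: version_def)
  qed
qed

lemma version_eq:
  assumes t: "0 \<le> t"
  shows "AE \<omega> in N. version t \<omega> = Y t \<omega>"
proof -
  interpret N: prob_space N by (rule prob_space_N)
  define W where "W \<omega> = version t \<omega> - Y t \<omega>" for \<omega>
  have [measurable]: "Y t \<in> borel_measurable N" "version t \<in> borel_measurable N"
    "\<And>m. Y (dyadic_floor m t) \<in> borel_measurable N"
    by (auto intro: Y_measurable t version_measurable dyadic_floor_nonneg)
  have Wm [measurable]: "W \<in> borel_measurable N" unfolding W_def [abs_def] by measurable
  have conv: "AE \<omega> in N. (\<lambda>m. Y (dyadic_floor m t) \<omega>) \<longlonglongrightarrow> version t \<omega>"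
    using regular_AE
  proof eventually_elim
    case (elim \<omega>)
    have "t \<le> real (nat \<lceil>t\<rceil>)" by linarith
    then show ?case using version_regularity [OF elim, of "nat \<lceil>t\<rceil>"] t by metis
  qed
  have char1: "(CLINT \<omega>|N. iexp (\<theta> * W \<omega>)) = 1" for \<theta>
  proof -
    have l1: "(\<lambda>m. CLINT \<omega>|N. iexp (\<theta> * (Y (dyadic_floor m t) \<omega> - Y t \<omega>))) \<longlonglongrightarrow> (CLINT \<omega>|N. iexp (\<theta> * W \<omega>))"
    proof (rule integral_dominated_convergence [where w = "\<lambda>_. 1"])
      show "AE \<omega> in N. (\<lambda>m. iexp (\<theta> * (Y (dyadic_floor m t) \<omega> - Y t \<omega>))) \<longlonglongrightarrow> iexp (\<theta> * W \<omega>)"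
        using conv by eventually_elim (auto simp: W_def intro!: tendsto_intros)
    qed auto
    have "(\<lambda>m. \<integral>e. \<bar>\<theta> * (lt (dyadic_floor m t) e - lt t e)\<bar> powr \<alpha> \<partial>control) \<longlonglongrightarrow> (\<integral>e. 0 \<partial>control)"
    proof (rule integral_dominated_convergence [where w = "\<lambda>e. \<bar>\<theta>\<bar> powr \<alpha> * \<bar>lt t e\<bar> powr \<alpha>"])
      show "integrable control (\<lambda>e. \<bar>\<theta>\<bar> powr \<alpha> * \<bar>lt t e\<bar> powr \<alpha>)"
        using lt_L_alpha [OF t] by (simp add: L_alpha_def)
      have "AE e in control. fst e \<in> G" by (rule AE_controlI) auto
      then show "AE e in control. (\<lambda>m. \<bar>\<theta> * (lt (dyadic_floor m t) e - lt t e)\<bar> powr \<alpha>) \<longlonglongrightarrow> 0"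
      proof eventually_elim
        case (elim e)
        obtain \<omega> x where e: "e = (\<omega>, x)" by (cases e)
        have \<omega>: "\<omega> \<in> G" using elim e by simp
        have "(\<lambda>m. l x (dyadic_floor m t) \<omega>) \<longlonglongrightarrow> l x t \<omega>"
          using t dyadic_floor_nonneg
          by (intro continuous_on_tendsto_compose [OF l_continuous_time [OF \<omega>] dyadic_floor_tendsto [OF t]]) auto
        then have "(\<lambda>m. \<bar>\<theta> * (lt (dyadic_floor m t) e - lt t e)\<bar>) \<longlonglongrightarrow> \<bar>\<theta> * (l x t \<omega> - l x t \<omega>)\<bar>"
          unfolding e lt_def prod.case by (intro tendsto_intros)
        then have "(\<lambda>m. \<bar>\<theta> * (lt (dyadic_floor m t) e - lt t e)\<bar> powr \<alpha>) \<longlonglongrightarrow> 0 powr \<alpha>"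
          using \<alpha> by (intro tendsto_powr') auto
        then show ?case by simp
      qed
      show "AE e in control. norm (\<bar>\<theta> * (lt (dyadic_floor m t) e - lt t e)\<bar> powr \<alpha>) \<le> \<bar>\<theta>\<bar> powr \<alpha> * \<bar>lt t e\<bar> powr \<alpha>" for m
        using lt_mono_AE [OF dyadic_floor_nonneg dyadic_floor_bounds(1) [OF t, of m]]
      proof eventually_elim
        case (elim e)
        have "\<bar>\<theta> * (lt (dyadic_floor m t) e - lt t e)\<bar> \<le> \<bar>\<theta>\<bar> * \<bar>lt t e\<bar>"
          unfolding abs_mult using elim by (intro mult_left_mono) auto
        then have "\<bar>\<theta> * (lt (dyadic_floor m t) e - lt t e)\<bar> powr \<alpha> \<le> (\<bar>\<theta>\<bar> * \<bar>lt t e\<bar>) powr \<alpha>"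
          using \<alpha> by (intro powr_mono2) auto
        then show ?case by (simp add: powr_mult)
      qed
    qed (use t dyadic_floor_nonneg in measurable)
    then have "(\<lambda>m. complex_of_real (exp (- (\<integral>e. \<bar>\<theta> * (lt (dyadic_floor m t) e - lt t e)\<bar> powr \<alpha> \<partial>control)))) \<longlonglongrightarrow> of_real (exp (- (\<integral>e. 0 \<partial>control)))"
      by (intro tendsto_intros)
    moreover have "(CLINT \<omega>|N. iexp (\<theta> * (Y (dyadic_floor m t) \<omega> - Y t \<omega>))) = complex_of_real (exp (- (\<integral>e. \<bar>\<theta> * (lt (dyadic_floor m t) e - lt t e)\<bar> powr \<alpha> \<partial>control)))" for m
      using Y_increment_char [of "{()}" "\<lambda>_. t" "\<lambda>_. dyadic_floor m t" "\<lambda>_. \<theta>"] t dyadic_floor_nonneg by simp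
    ultimately have "(\<lambda>m. CLINT \<omega>|N. iexp (\<theta> * (Y (dyadic_floor m t) \<omega> - Y t \<omega>))) \<longlonglongrightarrow> 1" by simp
    with l1 show ?thesis by (rule LIMSEQ_unique)
  qed
  have "AE \<omega> in N. cos (W \<omega> / real (Suc n)) = 1" for n
  proof -
    define \<theta> where "\<theta> = 1 / real (Suc n)"
    have i: "integrable N (\<lambda>\<omega>. cos (\<theta> * W \<omega>))" by (intro N.integrable_const_bound [where B = 1]) auto
    have ie: "integrable N (\<lambda>\<omega>. iexp (\<theta> * W \<omega>))" by (intro N.integrable_const_bound [where B = 1]) auto
    have "Re (CLINT \<omega>|N. iexp (\<theta> * W \<omega>)) = N.expectation (\<lambda>\<omega>. Re (iexp (\<theta> * W \<omega>)))"
      using ie by (rule integral_Re [symmetric])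
    also have "(\<lambda>\<omega>. Re (iexp (\<theta> * W \<omega>))) = (\<lambda>\<omega>. cos (\<theta> * W \<omega>))" by (simp add: Re_exp)
    finally have "N.expectation (\<lambda>\<omega>. cos (\<theta> * W \<omega>)) = 1" unfolding char1 by simp
    then have "N.expectation (\<lambda>\<omega>. 1 - cos (\<theta> * W \<omega>)) = 0" using i by (simp add: N.prob_space)
    then have "AE \<omega> in N. 1 - cos (\<theta> * W \<omega>) = 0"
      using i by (subst (asm) integral_nonneg_eq_0_iff_AE) auto
    then show ?thesis by eventually_elim (simp add: \<theta>_def)
  qed
  then have "AE \<omega> in N. \<forall>n. cos (W \<omega> / real (Suc n)) = 1" by (simp add: AE_all_countable)
  then show ?thesis
  proof eventually_elim
    case (elim \<omega>)
    obtain n :: nat where n: "\<bar>W \<omega>\<bar> < real n" using reals_Archimedean2 by blast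
    define x where "x = W \<omega> / real (Suc n)"
    have x: "\<bar>x\<bar> < 1" using n by (simp add: x_def abs_divide)
    have "cos x = 1" using elim by (simp add: x_def)
    then have "cos \<bar>x\<bar> = 1" by (simp only: cos_abs_real)
    have "\<bar>x\<bar> = 0"
    proof (rule ccontr)
      assume "\<bar>x\<bar> \<noteq> 0"
      then have "cos \<bar>x\<bar> < cos 0" using x pi_gt3 by (intro cos_monotone_0_pi) auto
      with \<open>cos \<bar>x\<bar> = 1\<close> show False by simp
    qed
    then show ?case by (simp add: x_def W_def)
  qed
qed

lemma version_modulus:
  assumes \<omega>: "\<omega> \<in> regular"
  shows "\<exists>C. \<forall>s t. 0 \<le> s \<and> s < t \<and> t \<le> 1 / 2 \<longrightarrow>
    \<bar>version t \<omega> - version s \<omega>\<bar> / ((t - s) powr (1 - H) * (ln (1 / (t - s))) powr (H + 1 / 2)) \<le> C"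
proof -
  obtain A where A: "0 \<le> A"
    "\<And>s t n. 0 \<le> s \<Longrightarrow> s \<le> t \<Longrightarrow> t \<le> real 1 \<Longrightarrow> t - s \<le> 1 / 2 ^ n \<Longrightarrow> 1 \<le> n \<Longrightarrow> \<bar>version t \<omega> - version s \<omega>\<bar> \<le> A * modulus n"
    using version_regularity [OF \<omega>, of 1] by metis
  define c where "c = 2 powr (1 - H) / ln 2 powr (H + 1 / 2)"
  have "\<bar>version t \<omega> - version s \<omega>\<bar> / ((t - s) powr (1 - H) * (ln (1 / (t - s))) powr (H + 1 / 2)) \<le> A * c"
    if st: "0 \<le> s" "s < t" "t \<le> 1 / 2" for s t
  proof -
    define h where "h = t - s"
    have h: "0 < h" "h \<le> 1 / 2" using st by (auto simp: h_def)
    define n where "n = nat \<lfloor>log 2 (1 / h)\<rfloor>"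
    have "1 \<le> log 2 (1 / h)"
    proof -
      have "2 \<le> 1 / h" using h by (simp add: le_divide_eq)
      then have "log 2 2 \<le> log 2 (1 / h)" using h by (subst log_le_cancel_iff) auto
      then show ?thesis by simp
    qed
    then have n: "1 \<le> n" "real n \<le> log 2 (1 / h)" "log 2 (1 / h) < real n + 1"
      unfolding n_def by linarith+
    have hn: "h \<le> 1 / 2 ^ n"
    proof -
      have "2 powr real n \<le> 2 powr (log 2 (1 / h))" using n(2) by simp
      also have "\<dots> = 1 / h" using h by simp
      finally have "2 ^ n \<le> 1 / h" by (simp add: powr_realpow)
      then show ?thesis using h by (simp add: field_simps)
    qed
    have "\<bar>version t \<omega> - version s \<omega>\<bar> \<le> A * modulus n"
      using st hn n by (intro A(2)) (auto simp: h_def)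
    also have "modulus n \<le> c * (h powr (1 - H) * ln (1 / h) powr (H + 1 / 2))"
    proof -
      have "1 / h = 2 powr (log 2 (1 / h))" using h by simp
      also have "\<dots> \<le> 2 powr (real n + 1)" using n(3) by simp
      finally have "2 powr (- real n) \<le> 2 * h"
        using h by (simp add: powr_add powr_minus field_simps)
      then have "(2 powr (- real n)) powr (1 - H) \<le> (2 * h) powr (1 - H)" using H by (intro powr_mono2) auto
      moreover have "(2 powr (H - 1)) ^ n = (2 powr (- real n)) powr (1 - H)"
        by (simp add: powr_power powr_powr algebra_simps)
      ultimately have 1: "(2 powr (H - 1)) ^ n \<le> 2 powr (1 - H) * h powr (1 - H)" by (simp add: powr_mult)
      have "real n \<le> ln (1 / h) / ln 2" using n(2) by (simp add: log_def)
      then have "real n powr (H + 1 / 2) \<le> (ln (1 / h) / ln 2) powr (H + 1 / 2)" using H by (intro powr_mono2) auto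
      then have 2: "real n powr (H + 1 / 2) \<le> ln (1 / h) powr (H + 1 / 2) / ln 2 powr (H + 1 / 2)" by (simp only: powr_divide)
      have "modulus n \<le> (2 powr (1 - H) * h powr (1 - H)) * (ln (1 / h) powr (H + 1 / 2) / ln 2 powr (H + 1 / 2))"
        unfolding modulus_def by (intro mult_mono 1 2) auto
      then show ?thesis by (simp add: c_def mult_ac)
    qed
    finally have "\<bar>version t \<omega> - version s \<omega>\<bar> \<le> A * (c * (h powr (1 - H) * ln (1 / h) powr (H + 1 / 2)))"
      using A(1) by (simp add: mult_left_mono)
    moreover have "0 < h powr (1 - H) * ln (1 / h) powr (H + 1 / 2)"
      using h by (intro mult_pos_pos) (auto simp: ln_div)
    ultimately show ?thesis unfolding h_def [symmetric] by (simp add: pos_divide_le_eq mult.assoc)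
  qed
  then show ?thesis by blast
qed

end

theorem theorem5p1:
  fixes P' :: "'w measure" and N :: "'b measure"
    and \<alpha> H :: real
    and B :: "real \<Rightarrow> 'w \<Rightarrow> real" and l :: "real \<Rightarrow> real \<Rightarrow> 'w \<Rightarrow> real"
    and M :: "('w \<times> real) set \<Rightarrow> 'b \<Rightarrow> real" and I :: "('w \<times> real \<Rightarrow> real) \<Rightarrow> 'b \<Rightarrow> real"
    and Y :: "real \<Rightarrow> 'b \<Rightarrow> real"
  assumes "0 < \<alpha>" and "\<alpha> < 2" and "0 < H" and "H < 1"
    and "fbm_local_time_stable_motion P' H B l N \<alpha> M I Y"
  shows "\<exists>Z. is_version N Z Y \<and>
    (\<forall>\<omega>\<in>space N. continuous_on {0..} (\<lambda>t. Z t \<omega>)) \<and>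
    (AE \<omega> in N.
      (SUP (s, t)\<in>{(s, t). 0 \<le> s \<and> s < t \<and> t \<le> 1 / 2}.
         ereal (\<bar>Z t \<omega> - Z s \<omega>\<bar> /
           ((t - s) powr (1 - H) * (ln (1 / (t - s))) powr (H + 1 / 2)))) < \<infinity>)"
proof -
  have fbm: "fractional_brownian_motion P' H B" and lt: "local_time P' B l"
    and sas: "sas_random_measure N (P' \<Otimes>\<^sub>M lborel) \<alpha> M I"
    and Y: "\<And>t. 0 \<le> t \<Longrightarrow> Y t \<in> borel_measurable N" "\<And>t. 0 \<le> t \<Longrightarrow> AE \<omega> in N. Y t \<omega> = I (\<lambda>(\<omega>', x). l x t \<omega>') \<omega>"
    using assms(5) by (auto simp: fbm_local_time_stable_motion_def)
  define good where "good \<omega> \<longleftrightarrow> continuous_on {0..} (\<lambda>t. B t \<omega>) \<and> (\<forall>x. \<forall>t\<ge>0. 0 \<le> l x t \<omega>) \<and>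
    continuous_on (UNIV \<times> {0..}) (\<lambda>(x, t). l x t \<omega>) \<and>
    (\<forall>t\<ge>0. \<forall>g :: real \<Rightarrow> ennreal. g \<in> borel_measurable borel \<longrightarrow>
        (\<integral>\<^sup>+s\<in>{0..t}. g (B s \<omega>) \<partial>lborel) = (\<integral>\<^sup>+x. g x * ennreal (l x t \<omega>) \<partial>lborel))" for \<omega>
  have "AE \<omega> in P'. good \<omega>"
    using fbm lt unfolding fractional_brownian_motion_def local_time_def good_def by (auto elim: eventually_elim2)
  then obtain E where E: "{\<omega> \<in> space P'. \<not> good \<omega>} \<subseteq> E" "emeasure P' E = 0" "E \<in> sets P'"
    by (rule AE_E)
  define G where "G = space P' - E"
  have G: "G \<in> sets P'" "\<And>\<omega>. \<omega> \<in> G \<Longrightarrow> good \<omega>" using E by (auto simp: G_def)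
  have G_AE: "AE \<omega> in P'. \<omega> \<in> G"
  proof -
    have "AE \<omega> in P'. \<omega> \<notin> E" using E by (intro AE_not_in null_setsI)
    with AE_space show ?thesis by eventually_elim (simp add: G_def)
  qed
  interpret prob_space P' using fbm by (simp add: fractional_brownian_motion_def)
  interpret local_time_stable_motion P' H B G l N \<alpha> M I Y
  proof unfold_locales
    show "(\<lambda>(\<omega>, x). l x t \<omega>) \<in> borel_measurable (P' \<Otimes>\<^sub>M lborel)" if "0 \<le> t" for t
      using lt that by (simp add: local_time_def)
  qed (use fbm sas Y G G_AE assms in \<open>auto simp: good_def\<close>)
  show ?thesis
  proof (intro exI [of _ version] conjI ballI)
    show "is_version N version Y"
      unfolding is_version_def using version_measurable version_eq by blast
    show "continuous_on {0..} (\<lambda>t. version t \<omega>)" for \<omega> by (rule version_continuous)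
    show "AE \<omega> in N. (SUP (s, t)\<in>{(s, t). 0 \<le> s \<and> s < t \<and> t \<le> 1 / 2}.
         ereal (\<bar>version t \<omega> - version s \<omega>\<bar> / ((t - s) powr (1 - H) * (ln (1 / (t - s))) powr (H + 1 / 2)))) < \<infinity>"
      using regular_AE
    proof eventually_elim
      case (elim \<omega>)
      obtain C where C: "\<And>s t. 0 \<le> s \<Longrightarrow> s < t \<Longrightarrow> t \<le> 1 / 2 \<Longrightarrow>
          \<bar>version t \<omega> - version s \<omega>\<bar> / ((t - s) powr (1 - H) * (ln (1 / (t - s))) powr (H + 1 / 2)) \<le> C"
        using version_modulus [OF elim] by blast
      have "(SUP (s, t)\<in>{(s, t). 0 \<le> s \<and> s < t \<and> t \<le> 1 / 2}.
         ereal (\<bar>version t \<omega> - version s \<omega>\<bar> / ((t - s) powr (1 - H) * (ln (1 / (t - s))) powr (H + 1 / 2)))) \<le> ereal C"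
        using C by (intro SUP_least) (auto split: prod.splits)
      also have "\<dots> < \<infinity>" by simp
      finally show ?case .
    qed
  qed
qed

end
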